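(* Let $q$ be a bounded probability density on $[0,1]^d$, let $T>0$ and $0<r\le T$. Let $K_r$ denote either the Čech complex or the Vietoris–Rips complex with filtration parameter $r$, and let $$F_n^{\mathrm{EC}}(\mathcal{P}_n):=\chi(K_r(n^{1/d}\mathcal{P}_n)),\qquad F_n^{\mathrm{EC}}(\xi_n):=\chi(K_r(n^{1/d}\xi_n)).$$ Then there exists a constant $C_0>0$ such that for $n\ge1$, $$d_K\left(\frac{F_n^{\mathrm{EC}}(\mathcal{P}_n)-\mathbb{E}F_n^{\mathrm{EC}}(\mathcal{P}_n)}{\sqrt{\mathrm{Var}F_n^{\mathrm{EC}}(\mathcal{P}_n)}},N\right)\le C_0\frac1{\sqrt n},$$ and for $n\ge2$, $$d_K\left(\frac{F_n^{\mathrm{EC}}(\xi_n)-\mathbb{E}F_n^{\mathrm{EC}}(\xi_n)}{\sqrt{\mathrm{Var}F_n^{\mathrm{EC}}(\xi_n)}},N\right)\le C_0\frac1{\sqrt n}.$$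
   Context: $\xi_n$ is the binomial point process formed by $n$ i.i.d. points with density $q$, and $\mathcal{P}_n$ is a Poisson point process with intensity measure $n\mathbb{Q}$, where $\mathbb{Q}$ has density $q$ with respect to Lebesgue measure. For a configuration $\eta$, $n^{1/d}\eta:=\{n^{1/d}x:x\in\eta\}$. For a finite set $\mathbb{A}=\{a_1,\dots,a_m\}\subset\mathbb{R}^d$: the Vietoris–Rips complex with parameter $r>0$ consists of all nonempty $\sigma\subset\mathbb{A}$ such that $d(a_i,a_j)<r$ for every pair of vertices $a_i,a_j\in\sigma$; the Čech complex with parameter $r$ consists of all nonempty $\sigma=\{a_i\}_{i\in I}$ with $\bigcap_{i\in I}B_{a_i}(r/2)\neq\emptyset$, where $B_x(\rho)$ is the closed Euclidean ball of radius $\rho$ and $d$ is Euclidean distance. A simplex with $\ell+1$ vertices has dimension $\ell$. The Euler characteristic of a simplicial complex $K$ is $\chi(K):=\sum_{k=0}^\infty(-1)^k\#\{S_k\}$, where $\#\{S_k\}$ is the number of simplices of dimension $k$. $d_K(Y,Z):=\sup_{t\in\mathbb{R}}|\mathbb{P}(Y\le t)-\mathbb{P}(Z\le t)|$ and $N$ is standard normal. Standardized variables are considered only when the variance is positive. *)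

theory Defs
  imports "HOL-Probability.Probability"
begin

text \<open>A simplicial complex is represented by the set of its simplices, each simplex being the
  finite nonempty set of its vertices.\<close>

definition rips_complex :: "real \<Rightarrow> 'a::metric_space set \<Rightarrow> 'a set set" where
  "rips_complex r A = {\<sigma>. \<sigma> \<subseteq> A \<and> \<sigma> \<noteq> {} \<and> (\<forall>a\<in>\<sigma>. \<forall>b\<in>\<sigma>. dist a b < r)}"

definition cech_complex :: "real \<Rightarrow> 'a::metric_space set \<Rightarrow> 'a set set" where
  "cech_complex r A = {\<sigma>. \<sigma> \<subseteq> A \<and> \<sigma> \<noteq> {} \<and> (\<Inter>a\<in>\<sigma>. cball a (r / 2)) \<noteq> {}}"

text \<open>For a finite complex all but finitely many terms of the series vanish.\<close>

definition euler_characteristic :: "'a set set \<Rightarrow> real" where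
  "euler_characteristic K = (\<Sum>k. (- 1) ^ k * real (card {\<sigma> \<in> K. card \<sigma> = k + 1}))"

definition rescaled :: "nat \<Rightarrow> (real ^ 'd) set \<Rightarrow> (real ^ 'd) set" where
  "rescaled n \<eta> = (\<lambda>x. (real n powr (1 / real CARD('d))) *\<^sub>R x) ` \<eta>"

text \<open>Point processes with almost surely finitely many, almost surely distinct points are
  represented as maps into finite subsets of the space. For the Poisson process this
  fits a finite intensity measure without atoms. The formula for the Poisson weights also
  covers sets of measure zero, where it is the point mass at zero because
  \<^term>\<open>(0::real) ^ 0 = 1\<close>. Finite disjoint families are covered by padding with empty sets.\<close>

definition poisson_point_process ::
  "'w measure \<Rightarrow> ('w \<Rightarrow> 'a::euclidean_space set) \<Rightarrow> 'a measure \<Rightarrow> bool" where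
  "poisson_point_process M P \<mu> \<longleftrightarrow>
     prob_space M \<and> finite_measure \<mu> \<and> sets \<mu> = sets borel \<and>
     (\<forall>\<omega>\<in>space M. finite (P \<omega>)) \<and>
     (\<forall>A\<in>sets borel.
        (\<lambda>\<omega>. card (P \<omega> \<inter> A)) \<in> M \<rightarrow>\<^sub>M count_space UNIV \<and>
        (\<forall>k. measure M {\<omega>\<in>space M. card (P \<omega> \<inter> A) = k}
             = exp (- measure \<mu> A) * measure \<mu> A ^ k / fact k)) \<and>
     (\<forall>A :: nat \<Rightarrow> 'a set. range A \<subseteq> sets borel \<longrightarrow> disjoint_family A \<longrightarrow>
        prob_space.indep_vars M (\<lambda>_. count_space UNIV) (\<lambda>i \<omega>. card (P \<omega> \<inter> A i)) UNIV)"

definition binomial_point_process ::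
  "'w measure \<Rightarrow> ('w \<Rightarrow> 'a::euclidean_space set) \<Rightarrow> nat \<Rightarrow> ('a \<Rightarrow> real) \<Rightarrow> bool" where
  "binomial_point_process M \<xi> n q \<longleftrightarrow>
     prob_space M \<and>
     (\<exists>X :: nat \<Rightarrow> 'w \<Rightarrow> 'a.
        prob_space.indep_vars M (\<lambda>_. borel) X {..<n} \<and>
        (\<forall>i<n. distributed M lborel (X i) (\<lambda>x. ennreal (q x))) \<and>
        (\<forall>\<omega>\<in>space M. \<xi> \<omega> = (\<lambda>i. X i \<omega>) ` {..<n}))"

definition kolmogorov_dist ::
  "'v measure \<Rightarrow> ('v \<Rightarrow> real) \<Rightarrow> 'w measure \<Rightarrow> ('w \<Rightarrow> real) \<Rightarrow> real" where
  "kolmogorov_dist M Y M' Z =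
     (SUP t. \<bar>measure M {\<omega>\<in>space M. Y \<omega> \<le> t} - measure M' {\<omega>\<in>space M'. Z \<omega> \<le> t}\<bar>)"

definition standardized :: "'w measure \<Rightarrow> ('w \<Rightarrow> real) \<Rightarrow> 'w \<Rightarrow> real" where
  "standardized M Y \<omega> =
     (Y \<omega> - prob_space.expectation M Y) / sqrt (prob_space.variance M Y)"

end

theory Submission
  imports Defs
begin

text \<open>The Euler characteristic is a functional of independent coordinates: the points
  themselves in the binomial case, the occupation numbers of a fine partition into cells in the
  Poisson case, where the mesh tends to zero at the end. For such a functional Stein's equation, an
  interpolation between two independent copies of the coordinates and the monotonicity of \<open>w * h w\<close> for
  its solution \<open>h\<close> bound the Kolmogorov distance by the standard deviation of \<open>\<Sum>k. D\<^sub>k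
  \<Delta>\<^sub>k\<close>, divided by the variance of the functional. Here \<open>D\<^sub>k\<close>
  and \<open>\<Delta>\<^sub>k\<close> are increments in the coordinate \<open>k\<close>. The
  standard deviation has order \<open>\<surd>n\<close> by the Efron--Stein inequality, because only
  simplices near a point change when the point is removed, and the number of its neighbours has
  bounded exponential moments. The variance has order at least \<open>n\<close>, because in linearly
  many disjoint blocks one can move one of two points so as to change the Euler characteristic by
  one, independently of the rest of the configuration.\<close>

section \<open>Stein's equation\<close>

text \<open>The density need not be bounded below, so no given region is sure to carry points.
  Averaging over a grid of side of order \<open>n powr (- 1 / d)\<close> still finds linearly many
  cubes of mass at least of order 1/n, because \<open>q\<close> is bounded above. Each such block
  gets a centred test function; these are orthogonal across blocks and have covariance bounded below
  with the Euler characteristic, so Bessel's inequality gives the variance bound.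

  The Poisson process has no fixed finite list of coordinates, hence the cells. Replacing points by
  cell centres can change the simplices however fine the mesh is, namely when a configuration sits
  exactly at a threshold. The filtration parameter is therefore shifted together with the mesh, and
  for every configuration the approximation becomes exact from some mesh on. An exponential moment
  of the number of points then carries means, variances and distribution functions to the limit.

  Blocks exist only for large n. The finitely many smaller n are absorbed by the constant, as the
  Kolmogorov distance is at most 1.\<close>

definition std_normal_cdf :: "real \<Rightarrow> real" where
  "std_normal_cdf x = measure std_normal_distribution {..x}"

text \<open>On a window around \<open>x\<close> the distribution function is a constant plus the
  integral of a continuous density over a compact interval, so the fundamental theorem of calculus
  applies.\<close>

lemma std_normal_cdf_deriv: "(std_normal_cdf has_real_derivative std_normal_density x) (at x)"
proof -
  interpret N: prob_space std_normal_distribution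
    by (rule real_dist_normal_dist[THEN real_distribution.axioms(1)])
  define a b where "a = x - 1" and "b = x + 1"
  have cont: "continuous_on S std_normal_density" for S
    unfolding normal_density_def by (intro continuous_intros) auto
  have eq: "std_normal_cdf u = std_normal_cdf a + integral {a..u} std_normal_density" if "u \<in> {a..b}" for u
  proof -
    have "std_normal_cdf u = measure std_normal_distribution ({..<a} \<union> {a..u})"
      unfolding std_normal_cdf_def using that by (intro arg_cong2[where f=measure]) auto
    also have "\<dots> = measure std_normal_distribution {..<a} + measure std_normal_distribution {a..u}"
      by (intro N.finite_measure_Union) auto
    also have "measure std_normal_distribution {..<a} = std_normal_cdf a"
    proof -
      have "measure std_normal_distribution {a} = 0"
        by (simp add: measure_def emeasure_density nn_integral_null_delta nn_integral_indicator_singleton)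
      moreover have "{..a} = {..<a} \<union> {a}" by auto
      moreover have "measure std_normal_distribution ({..<a} \<union> {a}) = measure std_normal_distribution {..<a} + measure std_normal_distribution {a}"
        by (intro N.finite_measure_Union) auto
      ultimately show ?thesis unfolding std_normal_cdf_def by simp
    qed
    also have "measure std_normal_distribution {a..u} = integral {a..u} std_normal_density"
    proof -
      have int: "set_integrable lborel {a..u} std_normal_density"
        by (rule borel_integrable_atLeastAtMost') (rule cont)
      have "measure std_normal_distribution {a..u} = (\<integral>y. indicator {a..u} y \<partial>std_normal_distribution)"
        by simp
      also have "\<dots> = (\<integral>y. std_normal_density y *\<^sub>R indicator {a..u} y \<partial>lborel)"
        by (subst integral_density) auto
      also have "\<dots> = (LINT y:{a..u}|lborel. std_normal_density y)"
        by (simp add: set_lebesgue_integral_def mult.commute)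
      also have "\<dots> = integral {a..u} std_normal_density"
        using set_borel_integral_eq_integral[OF int] by simp
      finally show ?thesis .
    qed
    finally show ?thesis .
  qed
  have "((\<lambda>u. integral {a..u} std_normal_density) has_real_derivative std_normal_density x) (at x within {a..b})"
    by (rule integral_has_real_derivative) (auto simp: a_def b_def cont)
  hence "((\<lambda>u. std_normal_cdf a + integral {a..u} std_normal_density) has_real_derivative std_normal_density x) (at x within {a..b})"
    by (auto intro!: derivative_eq_intros)
  hence "(std_normal_cdf has_real_derivative std_normal_density x) (at x within {a..b})"
    by (rule has_field_derivative_transform_within[OF _ zero_less_one]) (use eq[symmetric] in \<open>auto simp: a_def b_def\<close>)
  moreover have "at x within {a..b} = at x"
    by (rule at_within_interior) (auto simp: a_def b_def)
  ultimately show ?thesis by simp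
qed

section \<open>Tails and the Mills ratio of the normal distribution\<close>

lemma std_normal_density_deriv:
  "(std_normal_density has_real_derivative (- x * std_normal_density x)) (at x)"
  unfolding normal_density_def
  by (auto intro!: derivative_eq_intros simp: field_simps)

lemma std_normal_cdf_bounds: "0 \<le> std_normal_cdf x" "std_normal_cdf x \<le> 1"
proof -
  interpret N: prob_space std_normal_distribution
    by (rule real_dist_normal_dist[THEN real_distribution.axioms(1)])
  show "0 \<le> std_normal_cdf x" "std_normal_cdf x \<le> 1" by (auto simp: std_normal_cdf_def)
qed

lemma std_normal_cdf_uminus: "std_normal_cdf (- x) = 1 - std_normal_cdf x"
proof -
  interpret N: prob_space std_normal_distribution
    by (rule real_dist_normal_dist[THEN real_distribution.axioms(1)])
  have "measure std_normal_distribution {..-x} = (\<integral>y. std_normal_density y *\<^sub>R indicator {..-x} y \<partial>lborel)"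
    by (subst integral_density[symmetric]) auto
  also have "\<dots> = (\<integral>y. std_normal_density (-y) *\<^sub>R indicator {..-x} (-y) \<partial>lborel)"
    by (subst lborel_integral_real_affine[of "-1" _ 0]) auto
  also have "\<dots> = (\<integral>y. std_normal_density y *\<^sub>R indicator {x..} y \<partial>lborel)"
    by (intro Bochner_Integration.integral_cong) (auto simp: normal_density_def indicator_def)
  also have "\<dots> = measure std_normal_distribution {x..}"
    by (subst integral_density[symmetric]) auto
  also have "{x..} = {x} \<union> {x<..}" by auto
  also have "measure std_normal_distribution \<dots> = measure std_normal_distribution {x} + measure std_normal_distribution {x<..}"
    by (intro N.finite_measure_Union) auto
  also have "measure std_normal_distribution {x} = 0"
    by (simp add: measure_def emeasure_density nn_integral_indicator_singleton)
  also have "{x<..} = space std_normal_distribution - {..x}" by auto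
  also have "measure std_normal_distribution \<dots> = 1 - measure std_normal_distribution {..x}"
    by (rule N.prob_compl) simp
  finally show ?thesis by (simp add: std_normal_cdf_def)
qed

text \<open>Markov's inequality for the fourth moment, which is 3. Any decay faster than
  \<open>1 / x\<^sup>2\<close> is enough for the limits at minus infinity in the Mills
  bounds.\<close>

lemma std_normal_cdf_tail:
  assumes "x < 0" shows "std_normal_cdf x \<le> 3 / x ^ 4"
proof -
  interpret N: prob_space std_normal_distribution
    by (rule real_dist_normal_dist[THEN real_distribution.axioms(1)])
  have m: "has_bochner_integral lborel (\<lambda>y. std_normal_density y * y ^ 4) 3"
    using std_normal_moment_even[of 2] by (simp add: fact_numeral)
  have i: "integrable std_normal_distribution (\<lambda>y. y ^ 4)" 
    using m by (subst integrable_density) (auto simp: has_bochner_integral_iff)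
  have e: "(\<integral>y. y ^ 4 \<partial>std_normal_distribution) = 3"
    using m by (subst integral_density) (auto simp: has_bochner_integral_iff)
  have "x ^ 4 * std_normal_cdf x = (\<integral>y. x ^ 4 * indicator {..x} y \<partial>std_normal_distribution)"
    by (simp add: std_normal_cdf_def)
  also have "\<dots> \<le> (\<integral>y. y ^ 4 \<partial>std_normal_distribution)"
  proof (rule integral_mono[OF _ i])
    show "integrable std_normal_distribution (\<lambda>y. x ^ 4 * indicator {..x} y)"
      by (intro integrable_mult_right N.integrable_const_bound[of _ 1]) (auto simp: indicator_def)
    fix y :: real
    show "x ^ 4 * indicator {..x} y \<le> y ^ 4"
      using assms by (auto simp: indicator_def power_mono_even)
  qed
  finally show ?thesis using assms e by (simp add: field_simps)
qed

text \<open>Call the two expressions \<open>B\<close> and \<open>A\<close>. Then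
  \<open>B' = std_normal_cdf\<close> and \<open>A' = 2 * B\<close>, and both tend to zero at minus
  infinity. Nonnegativity thus passes from the distribution function to \<open>B\<close> and from
  \<open>B\<close> to \<open>A\<close>.\<close>

lemma Mills_lower: "0 \<le> x * std_normal_cdf x + std_normal_density x"
  and Mills_sharp: "0 \<le> (1 + x\<^sup>2) * std_normal_cdf x + x * std_normal_density x"
proof -
  define A where "A = (\<lambda>x. (1 + x\<^sup>2) * std_normal_cdf x + x * std_normal_density x)"
  define B where "B = (\<lambda>x. x * std_normal_cdf x + std_normal_density x)"
  have dB: "(B has_real_derivative std_normal_cdf x) (at x)" for x
    unfolding B_def
    by (auto intro!: derivative_eq_intros std_normal_cdf_deriv std_normal_density_deriv)
  have dA: "(A has_real_derivative 2 * B x) (at x)" for x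
    unfolding A_def B_def
    by (auto intro!: derivative_eq_intros std_normal_cdf_deriv std_normal_density_deriv
        simp: algebra_simps power2_eq_square)
  have mono: "f y \<le> f x" if "\<And>x. (f has_real_derivative f' x) (at x)" "\<And>x. 0 \<le> f' x" "y \<le> x" for f f' :: "real \<Rightarrow> real" and x y
    using DERIV_nonneg_imp_nondecreasing[OF that(3), of f] that by blast
  have lim: "0 \<le> f x" if "\<And>y x. y \<le> x \<Longrightarrow> f y \<le> f x" "(f \<longlongrightarrow> 0) at_bot" for f :: "real \<Rightarrow> real" and x
  proof (rule tendsto_upperbound[OF that(2)])
    show "\<forall>\<^sub>F y in at_bot. f y \<le> f x"
      using eventually_le_at_bot[of x] by (rule eventually_mono) (rule that(1))
  qed auto
  \<comment> \<open>One limit serves both functions. The constant 16 comes from the density, by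
    squaring \<open>x\<^sup>2 / 4 \<le> exp (x\<^sup>2 / 4)\<close>.\<close>
  have c0: "((\<lambda>x. x^k * g x) \<longlongrightarrow> 0) at_bot"
    if "k \<le> 2" "\<And>x. 0 \<le> g x" "\<And>x. x < 0 \<Longrightarrow> g x \<le> 16 / x ^ 4" for k and g :: "real \<Rightarrow> real"
  proof (rule tendsto_rabs_zero_cancel, rule tendsto_sandwich[of "\<lambda>_. 0" _ _ "\<lambda>x. 16 / x\<^sup>2"])
    show "\<forall>\<^sub>F x in at_bot. \<bar>x ^ k * g x\<bar> \<le> 16 / x\<^sup>2"
      using eventually_le_at_bot[of "-1"]
    proof eventually_elim
      case (elim x)
      have "\<bar>x\<bar>^k \<le> \<bar>x\<bar>^2" using elim that by (intro power_increasing) auto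
      hence "\<bar>x\<bar> ^ k * g x \<le> x\<^sup>2 * (16 / x^4)"
        using elim that(2)[of x] that(3)[of x] by (intro mult_mono) auto
      also have "\<dots> = 16 / x\<^sup>2" using elim by (simp add: field_simps power2_eq_square power4_eq_xxxx)
      finally show ?case using that(2)[of x] by (simp add: abs_mult power_abs)
    qed
    show "((\<lambda>x::real. 16 / x\<^sup>2) \<longlongrightarrow> 0) at_bot"
      by (intro tendsto_divide_0[OF tendsto_const] filterlim_at_top_imp_at_infinity filterlim_pow_at_bot_even filterlim_ident) auto
  qed auto
  have cdf_tail: "std_normal_cdf x \<le> 16 / x ^ 4" if "x < 0" for x
  proof -
    have "3 / x ^ 4 \<le> 16 / x ^ 4" using that by (intro divide_right_mono) auto
    with std_normal_cdf_tail[OF that] show ?thesis by simp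
  qed
  have pdf_tail: "std_normal_density x \<le> 16 / x ^ 4" if "x < 0" for x
  proof -
    have "(x\<^sup>2 / 4)\<^sup>2 \<le> (exp (x\<^sup>2 / 4))\<^sup>2"
      by (intro power_mono order_trans[OF _ exp_ge_add_one_self[of "x\<^sup>2/4"]]) auto
    also have "\<dots> = exp (x\<^sup>2 / 2)" by (simp flip: exp_double)
    finally have "x ^ 4 \<le> 16 * exp (x\<^sup>2 / 2)" by (simp add: power_divide flip: power_mult)
    moreover have "0 < x ^ 4" using that by simp
    ultimately have "exp (- x\<^sup>2 / 2) \<le> 16 / x ^ 4"
      by (simp add: exp_minus field_simps)
    moreover have "1 / sqrt (2 * pi) \<le> 1" using pi_gt3 by simp
    ultimately have "1 / sqrt (2 * pi) * exp (- x\<^sup>2 / 2) \<le> 1 * (16 / x ^ 4)" by (intro mult_mono) auto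
    thus ?thesis by (simp add: std_normal_density_def)
  qed
  note c = c0[of _ std_normal_cdf, OF _ std_normal_cdf_bounds(1) cdf_tail]
  note d = c0[of _ std_normal_density, OF _ _ pdf_tail]
  have B0: "0 \<le> B x" for x
  proof (rule lim[of B])
    show "B y \<le> B x" if "y \<le> x" for x y using mono[OF dB _ that] std_normal_cdf_bounds by auto
    show "(B \<longlongrightarrow> 0) at_bot" unfolding B_def using tendsto_add[OF c[of 1] d[of 0]] by simp
  qed
  have A0: "0 \<le> A x" for x
  proof (rule lim[of A])
    show "A y \<le> A x" if "y \<le> x" for x y using mono[OF dA _ that] B0 by auto
    show "(A \<longlongrightarrow> 0) at_bot" unfolding A_def 
      using tendsto_add[OF tendsto_add[OF c[of 0] c[of 2]] d[of 1]] by (simp add: algebra_simps)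
  qed
  show "0 \<le> x * std_normal_cdf x + std_normal_density x" using B0[of x] by (simp add: B_def)
  show "0 \<le> (1 + x\<^sup>2) * std_normal_cdf x + x * std_normal_density x" using A0[of x] by (simp add: A_def)
qed

lemma std_normal_density_minus: "std_normal_density (- x) = std_normal_density x"
  by (simp add: std_normal_density_def)

text \<open>The derivative of the quotient is the expression in \<open>Mills_sharp\<close> divided
  by the density. This is the source of the monotonicity of
  \<open>w * stein_sol z w\<close>.\<close>

lemma Mills_mono:
  assumes "x \<le> y"
  shows "x * std_normal_cdf x / std_normal_density x \<le> y * std_normal_cdf y / std_normal_density y"
proof (rule DERIV_nonneg_imp_nondecreasing[OF assms])
  fix w
  have p: "0 < std_normal_density w" by (rule normal_density_pos) simp
  have "((\<lambda>w. w * std_normal_cdf w / std_normal_density w) has_real_derivative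
      ((1 + w\<^sup>2) * std_normal_cdf w + w * std_normal_density w) / std_normal_density w) (at w)"
    using p by (auto intro!: derivative_eq_intros std_normal_cdf_deriv std_normal_density_deriv
        simp: field_simps power2_eq_square)
  moreover have "0 \<le> ((1 + w\<^sup>2) * std_normal_cdf w + w * std_normal_density w) / std_normal_density w"
    using Mills_sharp[of w] p by simp
  ultimately show "\<exists>d. ((\<lambda>w. w * std_normal_cdf w / std_normal_density w) has_real_derivative d) (at w) \<and> 0 \<le> d"
    by blast
qed

text \<open>The bounded solution of Stein's equation \<open>h' w - w * h w = of_bool (w \<le> z) - \<Phi> z\<close>.\<close>

definition stein_sol :: "real \<Rightarrow> real \<Rightarrow> real" where
  "stein_sol z w = (if w \<le> z then std_normal_cdf w * (1 - std_normal_cdf z)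
     else std_normal_cdf z * (1 - std_normal_cdf w)) / std_normal_density w"

text \<open>Read off from Stein's equation instead of being defined as a derivative. This gives a
  value also at \<open>w = z\<close>, where the solution has a kink.\<close>

definition stein_sol_deriv :: "real \<Rightarrow> real \<Rightarrow> real" where
  "stein_sol_deriv z w = w * stein_sol z w + of_bool (w \<le> z) - std_normal_cdf z"

text \<open>Compared with \<open>stein_sol_deriv\<close> the indicator has the opposite sign, which
  makes both summands nondecreasing in \<open>w\<close>.\<close>

definition stein_osc :: "real \<Rightarrow> real \<Rightarrow> real" where
  "stein_osc z w = w * stein_sol z w - of_bool (w \<le> z)"

section \<open>Monotonicity and increments of the Stein solution\<close>

lemma stein_mult_le:
  "w \<le> z \<Longrightarrow> w * stein_sol z w = (w * std_normal_cdf w / std_normal_density w) * (1 - std_normal_cdf z)"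
  by (simp add: stein_sol_def)

lemma stein_mult_ge:
  "z \<le> w \<Longrightarrow> w * stein_sol z w = - ((- w) * std_normal_cdf (- w) / std_normal_density (- w)) * std_normal_cdf z"
  by (cases "w = z") (auto simp: stein_sol_def std_normal_cdf_uminus std_normal_density_minus algebra_simps
      minus_divide_left)

text \<open>Left of \<open>z\<close> this is \<open>Mills_mono\<close> times a nonnegative constant,
  right of \<open>z\<close> the same after reflecting \<open>w\<close> to \<open>- w\<close>. The
  two formulas agree at \<open>z\<close>.\<close>

lemma stein_mult_mono:
  assumes "u \<le> v" shows "u * stein_sol z u \<le> v * stein_sol z v"
proof -
  have 1: "u * stein_sol z u \<le> v * stein_sol z v" if "u \<le> v" "v \<le> z" for u v
    using that Mills_mono[of u v] std_normal_cdf_bounds[of z]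
    by (auto simp: stein_mult_le simp del: times_divide_eq_left intro!: mult_right_mono)
  have 2: "u * stein_sol z u \<le> v * stein_sol z v" if "u \<le> v" "z \<le> u" for u v
  proof -
    have "v * stein_sol z v - u * stein_sol z u =
      ((- u) * std_normal_cdf (- u) / std_normal_density (- u) - (- v) * std_normal_cdf (- v) / std_normal_density (- v)) * std_normal_cdf z"
      using that by (subst (1 2) stein_mult_ge) (auto simp: algebra_simps)
    also have "\<dots> \<ge> 0" using Mills_mono[of "-v" "-u"] that std_normal_cdf_bounds[of z] by (intro mult_nonneg_nonneg) auto
    finally show ?thesis by simp
  qed
  show ?thesis
    using 1[of u v] 2[of u v] 1[of u z] 2[of z v] assms by (cases "v \<le> z"; cases "z \<le> u") auto
qed

text \<open>\<open>Mills_lower\<close> yields the lower estimate on the left of \<open>z\<close> and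
  the upper one on the right. Monotonicity carries each to the opposite side through the value at
  \<open>z\<close>.\<close>

lemma stein_mult_bound: "\<bar>w * stein_sol z w\<bar> \<le> 1"
proof -
  have M: "- 1 \<le> w * std_normal_cdf w / std_normal_density w" for w
    using Mills_lower[of w] normal_density_pos[of 1 0 w] by (simp add: field_simps)
  have lo: "- 1 \<le> w * stein_sol z w" if "w \<le> z" for w
  proof -
    have "- 1 \<le> (- 1) * (1 - std_normal_cdf z)" using std_normal_cdf_bounds[of z] by simp
    also have "\<dots> \<le> (w * std_normal_cdf w / std_normal_density w) * (1 - std_normal_cdf z)"
      using std_normal_cdf_bounds[of z] M[of w] by (intro mult_right_mono) auto
    finally show ?thesis using that by (simp add: stein_mult_le)
  qed
  have up: "w * stein_sol z w \<le> 1" if "z \<le> w" for w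
  proof -
    have "(- 1) * std_normal_cdf z \<le> ((- w) * std_normal_cdf (- w) / std_normal_density (- w)) * std_normal_cdf z"
      using std_normal_cdf_bounds[of z] M[of "-w"] by (intro mult_right_mono) auto
    hence "w * stein_sol z w \<le> std_normal_cdf z" using that by (subst stein_mult_ge) auto
    also have "\<dots> \<le> 1" by (rule std_normal_cdf_bounds)
    finally show ?thesis .
  qed
  have "- 1 \<le> w * stein_sol z w" using lo[of w] lo[of z] stein_mult_mono[of z w z] by (cases "w \<le> z") auto
  moreover have "w * stein_sol z w \<le> 1" using up[of w] up[of z] stein_mult_mono[of w z z] by (cases "z \<le> w") auto
  ultimately show ?thesis by simp
qed

text \<open>On either side of \<open>z\<close> the mean value theorem applies, and the monotone
  product at the intermediate point lies between its end values. An interval around \<open>z\<close>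
  is cut there. Since the indicator is nonincreasing, it is evaluated at \<open>v\<close> in the
  lower bound and at \<open>u\<close> in the upper one.\<close>

lemma stein_increment:
  assumes "u < v"
  shows "(v - u) * (u * stein_sol z u + of_bool (v \<le> z) - std_normal_cdf z) \<le> stein_sol z v - stein_sol z u"
    and "stein_sol z v - stein_sol z u \<le> (v - u) * (v * stein_sol z v + of_bool (u \<le> z) - std_normal_cdf z)"
proof -
  define lo up where
    "lo = (\<lambda>u v. (v - u) * (u * stein_sol z u + of_bool (v \<le> z) - std_normal_cdf z))" and
    "up = (\<lambda>u v. (v - u) * (v * stein_sol z v + of_bool (u \<le> z) - std_normal_cdf z))"
  have p: "0 < std_normal_density w" for w by (rule normal_density_pos) simp
  have L: "lo u v \<le> stein_sol z v - stein_sol z u \<and> stein_sol z v - stein_sol z u \<le> up u v" if uv: "u < v" "v \<le> z" for u v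
  proof -
    define f where "f = (\<lambda>w. std_normal_cdf w * (1 - std_normal_cdf z) / std_normal_density w)"
    have f: "stein_sol z w = f w" if "w \<le> z" for w using that by (simp add: f_def stein_sol_def)
    have df: "(f has_real_derivative (w * f w + 1 - std_normal_cdf z)) (at w)" for w
      unfolding f_def using p[of w]
      by (auto intro!: derivative_eq_intros std_normal_cdf_deriv std_normal_density_deriv simp: field_simps power2_eq_square)
    obtain c where c: "u < c" "c < v" "f v - f u = (v - u) * (c * f c + 1 - std_normal_cdf z)"
      using MVT2[OF uv(1), of f, OF df] by blast
    have "u * f u \<le> c * f c" "c * f c \<le> v * f v" 
      using stein_mult_mono[of u c z] stein_mult_mono[of c v z] c uv f by auto
    thus ?thesis using uv c f by (auto simp: lo_def up_def)
  qed
  have R: "lo u v \<le> stein_sol z v - stein_sol z u \<and> stein_sol z v - stein_sol z u \<le> up u v" if uv: "u < v" "z \<le> u" for u v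
  proof -
    define f where "f = (\<lambda>w. std_normal_cdf z * (1 - std_normal_cdf w) / std_normal_density w)"
    have f: "stein_sol z w = f w" if "z \<le> w" for w using that by (auto simp: f_def stein_sol_def)
    have df: "(f has_real_derivative (w * f w - std_normal_cdf z)) (at w)" for w
      unfolding f_def using p[of w]
      by (auto intro!: derivative_eq_intros std_normal_cdf_deriv std_normal_density_deriv simp: field_simps power2_eq_square)
    obtain c where c: "u < c" "c < v" "f v - f u = (v - u) * (c * f c - std_normal_cdf z)"
      using MVT2[OF uv(1), of f, OF df] by blast
    have *: "u * f u \<le> c * f c" "c * f c \<le> v * f v" 
      using stein_mult_mono[of u c z] stein_mult_mono[of c v z] c uv f by auto
    have "(v - u) * (c * f c - std_normal_cdf z) \<le> (v - u) * (v * f v + of_bool (u \<le> z) - std_normal_cdf z)"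
      using uv * by (intro mult_left_mono) auto
    thus ?thesis using uv c f * by (auto simp: lo_def up_def)
  qed
  have "lo u v \<le> stein_sol z v - stein_sol z u \<and> stein_sol z v - stein_sol z u \<le> up u v"
  proof (cases "u < z \<and> z < v")
    case True
    have "lo u v \<le> lo u z + lo z v"
    proof -
      have "(z - u) * (u * stein_sol z u + of_bool (v \<le> z) - std_normal_cdf z)
        \<le> (z - u) * (u * stein_sol z u + of_bool (z \<le> z) - std_normal_cdf z)"
        using True by (intro mult_left_mono) auto
      moreover have "(v - z) * (u * stein_sol z u + of_bool (v \<le> z) - std_normal_cdf z)
        \<le> (v - z) * (z * stein_sol z z + of_bool (v \<le> z) - std_normal_cdf z)"
        using True stein_mult_mono[of u z z] by (intro mult_left_mono) auto
      ultimately show ?thesis by (simp add: lo_def algebra_simps)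
    qed
    moreover have "up u z + up z v \<le> up u v"
    proof -
      have "(z - u) * (z * stein_sol z z + of_bool (u \<le> z) - std_normal_cdf z)
        \<le> (z - u) * (v * stein_sol z v + of_bool (u \<le> z) - std_normal_cdf z)"
        using True stein_mult_mono[of z v z] by (intro mult_left_mono) auto
      moreover have "(v - z) * (v * stein_sol z v + of_bool (z \<le> z) - std_normal_cdf z)
        \<le> (v - z) * (v * stein_sol z v + of_bool (u \<le> z) - std_normal_cdf z)"
        using True by (intro mult_left_mono) auto
      ultimately show ?thesis by (simp add: up_def algebra_simps)
    qed
    ultimately show ?thesis using L[of u z] R[of z v] True by auto
  qed (use L[of u v] R[of u v] assms in auto)
  thus "(v - u) * (u * stein_sol z u + of_bool (v \<le> z) - std_normal_cdf z) \<le> stein_sol z v - stein_sol z u"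
    "stein_sol z v - stein_sol z u \<le> (v - u) * (v * stein_sol z v + of_bool (u \<le> z) - std_normal_cdf z)"
    by (auto simp: lo_def up_def)
qed

lemma stein_osc_bound: "\<bar>stein_osc z w\<bar> \<le> 2"
  using stein_mult_bound[of w z] by (auto simp: stein_osc_def)

lemma stein_sol_deriv_bound: "\<bar>stein_sol_deriv z w\<bar> \<le> 2"
  using stein_mult_bound[of w z] std_normal_cdf_bounds[of z] by (auto simp: stein_sol_deriv_def)

text \<open>Both bounds of \<open>stein_increment\<close> are off the linear term by at most
  \<open>v - u\<close> times the increment of \<open>stein_osc\<close>. The right-hand side is
  nonnegative for either order of \<open>a\<close> and \<open>b\<close>, because
  \<open>stein_osc\<close> is nondecreasing.\<close>

lemma stein_taylor:
  "\<bar>stein_sol z a - stein_sol z b - (a - b) * stein_sol_deriv z a\<bar> \<le> (a - b) * (stein_osc z a - stein_osc z b)"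
proof -
  have prod: "0 \<le> (v - u) * (v * stein_sol z v - u * stein_sol z u)"
    "0 \<le> (v - u) * (of_bool (u \<le> z) - of_bool (v \<le> z))" if "u < v" for u v
    using that stein_mult_mono[of u v z] by (auto intro!: mult_nonneg_nonneg)
  consider "a = b" | "b < a" | "a < b" by linarith
  thus ?thesis
  proof cases
    case 2
    from stein_increment[OF 2, of z] prod[OF 2] show ?thesis
      unfolding stein_sol_deriv_def stein_osc_def by (auto simp: abs_le_iff algebra_simps)
  next
    case 3
    from stein_increment[OF 3, of z] prod[OF 3] show ?thesis
      unfolding stein_sol_deriv_def stein_osc_def by (auto simp: abs_le_iff algebra_simps)
  qed auto
qed

section \<open>Independent coordinates and the Efron--Stein inequality\<close>

locale indep_family =
  fixes \<nu> :: "'i \<Rightarrow> 'b measure"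
  assumes prob_\<nu>: "\<And>i. prob_space (\<nu> i)"

sublocale indep_family \<subseteq> product_prob_space \<nu> UNIV
  by (rule product_prob_spaceI) (rule prob_\<nu>)

lemma bounded_integrable:
  assumes "prob_space M" "f \<in> borel_measurable M" "\<And>x. \<bar>f x\<bar> \<le> (B::real)"
  shows "integrable M f"
proof -
  interpret prob_space M by fact
  show ?thesis by (rule integrable_const_bound[of _ B]) (use assms in auto)
qed

lemma bounded_integrable_space:
  assumes "prob_space M" "f \<in> borel_measurable M" "\<And>x. x \<in> space M \<Longrightarrow> \<bar>f x\<bar> \<le> (B::real)"
  shows "integrable M f"
proof -
  interpret prob_space M by fact
  show ?thesis by (rule integrable_const_bound[of _ B]) (use assms in auto)
qed

lemma bounded_expectation:
  assumes "prob_space M" "f \<in> borel_measurable M" "\<And>x. \<bar>f x\<bar> \<le> (B::real)"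
  shows "\<bar>integral\<^sup>L M f\<bar> \<le> B"
proof -
  interpret prob_space M by fact
  have "\<bar>integral\<^sup>L M f\<bar> \<le> (\<integral>x. \<bar>f x\<bar> \<partial>M)" by (rule integral_abs_bound)
  also have "\<dots> \<le> (\<integral>x. B \<partial>M)"
    using assms order_trans[OF abs_ge_zero assms(3)[of undefined]]
    by (intro integral_mono bounded_integrable[OF assms(1), of _ B]) auto
  finally show ?thesis by (simp add: prob_space)
qed

lemma expectation_abs_le_sqrt:
  assumes "prob_space M" "f \<in> borel_measurable M" "\<And>x. \<bar>f x\<bar> \<le> (B::real)"
  shows "(\<integral>x. \<bar>f x\<bar> \<partial>M) \<le> sqrt (\<integral>x. (f x)\<^sup>2 \<partial>M)"
proof -
  interpret prob_space M by fact
  have [measurable]: "f \<in> borel_measurable M" by fact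
  have "0 \<le> B" using assms(3)[of undefined] by linarith
  hence i: "integrable M (\<lambda>x. \<bar>f x\<bar>)" "integrable M (\<lambda>x. (\<bar>f x\<bar>)\<^sup>2)"
    using assms(3) by (intro bounded_integrable[OF assms(1), of _ B] bounded_integrable[OF assms(1), of _ "B\<^sup>2"];
      simp add: power2_le_iff_abs_le)+
  have "(\<integral>x. \<bar>f x\<bar> \<partial>M)\<^sup>2 \<le> (\<integral>x. (\<bar>f x\<bar>)\<^sup>2 \<partial>M)"
    using variance_eq[OF i] variance_positive[of "\<lambda>x. \<bar>f x\<bar>"] by simp
  thus ?thesis by (intro real_le_rsqrt) simp
qed

context indep_family begin

lemma prob_PiM: "prob_space (PiM I \<nu>)"
  by (rule prob_space_PiM) (rule prob_\<nu>)

lemma section_measurable: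
  assumes "f \<in> borel_measurable (PiM (insert j I) \<nu>)" "j \<notin> I" "x \<in> space (PiM I \<nu>)"
  shows "(\<lambda>z. f (x(j := z))) \<in> borel_measurable (\<nu> j)"
  using measurable_comp[OF measurable_component_update[OF assms(3,2)] assms(1)] by (simp add: comp_def)

lemma integral_section_measurable:
  fixes f :: "('i \<Rightarrow> 'b) \<Rightarrow> real"
  assumes [measurable]: "f \<in> borel_measurable (PiM (insert j I) \<nu>)"
  shows "(\<lambda>x. \<integral>z. f (x(j := z)) \<partial>\<nu> j) \<in> borel_measurable (PiM I \<nu>)"
proof -
  have "(\<lambda>(x, z). f (x(j := z))) \<in> borel_measurable (PiM I \<nu> \<Otimes>\<^sub>M \<nu> j)"
    by measurable
  thus ?thesis by (rule sigma_finite_measure.borel_measurable_lebesgue_integral[OF prob_space_imp_sigma_finite[OF prob_\<nu>]])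
qed

lemma section_measurable':
  assumes "f \<in> borel_measurable (PiM I \<nu>)" "j \<in> I" "x \<in> space (PiM I \<nu>)"
  shows "(\<lambda>z. f (x(j := z))) \<in> borel_measurable (\<nu> j)"
proof -
  have I: "insert j (I - {j}) = I" using assms by auto
  have "restrict x (I - {j}) \<in> space (PiM (I - {j}) \<nu>)" using assms(3) by (auto simp: space_PiM)
  from section_measurable[OF _ _ this, of f j] assms(1) I
  have "(\<lambda>z. f ((restrict x (I - {j}))(j := z))) \<in> borel_measurable (\<nu> j)" by simp
  moreover have "(restrict x (I - {j}))(j := z) = x(j := z)" for z
    using assms(2,3) by (auto simp: space_PiM restrict_def fun_eq_iff PiE_def extensional_def)
  ultimately show ?thesis by simp
qed

text \<open>Fubini in the coordinate \<open>j\<close>. The outer integral may again run over all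
  coordinates, because the inner one no longer depends on \<open>x j\<close>.\<close>

lemma resample_integral:
  fixes f :: "('i \<Rightarrow> 'b) \<Rightarrow> real"
  assumes I: "finite I" "j \<in> I" and f[measurable]: "f \<in> borel_measurable (PiM I \<nu>)" and B: "\<And>x. \<bar>f x\<bar> \<le> B"
  shows "(\<integral>x. f x \<partial>PiM I \<nu>) = (\<integral>x. (\<integral>z. f (x(j := z)) \<partial>\<nu> j) \<partial>PiM I \<nu>)"
proof -
  define I' where "I' = I - {j}"
  have II: "I = insert j I'" "finite I'" "j \<notin> I'" using I by (auto simp: I'_def)
  have 1: "(\<integral>x. f x \<partial>PiM I \<nu>) = (\<integral>x. (\<integral>z. f (x(j := z)) \<partial>\<nu> j) \<partial>PiM I' \<nu>)"
    unfolding II(1) using II f by (intro product_integral_insert bounded_integrable[OF prob_PiM _ B]) auto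
  define g where "g = (\<lambda>x. \<integral>z. f (x(j := z)) \<partial>\<nu> j)"
  have gm: "g \<in> borel_measurable (PiM I \<nu>)"
  proof -
    have "(\<lambda>(x, z). f (x(j := z))) \<in> borel_measurable (PiM I \<nu> \<Otimes>\<^sub>M \<nu> j)"
    proof -
      have "(\<lambda>(x, z). x(j := z)) \<in> measurable (PiM I \<nu> \<Otimes>\<^sub>M \<nu> j) (PiM (insert j I) \<nu>)" by measurable
      moreover have "insert j I = I" using I by auto
      ultimately have "(\<lambda>(x, z). x(j := z)) \<in> measurable (PiM I \<nu> \<Otimes>\<^sub>M \<nu> j) (PiM I \<nu>)" by simp
      from measurable_comp[OF this f] show ?thesis by (simp add: comp_def case_prod_beta)
    qed
    thus ?thesis unfolding g_def by (rule sigma_finite_measure.borel_measurable_lebesgue_integral[OF prob_space_imp_sigma_finite[OF prob_\<nu>]])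
  qed
  have gB: "\<bar>g x\<bar> \<le> B" if "x \<in> space (PiM I \<nu>)" for x
    unfolding g_def by (rule bounded_expectation[OF prob_\<nu> section_measurable'[OF f I(2) that] B])
  have "(\<integral>x. g x \<partial>PiM I \<nu>) = (\<integral>x. (\<integral>z. g (x(j := z)) \<partial>\<nu> j) \<partial>PiM I' \<nu>)"
    by (rule product_integral_insert[OF II(2,3), folded II(1), OF bounded_integrable_space[OF prob_PiM gm gB]])
  also have "\<dots> = (\<integral>x. g x \<partial>PiM I' \<nu>)" by (simp add: g_def prob_space.prob_space[OF prob_\<nu>])
  finally show ?thesis unfolding 1 g_def by (rule sym)
qed

text \<open>Since the substituted value \<open>d j\<close> is constant, each term bounds the conditional variance
  in the coordinate \<open>j\<close>, and Jensen's inequality lets the induction integrate out the others.\<close>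

lemma Efron_Stein:
  fixes g :: "('i \<Rightarrow> 'b) \<Rightarrow> real"
  assumes "finite I" "g \<in> borel_measurable (PiM I \<nu>)" "\<And>x. \<bar>g x\<bar> \<le> B" and d: "\<And>i. d i \<in> space (\<nu> i)"
  shows "(\<integral>x. (g x)\<^sup>2 \<partial>PiM I \<nu>) - (\<integral>x. g x \<partial>PiM I \<nu>)\<^sup>2
    \<le> (\<Sum>j\<in>I. \<integral>x. (g x - g (x(j := d j)))\<^sup>2 \<partial>PiM I \<nu>)"
  using assms(1-3)
proof (induction I arbitrary: g rule: finite_induct)
  case empty
  have "(\<integral>x. f x \<partial>PiM {} \<nu>) = f (\<lambda>k. undefined)" for f :: "('i \<Rightarrow> 'b) \<Rightarrow> real"
    by (simp add: PiM_empty lebesgue_integral_count_space_finite)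
  thus ?case by simp
next
  case (insert j I g)
  note [measurable] = insert.prems(1)
  note B = insert.prems(2)
  have B0: "0 \<le> B" using B[of undefined] by linarith
  have sqB: "\<bar>(g x)\<^sup>2\<bar> \<le> B\<^sup>2" for x using B[of x] by (simp add: power2_le_iff_abs_le B0)
  have dB: "\<bar>(g x - g y)\<^sup>2\<bar> \<le> (2 * B)\<^sup>2" for x y 
  proof -
    have "\<bar>g x - g y\<bar> \<le> \<bar>2 * B\<bar>" using B[of x] B[of y] by linarith
    thus ?thesis by (simp only: abs_le_square_iff abs_power2)
  qed
  have gB: "\<bar>g x - g y\<bar> \<le> 2 * B" for x y using B[of x] B[of y] by linarith
  define h where "h = (\<lambda>x. \<integral>z. g (x(j := z)) \<partial>\<nu> j)"
  have hm[measurable]: "h \<in> borel_measurable (PiM I \<nu>)" unfolding h_def by (rule integral_section_measurable) measurable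
  have upd: "(\<lambda>x. x(i := d i)) \<in> measurable (PiM K \<nu>) (PiM K \<nu>)" if "i \<in> K" for i K
  proof -
    have "(\<lambda>x. x(i := d i)) \<in> measurable (PiM K \<nu>) (PiM (insert i K) \<nu>)"
      using d[of i] by measurable
    thus ?thesis using that by (simp add: insert_absorb)
  qed
  \<comment> \<open>The induction hypothesis wants the bound at every argument, while
    \<open>h\<close> is controlled only on the product space. Clipping enforces the bound and
    changes nothing on that space.\<close>
  define h' where "h' = (\<lambda>x. max (-B) (min B (h x)))"
  have hh: "h' x = h x" if "x \<in> space (PiM I \<nu>)" for x
  proof -
    have "\<bar>h x\<bar> \<le> B" unfolding h_def
      by (rule bounded_expectation[OF prob_\<nu> section_measurable[OF insert.prems(1) insert.hyps(2) that] B])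
    thus ?thesis by (simp add: h'_def)
  qed
  have h'B: "\<bar>h' x\<bar> \<le> B" for x using B0 by (auto simp: h'_def)
  have "h' \<in> borel_measurable (PiM I \<nu>)" unfolding h'_def by measurable
  note IH = insert.IH[OF this h'B]
  have fold: "(\<integral>x. F x \<partial>PiM (insert j I) \<nu>) = (\<integral>x. (\<integral>z. F (x(j := z)) \<partial>\<nu> j) \<partial>PiM I \<nu>)"
    if "F \<in> borel_measurable (PiM (insert j I) \<nu>)" "\<And>x. \<bar>F x\<bar> \<le> C" for F and C :: real
    by (rule product_integral_insert[OF insert.hyps bounded_integrable[OF prob_PiM that]])
  have int1: "integrable (PiM I \<nu>) (\<lambda>x. \<integral>z. F (x(j := z)) \<partial>\<nu> j)"
    if "F \<in> borel_measurable (PiM (insert j I) \<nu>)" "\<And>x. \<bar>F x\<bar> \<le> C" for F and C :: real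
    using integral_section_measurable[OF that(1)]
      bounded_expectation[OF prob_\<nu> section_measurable[OF that(1) insert.hyps(2)] that(2)]
    by (intro bounded_integrable_space[OF prob_PiM, of _ _ C]) auto
  have h2: "integrable (PiM I \<nu>) (\<lambda>x. (h x)\<^sup>2)"
  proof (rule bounded_integrable_space[OF prob_PiM, of _ _ "B\<^sup>2"])
    show "\<bar>(h x)\<^sup>2\<bar> \<le> B\<^sup>2" if "x \<in> space (PiM I \<nu>)" for x
      using h'B[of x] hh[OF that] B0 by (simp add: power2_le_iff_abs_le)
  qed measurable
  define c where "c = (\<lambda>x. (g x - g (x(j := d j)))\<^sup>2)"
  have gi: "(\<lambda>x. g (x(i := d i))) \<in> borel_measurable (PiM (insert j I) \<nu>)" if "i \<in> insert j I" for i
    using measurable_comp[OF upd[OF that] insert.prems(1)] by (simp add: comp_def)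
  have cm: "c \<in> borel_measurable (PiM (insert j I) \<nu>)" unfolding c_def
    by (intro borel_measurable_power borel_measurable_diff insert.prems(1) gi) auto
  have cB: "\<bar>c x\<bar> \<le> (2*B)\<^sup>2" for x unfolding c_def by (rule dB)
  have "(\<integral>x. (g x)\<^sup>2 \<partial>PiM (insert j I) \<nu>) = (\<integral>x. (\<integral>z. (g (x(j := z)))\<^sup>2 \<partial>\<nu> j) \<partial>PiM I \<nu>)"
    by (rule fold[OF _ sqB]) measurable
  also have "\<dots> \<le> (\<integral>x. (h x)\<^sup>2 + (\<integral>z. c (x(j := z)) \<partial>\<nu> j) \<partial>PiM I \<nu>)"
  proof (rule integral_mono)
    show "integrable (PiM I \<nu>) (\<lambda>x. \<integral>z. (g (x(j := z)))\<^sup>2 \<partial>\<nu> j)"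
      by (rule int1[OF _ sqB]) measurable
    show "integrable (PiM I \<nu>) (\<lambda>x. (h x)\<^sup>2 + (\<integral>z. c (x(j := z)) \<partial>\<nu> j))"
      by (intro Bochner_Integration.integrable_add h2 int1[OF cm cB])
    fix x assume x: "x \<in> space (PiM I \<nu>)"
    note sm[measurable] = section_measurable[OF insert.prems(1) insert.hyps(2) x]
    define a where "a = g (x(j := d j))"
    have i: "integrable (\<nu> j) (\<lambda>z. g (x(j := z)))" by (rule bounded_integrable[OF prob_\<nu> sm B])
    have i2: "integrable (\<nu> j) (\<lambda>z. (g (x(j := z)))\<^sup>2)" by (rule bounded_integrable[OF prob_\<nu> _ sqB]) measurable
    have "(\<integral>z. c (x(j := z)) \<partial>\<nu> j) = (\<integral>z. (g (x(j := z)))\<^sup>2 - 2 * a * g (x(j := z)) + a\<^sup>2 \<partial>\<nu> j)"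
      by (intro Bochner_Integration.integral_cong) (auto simp: c_def a_def power2_eq_square algebra_simps)
    also have "\<dots> = (\<integral>z. (g (x(j := z)))\<^sup>2 \<partial>\<nu> j) - 2 * a * h x + a\<^sup>2"
      using i i2 by (simp add: h_def prob_space.prob_space[OF prob_\<nu>])
    finally have "(h x)\<^sup>2 + (\<integral>z. c (x(j := z)) \<partial>\<nu> j) = (\<integral>z. (g (x(j := z)))\<^sup>2 \<partial>\<nu> j) + (h x - a)\<^sup>2"
      by (simp add: power2_eq_square algebra_simps)
    thus "(\<integral>z. (g (x(j := z)))\<^sup>2 \<partial>\<nu> j) \<le> (h x)\<^sup>2 + (\<integral>z. c (x(j := z)) \<partial>\<nu> j)" by simp
  qed
  also have "\<dots> = (\<integral>x. (h x)\<^sup>2 \<partial>PiM I \<nu>) + (\<integral>x. c x \<partial>PiM (insert j I) \<nu>)"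
    using fold[OF cm cB] by (simp add: h2 int1[OF cm cB])
  finally have 1: "(\<integral>x. (g x)\<^sup>2 \<partial>PiM (insert j I) \<nu>) \<le> (\<integral>x. (h x)\<^sup>2 \<partial>PiM I \<nu>) + (\<integral>x. c x \<partial>PiM (insert j I) \<nu>)" .
  have e1: "(\<integral>x. h' x \<partial>PiM I \<nu>) = (\<integral>x. g x \<partial>PiM (insert j I) \<nu>)"
    unfolding fold[OF insert.prems(1) B] h_def[symmetric] by (intro Bochner_Integration.integral_cong) (simp_all add: hh)
  have e2: "(\<integral>x. (h' x)\<^sup>2 \<partial>PiM I \<nu>) = (\<integral>x. (h x)\<^sup>2 \<partial>PiM I \<nu>)"
    by (intro Bochner_Integration.integral_cong) (simp_all add: hh)
  have e3: "(\<integral>x. (h' x - h' (x(i := d i)))\<^sup>2 \<partial>PiM I \<nu>) \<le> (\<integral>x. (g x - g (x(i := d i)))\<^sup>2 \<partial>PiM (insert j I) \<nu>)" if i: "i \<in> I" for i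
  proof -
    have ij: "i \<noteq> j" using i insert.hyps by auto
    have m: "(\<lambda>x. (g x - g (x(i := d i)))\<^sup>2) \<in> borel_measurable (PiM (insert j I) \<nu>)"
      using i by (intro borel_measurable_power borel_measurable_diff insert.prems(1) gi) auto
    have hm': "(\<lambda>x. h' (x(i := d i))) \<in> borel_measurable (PiM I \<nu>)" 
      unfolding h'_def using measurable_comp[OF upd[OF i] hm] by (simp add: comp_def)
    have "(\<integral>x. (h' x - h' (x(i := d i)))\<^sup>2 \<partial>PiM I \<nu>) \<le> (\<integral>x. (\<integral>z. (g (x(j:=z)) - g ((x(j := z))(i := d i)))\<^sup>2 \<partial>\<nu> j) \<partial>PiM I \<nu>)"
    proof (rule integral_mono[OF _ int1[OF m dB]])
      show "integrable (PiM I \<nu>) (\<lambda>x. (h' x - h' (x(i := d i)))\<^sup>2)"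
      proof (rule bounded_integrable[OF prob_PiM, of _ _ "(2*B)\<^sup>2"])
        show "(\<lambda>x. (h' x - h' (x(i := d i)))\<^sup>2) \<in> borel_measurable (PiM I \<nu>)"
          using hm' \<open>h' \<in> borel_measurable (PiM I \<nu>)\<close> by measurable
        show "\<bar>(h' x - h' (x(i := d i)))\<^sup>2\<bar> \<le> (2 * B)\<^sup>2" for x
        proof -
          have "\<bar>h' x - h' (x(i := d i))\<bar> \<le> \<bar>2 * B\<bar>" using h'B[of x] h'B[of "x(i := d i)"] by linarith
          thus ?thesis by (simp only: abs_le_square_iff abs_power2)
        qed
      qed
      fix x assume x: "x \<in> space (PiM I \<nu>)"
      have x': "x(i := d i) \<in> space (PiM I \<nu>)" using measurable_space[OF upd[OF i] x] .
      note s1[measurable] = section_measurable[OF insert.prems(1) insert.hyps(2) x]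
      note s2[measurable] = section_measurable[OF insert.prems(1) insert.hyps(2) x']
      have "h' x - h' (x(i := d i)) = (\<integral>z. g (x(j:=z)) - g (x(i := d i, j := z)) \<partial>\<nu> j)"
        unfolding hh[OF x] hh[OF x'] h_def
        by (rule Bochner_Integration.integral_diff[symmetric])
          (rule bounded_integrable[OF prob_\<nu> s1 B] bounded_integrable[OF prob_\<nu> s2 B])+
      also have "\<bar>\<dots>\<bar> \<le> (\<integral>z. \<bar>g (x(j:=z)) - g (x(i := d i, j := z))\<bar> \<partial>\<nu> j)" by (rule integral_abs_bound)
      also have "\<dots> \<le> sqrt (\<integral>z. (g (x(j:=z)) - g (x(i := d i, j := z)))\<^sup>2 \<partial>\<nu> j)"
        by (rule expectation_abs_le_sqrt[OF prob_\<nu> borel_measurable_diff[OF s1 s2] gB])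
      finally have "(h' x - h' (x(i := d i)))\<^sup>2 \<le> (\<integral>z. (g (x(j:=z)) - g (x(i := d i, j := z)))\<^sup>2 \<partial>\<nu> j)"
        by (metis real_sqrt_abs real_sqrt_le_iff)
      thus "(h' x - h' (x(i := d i)))\<^sup>2 \<le> (\<integral>z. (g (x(j:=z)) - g ((x(j := z))(i := d i)))\<^sup>2 \<partial>\<nu> j)"
        using ij by (simp add: fun_upd_twist)
    qed
    also have "\<dots> = (\<integral>x. (g x - g (x(i := d i)))\<^sup>2 \<partial>PiM (insert j I) \<nu>)"
      by (rule fold[OF m dB, symmetric])
    finally show ?thesis .
  qed
  have "(\<integral>x. (h x)\<^sup>2 \<partial>PiM I \<nu>) - (\<integral>x. g x \<partial>PiM (insert j I) \<nu>)\<^sup>2 \<le> (\<Sum>i\<in>I. \<integral>x. (g x - g (x(i := d i)))\<^sup>2 \<partial>PiM (insert j I) \<nu>)"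
    using IH unfolding e1 e2 by (rule order_trans) (rule sum_mono[OF e3])
  with 1 show ?case
    unfolding sum.insert[OF insert.hyps] c_def by linarith
qed

end

section \<open>Normal approximation by interpolation\<close>

lemma abs_mult_bound: "\<bar>a\<bar> \<le> A \<Longrightarrow> \<bar>b\<bar> \<le> B \<Longrightarrow> \<bar>a * b\<bar> \<le> A * B" for a b A B :: real
  unfolding abs_mult by (rule mult_mono') auto

locale indep_seq = indep_family \<nu> for \<nu> :: "nat \<Rightarrow> 'b measure" +
  fixes m :: nat
begin

sublocale dbl: indep_family "\<lambda>p::nat \<times> bool. \<nu> (fst p)"
  by (rule indep_family.intro) (rule prob_\<nu>)

definition sites :: "(nat \<times> bool) set" where "sites = {..<m} \<times> UNIV"

abbreviation single :: "(nat \<Rightarrow> 'b) measure" where "single \<equiv> PiM {..<m} \<nu>"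
abbreviation doubled :: "(nat \<times> bool \<Rightarrow> 'b) measure" where "doubled \<equiv> PiM sites (\<lambda>p. \<nu> (fst p))"

text \<open>All configurations of the interpolation are selections of one copy per coordinate, so a
  single change of variables gives each of them the law \<open>single\<close>.\<close>

definition sel :: "(nat \<Rightarrow> bool) \<Rightarrow> (nat \<times> bool \<Rightarrow> 'b) \<Rightarrow> nat \<Rightarrow> 'b" where
  "sel s y = (\<lambda>i\<in>{..<m}. y (i, s i))"

definition swap :: "nat \<Rightarrow> (nat \<times> bool \<Rightarrow> 'b) \<Rightarrow> nat \<times> bool \<Rightarrow> 'b" where
  "swap k y = (\<lambda>p\<in>sites. y (fst p, if fst p = k then \<not> snd p else snd p))"

lemma finite_sites: "finite sites" by (simp add: sites_def)

lemma prob_single: "prob_space single" by (rule prob_PiM)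
lemma prob_doubled: "prob_space doubled" by (rule dbl.prob_PiM)

lemma sel_swap: "sel s (swap k y) = sel (s(k := \<not> s k)) y"
  by (auto simp: sel_def swap_def sites_def fun_eq_iff restrict_def)

lemma distr_sel: "distr doubled single (sel s) = single"
  unfolding sel_def
  using distr_PiM_reindex[of sites "\<lambda>p. \<nu> (fst p)" "\<lambda>i. (i, s i)" "{..<m}"] prob_\<nu>
  by (simp add: sites_def inj_on_def)

lemma distr_swap: "distr doubled doubled (swap k) = doubled"
proof -
  have "inj_on (\<lambda>p. (fst p, if fst p = k then \<not> snd p else snd p)) sites"
    by (auto simp: inj_on_def split: if_splits)
  moreover have "(\<lambda>p. (fst p, if fst p = k then \<not> snd p else snd p)) \<in> sites \<rightarrow> sites"
    by (auto simp: sites_def)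
  ultimately show ?thesis
    unfolding swap_def using distr_PiM_reindex[of sites "\<lambda>p. \<nu> (fst p)" "\<lambda>p. (fst p, if fst p = k then \<not> snd p else snd p)" sites] prob_\<nu>
    by (simp only: fst_conv)
qed

lemma measurable_sel[measurable]: "sel s \<in> measurable doubled single"
  unfolding sel_def
proof (rule measurable_restrict)
  fix i assume "i \<in> {..<m}"
  hence "(i, s i) \<in> sites" by (auto simp: sites_def)
  from measurable_component_singleton[OF this, of "\<lambda>p. \<nu> (fst p)"]
  show "(\<lambda>y. y (i, s i)) \<in> measurable doubled (\<nu> i)" by simp
qed

lemma measurable_swap[measurable]: "swap k \<in> measurable doubled doubled"
  unfolding swap_def
proof (rule measurable_restrict)
  fix p assume "p \<in> sites"
  hence "(fst p, if fst p = k then \<not> snd p else snd p) \<in> sites" by (auto simp: sites_def)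
  from measurable_component_singleton[OF this, of "\<lambda>p. \<nu> (fst p)"]
  show "(\<lambda>y. y (fst p, if fst p = k then \<not> snd p else snd p)) \<in> measurable doubled (\<nu> (fst p))" by simp
qed

lemma integral_sel:
  fixes f :: "(nat \<Rightarrow> 'b) \<Rightarrow> real"
  assumes "f \<in> borel_measurable single"
  shows "(\<integral>y. f (sel s y) \<partial>doubled) = (\<integral>x. f x \<partial>single)"
  using integral_distr[OF measurable_sel assms, of s] by (simp add: distr_sel)

lemma integral_swap:
  fixes f :: "(nat \<times> bool \<Rightarrow> 'b) \<Rightarrow> real"
  assumes "f \<in> borel_measurable doubled"
  shows "(\<integral>y. f (swap k y) \<partial>doubled) = (\<integral>y. f y \<partial>doubled)"
  using integral_distr[OF measurable_swap assms, of k] by (simp add: distr_swap)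

lemma integral_sel_indep:
  fixes f g :: "(nat \<Rightarrow> 'b) \<Rightarrow> real"
  assumes f[measurable]: "f \<in> borel_measurable single" and g[measurable]: "g \<in> borel_measurable single"
    and B: "\<And>x. \<bar>f x\<bar> \<le> B" "\<And>x. \<bar>g x\<bar> \<le> B'"
  shows "(\<integral>y. f (sel (\<lambda>_. True) y) * g (sel (\<lambda>_. False) y) \<partial>doubled) = (\<integral>x. f x \<partial>single) * (\<integral>x. g x \<partial>single)"
proof -
  define A where "A b = {..<m} \<times> {b}" for b :: bool
  have A: "A False \<inter> A True = {}" "finite (A b)" "A False \<union> A True = sites" for b
    by (auto simp: A_def sites_def)
  have part: "(\<integral>y. u (\<lambda>i\<in>{..<m}. y (i, b)) \<partial>PiM (A b) (\<lambda>p. \<nu> (fst p))) = (\<integral>x. u x \<partial>single)"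
    if u: "u \<in> borel_measurable single" for u :: "(nat \<Rightarrow> 'b) \<Rightarrow> real" and b
  proof -
    have "distr (PiM (A b) (\<lambda>p. \<nu> (fst p))) single (\<lambda>y. \<lambda>i\<in>{..<m}. y (i, b)) = single"
      using distr_PiM_reindex[of "A b" "\<lambda>p. \<nu> (fst p)" "\<lambda>i. (i, b)" "{..<m}"] prob_\<nu>
      by (simp add: A_def inj_on_def)
    moreover have "(\<lambda>y. \<lambda>i\<in>{..<m}. y (i, b)) \<in> measurable (PiM (A b) (\<lambda>p. \<nu> (fst p))) single"
    proof (rule measurable_restrict)
      fix i assume "i \<in> {..<m}"
      hence "(i, b) \<in> A b" by (auto simp: A_def)
      from measurable_component_singleton[OF this, of "\<lambda>p. \<nu> (fst p)"]
      show "(\<lambda>y. y (i, b)) \<in> measurable (PiM (A b) (\<lambda>p. \<nu> (fst p))) (\<nu> i)" by simp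
    qed
    ultimately show ?thesis using integral_distr[OF _ u] by metis
  qed
  have sel: "sel (\<lambda>_. True) (merge (A False) (A True) (x, y)) = (\<lambda>i\<in>{..<m}. y (i, True))"
    "sel (\<lambda>_. False) (merge (A False) (A True) (x, y)) = (\<lambda>i\<in>{..<m}. x (i, False))" for x y
    by (auto simp: sel_def merge_def A_def fun_eq_iff restrict_def)
  have B0: "0 \<le> B" "0 \<le> B'" using order_trans[OF abs_ge_zero B(1)] order_trans[OF abs_ge_zero B(2)] by auto
  have "integrable doubled (\<lambda>y. f (sel (\<lambda>_. True) y) * g (sel (\<lambda>_. False) y))"
    by (rule bounded_integrable[OF prob_doubled, of _ "B * B'"]) (auto simp: abs_mult intro!: mult_mono B B0)
  from dbl.product_integral_fold[OF A(1) A(2) A(2), unfolded A(3), OF this]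
  have "(\<integral>y. f (sel (\<lambda>_. True) y) * g (sel (\<lambda>_. False) y) \<partial>doubled) =
    (\<integral>x. (\<integral>y. f (\<lambda>i\<in>{..<m}. y (i, True)) * g (\<lambda>i\<in>{..<m}. x (i, False)) \<partial>PiM (A True) (\<lambda>p. \<nu> (fst p))) \<partial>PiM (A False) (\<lambda>p. \<nu> (fst p)))"
    by (simp add: sel)
  also have "\<dots> = (\<integral>x. f x \<partial>single) * (\<integral>x. g x \<partial>single)"
    by (simp add: part[OF f] part[OF g])
  finally show ?thesis .
qed

text \<open>Exchanging the two copies of the coordinate \<open>k\<close> leaves the joint law unchanged and reverses the
  signs of \<open>incr f k\<close> and \<open>diff f k\<close>. All cancellations below come from this.\<close>

definition mix :: "nat \<Rightarrow> (nat \<times> bool \<Rightarrow> 'b) \<Rightarrow> nat \<Rightarrow> 'b" where "mix k = sel (\<lambda>i. i < k)"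
definition flip :: "nat \<Rightarrow> (nat \<times> bool \<Rightarrow> 'b) \<Rightarrow> nat \<Rightarrow> 'b" where "flip k = sel (\<lambda>i. i = k)"

definition incr :: "((nat \<Rightarrow> 'b) \<Rightarrow> real) \<Rightarrow> nat \<Rightarrow> (nat \<times> bool \<Rightarrow> 'b) \<Rightarrow> real" where
  "incr f k y = f (mix k y) - f (mix (Suc k) y)"
definition diff :: "((nat \<Rightarrow> 'b) \<Rightarrow> real) \<Rightarrow> nat \<Rightarrow> (nat \<times> bool \<Rightarrow> 'b) \<Rightarrow> real" where
  "diff f k y = f (mix 0 y) - f (flip k y)"

lemma mix_swap: "mix k (swap k y) = mix (Suc k) y" "mix (Suc k) (swap k y) = mix k y"
  "mix 0 (swap k y) = flip k y" "flip k (swap k y) = mix 0 y"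
  unfolding mix_def flip_def sel_swap by (auto simp: fun_eq_iff sel_def restrict_def less_Suc_eq)

lemma incr_swap: "incr f k (swap k y) = - incr f k y"
  and diff_swap: "diff f k (swap k y) = - diff f k y"
  by (simp_all add: incr_def diff_def mix_swap)

lemma measurable_mix[measurable]: "mix k \<in> measurable doubled single" "flip k \<in> measurable doubled single"
  by (simp_all add: mix_def flip_def)

lemma measurable_incr[measurable (raw)]:
  assumes [measurable]: "f \<in> borel_measurable single"
  shows "incr f k \<in> borel_measurable doubled" "diff f k \<in> borel_measurable doubled"
  unfolding incr_def diff_def by measurable

text \<open>The difference of \<open>f\<close> at the two independent copies telescopes along
  \<open>mix k\<close>. Each increment is antisymmetric under the exchange of the copies of
  \<open>k\<close>, so integrating it against \<open>u\<close> is the same as integrating it against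
  half of the difference of \<open>u\<close> under that exchange.\<close>

lemma interpolation:
  fixes f u :: "(nat \<Rightarrow> 'b) \<Rightarrow> real"
  assumes f[measurable]: "f \<in> borel_measurable single" and u[measurable]: "u \<in> borel_measurable single"
    and B: "\<And>x. \<bar>f x\<bar> \<le> B" "\<And>x. \<bar>u x\<bar> \<le> B'"
  shows "(\<integral>x. f x * u x \<partial>single) - (\<integral>x. f x \<partial>single) * (\<integral>x. u x \<partial>single)
     = (\<Sum>k<m. \<integral>y. incr f k y * diff u k y \<partial>doubled) / 2"
proof -
  have B0: "0 \<le> B" "0 \<le> B'" using order_trans[OF abs_ge_zero B(1)] order_trans[OF abs_ge_zero B(2)] by auto
  have int: "integrable doubled (\<lambda>y. f (sel s y) * u (sel t y))" for s t
    by (rule bounded_integrable[OF prob_doubled, of _ "B * B'"]) (auto simp: abs_mult intro!: mult_mono B B0)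
  have inti: "integrable doubled (\<lambda>y. incr f k y * u (sel t y))" for k t
    using Bochner_Integration.integrable_diff[OF int int] by (simp add: incr_def mix_def left_diff_distrib)
  have "mix m = sel (\<lambda>_. True)" by (auto simp: mix_def sel_def fun_eq_iff restrict_def)
  moreover have "mix 0 = sel (\<lambda>_. False)" by (auto simp: mix_def)
  ultimately have "(\<integral>x. f x * u x \<partial>single) - (\<integral>x. f x \<partial>single) * (\<integral>x. u x \<partial>single)
     = (\<integral>y. f (mix 0 y) * u (mix 0 y) \<partial>doubled) - (\<integral>y. f (mix m y) * u (mix 0 y) \<partial>doubled)"
    using integral_sel[of "\<lambda>x. f x * u x" "\<lambda>_. False"] integral_sel_indep[OF f u B] by simp
  also have "\<dots> = (\<integral>y. (f (mix 0 y) - f (mix m y)) * u (mix 0 y) \<partial>doubled)"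
    unfolding mix_def left_diff_distrib by (subst Bochner_Integration.integral_diff[OF int int]) simp
  also have "\<dots> = (\<integral>y. (\<Sum>k<m. incr f k y * u (mix 0 y)) \<partial>doubled)"
  proof -
    have "(\<Sum>k<m. incr f k y) = f (mix 0 y) - f (mix m y)" for y
      unfolding incr_def by (rule sum_lessThan_telescope')
    thus ?thesis by (simp flip: sum_distrib_right)
  qed
  also have "\<dots> = (\<Sum>k<m. \<integral>y. incr f k y * u (mix 0 y) \<partial>doubled)"
    unfolding mix_def[of 0] by (rule Bochner_Integration.integral_sum) (rule inti)
  also have "\<dots> = (\<Sum>k<m. (\<integral>y. incr f k y * diff u k y \<partial>doubled) / 2)"
  proof (rule sum.cong[OF refl])
    fix k
    have "(\<integral>y. incr f k y * u (mix 0 y) \<partial>doubled) = (\<integral>y. incr f k (swap k y) * u (mix 0 (swap k y)) \<partial>doubled)"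
      by (rule integral_swap[symmetric]) measurable
    also have "\<dots> = - (\<integral>y. incr f k y * u (flip k y) \<partial>doubled)"
      by (simp add: incr_swap mix_swap)
    finally have *: "(\<integral>y. incr f k y * u (flip k y) \<partial>doubled) = - (\<integral>y. incr f k y * u (mix 0 y) \<partial>doubled)" by simp
    have "(\<integral>y. incr f k y * diff u k y \<partial>doubled) = (\<integral>y. incr f k y * u (mix 0 y) \<partial>doubled) - (\<integral>y. incr f k y * u (flip k y) \<partial>doubled)"
      unfolding diff_def right_diff_distrib mix_def[of 0] flip_def by (rule Bochner_Integration.integral_diff[OF inti inti])
    with * show "(\<integral>y. incr f k y * u (mix 0 y) \<partial>doubled) = (\<integral>y. incr f k y * diff u k y \<partial>doubled) / 2" by simp
  qed
  finally show ?thesis by (simp add: sum_divide_distrib)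
qed

text \<open>By \<open>interpolation\<close> with \<open>u = f\<close> the mean is twice the variance
  of \<open>f\<close>. Stein's method compares the sum with this mean.\<close>

definition carre :: "((nat \<Rightarrow> 'b) \<Rightarrow> real) \<Rightarrow> (nat \<times> bool \<Rightarrow> 'b) \<Rightarrow> real" where
  "carre f y = (\<Sum>k<m. incr f k y * diff f k y)"
text \<open>Each term changes sign under the exchange of the copies of \<open>k\<close>, so the mean
  is zero and the standard deviation controls the size. This sum collects the Taylor errors.\<close>

definition carre_abs :: "((nat \<Rightarrow> 'b) \<Rightarrow> real) \<Rightarrow> (nat \<times> bool \<Rightarrow> 'b) \<Rightarrow> real" where
  "carre_abs f y = (\<Sum>k<m. \<bar>incr f k y\<bar> * diff f k y)"

lemma std_normal_cdf_measurable[measurable]: "std_normal_cdf \<in> borel_measurable borel"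
  by (intro borel_measurable_continuous_onI continuous_at_imp_continuous_on ballI)
     (rule DERIV_isCont[OF std_normal_cdf_deriv])

lemma stein_sol_measurable[measurable]: "stein_sol z \<in> borel_measurable borel"
  unfolding stein_sol_def by measurable

text \<open>The bound grows with \<open>w\<close>, but the argument will be a bounded functional. It
  serves integrability and does not enter the rate.\<close>

lemma stein_sol_bound: "\<bar>stein_sol z w\<bar> \<le> sqrt (2 * pi) * exp (w\<^sup>2 / 2)"
proof -
  have "\<bar>stein_sol z w\<bar> \<le> 1 / std_normal_density w"
    using std_normal_cdf_bounds[of w] std_normal_cdf_bounds[of z] normal_density_pos[of 1 0 w]
    by (auto simp: stein_sol_def abs_mult intro!: divide_right_mono mult_le_one)
  also have "\<dots> = sqrt (2 * pi) * exp (w\<^sup>2 / 2)" by (simp add: std_normal_density_def exp_minus field_simps)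
  finally show ?thesis .
qed

text \<open>The function \<open>stein_osc z\<close> in the error term of \<open>stein_taylor\<close> is bounded. Exchanging the
  copies of coordinate \<open>k\<close> turns its increments into values, so that no third moments occur.\<close>

theorem Berry_Esseen_carre:
  fixes f :: "(nat \<Rightarrow> 'b) \<Rightarrow> real"
  assumes f[measurable]: "f \<in> borel_measurable single" and B: "\<And>x. \<bar>f x\<bar> \<le> B"
    and \<mu>: "\<mu> = (\<integral>x. f x \<partial>single)" and \<sigma>: "\<sigma>\<^sup>2 = (\<integral>x. (f x - \<mu>)\<^sup>2 \<partial>single)" "0 < \<sigma>"
    and V1: "(\<integral>y. (carre f y)\<^sup>2 \<partial>doubled) - (\<integral>y. carre f y \<partial>doubled)\<^sup>2 \<le> V"
    and V2: "(\<integral>y. (carre_abs f y)\<^sup>2 \<partial>doubled) - (\<integral>y. carre_abs f y \<partial>doubled)\<^sup>2 \<le> V"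
  shows "\<bar>measure single {x \<in> space single. (f x - \<mu>) / \<sigma> \<le> z} - std_normal_cdf z\<bar> \<le> 3 * sqrt V / \<sigma>\<^sup>2"
proof -
  interpret S: prob_space single by (rule prob_single)
  interpret D: prob_space doubled by (rule prob_doubled)
  have B0: "0 \<le> B" using order_trans[OF abs_ge_zero B] .
  define W where "W x = (f x - \<mu>) / \<sigma>" for x
  have [measurable]: "W \<in> borel_measurable single" unfolding W_def by measurable
  have \<mu>B: "\<bar>\<mu>\<bar> \<le> B" unfolding \<mu> by (rule bounded_expectation[OF prob_single f B])
  have WB: "\<bar>W x\<bar> \<le> 2 * B / \<sigma>" for x
    using B[of x] \<mu>B \<sigma>(2) by (auto simp: W_def abs_divide intro!: divide_right_mono)
  define u where "u x = stein_sol z (W x)" for x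
  have um[measurable]: "u \<in> borel_measurable single" unfolding u_def by measurable
  define BU where "BU = sqrt (2 * pi) * exp ((2 * B / \<sigma>)\<^sup>2 / 2)"
  have uB: "\<bar>u x\<bar> \<le> BU" for x
  proof -
    have "(W x)\<^sup>2 \<le> (2 * B / \<sigma>)\<^sup>2" using WB[of x] by (rule abs_le_square_iff[THEN iffD1, OF order_trans[OF _ abs_ge_self]])
    hence "exp ((W x)\<^sup>2 / 2) \<le> exp ((2 * B / \<sigma>)\<^sup>2 / 2)" by simp
    thus ?thesis using order_trans[OF stein_sol_bound[of z "W x"]] unfolding u_def BU_def by (metis mult_left_mono real_sqrt_ge_zero pi_ge_zero zero_le_mult_iff zero_le_numeral)
  qed
  have dB: "\<bar>diff f k y\<bar> \<le> 2 * B" "\<bar>incr f k y\<bar> \<le> 2 * B" for k y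
    using B[of "mix 0 y"] B[of "flip k y"] B[of "mix k y"] B[of "mix (Suc k) y"] by (auto simp: diff_def incr_def)
  have prodB: "\<bar>c * diff f k y\<bar> \<le> (2 * B) * (2 * B)" if "\<bar>c\<bar> \<le> 2 * B" for c k y
    unfolding abs_mult by (intro mult_mono that dB) (use B0 in auto)
  define c0 where "c0 = real m * ((2 * B) * (2 * B))"
  have cB: "\<bar>carre f y\<bar> \<le> c0" "\<bar>carre_abs f y\<bar> \<le> c0" for y
    unfolding carre_def carre_abs_def c0_def
    by (rule order_trans[OF sum_abs], rule order_trans[OF sum_mono[OF prodB]], use dB in auto)+
  have cm[measurable]: "carre f \<in> borel_measurable doubled" "carre_abs f \<in> borel_measurable doubled"
    unfolding carre_def carre_abs_def by measurable
  have inte: "integrable doubled h" if "h \<in> borel_measurable doubled" "\<And>y. \<bar>h y\<bar> \<le> C" for h and C :: real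
    by (rule bounded_integrable[OF prob_doubled that])
  have Ecarre: "(\<integral>y. carre f y \<partial>doubled) = 2 * \<sigma>\<^sup>2"
  proof -
    have "(\<integral>y. carre f y \<partial>doubled) = (\<Sum>k<m. \<integral>y. incr f k y * diff f k y \<partial>doubled)"
      unfolding carre_def by (rule Bochner_Integration.integral_sum) (rule inte[OF _ prodB[OF dB(2)]], measurable)
    also have "\<dots> = 2 * ((\<integral>x. f x * f x \<partial>single) - \<mu> * \<mu>)"
      using interpolation[OF f f B B] by (simp add: \<mu>)
    also have "(\<integral>x. f x * f x \<partial>single) - \<mu> * \<mu> = \<sigma>\<^sup>2"
    proof -
      have "\<bar>(f x)\<^sup>2\<bar> \<le> B\<^sup>2" for x using B[of x] B0 by (simp add: power2_le_iff_abs_le)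
      hence "integrable single (\<lambda>x. (f x)\<^sup>2)" by (intro bounded_integrable[OF prob_single, of _ "B\<^sup>2"]) auto
      from S.variance_eq[OF bounded_integrable[OF prob_single f B] this]
      show ?thesis unfolding \<sigma>(1) \<mu> by (simp add: power2_eq_square)
    qed
    finally show ?thesis .
  qed
  have swap0: "(\<integral>y. h y \<partial>doubled) = 0" if h: "h \<in> borel_measurable doubled" "\<And>y. h (swap k y) = - h y" for h :: "_ \<Rightarrow> real" and k
    using integral_swap[OF h(1), of k] h(2) by simp
  have Eabs: "(\<integral>y. carre_abs f y \<partial>doubled) = 0"
  proof -
    have "(\<integral>y. carre_abs f y \<partial>doubled) = (\<Sum>k<m. \<integral>y. \<bar>incr f k y\<bar> * diff f k y \<partial>doubled)"
      unfolding carre_abs_def by (rule Bochner_Integration.integral_sum) (rule inte[OF _ prodB], measurable, use dB in auto)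
    also have "\<dots> = 0"
    proof (intro sum.neutral ballI)
      fix k show "(\<integral>y. \<bar>incr f k y\<bar> * diff f k y \<partial>doubled) = 0"
        by (rule swap0[of _ k]) (measurable, simp add: incr_swap diff_swap)
    qed
    finally show ?thesis .
  qed
  have T1: "(\<integral>y. \<bar>carre f y - 2 * \<sigma>\<^sup>2\<bar> \<partial>doubled) \<le> sqrt V"
  proof -
    have "(\<integral>y. \<bar>carre f y - 2 * \<sigma>\<^sup>2\<bar> \<partial>doubled) \<le> sqrt (\<integral>y. (carre f y - 2 * \<sigma>\<^sup>2)\<^sup>2 \<partial>doubled)"
      by (rule expectation_abs_le_sqrt[OF prob_doubled, of _ "c0 + \<bar>2 * \<sigma>\<^sup>2\<bar>"])
        (auto intro!: order_trans[OF abs_triangle_ineq4] add_right_mono cB)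
    also have "(\<integral>y. (carre f y - 2 * \<sigma>\<^sup>2)\<^sup>2 \<partial>doubled) = (\<integral>y. (carre f y)\<^sup>2 \<partial>doubled) - (\<integral>y. carre f y \<partial>doubled)\<^sup>2"
      unfolding Ecarre[symmetric]
      by (rule D.variance_eq) (auto intro!: inte[OF _ cB(1)] inte[of _ "c0\<^sup>2"] abs_le_square_iff[THEN iffD1] order_trans[OF cB(1)])
    finally show ?thesis using V1 by (meson order_trans real_sqrt_le_mono)
  qed
  have T2: "(\<integral>y. \<bar>carre_abs f y\<bar> \<partial>doubled) \<le> sqrt V"
  proof -
    have "(\<integral>y. \<bar>carre_abs f y\<bar> \<partial>doubled) \<le> sqrt (\<integral>y. (carre_abs f y)\<^sup>2 \<partial>doubled)"
      by (rule expectation_abs_le_sqrt[OF prob_doubled cm(2) cB(2)])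
    also have "\<dots> \<le> sqrt V" using V2 Eabs by simp
    finally show ?thesis .
  qed
  define W0 where "W0 y = W (mix 0 y)" for y
  have [measurable]: "W0 \<in> borel_measurable doubled" unfolding W0_def by measurable
  have [measurable]: "stein_sol_deriv z \<in> borel_measurable borel" "stein_osc z \<in> borel_measurable borel"
    unfolding stein_sol_deriv_def stein_osc_def by measurable
  define g where "g y = stein_sol_deriv z (W0 y)" for y
  define os where "os y = stein_osc z (W0 y)" for y
  have [measurable]: "g \<in> borel_measurable doubled" "os \<in> borel_measurable doubled" unfolding g_def os_def by measurable
  have gB: "\<bar>g y\<bar> \<le> 2" "\<bar>os y\<bar> \<le> 2" for y
    unfolding g_def os_def by (rule stein_sol_deriv_bound stein_osc_bound)+
  \<comment> \<open>Stein's equation, integrated at \<open>W\<close>.\<close>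
  have step1: "measure single {x \<in> space single. W x \<le> z} - std_normal_cdf z
      = (\<integral>y. g y \<partial>doubled) - (\<integral>x. W x * u x \<partial>single)"
  proof -
    have i: "integrable single (\<lambda>x. W x * u x)"
      by (rule bounded_integrable[OF prob_single, of _ 1]) (auto simp: u_def stein_mult_bound)
    have "(\<integral>y. g y \<partial>doubled) = (\<integral>x. stein_sol_deriv z (W x) \<partial>single)"
      unfolding g_def W0_def mix_def by (rule integral_sel) measurable
    also have "\<dots> = (\<integral>x. W x * u x + (indicator {x \<in> space single. W x \<le> z} x - std_normal_cdf z) \<partial>single)"
      by (intro Bochner_Integration.integral_cong) (auto simp: stein_sol_deriv_def u_def indicator_def)
    also have "\<dots> = (\<integral>x. W x * u x \<partial>single) + (\<integral>x. (indicator {x \<in> space single. W x \<le> z} x - std_normal_cdf z) \<partial>single)"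
      by (rule Bochner_Integration.integral_add[OF i])
        (intro Bochner_Integration.integrable_diff S.integrable_const S.integrable_const_bound[of _ 1], auto simp: indicator_def)
    also have "(\<integral>x. (indicator {x \<in> space single. W x \<le> z} x - std_normal_cdf z) \<partial>single) =
      measure single {x \<in> space single. W x \<le> z} - std_normal_cdf z"
      by (subst Bochner_Integration.integral_diff) (auto simp: S.prob_space intro!: S.integrable_const_bound[of _ 1])
    finally show ?thesis by simp
  qed
  \<comment> \<open>Interpolation with the Stein solution as test function replaces the factor
    \<open>W\<close> by increments.\<close>
  have step2: "(\<integral>x. W x * u x \<partial>single) = (\<Sum>k<m. \<integral>y. incr f k y * diff u k y \<partial>doubled) / (2 * \<sigma>)"
  proof -
    have i: "integrable single (\<lambda>x. f x * u x)" "integrable single u"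
      using bounded_integrable[OF prob_single um uB] by (auto intro!: bounded_integrable[OF prob_single, of _ "B * BU"] mult_mono B uB B0 simp: abs_mult)
    have "(\<integral>x. W x * u x \<partial>single) = (\<integral>x. (f x * u x - \<mu> * u x) / \<sigma> \<partial>single)"
      by (simp add: W_def left_diff_distrib diff_divide_distrib)
    also have "\<dots> = ((\<integral>x. f x * u x \<partial>single) - \<mu> * (\<integral>x. u x \<partial>single)) / \<sigma>"
      using i by simp
    finally show ?thesis using interpolation[OF f um B uB] by (simp add: \<mu>)
  qed
  have duB: "\<bar>diff u k y\<bar> \<le> 2 * BU" for k y using uB[of "mix 0 y"] uB[of "flip k y"] by (auto simp: diff_def)
  have iu: "integrable doubled (\<lambda>y. incr f k y * diff u k y)" for k
    by (rule inte[of _ "2 * B * (2 * BU)"]) (measurable, intro abs_mult_bound dB duB)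
  have ig: "integrable doubled (\<lambda>y. g y * carre f y)"
    by (rule inte[of _ "2 * c0"]) (measurable, intro abs_mult_bound gB cB)
  \<comment> \<open>The Taylor remainder after the increment of \<open>u\<close> is replaced by
    \<open>g\<close> times the increment of \<open>f / \<sigma>\<close>.\<close>
  define rem where "rem k y = incr f k y * (diff u k y - diff f k y / \<sigma> * g y)" for k y
  have irem: "integrable doubled (rem k)" for k
  proof -
    have "integrable doubled (\<lambda>y. incr f k y * diff u k y - (incr f k y * diff f k y) * g y / \<sigma>)"
    proof (intro Bochner_Integration.integrable_diff iu integrable_divide)
      show "integrable doubled (\<lambda>y. (incr f k y * diff f k y) * g y)"
        by (rule inte[of _ "(2*B)*(2*B)*2"]) (measurable, intro abs_mult_bound dB gB)
    qed
    thus ?thesis by (simp add: rem_def[abs_def] algebra_simps)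
  qed
  have remb: "\<bar>rem k y\<bar> \<le> \<bar>incr f k y\<bar> * (diff f k y / \<sigma> * (os y - stein_osc z (W (flip k y))))" for k y
  proof -
    have "W (mix 0 y) - W (flip k y) = diff f k y / \<sigma>" by (simp add: W_def diff_def diff_divide_distrib)
    with stein_taylor[of z "W (mix 0 y)" "W (flip k y)"]
    have "\<bar>diff u k y - diff f k y / \<sigma> * g y\<bar> \<le> diff f k y / \<sigma> * (os y - stein_osc z (W (flip k y)))"
      by (simp add: u_def diff_def g_def os_def W0_def)
    thus ?thesis unfolding rem_def abs_mult by (rule mult_left_mono) simp
  qed
  \<comment> \<open>The exchange of the copies turns the term at \<open>flip k\<close> into minus
    the term at \<open>mix 0\<close>, whence the factor 2.\<close>
  have rem1: "(\<integral>y. \<bar>rem k y\<bar> \<partial>doubled) \<le> 2 / \<sigma> * (\<integral>y. \<bar>incr f k y\<bar> * diff f k y * os y \<partial>doubled)" for k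
  proof -
    define p where "p y = \<bar>incr f k y\<bar> * diff f k y" for y
    have [measurable]: "p \<in> borel_measurable doubled" unfolding p_def by measurable
    have pB: "\<bar>p y\<bar> \<le> (2*B)*(2*B)" for y unfolding p_def by (rule prodB) (simp add: dB)
    have osB: "\<bar>stein_osc z (W (flip k y))\<bar> \<le> 2" for y by (rule stein_osc_bound)
    have i1: "integrable doubled (\<lambda>y. p y * os y)"
      by (rule inte[of _ "(2*B)*(2*B)*2"]) (measurable, intro abs_mult_bound pB gB)
    have i2: "integrable doubled (\<lambda>y. p y * stein_osc z (W (flip k y)))"
      by (rule inte[of _ "(2*B)*(2*B)*2"]) (measurable, intro abs_mult_bound pB osB)
    have "(\<integral>y. \<bar>rem k y\<bar> \<partial>doubled) \<le> (\<integral>y. (p y * os y - p y * stein_osc z (W (flip k y))) / \<sigma> \<partial>doubled)"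
    proof (rule integral_mono)
      show "integrable doubled (\<lambda>y. \<bar>rem k y\<bar>)" using irem by simp
      show "integrable doubled (\<lambda>y. (p y * os y - p y * stein_osc z (W (flip k y))) / \<sigma>)" using i1 i2 by simp
      show "\<bar>rem k y\<bar> \<le> (p y * os y - p y * stein_osc z (W (flip k y))) / \<sigma>" for y
        using remb[of k y] by (simp add: p_def algebra_simps diff_divide_distrib)
    qed
    also have "\<dots> = ((\<integral>y. p y * os y \<partial>doubled) - (\<integral>y. p y * stein_osc z (W (flip k y)) \<partial>doubled)) / \<sigma>"
      using i1 i2 by simp
    also have "(\<integral>y. p y * stein_osc z (W (flip k y)) \<partial>doubled) = (\<integral>y. p (swap k y) * stein_osc z (W (flip k (swap k y))) \<partial>doubled)"
      by (rule integral_swap[symmetric]) measurable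
    also have "\<dots> = - (\<integral>y. p y * os y \<partial>doubled)"
      by (simp add: p_def incr_swap diff_swap mix_swap os_def W0_def)
    finally show ?thesis by (simp add: p_def)
  qed
  have "(\<Sum>k<m. \<integral>y. incr f k y * diff u k y \<partial>doubled) =
    (\<Sum>k<m. (\<integral>y. rem k y \<partial>doubled) + (\<integral>y. incr f k y * diff f k y * g y / \<sigma> \<partial>doubled))"
  proof (rule sum.cong[OF refl])
    fix k
    have ik: "integrable doubled (\<lambda>y. incr f k y * diff f k y * g y / \<sigma>)"
      using Bochner_Integration.integrable_diff[OF iu irem, of k k] by (simp add: rem_def algebra_simps)
    have "(\<integral>y. incr f k y * diff u k y \<partial>doubled) = (\<integral>y. rem k y + incr f k y * diff f k y * g y / \<sigma> \<partial>doubled)"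
      by (rule Bochner_Integration.integral_cong[OF refl]) (simp add: rem_def algebra_simps)
    also have "\<dots> = (\<integral>y. rem k y \<partial>doubled) + (\<integral>y. incr f k y * diff f k y * g y / \<sigma> \<partial>doubled)"
      by (rule Bochner_Integration.integral_add[OF irem ik])
    finally show "(\<integral>y. incr f k y * diff u k y \<partial>doubled) = (\<integral>y. rem k y \<partial>doubled) + (\<integral>y. incr f k y * diff f k y * g y / \<sigma> \<partial>doubled)" .
  qed
  also have "\<dots> = (\<Sum>k<m. \<integral>y. rem k y \<partial>doubled) + (\<integral>y. g y * carre f y \<partial>doubled) / \<sigma>"
  proof -
    have ik: "integrable doubled (\<lambda>y. incr f k y * diff f k y * g y / \<sigma>)" for k
      using Bochner_Integration.integrable_diff[OF iu irem, of k k] by (simp add: rem_def algebra_simps)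
    have "(\<Sum>k<m. \<integral>y. incr f k y * diff f k y * g y / \<sigma> \<partial>doubled) = (\<integral>y. (\<Sum>k<m. incr f k y * diff f k y * g y / \<sigma>) \<partial>doubled)"
      by (rule Bochner_Integration.integral_sum[symmetric]) (rule ik)
    also have "\<dots> = (\<integral>y. g y * carre f y / \<sigma> \<partial>doubled)"
      by (simp add: carre_def sum_distrib_left sum_divide_distrib algebra_simps)
    finally show ?thesis by (simp add: sum.distrib)
  qed
  finally have step3: "(\<integral>x. W x * u x \<partial>single) =
     (\<Sum>k<m. \<integral>y. rem k y \<partial>doubled) / (2 * \<sigma>) + (\<integral>y. g y * carre f y \<partial>doubled) / (2 * \<sigma>\<^sup>2)"
    unfolding step2 by (simp add: add_divide_distrib power2_eq_square field_simps)
  have R: "\<bar>\<Sum>k<m. \<integral>y. rem k y \<partial>doubled\<bar> \<le> 2 / \<sigma> * (2 * sqrt V)"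
  proof -
    have io: "integrable doubled (\<lambda>y. \<bar>incr f k y\<bar> * diff f k y * os y)" for k
      by (rule inte[of _ "(2*B)*(2*B)*2"]) (measurable, intro abs_mult_bound gB, simp_all only: abs_idempotent dB)
    have "\<bar>\<Sum>k<m. \<integral>y. rem k y \<partial>doubled\<bar> \<le> (\<Sum>k<m. \<integral>y. \<bar>rem k y\<bar> \<partial>doubled)"
      by (rule order_trans[OF sum_abs]) (intro sum_mono integral_abs_bound)
    also have "\<dots> \<le> (\<Sum>k<m. 2 / \<sigma> * (\<integral>y. \<bar>incr f k y\<bar> * diff f k y * os y \<partial>doubled))"
      by (intro sum_mono rem1)
    also have "\<dots> = 2 / \<sigma> * (\<integral>y. (\<Sum>k<m. \<bar>incr f k y\<bar> * diff f k y * os y) \<partial>doubled)"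
      by (subst Bochner_Integration.integral_sum) (auto simp: io sum_distrib_left)
    also have "(\<integral>y. (\<Sum>k<m. \<bar>incr f k y\<bar> * diff f k y * os y) \<partial>doubled) = (\<integral>y. os y * carre_abs f y \<partial>doubled)"
      by (simp add: carre_abs_def sum_distrib_left algebra_simps)
    also have "2 / \<sigma> * (\<integral>y. os y * carre_abs f y \<partial>doubled) \<le> 2 / \<sigma> * (\<integral>y. 2 * \<bar>carre_abs f y\<bar> \<partial>doubled)"
    proof (intro mult_left_mono integral_mono)
      show "integrable doubled (\<lambda>y. os y * carre_abs f y)"
        by (rule inte[of _ "2 * c0"]) (measurable, intro abs_mult_bound gB cB)
      show "integrable doubled (\<lambda>y. 2 * \<bar>carre_abs f y\<bar>)"
        by (intro integrable_mult_right integrable_abs inte[OF cm(2) cB(2)])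
      show "os y * carre_abs f y \<le> 2 * \<bar>carre_abs f y\<bar>" for y
        by (rule order_trans[OF abs_ge_self]) (auto simp: abs_mult intro!: mult_right_mono gB)
    qed (use \<sigma> in auto)
    also have "\<dots> \<le> 2 / \<sigma> * (2 * sqrt V)"
      using T2 \<sigma> by (intro mult_left_mono) auto
    finally show ?thesis .
  qed
  \<comment> \<open>The bound 2 for \<open>g\<close> cancels against the 2 in
    \<open>2 * \<sigma>\<^sup>2\<close>, and \<open>2 * \<sigma>\<^sup>2\<close> is the mean of
    \<open>carre f\<close>, so only its deviation from the mean remains.\<close>
  have G: "\<bar>(\<integral>y. g y \<partial>doubled) - (\<integral>y. g y * carre f y \<partial>doubled) / (2 * \<sigma>\<^sup>2)\<bar> \<le> sqrt V / \<sigma>\<^sup>2"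
  proof -
    have igg: "integrable doubled g" by (rule inte[OF _ gB(1)]) measurable
    have i4: "integrable doubled (\<lambda>y. \<bar>carre f y - 2 * \<sigma>\<^sup>2\<bar>)"
      by (intro integrable_abs Bochner_Integration.integrable_diff inte[OF cm(1) cB(1)] D.integrable_const)
    have "(\<integral>y. g y \<partial>doubled) - (\<integral>y. g y * carre f y \<partial>doubled) / (2 * \<sigma>\<^sup>2)
      = - (\<integral>y. g y * (carre f y - 2 * \<sigma>\<^sup>2) / (2 * \<sigma>\<^sup>2) \<partial>doubled)"
    proof -
      have "(\<integral>y. g y * (carre f y - 2 * \<sigma>\<^sup>2) / (2 * \<sigma>\<^sup>2) \<partial>doubled) = (\<integral>y. g y * carre f y / (2 * \<sigma>\<^sup>2) - g y \<partial>doubled)"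
        using \<sigma>(2) by (intro Bochner_Integration.integral_cong) (auto simp: right_diff_distrib diff_divide_distrib)
      also have "\<dots> = (\<integral>y. g y * carre f y \<partial>doubled) / (2 * \<sigma>\<^sup>2) - (\<integral>y. g y \<partial>doubled)"
        using igg ig by simp
      finally show ?thesis by simp
    qed
    also have "\<bar>\<dots>\<bar> \<le> (\<integral>y. \<bar>g y * (carre f y - 2 * \<sigma>\<^sup>2) / (2 * \<sigma>\<^sup>2)\<bar> \<partial>doubled)"
      unfolding abs_minus_cancel by (rule integral_abs_bound)
    also have "\<dots> \<le> (\<integral>y. \<bar>carre f y - 2 * \<sigma>\<^sup>2\<bar> / \<sigma>\<^sup>2 \<partial>doubled)"
    proof (rule integral_mono)
      have "integrable doubled (\<lambda>y. (g y * carre f y - 2 * \<sigma>\<^sup>2 * g y) / (2 * \<sigma>\<^sup>2))" using ig igg by simp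
      thus "integrable doubled (\<lambda>y. \<bar>g y * (carre f y - 2 * \<sigma>\<^sup>2) / (2 * \<sigma>\<^sup>2)\<bar>)"
        by (intro integrable_abs) (simp add: algebra_simps)
      show "integrable doubled (\<lambda>y. \<bar>carre f y - 2 * \<sigma>\<^sup>2\<bar> / \<sigma>\<^sup>2)" using i4 by simp
      fix y
      have "\<bar>g y\<bar> * \<bar>carre f y - 2 * \<sigma>\<^sup>2\<bar> \<le> 2 * \<bar>carre f y - 2 * \<sigma>\<^sup>2\<bar>" by (intro mult_right_mono gB) simp
      thus "\<bar>g y * (carre f y - 2 * \<sigma>\<^sup>2) / (2 * \<sigma>\<^sup>2)\<bar> \<le> \<bar>carre f y - 2 * \<sigma>\<^sup>2\<bar> / \<sigma>\<^sup>2"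
        using \<sigma>(2) divide_right_mono[of _ _ "2 * \<sigma>\<^sup>2"] by (fastforce simp: abs_mult)
    qed
    also have "\<dots> \<le> sqrt V / \<sigma>\<^sup>2" using T1 by (simp add: divide_right_mono)
    finally show ?thesis .
  qed
  have "\<bar>measure single {x \<in> space single. W x \<le> z} - std_normal_cdf z\<bar>
    \<le> \<bar>(\<integral>y. g y \<partial>doubled) - (\<integral>y. g y * carre f y \<partial>doubled) / (2 * \<sigma>\<^sup>2)\<bar> + \<bar>\<Sum>k<m. \<integral>y. rem k y \<partial>doubled\<bar> / (2 * \<sigma>)"
  proof -
    have "\<bar>\<Sum>k<m. \<integral>y. rem k y \<partial>doubled\<bar> / (2 * \<sigma>) = \<bar>(\<Sum>k<m. \<integral>y. rem k y \<partial>doubled) / (2 * \<sigma>)\<bar>"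
      using \<sigma>(2) by simp
    thus ?thesis unfolding step1 step3 by linarith
  qed
  \<comment> \<open>One multiple of \<open>sqrt V / \<sigma>\<^sup>2\<close> comes from the
    first-order term and two from the remainder.\<close>
  also have "\<dots> \<le> sqrt V / \<sigma>\<^sup>2 + 2 / \<sigma> * (2 * sqrt V) / (2 * \<sigma>)"
    using R G \<sigma>(2) by (intro add_mono divide_right_mono) auto
  also have "\<dots> = 3 * sqrt V / \<sigma>\<^sup>2" using \<sigma>(2) by (simp add: power2_eq_square field_simps)
  finally show ?thesis by (simp add: W_def)
qed

end

section \<open>Sums of local terms\<close>

text \<open>Absorbs a factor \<open>1 + card\<close> of a neighbourhood into the powers of two that
  also bound the number of simplices.\<close>

lemma one_plus_le_pow2: "1 + real n \<le> 2 ^ n"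
  using Bernoulli_inequality[of 1 n] by simp

lemma sum_square_weighted:
  fixes \<tau> v :: "'i \<Rightarrow> real"
  assumes "\<And>k. k \<in> I \<Longrightarrow> 0 \<le> \<tau> k"
  shows "(\<Sum>k\<in>I. \<tau> k * v k)\<^sup>2 \<le> (\<Sum>k\<in>I. \<tau> k) * (\<Sum>k\<in>I. \<tau> k * (v k)\<^sup>2)"
proof -
  have "(\<Sum>k\<in>I. \<tau> k * v k) = (\<Sum>k\<in>I. sqrt (\<tau> k) * (sqrt (\<tau> k) * v k))"
    using assms by (intro sum.cong) (auto simp flip: mult.assoc)
  also have "\<dots>\<^sup>2 \<le> (\<Sum>k\<in>I. (sqrt (\<tau> k))\<^sup>2) * (\<Sum>k\<in>I. (sqrt (\<tau> k) * v k)\<^sup>2)"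
    by (rule Cauchy_Schwarz_ineq_sum)
  finally show ?thesis using assms by (simp add: power_mult_distrib cong: sum.cong)
qed

lemma power4_add_le: "(a + b) ^ 4 \<le> 8 * (a ^ 4 + b ^ 4)" for a b :: real
proof -
  have *: "(a + b)\<^sup>2 \<le> 2 * (a\<^sup>2 + b\<^sup>2)" for a b :: real
    using zero_le_power2[of "a - b"] by (simp add: power2_eq_square algebra_simps)
  have "((a + b)\<^sup>2)\<^sup>2 \<le> (2 * (a\<^sup>2 + b\<^sup>2))\<^sup>2" by (intro power_mono *) simp
  also have "\<dots> \<le> 4 * (2 * ((a\<^sup>2)\<^sup>2 + (b\<^sup>2)\<^sup>2))" 
    unfolding power_mult_distrib[of 2] using *[of "a\<^sup>2" "b\<^sup>2"] by simp
  finally show ?thesis by simp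
qed

text \<open>A coordinate with the value \<open>dead i\<close> takes part in no term: it is a removed point or an empty cell.\<close>

locale local_functional = indep_seq \<nu> m for \<nu> :: "nat \<Rightarrow> 'b measure" and m +
  fixes h :: "nat set \<Rightarrow> (nat \<Rightarrow> 'b) \<Rightarrow> real"
    and alive :: "nat \<Rightarrow> 'b \<Rightarrow> bool" and near :: "nat \<Rightarrow> nat \<Rightarrow> 'b \<Rightarrow> 'b \<Rightarrow> bool"
    and dead :: "nat \<Rightarrow> 'b" and C lam :: real
  assumes h_meas: "A \<subseteq> {..<m} \<Longrightarrow> h A \<in> borel_measurable single"
    and h_cong: "(\<And>i. i \<in> A \<Longrightarrow> x i = x' i) \<Longrightarrow> h A x = h A x'"
    and h_bound: "\<bar>h A x\<bar> \<le> 1"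
    and h_alive: "h A x \<noteq> 0 \<Longrightarrow> i \<in> A \<Longrightarrow> alive i (x i)"
    and h_near: "h A x \<noteq> 0 \<Longrightarrow> i \<in> A \<Longrightarrow> j \<in> A \<Longrightarrow> near i j (x i) (x j)"
    and near_alive: "near i j a b \<Longrightarrow> alive i a"
    and near_meas: "Measurable.pred (\<nu> i \<Otimes>\<^sub>M \<nu> j) (\<lambda>z. near i j (fst z) (snd z))"
    and alive_meas: "Measurable.pred (\<nu> i) (alive i)"
    and dead: "dead i \<in> space (\<nu> i)" "\<not> alive i (dead i)"
    and sum_alive: "(\<Sum>i<m. measure (\<nu> i) {a \<in> space (\<nu> i). alive i a}) \<le> lam"
    and sum_near: "j < m \<Longrightarrow> b \<in> space (\<nu> j) \<Longrightarrow> (\<Sum>i<m. measure (\<nu> i) {a \<in> space (\<nu> i). near i j a b}) \<le> C"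
begin

section \<open>Add-one costs and their locality\<close>

definition functional :: "(nat \<Rightarrow> 'b) \<Rightarrow> real" where
  "functional x = (\<Sum>A\<in>Pow {..<m}. h A x)"

definition addone :: "nat \<Rightarrow> (nat \<Rightarrow> 'b) \<Rightarrow> real" where
  "addone k x = (\<Sum>A\<in>{A \<in> Pow {..<m}. k \<in> A}. h A x)"

text \<open>Neighbours are counted among both copies of all coordinates, so that one number controls
  every selection at once.\<close>

definition nbrs :: "nat \<times> bool \<Rightarrow> (nat \<times> bool \<Rightarrow> 'b) \<Rightarrow> (nat \<times> bool) set" where
  "nbrs p y = {q \<in> sites. near (fst q) (fst p) (y q) (y p)}"

text \<open>The power is the number of subsets of the neighbourhood, which bounds the number of
  nonzero terms through \<open>p\<close>.\<close>

definition weight :: "nat \<times> bool \<Rightarrow> (nat \<times> bool \<Rightarrow> 'b) \<Rightarrow> real" where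
  "weight p y = of_bool (alive (fst p) (y p)) * 2 ^ card (nbrs p y)"

lemma finite_nbrs: "finite (nbrs p y)" by (simp add: nbrs_def finite_sites)

lemma functional_diff:
  assumes "\<And>i. i \<noteq> k \<Longrightarrow> x i = x' i"
  shows "functional x - functional x' = addone k x - addone k x'"
proof -
  have split: "functional z = addone k z + (\<Sum>A\<in>{A \<in> Pow {..<m}. k \<notin> A}. h A z)" for z
    unfolding functional_def addone_def
    by (subst sum.union_disjoint[symmetric]) (auto intro!: sum.cong)
  have "(\<Sum>A\<in>{A \<in> Pow {..<m}. k \<notin> A}. h A x) = (\<Sum>A\<in>{A \<in> Pow {..<m}. k \<notin> A}. h A x')"
    by (intro sum.cong h_cong assms) auto
  thus ?thesis by (simp add: split)
qed

text \<open>The index set of a nonzero term through \<open>k\<close> lies inside the neighbourhood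
  of \<open>k\<close>, and each term is at most one in absolute value.\<close>

lemma addone_bound:
  assumes k: "k < m" shows "\<bar>addone k (sel s y)\<bar> \<le> weight (k, s k) y"
proof (cases "alive k (y (k, s k))")
  case False
  have "h A (sel s y) = 0" if "k \<in> A" for A
    using h_alive[of A "sel s y" k] that False k by (auto simp: sel_def)
  thus ?thesis by (simp add: addone_def weight_def)
next
  case True
  define B where "B = {i \<in> {..<m}. near i k (y (i, s i)) (y (k, s k))}"
  have fB: "finite B" by (simp add: B_def)
  have "\<bar>addone k (sel s y)\<bar> \<le> (\<Sum>A\<in>{A \<in> Pow {..<m}. k \<in> A}. \<bar>h A (sel s y)\<bar>)"
    unfolding addone_def by (rule sum_abs)
  also have "\<dots> \<le> (\<Sum>A\<in>{A \<in> Pow {..<m}. k \<in> A}. of_bool (A \<in> Pow B))"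
  proof (rule sum_mono)
    fix A assume A: "A \<in> {A \<in> Pow {..<m}. k \<in> A}"
    show "\<bar>h A (sel s y)\<bar> \<le> of_bool (A \<in> Pow B)"
    proof (cases "h A (sel s y) = 0")
      case False
      have "A \<subseteq> B"
      proof
        fix i assume "i \<in> A"
        with h_near[OF False this, of k] A k show "i \<in> B" by (auto simp: B_def sel_def subset_iff)
      qed
      thus ?thesis using h_bound by simp
    qed simp
  qed
  also have "\<dots> = real (card ({A \<in> Pow {..<m}. k \<in> A} \<inter> Pow B))"
    by (subst sum_of_bool_eq) (auto simp: Pow_def)
  also have "\<dots> \<le> real (card (Pow B))" using fB by (intro of_nat_mono card_mono) auto
  also have "\<dots> = 2 ^ card B" using fB by (simp add: card_Pow)
  also have "\<dots> \<le> 2 ^ card (nbrs (k, s k) y)"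
  proof (rule power_increasing)
    have "card B = card ((\<lambda>i. (i, s i)) ` B)" by (simp add: card_image inj_on_def)
    also have "\<dots> \<le> card (nbrs (k, s k) y)"
      by (intro card_mono finite_nbrs) (auto simp: nbrs_def B_def sites_def)
    finally show "card B \<le> card (nbrs (k, s k) y)" .
  qed simp
  finally show ?thesis using True by (simp add: weight_def)
qed

lemma incr_addone: "incr functional k y = addone k (mix k y) - addone k (mix (Suc k) y)"
  unfolding incr_def by (rule functional_diff) (auto simp: mix_def sel_def less_Suc_eq restrict_def)

lemma diff_addone: "diff functional k y = addone k (mix 0 y) - addone k (flip k y)"
  unfolding diff_def by (rule functional_diff) (auto simp: mix_def flip_def sel_def restrict_def)

lemma incr_bound: "k < m \<Longrightarrow> \<bar>incr functional k y\<bar> \<le> weight (k, False) y + weight (k, True) y"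
  using addone_bound[of k "\<lambda>i. i < k" y] addone_bound[of k "\<lambda>i. i < Suc k" y]
  by (auto simp: incr_addone mix_def)

lemma diff_bound: "k < m \<Longrightarrow> \<bar>diff functional k y\<bar> \<le> weight (k, False) y + weight (k, True) y"
  using addone_bound[of k "\<lambda>i. False" y] addone_bound[of k "\<lambda>i. i = k" y]
  by (auto simp: diff_addone mix_def flip_def)

definition touch :: "nat \<times> bool \<Rightarrow> nat \<Rightarrow> (nat \<times> bool \<Rightarrow> 'b) \<Rightarrow> bool" where
  "touch p k y \<longleftrightarrow> alive (fst p) (y p) \<and>
     (k = fst p \<or> (\<exists>b. near k (fst p) (y (k, b)) (y p)))"

text \<open>A term affected by the removal uses the copy \<open>p\<close>. After the removal it
  vanishes because the value is dead; before, a nonzero value would make \<open>p\<close> alive and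
  near the selected copy of \<open>k\<close>.\<close>

lemma addone_upd:
  assumes k: "k < m" and p: "p \<in> sites" and nt: "\<not> touch p k y"
  shows "addone k (sel s (y(p := dead (fst p)))) = addone k (sel s y)"
  unfolding addone_def
proof (rule sum.cong[OF refl])
  fix A assume A: "A \<in> {A \<in> Pow {..<m}. k \<in> A}"
  obtain i b where pib: "p = (i, b)" by (cases p)
  show "h A (sel s (y(p := dead (fst p)))) = h A (sel s y)"
  proof (cases "i \<in> A \<and> s i = b")
    case False
    show ?thesis by (rule h_cong) (use False pib A in \<open>auto simp: sel_def subset_iff restrict_def\<close>)
  next
    case True
    have im: "i < m" using p pib by (auto simp: sites_def)
    have "h A (sel s (y(p := dead (fst p)))) = 0"
    proof (rule ccontr)
      assume "h A (sel s (y(p := dead (fst p)))) \<noteq> 0"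
      from h_alive[OF this, of i] show False using dead(2)[of i] True im pib by (simp add: sel_def)
    qed
    moreover have "h A (sel s y) = 0"
    proof (rule ccontr)
      assume nz: "h A (sel s y) \<noteq> 0"
      have "alive i (y p)" using h_alive[OF nz, of i] True im pib by (auto simp: sel_def)
      moreover have "near k i (y (k, s k)) (y p)" using h_near[OF nz, of k i] True A im k pib by (auto simp: sel_def)
      ultimately show False using nt pib by (auto simp: touch_def)
    qed
    ultimately show ?thesis by simp
  qed
qed

lemma weight_upd:
  assumes p: "p \<in> sites" shows "weight q (y(p := dead (fst p))) \<le> weight q y"
proof (cases "q = p")
  case True thus ?thesis by (simp add: weight_def dead)
next
  case False
  have "nbrs q (y(p := dead (fst p))) \<subseteq> nbrs q y"
    using False dead(2) near_alive by (fastforce simp: nbrs_def split: if_splits)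
  hence "card (nbrs q (y(p := dead (fst p)))) \<le> card (nbrs q y)" by (intro card_mono finite_nbrs)
  thus ?thesis using False by (simp add: weight_def power_increasing)
qed

lemma weight_pow4: "weight q y ^ 4 \<le> 16 ^ card (nbrs q y)"
proof -
  have "weight q y ^ 4 \<le> (2 ^ card (nbrs q y)) ^ 4"
    by (intro power_mono) (auto simp: weight_def)
  also have "\<dots> = 16 ^ card (nbrs q y)" by (simp flip: power_mult add: mult.commute[of _ 4]) (simp add: power_mult)
  finally show ?thesis .
qed

text \<open>The identity gives \<open>carre\<close> and the absolute value gives
  \<open>carre_abs\<close>; both are treated together since
  \<open>\<bar>\<psi> t\<bar> \<le> \<bar>t\<bar>\<close> is all that is needed of
  \<open>\<psi>\<close>, apart from measurability.\<close>

definition quad :: "(real \<Rightarrow> real) \<Rightarrow> (nat \<times> bool \<Rightarrow> 'b) \<Rightarrow> real" where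
  "quad \<psi> y = (\<Sum>k<m. \<psi> (incr functional k y) * diff functional k y)"

lemma sum_touch:
  assumes p: "p \<in> sites"
  shows "(\<Sum>k<m. of_bool (touch p k y) :: real) \<le> of_bool (alive (fst p) (y p)) * 2 ^ card (nbrs p y)"
proof (cases "alive (fst p) (y p)")
  case True
  have "(\<Sum>k<m. of_bool (touch p k y) :: real) = real (card {k \<in> {..<m}. touch p k y})"
    by (simp add: of_bool_def sum.If_cases Int_def)
  also have "{k \<in> {..<m}. touch p k y} \<subseteq> insert (fst p) (fst ` nbrs p y)"
    by (force simp: touch_def nbrs_def sites_def image_iff)
  hence "card {k \<in> {..<m}. touch p k y} \<le> card (insert (fst p) (fst ` nbrs p y))"
    by (intro card_mono) (auto simp: finite_nbrs)
  also have "\<dots> \<le> Suc (card (fst ` nbrs p y))" by (rule card_insert_le_m1) auto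
  also have "\<dots> \<le> Suc (card (nbrs p y))" by (simp add: card_image_le finite_nbrs)
  also have "real (Suc (card (nbrs p y))) \<le> 2 ^ card (nbrs p y)" using one_plus_le_pow2[of "card (nbrs p y)"] by simp
  finally show ?thesis using True by simp
qed (simp add: touch_def)

text \<open>Only touched coordinates contribute. There the summand before and after the removal is
  at most the squared sum of the two weights, since a removal never increases a weight.
  Cauchy--Schwarz over the touched coordinates costs their number, which is at most a power of
  two.\<close>

lemma quad_removal:
  assumes \<psi>: "\<And>t. \<bar>\<psi> t\<bar> \<le> \<bar>t\<bar>" and p: "p \<in> sites"
  shows "(quad \<psi> y - quad \<psi> (y(p := dead (fst p))))\<^sup>2 \<le>
     32 * (\<Sum>k<m. of_bool (touch p k y) *
        (2 * 256 ^ card (nbrs p y) + 256 ^ card (nbrs (k, False) y) + 256 ^ card (nbrs (k, True) y)))"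
proof -
  define y' where "y' = y(p := dead (fst p))"
  define t where "t y k = \<psi> (incr functional k y) * diff functional k y" for y k
  define v where "v k = weight (k, False) y + weight (k, True) y" for k
  define N where "N q = card (nbrs q y)" for q
  have tb: "\<bar>t z k\<bar> \<le> (v k)\<^sup>2" if "k < m" "weight (k, False) z + weight (k, True) z \<le> v k" for z k
    unfolding t_def power2_eq_square using order_trans[OF \<psi> incr_bound[OF that(1)]] diff_bound[OF that(1), of z] that(2)
    by (intro abs_mult_bound) (auto intro: order_trans)
  have tt: "\<bar>t y k - t y' k\<bar> \<le> of_bool (touch p k y) * (2 * (v k)\<^sup>2)" if k: "k < m" for k
  proof (cases "touch p k y")
    case True
    have "weight (k, b) y' \<le> weight (k, b) y" for b unfolding y'_def by (rule weight_upd[OF p])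
    hence "\<bar>t y' k\<bar> \<le> (v k)\<^sup>2" by (intro tb k) (auto simp: v_def intro: add_mono)
    moreover have "\<bar>t y k\<bar> \<le> (v k)\<^sup>2" by (intro tb k) (auto simp: v_def)
    ultimately show ?thesis using True by simp
  next
    case False
    have "t y k = t y' k" unfolding t_def y'_def incr_addone diff_addone mix_def flip_def
      by (simp add: addone_upd[OF k p False])
    thus ?thesis by simp
  qed
  have "\<bar>quad \<psi> y - quad \<psi> y'\<bar> = \<bar>\<Sum>k<m. t y k - t y' k\<bar>" by (simp add: quad_def t_def sum_subtractf)
  also have "\<dots> \<le> (\<Sum>k<m. of_bool (touch p k y) * (2 * (v k)\<^sup>2))"
    by (rule order_trans[OF sum_abs]) (intro sum_mono tt, auto)
  finally have "(quad \<psi> y - quad \<psi> y')\<^sup>2 \<le> (\<Sum>k<m. of_bool (touch p k y) * (2 * (v k)\<^sup>2))\<^sup>2"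
    using abs_le_square_iff by fastforce
  also have "\<dots> \<le> (\<Sum>k<m. of_bool (touch p k y)) * (\<Sum>k<m. of_bool (touch p k y) * (2 * (v k)\<^sup>2)\<^sup>2)"
    by (rule sum_square_weighted) simp
  also have "\<dots> \<le> 2 ^ N p * (\<Sum>k<m. of_bool (touch p k y) * (2 * (v k)\<^sup>2)\<^sup>2)"
  proof (rule mult_right_mono)
    show "(\<Sum>k<m. of_bool (touch p k y)) \<le> (2::real) ^ N p"
      using sum_touch[OF p, of y] by (rule order_trans) (simp add: N_def)
  qed (auto intro!: sum_nonneg)
  also have "\<dots> = (\<Sum>k<m. of_bool (touch p k y) * (2 ^ N p * (2 * (v k)\<^sup>2)\<^sup>2))"
    by (simp add: sum_distrib_left algebra_simps)
  also have "\<dots> \<le> (\<Sum>k<m. of_bool (touch p k y) * (32 * (2 * 256 ^ N p + 256 ^ N (k, False) + 256 ^ N (k, True))))"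
  proof (intro sum_mono mult_left_mono)
    fix k
    \<comment> \<open>A product of counts at two sites is split into squares, so that only one
      neighbour count at a time has to be integrated. This is how 16 becomes 256.\<close>
    have *: "2 ^ N p * 16 ^ N q \<le> (256 ^ N p + 256 ^ N q :: real)" for q
    proof -
      have "(2::real) ^ N p * 16 ^ N q \<le> 16 ^ N p * 16 ^ N q" by (intro mult_right_mono power_mono) auto
      also have "\<dots> \<le> (16 ^ N p)\<^sup>2 + (16 ^ N q)\<^sup>2"
        using sum_squares_bound[of "16 ^ N p :: real" "16 ^ N q"] zero_le_power2[of "16 ^ N p :: real"] zero_le_power2[of "16 ^ N q :: real"]
        by linarith
      also have "\<dots> = 256 ^ N p + 256 ^ N q" by (simp flip: power_mult add: mult.commute[of _ 2]) (simp add: power_mult)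
      finally show ?thesis .
    qed
    have "(2 * (v k)\<^sup>2)\<^sup>2 = 4 * v k ^ 4" by (simp add: power_mult_distrib)
    also have "\<dots> \<le> 4 * (8 * (weight (k, False) y ^ 4 + weight (k, True) y ^ 4))"
      unfolding v_def by (intro mult_left_mono power4_add_le) auto
    also have "\<dots> \<le> 32 * (16 ^ N (k, False) + 16 ^ N (k, True))"
      using weight_pow4[of "(k, False)" y] weight_pow4[of "(k, True)" y] by (simp add: N_def)
    finally have "2 ^ N p * (2 * (v k)\<^sup>2)\<^sup>2 \<le> 2 ^ N p * (32 * (16 ^ N (k, False) + 16 ^ N (k, True)))"
      by (intro mult_left_mono) auto
    also have "\<dots> \<le> 32 * (2 * 256 ^ N p + 256 ^ N (k, False) + 256 ^ N (k, True))"
      using *[of "(k, False)"] *[of "(k, True)"] by (simp add: algebra_simps)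
    finally show "2 ^ N p * (2 * (v k)\<^sup>2)\<^sup>2 \<le> 32 * (2 * 256 ^ N p + 256 ^ N (k, False) + 256 ^ N (k, True))" .
  qed simp
  also have "\<dots> = 32 * (\<Sum>k<m. of_bool (touch p k y) * (2 * 256 ^ N p + 256 ^ N (k, False) + 256 ^ N (k, True)))"
    by (simp only: sum_distrib_left mult.left_commute[of 32])
  finally show ?thesis by (simp only: y'_def N_def)
qed

section \<open>Exponential moments of neighbour counts\<close>

lemma functional_measurable[measurable]: "functional \<in> borel_measurable single"
  unfolding functional_def by (intro borel_measurable_sum h_meas) auto

lemma functional_bound: "\<bar>functional x\<bar> \<le> 2 ^ m"
proof -
  have "\<bar>functional x\<bar> \<le> (\<Sum>A\<in>Pow {..<m}. 1)"
    unfolding functional_def by (rule order_trans[OF sum_abs]) (intro sum_mono h_bound)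
  thus ?thesis by (simp add: card_Pow)
qed

lemma component_measurable: "p \<in> sites \<Longrightarrow> (\<lambda>y. y p) \<in> measurable doubled (\<nu> (fst p))"
  using measurable_component_singleton[of p sites "\<lambda>p. \<nu> (fst p)"] by simp

lemma near_site_measurable:
  assumes "p \<in> sites" "q \<in> sites"
  shows "Measurable.pred doubled (\<lambda>y. near (fst q) (fst p) (y q) (y p))"
proof -
  have "(\<lambda>y. (y q, y p)) \<in> measurable doubled (\<nu> (fst q) \<Otimes>\<^sub>M \<nu> (fst p))"
    by (intro measurable_Pair component_measurable assms)
  from measurable_compose[OF this near_meas] show ?thesis by simp
qed

lemma alive_site_measurable: "p \<in> sites \<Longrightarrow> Measurable.pred doubled (\<lambda>y. alive (fst p) (y p))"
  using measurable_compose[OF component_measurable alive_meas] by simp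

lemma power_card_nbrs: "c ^ card (nbrs p y) = (\<Prod>q\<in>sites. if near (fst q) (fst p) (y q) (y p) then c else 1)" for c :: real
  by (simp add: nbrs_def prod.If_cases finite_sites Int_def)

lemma pow_nbrs_measurable:
  assumes "p \<in> sites" shows "(\<lambda>y. c ^ card (nbrs p y) :: real) \<in> borel_measurable doubled"
  unfolding power_card_nbrs
  by (intro borel_measurable_prod measurable_If predE[OF near_site_measurable] assms) auto

lemma pow_nbrs_bound:
  assumes "1 \<le> c" shows "\<bar>c ^ card (nbrs p y)\<bar> \<le> (c ^ card sites :: real)"
  using assms by (auto intro!: power_increasing card_mono simp: finite_sites nbrs_def)

lemma touch_measurable:
  assumes p: "p \<in> sites" and k: "k < m"
  shows "Measurable.pred doubled (touch p k)"
proof -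
  have s: "(k, b) \<in> sites" for b using k by (simp add: sites_def)
  note [measurable] = alive_site_measurable[OF p] near_site_measurable[OF p s, simplified]
  show ?thesis unfolding touch_def[abs_def] ex_bool_eq by measurable
qed

text \<open>Given the values on \<open>V\<close>, the weight \<open>\<phi>\<close> is constant and
  the other sites are neighbours of \<open>q\<close> independently of each other. A site that is a
  neighbour with probability \<open>p\<close> contributes
  \<open>1 + (c - 1) * p \<le> exp ((c - 1) * p)\<close>, and the probabilities have a bounded sum.
  Sites in \<open>V\<close> cost at most a factor \<open>c\<close> each.\<close>

lemma expectation_pow_nbrs:
  fixes \<phi> :: "(nat \<times> bool \<Rightarrow> 'b) \<Rightarrow> real"
  assumes V: "V \<subseteq> sites" "q \<in> V" and c: "1 \<le> c"
    and \<phi>: "\<phi> \<in> borel_measurable doubled" "\<And>y. 0 \<le> \<phi> y" "\<And>y. \<phi> y \<le> B"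
    and dep: "\<And>y y'. (\<And>p. p \<in> V \<Longrightarrow> y p = y' p) \<Longrightarrow> \<phi> y = \<phi> y'"
  shows "(\<integral>y. \<phi> y * c ^ card (nbrs q y) \<partial>doubled) \<le> c ^ card V * exp (2 * (c - 1) * C) * (\<integral>y. \<phi> y \<partial>doubled)"
proof -
  define R where "R = sites - V"
  have VR: "V \<inter> R = {}" "finite V" "finite R" "V \<union> R = sites"
    using V finite_sites by (auto simp: R_def intro: finite_subset)
  have q: "q \<in> sites" using V by auto
  define K where "K = c ^ card V * exp (2 * (c - 1) * C)"
  define \<nu>' where "\<nu>' = (\<lambda>p::nat\<times>bool. \<nu> (fst p))"
  have int: "integrable doubled (\<lambda>y. \<phi> y * c ^ card (nbrs q y))"
    by (rule bounded_integrable[OF prob_doubled, of _ "B * c ^ card sites"])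
      (intro borel_measurable_times \<phi> pow_nbrs_measurable q, intro abs_mult_bound pow_nbrs_bound c, use \<phi> in auto)
  have int\<phi>: "integrable doubled \<phi>"
    by (rule bounded_integrable[OF prob_doubled, of _ B]) (use \<phi> in auto)
  have probR: "prob_space (PiM R \<nu>')" unfolding \<nu>'_def by (rule dbl.prob_PiM)
  have probV: "prob_space (PiM V \<nu>')" unfolding \<nu>'_def by (rule dbl.prob_PiM)
  have mergeV: "merge V R (x, y) p = x p" if "p \<in> V" for x y p using that by (simp add: merge_def)
  have mergeR: "merge V R (x, y) p = y p" if "p \<in> R" for x y p using that VR(1) by (auto simp: merge_def)
  have inner: "(\<integral>y. \<phi> (merge V R (x, y)) * c ^ card (nbrs q (merge V R (x, y))) \<partial>PiM R \<nu>')
      \<le> K * (\<integral>y. \<phi> (merge V R (x, y)) \<partial>PiM R \<nu>')" if x: "x \<in> space (PiM V \<nu>')" for x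
  proof -
    define a where "a = \<phi> (merge V R (x, \<lambda>_. undefined))"
    have a: "\<phi> (merge V R (x, y)) = a" for y unfolding a_def by (rule dep) (simp add: mergeV)
    have a0: "0 \<le> a" unfolding a_def by (rule \<phi>)
    define F where "F p = (\<lambda>b. if near (fst p) (fst q) b (x q) then c else 1)" for p :: "nat \<times> bool"
    have xq: "x q \<in> space (\<nu> (fst q))" using x V by (auto simp: space_PiM \<nu>'_def)
    have nm: "Measurable.pred (\<nu> i) (\<lambda>b. near i (fst q) b (x q))" for i
    proof -
      have "(\<lambda>b. (b, x q)) \<in> measurable (\<nu> i) (\<nu> i \<Otimes>\<^sub>M \<nu> (fst q))" using xq by measurable
      from measurable_compose[OF this near_meas] show ?thesis by simp
    qed
    have Fm: "F p \<in> borel_measurable (\<nu> (fst p))" for p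
      unfolding F_def using nm by (intro measurable_If) auto
    have FB: "\<bar>F p b\<bar> \<le> c" for p b using c by (auto simp: F_def)
    have Fint: "integrable (\<nu> (fst p)) (F p)" for p
      by (rule bounded_integrable[OF prob_\<nu> Fm FB])
    have pr: "(\<integral>b. F p b \<partial>\<nu> (fst p)) \<le> exp ((c - 1) * measure (\<nu> (fst p)) {b \<in> space (\<nu> (fst p)). near (fst p) (fst q) b (x q)})" for p
    proof -
      let ?S = "{b \<in> space (\<nu> (fst p)). near (fst p) (fst q) b (x q)}"
      have S: "?S \<in> sets (\<nu> (fst p))" using nm by simp
      have "(\<integral>b. F p b \<partial>\<nu> (fst p)) = (\<integral>b. 1 + (c - 1) * indicator ?S b \<partial>\<nu> (fst p))"
        by (intro Bochner_Integration.integral_cong) (auto simp: F_def indicator_def)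
      also have "\<dots> = 1 + (c - 1) * measure (\<nu> (fst p)) ?S"
      proof -
        have "integrable (\<nu> (fst p)) (indicator ?S :: _ \<Rightarrow> real)"
          by (rule bounded_integrable[OF prob_\<nu>, where B=1]) (use S in \<open>auto simp: indicator_def\<close>)
        moreover have "integrable (\<nu> (fst p)) (\<lambda>_. 1 :: real)" by (rule bounded_integrable[OF prob_\<nu>, where B=1]) auto
        ultimately show ?thesis using S sets.sets_into_space[OF S]
          by (simp add: prob_space.prob_space[OF prob_\<nu>] Int_absorb1)
      qed
      also have "\<dots> \<le> exp ((c - 1) * measure (\<nu> (fst p)) ?S)" by (rule exp_ge_add_one_self)
      finally show ?thesis .
    qed
    have cn: "c ^ card (nbrs q (merge V R (x, y))) \<le> c ^ card V * (\<Prod>p\<in>R. F p (y p))" for y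
    proof -
      let ?z = "merge V R (x, y)"
      have "c ^ card (nbrs q ?z) = (\<Prod>p\<in>V. if near (fst p) (fst q) (?z p) (?z q) then c else 1) *
          (\<Prod>p\<in>R. if near (fst p) (fst q) (?z p) (?z q) then c else 1)"
        unfolding power_card_nbrs VR(4)[symmetric] by (rule prod.union_disjoint[OF VR(2,3,1)])
      also have "\<dots> \<le> (\<Prod>p\<in>V. c) * (\<Prod>p\<in>R. F p (y p))"
        using c V by (intro mult_mono prod_mono) (auto simp: F_def mergeR mergeV intro!: prod_nonneg)
      finally show ?thesis by simp
    qed
    have Pint: "integrable (PiM R \<nu>') (\<lambda>y. \<Prod>p\<in>R. F p (y p))"
      unfolding \<nu>'_def by (rule dbl.product_integrable_prod[OF VR(3) Fint])
    have "(\<integral>y. \<phi> (merge V R (x, y)) * c ^ card (nbrs q (merge V R (x, y))) \<partial>PiM R \<nu>')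
      \<le> (\<integral>y. a * (c ^ card V * (\<Prod>p\<in>R. F p (y p))) \<partial>PiM R \<nu>')"
    proof (rule integral_mono')
      show "integrable (PiM R \<nu>') (\<lambda>y. a * (c ^ card V * (\<Prod>p\<in>R. F p (y p))))"
        by (intro integrable_mult_right Pint)
      show "\<phi> (merge V R (x, y)) * c ^ card (nbrs q (merge V R (x, y))) \<le> a * (c ^ card V * (\<Prod>p\<in>R. F p (y p)))" for y
        unfolding a by (intro mult_left_mono cn a0)
      show "0 \<le> a * (c ^ card V * (\<Prod>p\<in>R. F p (y p)))" for y
        using a0 c by (intro mult_nonneg_nonneg prod_nonneg) (auto simp: F_def)
    qed
    also have "\<dots> = a * (c ^ card V * (\<Prod>p\<in>R. \<integral>b. F p b \<partial>\<nu> (fst p)))"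
      using dbl.product_integral_prod[OF VR(3) Fint] by (simp add: \<nu>'_def)
    also have "(\<Prod>p\<in>R. \<integral>b. F p b \<partial>\<nu> (fst p)) \<le> exp (2 * (c - 1) * C)"
    proof -
      define P where "P p = measure (\<nu> (fst p)) {b \<in> space (\<nu> (fst p)). near (fst p) (fst q) b (x q)}" for p :: "nat \<times> bool"
      have "(\<Prod>p\<in>R. \<integral>b. F p b \<partial>\<nu> (fst p)) \<le> (\<Prod>p\<in>R. exp ((c - 1) * P p))"
        unfolding P_def using c by (intro prod_mono conjI pr integral_nonneg_AE) (auto simp: F_def)
      also have "\<dots> = exp ((c - 1) * (\<Sum>p\<in>R. P p))" using VR(3) by (simp add: exp_sum sum_distrib_left)
      \<comment> \<open>Both copies of every coordinate may be neighbours, hence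
        \<open>2 * C\<close>.\<close>
      also have "\<dots> \<le> exp ((c - 1) * (2 * C))"
      proof -
        have "(\<Sum>p\<in>R. P p) \<le> (\<Sum>p\<in>sites. P p)" by (rule sum_mono2) (auto simp: finite_sites R_def P_def)
        also have "\<dots> = (\<Sum>i<m. \<Sum>b\<in>UNIV. P (i, b))" unfolding sites_def by (simp add: sum.cartesian_product)
        also have "\<dots> = 2 * (\<Sum>i<m. measure (\<nu> i) {b \<in> space (\<nu> i). near i (fst q) b (x q)})"
          by (simp add: P_def sum_distrib_left)
        also have "\<dots> \<le> 2 * C" using sum_near[OF _ xq] q by (auto simp: sites_def)
        finally show ?thesis using c by (simp add: mult_left_mono)
      qed
      finally show ?thesis by (simp add: mult_ac)
    qed
    also have "a * (c ^ card V * exp (2 * (c - 1) * C)) = K * (\<integral>y. \<phi> (merge V R (x, y)) \<partial>PiM R \<nu>')"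
      by (simp add: a K_def prob_space.prob_space[OF probR])
    finally show ?thesis using a0 c by (simp add: mult_left_mono)
  qed
  have fold1: "(\<integral>y. u y \<partial>doubled) = (\<integral>x. (\<integral>y. u (merge V R (x, y)) \<partial>PiM R \<nu>') \<partial>PiM V \<nu>')" if "integrable doubled u" for u :: "_ \<Rightarrow> real"
    unfolding \<nu>'_def using dbl.product_integral_fold[OF VR(1-3), of u] that by (simp add: VR(4))
  have int1: "integrable (PiM V \<nu>') (\<lambda>x. \<integral>y. u (merge V R (x, y)) \<partial>PiM R \<nu>')" if "integrable doubled u" for u :: "_ \<Rightarrow> real"
  proof -
    interpret pair_sigma_finite "PiM V \<nu>'" "PiM R \<nu>'"
      by (intro pair_sigma_finite.intro prob_space_imp_sigma_finite probV probR)
    have "integrable (PiM V \<nu>' \<Otimes>\<^sub>M PiM R \<nu>') (\<lambda>z. u (merge V R z))"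
      by (rule integrable_distr[OF measurable_merge])
        (use that dbl.distr_merge[OF VR(1-3)] in \<open>simp add: \<nu>'_def VR(4)\<close>)
    from integrable_fst'[OF this] show ?thesis .
  qed
  show ?thesis
    unfolding fold1[OF int] fold1[OF int\<phi>] K_def[symmetric]
    by (subst Bochner_Integration.integral_mult_right_zero[symmetric])
      (intro integral_mono int1[OF int] integrable_mult_right int1[OF int\<phi>] inner)
qed

lemma single_site_integral:
  fixes u :: "'b \<Rightarrow> real"
  assumes "p \<in> sites" "u \<in> borel_measurable (\<nu> (fst p))"
  shows "(\<integral>y. u (y p) \<partial>doubled) = (\<integral>b. u b \<partial>\<nu> (fst p))"
proof -
  have "distr doubled (\<nu> (fst p)) (\<lambda>y. y p) = \<nu> (fst p)"
    using distr_PiM_component[of sites "\<lambda>p. \<nu> (fst p)" p] assms(1) prob_\<nu> by simp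
  with integral_distr[OF component_measurable[OF assms(1)] assms(2)] show ?thesis by simp
qed

text \<open>The neighbour estimate is applied twice: with the weight \<open>touch\<close>, to
  integrate out the powers of 256, and then with the weight \<open>alive\<close>, to bound the
  expected number of touched coordinates.\<close>

lemma quad_removal_expectation:
  assumes \<psi>: "\<And>t. \<bar>\<psi> t\<bar> \<le> \<bar>t\<bar>" and p: "p \<in> sites" and C: "0 \<le> C"
  shows "(\<integral>y. (quad \<psi> y - quad \<psi> (y(p := dead (fst p))))\<^sup>2 \<partial>doubled)
    \<le> 256 ^ 4 * exp (512 * C) * measure (\<nu> (fst p)) {a \<in> space (\<nu> (fst p)). alive (fst p) a}"
proof -
  \<comment> \<open>At most three sites are fixed, and 510 is \<open>2 * (256 - 1)\<close>. The
    second application, in base 2 with one fixed site, adds the factor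
    \<open>2 * exp (2 * C)\<close>.\<close>
  define K where "K = 256 ^ 3 * exp (510 * C)"
  define \<tau> where "\<tau> k y = (of_bool (touch p k y) :: real)" for k y
  define al where "al y = (of_bool (alive (fst p) (y p)) :: real)" for y
  define P where "P = (\<lambda>q y. 256 ^ card (nbrs q y) :: real)"
  have \<tau>m: "\<tau> k \<in> borel_measurable doubled" if "k < m" for k
    unfolding \<tau>_def using touch_measurable[OF p that] by measurable
  have alm: "al \<in> borel_measurable doubled"
    unfolding al_def using alive_site_measurable[OF p] by measurable
  have s: "(k, b) \<in> sites" if "k < m" for k b using that by (simp add: sites_def)
  have kint: "integrable doubled (\<lambda>y. \<tau> k y * P q y)" if "k < m" "q \<in> sites" for k q
    by (rule bounded_integrable[OF prob_doubled, of _ "1 * 256 ^ card sites"])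
      (unfold P_def, intro borel_measurable_times \<tau>m pow_nbrs_measurable that, intro abs_mult_bound pow_nbrs_bound, auto simp: \<tau>_def)
  have kint0: "integrable doubled (\<tau> k)" if "k < m" for k
    by (rule bounded_integrable[OF prob_doubled, of _ 1]) (use \<tau>m[OF that] in \<open>auto simp: \<tau>_def\<close>)
  have key: "(\<integral>y. \<tau> k y * P q y \<partial>doubled) \<le> K * (\<integral>y. \<tau> k y \<partial>doubled)"
    if k: "k < m" and q: "q \<in> {p, (k, False), (k, True)}" for k q
  proof -
    let ?V = "{p, (k, False), (k, True)}"
    have "(\<integral>y. \<tau> k y * P q y \<partial>doubled) \<le> 256 ^ card ?V * exp (2 * (256 - 1) * C) * (\<integral>y. \<tau> k y \<partial>doubled)"
      unfolding P_def
    proof (rule expectation_pow_nbrs[where B=1, OF _ _ _ \<tau>m[OF k]])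
      show "?V \<subseteq> sites" using p s[OF k] by auto
      show "\<tau> k y = \<tau> k y'" if "\<And>r. r \<in> ?V \<Longrightarrow> y r = y' r" for y y'
        using that by (auto simp: \<tau>_def touch_def ex_bool_eq)
    qed (use q in \<open>auto simp: \<tau>_def\<close>)
    also have "\<dots> \<le> K * (\<integral>y. \<tau> k y \<partial>doubled)"
    proof (intro mult_right_mono)
      have "card ?V \<le> 3" by (rule order_trans[OF card_insert_le_m1]) auto
      hence "(256::real) ^ card ?V \<le> 256 ^ 3" by (intro power_increasing) auto
      thus "256 ^ card ?V * exp (2 * (256 - 1) * C) \<le> K" by (simp add: K_def)
    qed (simp add: \<tau>_def)
    finally show ?thesis .
  qed
  define L where "L = (\<integral>y. (quad \<psi> y - quad \<psi> (y(p := dead (fst p))))\<^sup>2 \<partial>doubled)"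
  have "L \<le> (\<integral>y. 32 * (\<Sum>k<m. 2 * (\<tau> k y * P p y) + \<tau> k y * P (k, False) y + \<tau> k y * P (k, True) y) \<partial>doubled)"
    unfolding L_def
  proof (rule integral_mono')
    show "integrable doubled (\<lambda>y. 32 * (\<Sum>k<m. 2 * (\<tau> k y * P p y) + \<tau> k y * P (k, False) y + \<tau> k y * P (k, True) y))"
      by (intro integrable_mult_right Bochner_Integration.integrable_sum Bochner_Integration.integrable_add kint s p) auto
    fix y
    show "(quad \<psi> y - quad \<psi> (y(p := dead (fst p))))\<^sup>2 \<le> 32 * (\<Sum>k<m. 2 * (\<tau> k y * P p y) + \<tau> k y * P (k, False) y + \<tau> k y * P (k, True) y)"
      using quad_removal[OF \<psi> p, of y] by (simp add: \<tau>_def P_def algebra_simps)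
  qed (auto intro!: sum_nonneg add_nonneg_nonneg simp: \<tau>_def P_def)
  also have "\<dots> = 32 * (\<Sum>k<m. 2 * (\<integral>y. \<tau> k y * P p y \<partial>doubled) + (\<integral>y. \<tau> k y * P (k, False) y \<partial>doubled) + (\<integral>y. \<tau> k y * P (k, True) y \<partial>doubled))"
    using kint s p by (subst integral_mult_right_zero, subst Bochner_Integration.integral_sum) (auto intro!: sum.cong)
  also have "\<dots> \<le> 32 * (\<Sum>k<m. 4 * K * (\<integral>y. \<tau> k y \<partial>doubled))"
  proof (intro mult_left_mono sum_mono)
    fix k assume "k \<in> {..<m}"
    hence k: "k < m" by simp
    show "2 * (\<integral>y. \<tau> k y * P p y \<partial>doubled) + (\<integral>y. \<tau> k y * P (k, False) y \<partial>doubled) + (\<integral>y. \<tau> k y * P (k, True) y \<partial>doubled) \<le> 4 * K * (\<integral>y. \<tau> k y \<partial>doubled)"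
      using key[OF k, of p] key[OF k, of "(k, False)"] key[OF k, of "(k, True)"] by simp
  qed simp
  also have "\<dots> = 128 * K * (\<integral>y. (\<Sum>k<m. \<tau> k y) \<partial>doubled)"
    using kint0 by (subst Bochner_Integration.integral_sum) (auto simp: sum_distrib_left mult.assoc)
  also have "(\<integral>y. (\<Sum>k<m. \<tau> k y) \<partial>doubled) \<le> (\<integral>y. al y * 2 ^ card (nbrs p y) \<partial>doubled)"
  proof (rule integral_mono)
    show "integrable doubled (\<lambda>y. al y * 2 ^ card (nbrs p y))"
      by (rule bounded_integrable[OF prob_doubled, of _ "1 * 2 ^ card sites"])
        (intro borel_measurable_times alm pow_nbrs_measurable p, intro abs_mult_bound pow_nbrs_bound, auto simp: al_def)
    show "(\<Sum>k<m. \<tau> k y) \<le> al y * 2 ^ card (nbrs p y)" for y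
      using sum_touch[OF p] by (simp add: \<tau>_def al_def)
  qed (intro Bochner_Integration.integrable_sum kint0, simp)
  also have "(\<integral>y. al y * 2 ^ card (nbrs p y) \<partial>doubled) \<le> 2 ^ card {p} * exp (2 * (2 - 1) * C) * (\<integral>y. al y \<partial>doubled)"
    by (rule expectation_pow_nbrs[where B=1, OF _ _ _ alm]) (use p in \<open>auto simp: al_def\<close>)
  also have "(\<integral>y. al y \<partial>doubled) = measure (\<nu> (fst p)) {a \<in> space (\<nu> (fst p)). alive (fst p) a}"
  proof -
    have "(\<integral>y. al y \<partial>doubled) = (\<integral>a. of_bool (alive (fst p) a) \<partial>\<nu> (fst p))"
      unfolding al_def using alive_meas by (intro single_site_integral p) measurable
    also have "\<dots> = (\<integral>a. indicator {a \<in> space (\<nu> (fst p)). alive (fst p) a} a \<partial>\<nu> (fst p))"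
      by (intro Bochner_Integration.integral_cong) auto
    finally show ?thesis using predE[OF alive_meas] by (simp add: Int_def conj_ac)
  qed
  finally have "L \<le> 128 * K * (2 ^ card {p} * exp (2 * (2 - 1) * C) * measure (\<nu> (fst p)) {a \<in> space (\<nu> (fst p)). alive (fst p) a})"
    by (simp add: K_def mult_left_mono)
  also have "\<dots> = 256 ^ 4 * exp (512 * C) * measure (\<nu> (fst p)) {a \<in> space (\<nu> (fst p)). alive (fst p) a}"
    by (simp add: K_def flip: exp_add)
  finally show ?thesis unfolding L_def .
qed

lemma quad_variance:
  assumes \<psi>: "\<And>t. \<bar>\<psi> t\<bar> \<le> \<bar>t\<bar>" "\<psi> \<in> borel_measurable borel" and C: "0 \<le> C"
  shows "(\<integral>y. (quad \<psi> y)\<^sup>2 \<partial>doubled) - (\<integral>y. quad \<psi> y \<partial>doubled)\<^sup>2 \<le> 2 * 256 ^ 4 * exp (512 * C) * lam"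
proof -
  define B where "B = (2::real) * 2 ^ m"
  have b: "\<bar>diff functional k y\<bar> \<le> B" "\<bar>incr functional k y\<bar> \<le> B" for k y
    using functional_bound[of "mix 0 y"] functional_bound[of "flip k y"] functional_bound[of "mix k y"] functional_bound[of "mix (Suc k) y"]
    by (auto simp: diff_def incr_def B_def)
  have bq: "\<bar>quad \<psi> y\<bar> \<le> real m * (B * B)" for y
  proof -
    have "\<bar>\<psi> (incr functional k y) * diff functional k y\<bar> \<le> B * B" for k
      by (intro abs_mult_bound order_trans[OF \<psi>(1) b(2)] b)
    from order_trans[OF sum_abs sum_mono[OF this, of "\<lambda>k. k" "{..<m}"]] show ?thesis by (simp add: quad_def)
  qed
  have qm: "quad \<psi> \<in> borel_measurable doubled"
    unfolding quad_def[abs_def] using \<psi>(2) by measurable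
  have "(\<integral>y. (quad \<psi> y)\<^sup>2 \<partial>doubled) - (\<integral>y. quad \<psi> y \<partial>doubled)\<^sup>2
    \<le> (\<Sum>p\<in>sites. \<integral>y. (quad \<psi> y - quad \<psi> (y(p := dead (fst p))))\<^sup>2 \<partial>doubled)"
    by (rule dbl.Efron_Stein[OF finite_sites qm bq]) (rule dead)
  also have "\<dots> \<le> (\<Sum>p\<in>sites. 256 ^ 4 * exp (512 * C) * measure (\<nu> (fst p)) {a \<in> space (\<nu> (fst p)). alive (fst p) a})"
    by (intro sum_mono quad_removal_expectation \<psi> C)
  also have "\<dots> = 256 ^ 4 * exp (512 * C) * (\<Sum>i<m. \<Sum>b\<in>(UNIV::bool set). measure (\<nu> i) {a \<in> space (\<nu> i). alive i a})"
    unfolding sites_def sum.cartesian_product by (simp only: sum_distrib_left split_beta)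
  also have "\<dots> = 2 * 256 ^ 4 * exp (512 * C) * (\<Sum>i<m. measure (\<nu> i) {a \<in> space (\<nu> i). alive i a})"
    by (simp flip: sum_distrib_left)
  also have "\<dots> \<le> 2 * 256 ^ 4 * exp (512 * C) * lam" by (intro mult_left_mono sum_alive) simp
  finally show ?thesis .
qed

theorem Berry_Esseen_local:
  assumes C: "0 \<le> C" and \<mu>: "\<mu> = (\<integral>x. functional x \<partial>single)"
    and \<sigma>: "\<sigma>\<^sup>2 = (\<integral>x. (functional x - \<mu>)\<^sup>2 \<partial>single)" "0 < \<sigma>"
  shows "\<bar>measure single {x \<in> space single. (functional x - \<mu>) / \<sigma> \<le> z} - std_normal_cdf z\<bar>
    \<le> 3 * sqrt (2 * 256 ^ 4 * exp (512 * C) * lam) / \<sigma>\<^sup>2"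
proof -
  have "carre functional = quad (\<lambda>t. t)" "carre_abs functional = quad abs"
    by (simp_all add: carre_def[abs_def] carre_abs_def[abs_def] quad_def[abs_def])
  with quad_variance[of "\<lambda>t. t"] quad_variance[of abs] C show ?thesis
    by (intro Berry_Esseen_carre[OF functional_measurable functional_bound \<mu> \<sigma>]) auto
qed

end

section \<open>Alternating sums over simplices\<close>

text \<open>The exponent \<open>card \<sigma> + 1\<close> has the parity of the dimension
  \<open>card \<sigma> - 1\<close> and avoids truncated subtraction at the empty set.\<close>

definition alt_count :: "'a set set \<Rightarrow> 'a set \<Rightarrow> real" where
  "alt_count S A = (\<Sum>\<sigma>\<in>Pow A. (- 1) ^ (card \<sigma> + 1) * of_bool (\<sigma> \<in> S))"

lemma euler_characteristic_alt_count:
  assumes "finite A" "{} \<notin> S"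
  shows "euler_characteristic {\<sigma>. \<sigma> \<subseteq> A \<and> \<sigma> \<in> S} = alt_count S A"
proof -
  define K where "K = {\<sigma>. \<sigma> \<subseteq> A \<and> \<sigma> \<in> S}"
  have fK: "finite K" using assms by (auto simp: K_def intro: finite_subset[of _ "Pow A"])
  have z: "{\<sigma> \<in> K. card \<sigma> = k + 1} = {}" if "k \<notin> {..<card A}" for k
  proof -
    have "card \<sigma> \<noteq> k + 1" if "\<sigma> \<in> K" for \<sigma>
      using card_mono[OF assms(1), of \<sigma>] that \<open>k \<notin> {..<card A}\<close> by (simp add: K_def)
    thus ?thesis by blast
  qed
  have "euler_characteristic K = (\<Sum>k<card A. (- 1) ^ k * real (card {\<sigma> \<in> K. card \<sigma> = k + 1}))"
    unfolding euler_characteristic_def 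
  proof (rule suminf_finite)
    fix k assume "k \<notin> {..<card A}"
    from z[OF this] show "(- 1) ^ k * real (card {\<sigma> \<in> K. card \<sigma> = k + 1}) = 0" by (simp only: card.empty of_nat_0 mult_zero_right)
  qed simp
  also have "\<dots> = (\<Sum>k<card A. \<Sum>\<sigma>\<in>{\<sigma> \<in> K. card \<sigma> - 1 = k}. (- 1) ^ (card \<sigma> + 1))"
  proof (rule sum.cong[OF refl])
    fix k
    \<comment> \<open>Truncated subtraction would also put the empty set into dimension 0; it is
      excluded by hypothesis.\<close>
    have *: "{\<sigma> \<in> K. card \<sigma> - 1 = k} = {\<sigma> \<in> K. card \<sigma> = k + 1}"
    proof (intro set_eqI iffI)
      fix \<sigma> assume s: "\<sigma> \<in> {\<sigma> \<in> K. card \<sigma> - 1 = k}"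
      hence "\<sigma> \<noteq> {}" "finite \<sigma>" using assms by (auto simp: K_def intro: finite_subset)
      hence "card \<sigma> > 0" by (simp add: card_gt_0_iff)
      thus "\<sigma> \<in> {\<sigma> \<in> K. card \<sigma> = k + 1}" using s by auto
    qed auto
    have "(\<Sum>\<sigma>\<in>{\<sigma> \<in> K. card \<sigma> - 1 = k}. (- 1) ^ (card \<sigma> + 1)) = (\<Sum>\<sigma>\<in>{\<sigma> \<in> K. card \<sigma> = k + 1}. (- 1 :: real) ^ k)"
      unfolding * by (intro sum.cong) auto
    thus "(- 1) ^ k * real (card {\<sigma> \<in> K. card \<sigma> = k + 1}) = (\<Sum>\<sigma>\<in>{\<sigma> \<in> K. card \<sigma> - 1 = k}. (- 1) ^ (card \<sigma> + 1))"
      by simp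
  qed
  also have "\<dots> = (\<Sum>\<sigma>\<in>K. (- 1) ^ (card \<sigma> + 1))"
  proof (rule sum.group[OF fK])
    show "(\<lambda>\<sigma>. card \<sigma> - 1) ` K \<subseteq> {..<card A}"
    proof safe
      fix \<sigma> assume "\<sigma> \<in> K"
      hence "\<sigma> \<subseteq> A" "\<sigma> \<noteq> {}" using assms by (auto simp: K_def)
      hence "card \<sigma> \<le> card A" "card \<sigma> > 0" using assms(1) by (auto simp: card_gt_0_iff intro: card_mono finite_subset)
      thus "card \<sigma> - 1 < card A" by auto
    qed
  qed auto
  also have "\<dots> = alt_count S A"
    unfolding alt_count_def K_def using assms(1) by (intro sum.mono_neutral_cong_left) auto
  finally show ?thesis unfolding K_def .
qed

lemma alt_count_image:
  assumes "inj_on p J"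
  shows "alt_count S (p ` J) = (\<Sum>B\<in>Pow J. (- 1) ^ (card B + 1) * of_bool (p ` B \<in> S))"
proof -
  have "bij_betw ((`) p) (Pow J) (Pow (p ` J))" by (intro bij_betw_imageI inj_on_image_Pow assms image_Pow_surj refl)
  from sum.reindex_bij_betw[OF this] show ?thesis
    unfolding alt_count_def using assms
    by (subst sum.reindex_bij_betw[OF \<open>bij_betw ((`) p) (Pow J) (Pow (p ` J))\<close>, symmetric])
      (auto intro!: sum.cong simp: card_image inj_on_subset)
qed

text \<open>What the two complexes have in common. Whether points at distance exactly
  \<open>R\<close> span an edge is left open, since the complexes differ there.\<close>

locale simplex_family =
  fixes S :: "'a::metric_space set set" and R :: real
  assumes empty_notin: "{} \<notin> S"
    and simplex_dist: "\<sigma> \<in> S \<Longrightarrow> x \<in> \<sigma> \<Longrightarrow> y \<in> \<sigma> \<Longrightarrow> dist x y \<le> R"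
    and pair_in: "dist x y < R \<Longrightarrow> {x, y} \<in> S"
    and R_pos: "0 < R"
begin

lemma singleton_in: "{x} \<in> S" using pair_in[of x x] R_pos by simp

text \<open>No simplex meets both sets, so the faces split into those of \<open>A\<close> and those
  of \<open>B\<close>. They share only the empty set, which is not a simplex.\<close>

lemma alt_count_union:
  assumes "finite A" "finite B" "\<And>a b. a \<in> A \<Longrightarrow> b \<in> B \<Longrightarrow> R < dist a b"
  shows "alt_count S (A \<union> B) = alt_count S A + alt_count S B"
proof -
  have disj: "A \<inter> B = {}" using assms(3) R_pos by fastforce
  let ?f = "\<lambda>\<sigma>. (- 1 :: real) ^ (card \<sigma> + 1) * of_bool (\<sigma> \<in> S)"
  have "alt_count S (A \<union> B) = sum ?f (Pow A \<union> Pow B)"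
    unfolding alt_count_def
  proof (rule sum.mono_neutral_right)
    show "\<forall>\<sigma>\<in>Pow (A \<union> B) - (Pow A \<union> Pow B). ?f \<sigma> = 0"
    proof
      fix \<sigma> assume "\<sigma> \<in> Pow (A \<union> B) - (Pow A \<union> Pow B)"
      then obtain a b where "a \<in> \<sigma>" "b \<in> \<sigma>" "a \<in> A" "b \<in> B" by blast
      with simplex_dist[of \<sigma> a b] assms(3)[of a b] show "?f \<sigma> = 0" by auto
    qed
  qed (use assms in auto)
  also have "\<dots> = sum ?f (Pow A) + sum ?f (Pow B) - sum ?f (Pow A \<inter> Pow B)"
    by (rule sum_Un) (use assms in auto)
  also have "Pow A \<inter> Pow B = {{}}" using disj by auto
  finally show ?thesis by (simp add: alt_count_def empty_notin)
qed

lemma alt_count_singleton: "alt_count S {x} = 1"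
  by (simp add: alt_count_def Pow_insert empty_notin singleton_in)

lemma alt_count_pair:
  assumes "x \<noteq> y" "dist x y < R" shows "alt_count S {x, y} = 1"
proof -
  have P: "Pow {x, y} = {{}, {x}, {y}, {x, y}}" by auto
  show ?thesis unfolding alt_count_def P using assms pair_in[of x y]
    by (simp add: empty_notin singleton_in doubleton_eq_iff insert_commute)
qed

end

section \<open>Cech and Vietoris--Rips complexes of rescaled points\<close>

definition scaled_simplices :: "(real \<Rightarrow> 'a set \<Rightarrow> 'a set set) \<Rightarrow> real \<Rightarrow> real \<Rightarrow> 'a::real_normed_vector set set" where
  "scaled_simplices K c r = {\<sigma>. (\<lambda>x. c *\<^sub>R x) ` \<sigma> \<in> K r UNIV}"

lemma dist_scaleR: "dist (c *\<^sub>R x) (c *\<^sub>R y) = \<bar>c\<bar> * dist x y" for x y :: "'a::real_normed_vector"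
  by (simp add: dist_norm flip: scaleR_right_diff_distrib)

lemma rips_scaled_iff:
  "\<sigma> \<in> scaled_simplices rips_complex c r \<longleftrightarrow> \<sigma> \<noteq> {} \<and> (\<forall>a\<in>\<sigma>. \<forall>b\<in>\<sigma>. \<bar>c\<bar> * dist a b < r)"
  by (auto simp: scaled_simplices_def rips_complex_def dist_scaleR)

lemma cech_scaled_iff:
  "\<sigma> \<in> scaled_simplices cech_complex c r \<longleftrightarrow> \<sigma> \<noteq> {} \<and> (\<exists>z. \<forall>a\<in>\<sigma>. dist (c *\<^sub>R a) z \<le> r / 2)"
proof -
  have "(\<Inter>a\<in>(\<lambda>x. c *\<^sub>R x) ` \<sigma>. cball a (r / 2)) \<noteq> {} \<longleftrightarrow> (\<exists>z. \<forall>a\<in>\<sigma>. dist (c *\<^sub>R a) z \<le> r / 2)"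
    unfolding ex_in_conv[symmetric] by simp
  thus ?thesis unfolding scaled_simplices_def cech_complex_def by simp
qed

text \<open>The scaling is moved from the points into the family of simplices, so that the points
  keep their original law.\<close>

lemma complex_rescaled:
  assumes K: "K = cech_complex \<or> K = rips_complex" and c: "0 < c" and A: "finite A"
  shows "euler_characteristic (K r ((\<lambda>x. c *\<^sub>R x) ` A)) = alt_count (scaled_simplices K c r) A"
proof -
  let ?c = "\<lambda>x::'a. c *\<^sub>R x"
  have inj: "inj_on ?c A" using c by (auto simp: inj_on_def)
  have "K r (?c ` A) = {\<sigma>. \<sigma> \<subseteq> ?c ` A \<and> \<sigma> \<in> K r UNIV}"
    using K by (auto simp: cech_complex_def rips_complex_def)
  hence "euler_characteristic (K r (?c ` A)) = alt_count (K r UNIV) (?c ` A)"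
    using euler_characteristic_alt_count[of "?c ` A" "K r UNIV"] A K
    by (auto simp: cech_complex_def rips_complex_def)
  also have "\<dots> = alt_count (scaled_simplices K c r) A"
    by (subst alt_count_image[OF inj]) (simp add: alt_count_def scaled_simplices_def)
  finally show ?thesis .
qed

lemma simplex_family_scaled:
  assumes K: "K = cech_complex \<or> K = rips_complex" and c: "0 < c" and r: "0 < r"
  shows "simplex_family (scaled_simplices K c r) (r / c)"
  using K
proof
  assume K: "K = cech_complex"
  show ?thesis unfolding K
  proof (unfold_locales, goal_cases)
    case (2 \<sigma> x y)
    then obtain z where "dist (c *\<^sub>R x) z \<le> r / 2" "dist (c *\<^sub>R y) z \<le> r / 2" by (auto simp: cech_scaled_iff)
    hence "dist (c *\<^sub>R x) (c *\<^sub>R y) \<le> r" using dist_triangle2[of "c *\<^sub>R x" "c *\<^sub>R y" z] by linarith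
    thus ?case using c by (simp add: dist_scaleR field_simps)
  next
    case (3 x y)
    hence "dist (c *\<^sub>R x) (c *\<^sub>R y) < r" using c by (simp add: dist_scaleR field_simps)
    \<comment> \<open>Balls of radius \<open>r / 2\<close> about two points at distance less than
      \<open>r\<close> meet in the midpoint.\<close>
    hence "dist (c *\<^sub>R a) (midpoint (c *\<^sub>R x) (c *\<^sub>R y)) \<le> r / 2" if "a \<in> {x, y}" for a
      using that by (auto simp: dist_midpoint)
    thus ?case by (auto simp: cech_scaled_iff)
  qed (use r c in \<open>auto simp: cech_scaled_iff\<close>)
next
  assume K: "K = rips_complex"
  show ?thesis unfolding K
    by unfold_locales (use r c in \<open>auto simp: rips_scaled_iff field_simps dist_commute less_imp_le\<close>)
qed

text \<open>Nested nonempty compact sets: the intersections of the balls with the enlarged radii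
  shrink to the intersection of the original balls.\<close>

lemma cballs_limit:
  fixes y :: "'i \<Rightarrow> 'a::heine_borel"
  assumes "A \<noteq> {}" "\<And>n::nat. \<exists>z. \<forall>a\<in>A. dist (y a) z \<le> \<rho> + 1 / real (Suc n)"
  shows "\<exists>z. \<forall>a\<in>A. dist (y a) z \<le> \<rho>"
proof -
  define D where "D n = (\<Inter>a\<in>A. cball (y a) (\<rho> + 1 / real (Suc n)))" for n
  obtain a0 where a0: "a0 \<in> A" using assms by auto
  have "\<Inter>(range D) \<noteq> {}"
  proof (rule compact_nest)
    fix n
    show "compact (D n)"
      unfolding D_def by (rule compact_Inter) (use a0 in auto)
    show "D n \<noteq> {}" using assms(2)[of n] unfolding D_def ex_in_conv[symmetric] by simp
  next
    fix m n :: nat assume "m \<le> n"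
    hence "1 / real (Suc n) \<le> 1 / real (Suc m)" by (intro divide_left_mono) auto
    thus "D n \<subseteq> D m" by (force simp: D_def)
  qed
  then obtain z where z: "z \<in> D n" for n by auto
  have "dist (y a) z \<le> \<rho>" if "a \<in> A" for a
  proof (rule field_le_epsilon)
    fix e :: real assume "0 < e"
    then obtain n where "1 / real (Suc n) < e" using nat_approx_posE by blast
    moreover have "dist (y a) z \<le> \<rho> + 1 / real (Suc n)" using z[of n] that by (auto simp: D_def)
    ultimately show "dist (y a) z \<le> \<rho> + e" by linarith
  qed
  thus ?thesis by blast
qed

text \<open>The Rips condition is a finite conjunction. The Cech condition quantifies over an
  uncountable set of centres; a countable dense set suffices if the radius is enlarged by
  \<open>1 / Suc n\<close> for every \<open>n\<close>, and \<open>cballs_limit\<close> recovers the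
  original condition.\<close>

lemma simplex_measurable:
  fixes \<nu> :: "nat \<Rightarrow> 'a::euclidean_space measure"
  assumes K: "K = cech_complex \<or> K = rips_complex" and A: "A \<subseteq> I" "finite A"
    and \<nu>: "\<And>i. sets (\<nu> i) = sets borel"
  shows "Measurable.pred (PiM I \<nu>) (\<lambda>x. x ` A \<in> scaled_simplices K c r)"
proof -
  note \<nu>[measurable_cong]
  have m[measurable]: "(\<lambda>x. x a) \<in> borel_measurable (PiM I \<nu>)" if "a \<in> A" for a
    using measurable_component_singleton[of a I \<nu>] that A \<nu>[of a] by (auto simp: measurable_def cong: measurable_cong_sets)
  obtain D :: "'a set" where D: "countable D" "\<And>X. open X \<Longrightarrow> X \<noteq> {} \<Longrightarrow> \<exists>d\<in>D. d \<in> X"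
    using countable_dense_setE by blast
  from K show ?thesis
  proof
    assume K: "K = rips_complex"
    have "(\<lambda>x. x ` A \<in> scaled_simplices K c r) = (\<lambda>x. A \<noteq> {} \<and> (\<forall>a\<in>A. \<forall>b\<in>A. \<bar>c\<bar> * dist (x a) (x b) < r))"
      by (auto simp: K rips_scaled_iff)
    also have "Measurable.pred (PiM I \<nu>) \<dots>"
      using A(2) by (intro pred_intros_logic pred_intros_finite) measurable
    finally show ?thesis .
  next
    assume K: "K = cech_complex"
    have "x ` A \<in> scaled_simplices K c r \<longleftrightarrow> A \<noteq> {} \<and> (\<forall>n::nat. \<exists>z\<in>D. \<forall>a\<in>A. dist (c *\<^sub>R x a) z < r / 2 + 1 / real (Suc n))" for x
    proof (intro iffI conjI allI)
      assume L: "x ` A \<in> scaled_simplices K c r"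
      thus "A \<noteq> {}" by (auto simp: K cech_scaled_iff)
      fix n :: nat
      from L obtain z where z: "\<And>a. a \<in> A \<Longrightarrow> dist (c *\<^sub>R x a) z \<le> r / 2" by (auto simp: K cech_scaled_iff)
      obtain d where d: "d \<in> D" "d \<in> ball z (1 / real (Suc n))" using D(2)[of "ball z (1 / real (Suc n))"] by auto
      have "dist (c *\<^sub>R x a) d < r / 2 + 1 / real (Suc n)" if "a \<in> A" for a
        using dist_triangle[of "c *\<^sub>R x a" d z] z[OF that] d(2) by (auto simp: dist_commute)
      with d show "\<exists>z\<in>D. \<forall>a\<in>A. dist (c *\<^sub>R x a) z < r / 2 + 1 / real (Suc n)" by blast
    next
      assume R: "A \<noteq> {} \<and> (\<forall>n::nat. \<exists>z\<in>D. \<forall>a\<in>A. dist (c *\<^sub>R x a) z < r / 2 + 1 / real (Suc n))"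
      have "\<exists>z. \<forall>a\<in>A. dist (c *\<^sub>R x a) z \<le> r / 2 + 1 / real (Suc n)" for n
        using R less_imp_le by meson
      hence "\<exists>z. \<forall>a\<in>A. dist (c *\<^sub>R x a) z \<le> r / 2" 
        using cballs_limit[of A "\<lambda>a. c *\<^sub>R x a" "r / 2", OF conjunct1[OF R]] by blast
      thus "x ` A \<in> scaled_simplices K c r" using R by (auto simp: K cech_scaled_iff)
    qed
    hence "(\<lambda>x. x ` A \<in> scaled_simplices K c r) = (\<lambda>x. A \<noteq> {} \<and> (\<forall>n::nat. \<exists>z\<in>D. \<forall>a\<in>A. dist (c *\<^sub>R x a) z < r / 2 + 1 / real (Suc n)))"
      by (rule ext)
    also have "Measurable.pred (PiM I \<nu>) \<dots>"
    proof (intro pred_intros_logic pred_intros_countable)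
      fix n :: nat
      show "Measurable.pred (PiM I \<nu>) (\<lambda>x. \<exists>z\<in>D. \<forall>a\<in>A. dist (c *\<^sub>R x a) z < r / 2 + 1 / real (Suc n))"
        unfolding pred_def
      proof (rule sets.sets_Collect_countable_Ex'[OF _ D(1)])
        fix z
        show "{x \<in> space (PiM I \<nu>). \<forall>a\<in>A. dist (c *\<^sub>R x a) z < r / 2 + 1 / real (Suc n)} \<in> sets (PiM I \<nu>)"
          using A(2) by measurable
      qed
    qed measurable
    finally show ?thesis .
  qed
qed

text \<open>Moving the vertices by at most \<open>\<epsilon>\<close> is compensated by moving the filtration parameter, in the
  direction that turns the boundary case of the respective complex into an eventual equality.\<close>

definition perturbed :: "(real \<Rightarrow> 'a set \<Rightarrow> 'a set set) \<Rightarrow> real \<Rightarrow> real \<Rightarrow> real \<Rightarrow> 'a::real_normed_vector set set" where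
  "perturbed K c r \<epsilon> = scaled_simplices K c (if K = cech_complex then r + 2 * c * \<epsilon> else r - 2 * c * \<epsilon>)"

lemma perturbed_eventually:
  fixes p :: "nat \<Rightarrow> 'a::euclidean_space \<Rightarrow> 'a"
  assumes K: "K = cech_complex \<or> K = rips_complex" and c: "0 < c" and \<sigma>: "finite \<sigma>"
    and \<epsilon>: "\<epsilon> \<longlonglongrightarrow> 0" "\<And>k. 0 \<le> \<epsilon> k" and p: "\<And>k x. x \<in> \<sigma> \<Longrightarrow> eventually (\<lambda>k. dist (p k x) x \<le> \<epsilon> k) sequentially"
  shows "eventually (\<lambda>k. p k ` \<sigma> \<in> perturbed K c r (\<epsilon> k) \<longleftrightarrow> \<sigma> \<in> scaled_simplices K c r) sequentially"
proof (cases "\<sigma> = {}")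
  case True
  thus ?thesis using K by (auto simp: perturbed_def cech_scaled_iff rips_scaled_iff)
next
  case False
  have pe: "eventually (\<lambda>k. \<forall>x\<in>\<sigma>. dist (p k x) x \<le> \<epsilon> k) sequentially"
    using \<sigma> p by (simp add: eventually_ball_finite)
  have sc: "dist (c *\<^sub>R p k x) (c *\<^sub>R x) \<le> c * \<epsilon> k" if "dist (p k x) x \<le> \<epsilon> k" for k x
    using that c by (simp add: dist_scaleR)
  show ?thesis
  proof (cases "K = cech_complex")
    case cech: True
    show ?thesis
    proof (cases "\<sigma> \<in> scaled_simplices K c r")
      case True
      then obtain z where z: "\<And>a. a \<in> \<sigma> \<Longrightarrow> dist (c *\<^sub>R a) z \<le> r / 2" by (auto simp: cech cech_scaled_iff)
      from pe show ?thesis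
      proof eventually_elim
        case (elim k)
        have "dist (c *\<^sub>R p k a) z \<le> (r + 2 * c * \<epsilon> k) / 2" if "a \<in> \<sigma>" for a
          using dist_triangle[of "c *\<^sub>R p k a" z "c *\<^sub>R a"] sc[OF bspec[OF elim that]] z[OF that] by simp
        thus ?case using True False by (auto simp: perturbed_def cech cech_scaled_iff)
      qed
    next
      case notin: False
      have "\<exists>n::nat. \<not> (\<exists>z. \<forall>a\<in>\<sigma>. dist (c *\<^sub>R a) z \<le> r / 2 + 1 / real (Suc n))"
        using cballs_limit[OF False, of "\<lambda>a. c *\<^sub>R a" "r / 2"] notin False unfolding cech cech_scaled_iff by blast
      then obtain \<delta> :: real where n: "\<not> (\<exists>z. \<forall>a\<in>\<sigma>. dist (c *\<^sub>R a) z \<le> r / 2 + \<delta>)" "0 < \<delta>"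
        by (metis of_nat_0_less_iff zero_less_Suc zero_less_divide_1_iff)
      have "(\<lambda>k. 2 * c * \<epsilon> k) \<longlonglongrightarrow> 2 * c * 0" by (intro tendsto_intros \<epsilon>)
      hence "eventually (\<lambda>k. 2 * c * \<epsilon> k < \<delta>) sequentially"
        using n(2) by (intro order_tendstoD) auto
      with pe show ?thesis
      proof eventually_elim
        case (elim k)
        have "p k ` \<sigma> \<notin> perturbed K c r (\<epsilon> k)"
        proof
          assume "p k ` \<sigma> \<in> perturbed K c r (\<epsilon> k)"
          then obtain z where z: "\<And>a. a \<in> \<sigma> \<Longrightarrow> dist (c *\<^sub>R p k a) z \<le> (r + 2 * c * \<epsilon> k) / 2"
            by (auto simp: perturbed_def cech cech_scaled_iff)
          have "dist (c *\<^sub>R a) z \<le> r / 2 + \<delta>" if "a \<in> \<sigma>" for a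
          proof -
            have "dist (c *\<^sub>R a) z \<le> c * \<epsilon> k + (r + 2 * c * \<epsilon> k) / 2"
              using dist_triangle3[of "c *\<^sub>R a" z "c *\<^sub>R p k a"] sc[OF bspec[OF elim(1) that]] z[OF that]
              by linarith
            moreover have "(r + 2 * c * \<epsilon> k) / 2 = r / 2 + c * \<epsilon> k" "2 * c * \<epsilon> k = c * \<epsilon> k + c * \<epsilon> k"
              by (simp_all add: field_simps)
            ultimately show ?thesis using elim(2) by linarith
          qed
          with n(1) show False by blast
        qed
        thus ?case using notin by simp
      qed
    qed
  next
    case ncech: False
    hence rips: "K = rips_complex" using K by blast
    show ?thesis
    proof (cases "\<sigma> \<in> scaled_simplices K c r")
      case True
      \<comment> \<open>Of the four terms, two account for the displacement of the end points and
        two for the decrease of the parameter.\<close>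
      have "eventually (\<lambda>k. \<forall>a\<in>\<sigma>. \<forall>b\<in>\<sigma>. 4 * c * \<epsilon> k < r - c * dist a b) sequentially"
      proof (intro eventually_ball_finite \<sigma> ballI)
        fix a b assume ab: "a \<in> \<sigma>" "b \<in> \<sigma>"
        have "(\<lambda>k. 4 * c * \<epsilon> k) \<longlonglongrightarrow> 4 * c * 0" by (intro tendsto_intros \<epsilon>)
        moreover have "4 * c * 0 < r - c * dist a b" using True ab c by (auto simp: rips rips_scaled_iff)
        ultimately show "eventually (\<lambda>k. 4 * c * \<epsilon> k < r - c * dist a b) sequentially" by (rule order_tendstoD)
      qed
      with pe show ?thesis
      proof eventually_elim
        case (elim k)
        have "c * dist (p k a) (p k b) < r - 2 * c * \<epsilon> k" if ab: "a \<in> \<sigma>" "b \<in> \<sigma>" for a b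
        proof -
          have "dist (p k a) (p k b) \<le> dist (p k a) a + dist a b + dist (p k b) b"
            using dist_triangle[of "p k a" "p k b" a] dist_triangle[of a "p k b" b] by (simp add: dist_commute)
          also have "\<dots> \<le> 2 * \<epsilon> k + dist a b"
            using bspec[OF elim(1) ab(1)] bspec[OF elim(1) ab(2)] by linarith
          finally have "c * dist (p k a) (p k b) \<le> c * (2 * \<epsilon> k + dist a b)" using c by (intro mult_left_mono) auto
          also have "\<dots> < r - 2 * c * \<epsilon> k" 
            using bspec[OF bspec[OF elim(2) ab(1)] ab(2)] by (simp add: algebra_simps)
          finally show ?thesis .
        qed
        thus ?case using True False c ncech by (auto simp: perturbed_def rips rips_scaled_iff)
      qed
    next
      case notin: False
      from pe show ?thesis
      proof eventually_elim
        case (elim k)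
        have "\<sigma> \<in> scaled_simplices K c r" if "p k ` \<sigma> \<in> perturbed K c r (\<epsilon> k)"
        proof -
          have "c * dist a b < r" if ab: "a \<in> \<sigma>" "b \<in> \<sigma>" for a b
          proof -
            have "c * dist (p k a) (p k b) < r - 2 * c * \<epsilon> k"
              using \<open>p k ` \<sigma> \<in> perturbed K c r (\<epsilon> k)\<close> ab c ncech by (auto simp: perturbed_def rips rips_scaled_iff)
            moreover have "dist a b \<le> dist (p k a) a + dist (p k a) (p k b) + dist (p k b) b"
              using dist_triangle[of a b "p k a"] dist_triangle[of "p k a" b "p k b"] by (simp add: dist_commute)
            hence "dist a b \<le> 2 * \<epsilon> k + dist (p k a) (p k b)" 
              using bspec[OF elim ab(1)] bspec[OF elim ab(2)] by linarith
            hence "c * dist a b \<le> c * (2 * \<epsilon> k + dist (p k a) (p k b))" using c by (intro mult_left_mono) auto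
            ultimately show ?thesis by (simp add: algebra_simps)
          qed
          thus ?thesis using False c by (auto simp: rips rips_scaled_iff)
        qed
        thus ?case using notin by blast
      qed
    qed
  qed
qed

section \<open>Well-separated blocks\<close>

definition cubebox :: "real ^ 'd \<Rightarrow> real \<Rightarrow> (real ^ 'd) set" where
  "cubebox l t = {x. \<forall>i. l $ i \<le> x $ i \<and> x $ i \<le> l $ i + t}"

lemma cubebox_cbox: "cubebox l t = cbox l (l + vec t)"
  by (auto simp: cubebox_def mem_box_cart)

lemma cubebox_borel[measurable, simp]: "cubebox l t \<in> sets borel"
  by (simp add: cubebox_cbox)

lemma emeasure_cubebox:
  assumes "0 \<le> t" shows "emeasure lborel (cubebox (l :: real ^ 'd) t) = ennreal (t ^ CARD('d))"
proof -
  have ne: "cbox l (l + vec t) \<noteq> {}" using assms by (auto simp: interval_ne_empty_cart)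
  have "measure lborel (cbox l (l + vec t)) = t ^ CARD('d)"
    using content_cbox_cart[OF ne] by simp
  thus ?thesis unfolding cubebox_cbox by (subst emeasure_eq_ennreal_measure) (auto simp: emeasure_lborel_cbox_eq)
qed

lemma component_dist_le: "\<bar>x $ i - y $ i\<bar> \<le> dist x y" for x y :: "real ^ 'd"
  using component_le_norm_cart[of "x - y" i] by (simp add: dist_norm)

lemma dist_le_components:
  fixes x y :: "real ^ 'd"
  assumes "\<And>i. \<bar>x $ i - y $ i\<bar> \<le> t" shows "dist x y \<le> real CARD('d) * t"
proof -
  have "dist x y \<le> (\<Sum>i\<in>UNIV. \<bar>(x - y) $ i\<bar>)" unfolding dist_norm by (rule norm_le_l1_cart)
  also have "\<dots> \<le> (\<Sum>i\<in>(UNIV::'d set). t)" using assms by (intro sum_mono) simp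
  finally show ?thesis by simp
qed

section \<open>Mass estimates for a bounded density\<close>

locale bounded_density =
  fixes q :: "real ^ 'd \<Rightarrow> real" and M :: real
  assumes q_meas[measurable]: "q \<in> borel_measurable borel"
    and q_nonneg: "0 \<le> q x" and q_le: "q x \<le> M" and M_ge: "1 \<le> M"
    and q_supp: "x \<notin> cbox 0 1 \<Longrightarrow> q x = 0"
    and q_prob: "prob_space (density lborel (\<lambda>x. ennreal (q x)))"
begin

definition Q :: "(real ^ 'd) measure" where "Q = density lborel (\<lambda>x. ennreal (q x))"

lemma prob_Q: "prob_space Q" using q_prob by (simp add: Q_def)

lemma sets_Q[measurable_cong, simp]: "sets Q = sets borel" by (simp add: Q_def)
lemma space_Q[simp]: "space Q = UNIV" by (simp add: Q_def)

lemma Q_le_volume: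
  assumes "A \<in> sets borel" "emeasure lborel A \<le> ennreal v" "0 \<le> v"
  shows "measure Q A \<le> M * v"
proof -
  interpret Q: prob_space Q by (rule prob_Q)
  have "emeasure Q A = (\<integral>\<^sup>+x. ennreal (q x) * indicator A x \<partial>lborel)"
    unfolding Q_def using assms by (subst emeasure_density) auto
  also have "\<dots> \<le> (\<integral>\<^sup>+x. ennreal M * indicator A x \<partial>lborel)"
    by (intro nn_integral_mono mult_right_mono) (auto simp: q_le ennreal_leI)
  also have "\<dots> = ennreal M * emeasure lborel A" using assms by (simp add: nn_integral_cmult_indicator)
  also have "\<dots> \<le> ennreal M * ennreal v" by (intro mult_left_mono assms) simp
  also have "\<dots> = ennreal (M * v)" using M_ge assms by (simp add: ennreal_mult)
  finally show ?thesis using M_ge assms by (simp add: Q.emeasure_eq_measure)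
qed

lemma Q_cubebox_le: "0 \<le> t \<Longrightarrow> measure Q (cubebox l t) \<le> M * t ^ CARD('d)"
  by (rule Q_le_volume) (auto simp: emeasure_cubebox)

lemma Q_outside: "measure Q (- cbox 0 1) = 0"
proof -
  have "emeasure Q (- cbox 0 1) = (\<integral>\<^sup>+x. ennreal (q x) * indicator (- cbox 0 1) x \<partial>lborel)"
    unfolding Q_def by (subst emeasure_density) auto
  also have "\<dots> = (\<integral>\<^sup>+x. 0 \<partial>(lborel :: (real ^ 'd) measure))"
    by (intro nn_integral_cong) (auto simp: indicator_def q_supp)
  finally show ?thesis by (simp add: measure_def)
qed

lemma Q_cball_le: "0 \<le> t \<Longrightarrow> measure Q (cball x t) \<le> M * (2 * t) ^ CARD('d)"
proof -
  assume t: "0 \<le> t"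
  interpret Q: prob_space Q by (rule prob_Q)
  have "y \<in> cubebox (x - vec t) (2 * t)" if "y \<in> cball x t" for y
    unfolding cubebox_def
  proof (safe)
    fix i
    have "\<bar>x $ i - y $ i\<bar> \<le> t" using component_dist_le[of x i y] that by simp
    thus "(x - vec t) $ i \<le> y $ i" "y $ i \<le> (x - vec t) $ i + 2 * t" by (auto simp: abs_le_iff)
  qed
  hence "measure Q (cball x t) \<le> measure Q (cubebox (x - vec t) (2 * t))"
    by (intro Q.finite_measure_mono) auto
  also have "\<dots> \<le> M * (2 * t) ^ CARD('d)" using t by (intro Q_cubebox_le) simp
  finally show ?thesis .
qed

text \<open>Pigeonhole: the \<open>k ^ CARD('d)\<close> closed subcubes cover the cube, so they
  cannot all have less than the average mass.\<close>

lemma heavy_subcube: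
  assumes t: "0 < t" and k: "0 < (k::nat)"
  shows "\<exists>l'. cubebox l' (t / real k) \<subseteq> cubebox l t \<and>
     measure Q (cubebox l t) / real k ^ CARD('d) \<le> measure Q (cubebox l' (t / real k))"
proof (rule ccontr)
  assume neg: "\<not> ?thesis"
  interpret Q: prob_space Q by (rule prob_Q)
  define W where "W = (UNIV :: 'd set) \<rightarrow>\<^sub>E {..<k}"
  define l' where "l' w = (\<chi> i. l $ i + real (w i) * (t / real k))" for w :: "'d \<Rightarrow> nat"
  have cW: "card W = k ^ CARD('d)" "finite W" unfolding W_def by (auto simp: card_PiE finite_PiE)
  have sub: "cubebox (l' w) (t / real k) \<subseteq> cubebox l t" if "w \<in> W" for w
  proof
    fix x assume x: "x \<in> cubebox (l' w) (t / real k)"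
    show "x \<in> cubebox l t" unfolding cubebox_def
    proof safe
      fix i
      have b: "l $ i + real (w i) * (t / real k) \<le> x $ i" "x $ i \<le> l $ i + real (w i) * (t / real k) + t / real k"
        using x by (auto simp: cubebox_def l'_def)
      have "0 \<le> real (w i) * (t / real k)" using t by simp
      with b(1) show "l $ i \<le> x $ i" by linarith
      have "w i < k" using that by (auto simp: W_def)
      hence "real (w i) + 1 \<le> real k" by linarith
      hence "(real (w i) + 1) * (t / real k) \<le> real k * (t / real k)" using t by (intro mult_right_mono) auto
      hence "real (w i) * (t / real k) + t / real k \<le> t" using k by (simp add: algebra_simps)
      with b(2) show "x $ i \<le> l $ i + t" by linarith
    qed
  qed
  have cover: "cubebox l t \<subseteq> (\<Union>w\<in>W. cubebox (l' w) (t / real k))"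
  proof
    fix x assume x: "x \<in> cubebox l t"
    \<comment> \<open>The minimum assigns points on an upper face to the last subcube.\<close>
    define w where "w i = min (k - 1) (nat \<lfloor>(x $ i - l $ i) * real k / t\<rfloor>)" for i
    have "x \<in> cubebox (l' w) (t / real k)" unfolding cubebox_def
    proof safe
      fix i
      define u where "u = (x $ i - l $ i) * real k / t"
      have xb: "0 \<le> x $ i - l $ i" "x $ i - l $ i \<le> t" using x by (auto simp: cubebox_def algebra_simps)
      have "(x $ i - l $ i) * real k \<le> t * real k" using xb by (intro mult_right_mono) auto
      hence u: "0 \<le> u" "u \<le> real k" using xb t by (simp_all add: u_def pos_divide_le_eq mult.commute)
      have xu: "x $ i = l $ i + u * (t / real k)" using t k by (simp add: u_def)
      have "real (w i) \<le> u" using u by (simp add: w_def u_def[symmetric] min_def) linarith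
      moreover have "u \<le> real (w i) + 1"
      proof (cases "k - 1 \<le> nat \<lfloor>u\<rfloor>")
        case True thus ?thesis using u k by (simp add: w_def u_def[symmetric])
      next
        case False
        hence "w i = nat \<lfloor>u\<rfloor>" by (simp add: w_def u_def[symmetric])
        thus ?thesis using u by simp
      qed
      ultimately have "real (w i) * (t / real k) \<le> u * (t / real k)" "u * (t / real k) \<le> (real (w i) + 1) * (t / real k)"
        using t by (intro mult_right_mono; simp)+
      thus "l' w $ i \<le> x $ i" "x $ i \<le> l' w $ i + t / real k" unfolding xu l'_def by (auto simp: algebra_simps)
    qed
    moreover have "w \<in> W" using k by (auto simp: W_def w_def)
    ultimately show "x \<in> (\<Union>w\<in>W. cubebox (l' w) (t / real k))" by blast
  qed
  have "measure Q (cubebox l t) \<le> measure Q (\<Union>w\<in>W. cubebox (l' w) (t / real k))"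
    by (intro Q.finite_measure_mono cover) (use cW in auto)
  also have "\<dots> \<le> (\<Sum>w\<in>W. measure Q (cubebox (l' w) (t / real k)))"
    by (intro Q.finite_measure_subadditive_finite) (use cW in auto)
  also have "\<dots> < (\<Sum>w\<in>W. measure Q (cubebox l t) / real k ^ CARD('d))"
  proof (rule sum_strict_mono)
    show "W \<noteq> {}" using k by (auto simp: W_def PiE_eq_empty_iff)
  qed (use cW neg sub in force)+
  also have "\<dots> = measure Q (cubebox l t)" using cW k by simp
  finally show False by simp
qed

text \<open>Given one point in \<open>a\<close> and no further points in \<open>N\<close>, a second point spans an edge with the first
  if it lies in \<open>a\<close> and is isolated from it if it lies in \<open>b\<close>.\<close>

definition good_block :: "real \<Rightarrow> real \<Rightarrow> real \<Rightarrow> (real ^ 'd) set \<Rightarrow> (real ^ 'd) set \<Rightarrow> (real ^ 'd) set \<Rightarrow> bool" where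
  "good_block \<delta> n \<rho> a b N \<longleftrightarrow> a \<in> sets borel \<and> b \<in> sets borel \<and> N \<in> sets borel \<and> a \<subseteq> N \<and> b \<subseteq> N \<and> N \<subseteq> cbox 0 1 \<and>
     \<delta> / n \<le> measure Q a \<and> \<delta> / n \<le> measure Q b \<and> measure Q N \<le> 1 / (\<delta> * n) \<and>
     (\<forall>x\<in>a. \<forall>y\<in>a. dist x y < \<rho>) \<and> (\<forall>x\<in>a. \<forall>y\<in>b. \<rho> < dist x y) \<and>
     (\<forall>x\<in>a \<union> b. \<forall>y. y \<notin> N \<longrightarrow> \<rho> < dist x y)"

lemma power_mult_le_one_minus: "0 \<le> x \<Longrightarrow> x \<le> 1 \<Longrightarrow> 1 - real k * x \<le> (1 - x) ^ k" for x :: real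
  using Bernoulli_inequality[of "- x" k] by simp

text \<open>Here \<open>s\<close> stands for \<open>n powr (1 / d)\<close>, while
  \<open>\<Lambda>\<close>, \<open>k\<close> and \<open>\<delta>\<close> do not depend on it. The
  first condition on \<open>\<Lambda>\<close> makes the mass lost in the margins of a grid of side
  about \<open>\<Lambda> / s\<close> small, the second makes a ball of radius
  \<open>2 * \<rho>\<close> light compared with a grid cube, and \<open>k\<close> is so large that a
  subcube has diameter below \<open>\<rho>\<close>.\<close>

lemma good_blocks_at:
  fixes r s \<Lambda> :: real and k :: nat
  assumes r: "0 < r" and \<Lambda>1: "24 * M * real CARD('d) * r \<le> \<Lambda>" and \<Lambda>2: "4 * r * (4 * M + 1) \<le> \<Lambda>"
    and s: "\<Lambda> \<le> s" and k: "2 * real CARD('d) * \<Lambda> / r < real k"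
    and \<delta>: "0 < \<delta>" "\<delta> \<le> \<Lambda> ^ CARD('d) / (2 * real k ^ CARD('d))" "\<delta> \<le> \<Lambda> ^ CARD('d) / 4"
      "\<delta> \<le> 1 / (M * (2 * \<Lambda>) ^ CARD('d))"
  shows "\<exists>Z a b N. finite (Z :: ('d \<Rightarrow> nat) set) \<and> s ^ CARD('d) / ((2 * \<Lambda>) ^ CARD('d) * (4 * M)) \<le> real (card Z) \<and>
     (\<forall>z\<in>Z. good_block \<delta> (s ^ CARD('d)) (r / s) (a z) (b z) (N z)) \<and> disjoint_family_on N Z"
proof -
  interpret Q: prob_space Q by (rule prob_Q)
  define d where "d = CARD('d)"
  have d1: "1 \<le> real d" unfolding d_def using zero_less_card_finite[where 'a='d] by linarith
  define \<rho> where "\<rho> = r / s"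
  have \<Lambda>0: "0 < \<Lambda>" 
  proof -
    have "0 < 4 * r * (4 * M + 1)" using r M_ge by (intro mult_pos_pos) auto
    with \<Lambda>2 show ?thesis by linarith
  qed
  have s0: "0 < s" using s \<Lambda>0 by linarith
  have \<rho>0: "0 < \<rho>" using r s0 by (simp add: \<rho>_def)
  \<comment> \<open>The number of grid cubes per side. Rounding loses at most a factor 2, so that
    the side \<open>L = 1 / p\<close> lies between \<open>\<Lambda> / s\<close> and
    \<open>2 * \<Lambda> / s\<close>.\<close>
  define p where "p = nat \<lfloor>s / \<Lambda>\<rfloor>"
  have s\<Lambda>: "1 \<le> s / \<Lambda>" using s \<Lambda>0 by simp
  have p1: "1 \<le> p" using s\<Lambda> unfolding p_def by (simp add: le_nat_iff le_floor_iff)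
  have p_le: "real p \<le> s / \<Lambda>" using s\<Lambda> by (simp add: p_def)
  have p_ge: "s / (2 * \<Lambda>) \<le> real p"
  proof -
    have "s / \<Lambda> < real p + 1" using s\<Lambda> unfolding p_def by linarith
    also have "\<dots> \<le> 2 * real p" using p1 by linarith
    finally show ?thesis using \<Lambda>0 by (simp add: field_simps)
  qed
  have p0: "0 < real p" using p1 by simp
  define L where "L = 1 / real p"
  have L0: "0 < L" using p0 by (simp add: L_def)
  have L_ge: "\<Lambda> / s \<le> L" using p_le p0 s0 \<Lambda>0 by (simp add: L_def field_simps)
  have L_le: "L \<le> 2 * \<Lambda> / s" using p_ge p0 s0 \<Lambda>0 by (simp add: L_def field_simps)
  have \<rho>p: "\<rho> * real p \<le> r / \<Lambda>"
  proof -
    have "\<rho> * real p \<le> \<rho> * (s / \<Lambda>)" using p_le \<rho>0 by (intro mult_left_mono) auto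
    thus ?thesis using s0 by (simp add: \<rho>_def)
  qed
  have r\<Lambda>: "6 * real d * (r / \<Lambda>) \<le> 1 / (4 * M)"
  proof -
    have "6 * real d * r * (4 * M) \<le> \<Lambda>" using \<Lambda>1 by (simp add: d_def mult_ac)
    thus ?thesis using \<Lambda>0 M_ge by (simp add: field_simps)
  qed
  have M4: "1 / (4 * M) \<le> 1 / 4" using M_ge by (simp add: field_simps)
  have \<rho>p6: "6 * \<rho> * real p \<le> 1 / 4"
  proof -
    have "6 * (\<rho> * real p) \<le> 6 * (r / \<Lambda>)" using \<rho>p by simp
    also have "\<dots> \<le> 6 * real d * (r / \<Lambda>)" using d1 r \<Lambda>0 by (intro mult_right_mono) auto
    also have "\<dots> \<le> 1 / 4" using r\<Lambda> M4 by linarith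
    finally show ?thesis by simp
  qed
  have L6: "6 * \<rho> < L"
  proof -
    have "6 * \<rho> * real p < L * real p" using \<rho>p6 p0 by (simp add: L_def)
    thus ?thesis using p0 by simp
  qed
  define Z0 where "Z0 = (UNIV :: 'd set) \<rightarrow>\<^sub>E {..<p}"
  have Z0: "finite Z0" "card Z0 = p ^ d" unfolding Z0_def by (auto simp: card_PiE finite_PiE d_def)
  define l where "l z = (\<chi> i. real (z i) * L)" for z :: "'d \<Rightarrow> nat"
  \<comment> \<open>The margins \<open>3 * \<rho>\<close> of the core and \<open>\<rho>\<close> of
    \<open>N\<close> leave a gap of \<open>2 * \<rho>\<close>, so points of the core are farther
    than \<open>\<rho>\<close> from everything outside \<open>N\<close>.\<close>
  define core where "core z = cubebox (l z + vec (3 * \<rho>)) (L - 6 * \<rho>)" for z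
  define N where "N z = cubebox (l z + vec \<rho>) (L - 2 * \<rho>)" for z
  have Ni: "real (z i) * L + \<rho> \<le> x $ i \<and> x $ i \<le> real (z i) * L + L - \<rho>" if "x \<in> N z" for x z i
    using that by (auto simp: N_def cubebox_def l_def algebra_simps dest: spec[of _ i])
  have corei: "real (z i) * L + 3 * \<rho> \<le> x $ i \<and> x $ i \<le> real (z i) * L + L - 3 * \<rho>" if "x \<in> core z" for x z i
    using that by (auto simp: core_def cubebox_def l_def algebra_simps dest: spec[of _ i])
  have coreN: "core z \<subseteq> N z" for z
  proof
    fix x assume "x \<in> core z"
    from corei[OF this] show "x \<in> N z" unfolding N_def cubebox_def l_def using \<rho>0 by (auto simp: algebra_simps) (smt (verit))+
  qed
  have Ndisj: "disjoint_family_on N Z0"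
    unfolding disjoint_family_on_def
  proof (intro ballI impI)
    fix z z' assume zz: "z \<in> Z0" "z' \<in> Z0" "z \<noteq> z'"
    have apart: False if "x \<in> N u" "x \<in> N v" "u i < v i" for x u v i
    proof -
      have "real (u i) + 1 \<le> real (v i)" using that(3) by linarith
      hence "(real (u i) + 1) * L \<le> real (v i) * L" using L0 by (intro mult_right_mono) auto
      thus False using Ni[OF that(1), of i] Ni[OF that(2), of i] \<rho>0 by (simp add: algebra_simps)
    qed
    obtain i where "z i \<noteq> z' i" using zz(3) by auto
    thus "N z \<inter> N z' = {}" using apart[of _ z z' i] apart[of _ z' z i] by (cases "z i < z' i") auto
  qed
  have Ncube: "N z \<subseteq> cbox 0 1" if "z \<in> Z0" for z
  proof
    fix x assume x: "x \<in> N z"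
    show "x \<in> cbox 0 1" unfolding mem_box_cart
    proof
      fix i
      have "z i < p" using that by (auto simp: Z0_def)
      hence "real (z i) + 1 \<le> real p" by linarith
      hence "(real (z i) + 1) * L \<le> real p * L" using L0 by (intro mult_right_mono) auto
      moreover have "real p * L = 1" using p0 by (simp add: L_def)
      moreover have "0 \<le> real (z i) * L" using L0 by simp
      moreover have "(real (z i) + 1) * L = real (z i) * L + L" by (simp add: algebra_simps)
      ultimately show "(0 :: real ^ 'd) $ i \<le> x $ i \<and> x $ i \<le> (1 :: real ^ 'd) $ i"
        using Ni[OF x, of i] \<rho>0 unfolding zero_index one_index by linarith
    qed
  qed
  \<comment> \<open>The margins have volume at most \<open>1 / (4 * M)\<close>, hence mass at most
    1/4.\<close>
  have core_sum: "3 / 4 \<le> (\<Sum>z\<in>Z0. measure Q (core z))"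
  proof -
    define U where "U = (\<Union>z\<in>Z0. core z)"
    have Um: "U \<in> sets borel" unfolding U_def core_def using Z0 by (intro sets.finite_UN) auto
    have "emeasure lborel U = (\<Sum>z\<in>Z0. emeasure lborel (core z))"
      unfolding U_def
    proof (rule sum_emeasure[symmetric])
      show "disjoint_family_on core Z0" using Ndisj coreN unfolding disjoint_family_on_def by blast
    qed (use Z0 in \<open>auto simp: core_def\<close>)
    also have "\<dots> = (\<Sum>z\<in>Z0. ennreal ((L - 6 * \<rho>) ^ d))"
      unfolding core_def d_def using L6 by (simp add: emeasure_cubebox)
    also have "\<dots> = ennreal (real (card Z0) * (L - 6 * \<rho>) ^ d)"
      using L6 by (simp add: ennreal_of_nat_eq_real_of_nat ennreal_mult)
    also have "real (card Z0) * (L - 6 * \<rho>) ^ d = (1 - 6 * \<rho> * real p) ^ d"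
      using p0 by (simp add: Z0 L_def algebra_simps flip: power_mult_distrib)
    finally have eU: "emeasure lborel U = ennreal ((1 - 6 * \<rho> * real p) ^ d)" .
    have Usub: "U \<subseteq> cbox 0 1" unfolding U_def using coreN Ncube by blast
    have lo: "1 - 1 / (4 * M) \<le> (1 - 6 * \<rho> * real p) ^ d"
    proof -
      have "1 - 1 / (4 * M) \<le> 1 - real d * (6 * \<rho> * real p)"
        using order_trans[OF mult_left_mono[OF \<rho>p, of "6 * real d"] r\<Lambda>] by (simp add: mult_ac)
      also have "\<dots> \<le> (1 - 6 * \<rho> * real p) ^ d"
        using \<rho>p6 \<rho>0 by (intro power_mult_le_one_minus) auto
      finally show ?thesis .
    qed
    have "cbox (0 :: real ^ 'd) 1 = cubebox 0 1" by (auto simp: cubebox_def mem_box_cart)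
    hence e1: "emeasure lborel (cbox (0 :: real ^ 'd) 1) = 1" using emeasure_cubebox[of 1 "0 :: real ^ 'd"] by simp
    have pw: "0 \<le> (1 - 6 * \<rho> * real p) ^ d" using \<rho>p6 by simp
    have "emeasure lborel (cbox 0 1 - U) = 1 - ennreal ((1 - 6 * \<rho> * real p) ^ d)"
      using Um Usub by (subst emeasure_Diff) (auto simp: eU e1)
    also have "\<dots> = ennreal (1 - (1 - 6 * \<rho> * real p) ^ d)"
      using pw by (simp add: ennreal_minus flip: ennreal_1)
    also have "\<dots> \<le> ennreal (1 / (4 * M))" using lo by (intro ennreal_leI) linarith
    finally have "measure Q (cbox 0 1 - U) \<le> M * (1 / (4 * M))"
      using M_ge Um by (intro Q_le_volume) auto
    hence A: "measure Q (cbox 0 1 - U) \<le> 1 / 4" using M_ge by simp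
    have "- U = (cbox 0 1 - U) \<union> (- cbox 0 1)" using Usub by auto
    hence "measure Q (- U) \<le> measure Q (cbox 0 1 - U) + measure Q (- cbox 0 1)"
      using Um by (auto intro!: measure_Un_le)
    also have "\<dots> \<le> 1 / 4" using A by (simp add: Q_outside)
    finally have "measure Q (- U) \<le> 1 / 4" .
    moreover have "measure Q (- U) = 1 - measure Q U"
      using Q.prob_compl[of U] Um by (simp add: Compl_eq_Diff_UNIV)
    moreover have "measure Q U \<le> (\<Sum>z\<in>Z0. measure Q (core z))"
      unfolding U_def by (intro Q.finite_measure_subadditive_finite) (use Z0 in \<open>auto simp: core_def\<close>)
    ultimately show ?thesis by linarith
  qed
  define v where "v = L ^ d"
  have v0: "0 < v" using L0 by (simp add: v_def)
  have pv: "real (p ^ d) * v = 1" using p0 by (simp add: v_def L_def power_one_over)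
  define Z where "Z = {z \<in> Z0. v / 2 \<le> measure Q (core z)}"
  have fZ: "finite Z" using Z0 by (simp add: Z_def)
  have core_le: "measure Q (core z) \<le> M * v" for z
  proof -
    have "measure Q (core z) \<le> M * (L - 6 * \<rho>) ^ d" unfolding core_def d_def using L6 by (intro Q_cubebox_le) simp
    also have "\<dots> \<le> M * v" unfolding v_def using L6 \<rho>0 M_ge by (intro mult_left_mono power_mono) auto
    finally show ?thesis .
  qed
  \<comment> \<open>Cores outside \<open>Z\<close> carry at most half of the unit mass, since the
    grid cubes have total volume 1. The remaining quarter is spread over \<open>Z\<close>, where
    each core has mass at most \<open>M * v\<close>.\<close>
  have cardZ: "real (p ^ d) / (4 * M) \<le> real (card Z)"
  proof -
    have "(\<Sum>z\<in>Z0. measure Q (core z)) = (\<Sum>z\<in>Z. measure Q (core z)) + (\<Sum>z\<in>Z0 - Z. measure Q (core z))"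
      using Z0 by (subst sum.subset_diff[of Z Z0]) (auto simp: Z_def)
    also have "(\<Sum>z\<in>Z. measure Q (core z)) \<le> real (card Z) * (M * v)"
      by (rule sum_bounded_above) (rule core_le)
    also have "(\<Sum>z\<in>Z0 - Z. measure Q (core z)) \<le> real (card (Z0 - Z)) * (v / 2)"
      by (rule sum_bounded_above) (auto simp: Z_def)
    also have "\<dots> \<le> real (p ^ d) * (v / 2)"
      using v0 Z0 by (intro mult_right_mono) (auto simp flip: Z0(2) intro!: card_mono)
    also have "\<dots> = 1 / 2" using pv by simp
    finally have "1 / 4 \<le> real (card Z) * (M * v)" using core_sum by linarith
    hence "1 / 4 * real (p ^ d) \<le> real (card Z) * (M * v) * real (p ^ d)" by (intro mult_right_mono) auto
    also have "\<dots> = real (card Z) * M * (real (p ^ d) * v)" by simp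
    finally have "1 / 4 * real (p ^ d) \<le> real (card Z) * M" unfolding pv by simp
    thus ?thesis using M_ge by (simp add: field_simps)
  qed
  have "0 \<le> 2 * real CARD('d) * \<Lambda> / r" using \<Lambda>0 r by simp
  hence k0: "0 < k" using k by linarith
  have vs: "(\<Lambda> / s) ^ d \<le> v" unfolding v_def using L_ge \<Lambda>0 s0 by (intro power_mono) auto
  define t where "t = L - 6 * \<rho>"
  have t0: "0 < t" using L6 by (simp add: t_def)
  have "\<exists>l'. cubebox l' (t / real k) \<subseteq> core z \<and> measure Q (core z) / real k ^ d \<le> measure Q (cubebox l' (t / real k))" for z
    unfolding core_def d_def t_def[symmetric] by (rule heavy_subcube[OF t0 k0])
  then obtain l' where l': "\<And>z. cubebox (l' z) (t / real k) \<subseteq> core z"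
    "\<And>z. measure Q (core z) / real k ^ d \<le> measure Q (cubebox (l' z) (t / real k))" by metis
  define a where "a z = cubebox (l' z) (t / real k)" for z
  \<comment> \<open>The subcube contains the corner \<open>l' z\<close> and has diameter below
    \<open>\<rho>\<close>, so removing the ball of radius \<open>2 * \<rho>\<close> keeps
    \<open>b z\<close> farther than \<open>\<rho>\<close> from all of \<open>a z\<close>.\<close>
  define b where "b z = core z - cball (l' z) (2 * \<rho>)" for z
  have tk: "real d * (t / real k) < \<rho>"
  proof -
    have "real d * t \<le> real d * (2 * \<Lambda> / s)" using L_le \<rho>0 d1 by (intro mult_left_mono) (auto simp: t_def)
    also have "\<dots> = (2 * real d * \<Lambda> / r) * \<rho>" using r by (simp add: \<rho>_def)
    also have "\<dots> < real k * \<rho>" using k \<rho>0 unfolding d_def by (intro mult_strict_right_mono)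
    finally show ?thesis using k0 by (simp add: field_simps)
  qed
  have adist: "dist x y < \<rho>" if "x \<in> cubebox (l' z) (t / real k)" "y \<in> cubebox (l' z) (t / real k)" for x y z
  proof -
    have "\<bar>x $ i - y $ i\<bar> \<le> t / real k" for i
      using that unfolding cubebox_def by (smt (verit) mem_Collect_eq)
    from dist_le_components[OF this] tk show ?thesis unfolding d_def by linarith
  qed
  have corner: "l' z \<in> cubebox (l' z) (t / real k)" for z using t0 by (simp add: cubebox_def)
  have good: "good_block \<delta> (s ^ d) \<rho> (a z) (b z) (N z)" if z: "z \<in> Z" for z
  proof -
    have cz: "v / 2 \<le> measure Q (core z)" and z0: "z \<in> Z0" using z by (auto simp: Z_def)
    have sd: "0 < s ^ d" using s0 by simp
    have aQ: "\<delta> / s ^ d \<le> measure Q (a z)"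
    proof -
      have "\<delta> / s ^ d \<le> (\<Lambda> ^ d / (2 * real k ^ d)) / s ^ d" using \<delta>(2) sd unfolding d_def by (intro divide_right_mono) auto
      also have "\<dots> = (\<Lambda> / s) ^ d / 2 / real k ^ d" by (simp add: power_divide)
      also have "\<dots> \<le> measure Q (core z) / real k ^ d" using vs cz by (intro divide_right_mono) auto
      also have "\<dots> \<le> measure Q (a z)" unfolding a_def by (rule l')
      finally show ?thesis .
    qed
    have bQ: "\<delta> / s ^ d \<le> measure Q (b z)"
    proof -
      have "measure Q (cball (l' z) (2 * \<rho>)) \<le> M * (2 * (2 * \<rho>)) ^ d" unfolding d_def using \<rho>0 by (intro Q_cball_le) simp
      also have "\<dots> = M * (4 * r) ^ d / s ^ d" by (simp add: \<rho>_def power_divide)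
      also have "\<dots> \<le> (\<Lambda> ^ d / 4) / s ^ d"
      proof (intro divide_right_mono)
        \<comment> \<open>The factor \<open>4 * M\<close> is absorbed into a d-th power, which
          allows a condition on \<open>\<Lambda>\<close> that is linear in \<open>M\<close>.\<close>
        have "M * 4 \<le> (4 * M + 1) ^ d"
          using self_le_power[of "4 * M + 1" d] M_ge d1 by simp
        hence "M * 4 * (4 * r) ^ d \<le> (4 * M + 1) ^ d * (4 * r) ^ d" using r by (intro mult_right_mono) auto
        also have "\<dots> = (4 * r * (4 * M + 1)) ^ d" by (simp add: power_mult_distrib)
        also have "\<dots> \<le> \<Lambda> ^ d" using \<Lambda>2 r M_ge by (intro power_mono) auto
        finally show "M * (4 * r) ^ d \<le> \<Lambda> ^ d / 4" by simp
      qed (use sd in auto)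
      also have "\<dots> = (\<Lambda> / s) ^ d / 4" by (simp add: power_divide)
      also have "\<dots> \<le> v / 4" using vs by simp
      finally have c: "measure Q (cball (l' z) (2 * \<rho>)) \<le> v / 4" .
      have "measure Q (core z) \<le> measure Q (b z \<union> cball (l' z) (2 * \<rho>))"
        by (intro Q.finite_measure_mono) (auto simp: b_def core_def)
      also have "\<dots> \<le> measure Q (b z) + measure Q (cball (l' z) (2 * \<rho>))"
        by (intro measure_Un_le) (auto simp: b_def core_def)
      finally have "v / 4 \<le> measure Q (b z)" using c cz by linarith
      moreover have "\<delta> / s ^ d \<le> (\<Lambda> ^ d / 4) / s ^ d" using \<delta>(3) sd unfolding d_def by (intro divide_right_mono) auto
      moreover have "(\<Lambda> ^ d / 4) / s ^ d = (\<Lambda> / s) ^ d / 4" by (simp add: power_divide)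
      ultimately show ?thesis using vs by linarith
    qed
    have NQ: "measure Q (N z) \<le> 1 / (\<delta> * s ^ d)"
    proof -
      have "measure Q (N z) \<le> M * (L - 2 * \<rho>) ^ d" unfolding N_def d_def using L6 \<rho>0 by (intro Q_cubebox_le) simp
      also have "\<dots> \<le> M * (2 * \<Lambda> / s) ^ d" using L_le L6 \<rho>0 M_ge by (intro mult_left_mono power_mono) auto
      also have "\<dots> = (M * (2 * \<Lambda>) ^ d) / s ^ d" by (simp add: power_divide)
      also have "\<dots> \<le> (1 / \<delta>) / s ^ d"
      proof (intro divide_right_mono)
        have "0 < M * (2 * \<Lambda>) ^ d" using M_ge \<Lambda>0 by simp
        thus "M * (2 * \<Lambda>) ^ d \<le> 1 / \<delta>" using \<delta>(1,4) unfolding d_def by (simp add: field_simps)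
      qed (use sd in auto)
      finally show ?thesis by simp
    qed
    have ab: "a z \<subseteq> core z" "b z \<subseteq> core z" using l'(1) by (auto simp: a_def b_def)
    have out: "\<rho> < dist x y" if xy: "x \<in> core z" "y \<notin> N z" for x y
    proof -
      obtain i where i: "\<not> (real (z i) * L + \<rho> \<le> y $ i \<and> y $ i \<le> real (z i) * L + L - \<rho>)"
        using xy(2) unfolding N_def cubebox_def l_def by (auto simp: algebra_simps)
      from i corei[OF xy(1), of i] \<rho>0 have "\<rho> < \<bar>x $ i - y $ i\<bar>" by linarith
      also have "\<dots> \<le> dist x y" by (rule component_dist_le)
      finally show ?thesis .
    qed
    have sep: "\<rho> < dist x y" if "x \<in> a z" "y \<in> b z" for x y
    proof -
      have "dist (l' z) x < \<rho>" using adist[OF corner] that(1) by (simp add: a_def)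
      moreover have "2 * \<rho> < dist (l' z) y" using that(2) by (simp add: b_def)
      ultimately show ?thesis using dist_triangle[of "l' z" y x] by linarith
    qed
    show ?thesis unfolding good_block_def
      using aQ bQ NQ ab coreN[of z] Ncube[OF z0] out sep adist
      by (auto simp: a_def b_def core_def N_def)
  qed
  have "disjoint_family_on N Z" using Ndisj unfolding Z_def disjoint_family_on_def by blast
  moreover have "s ^ d / ((2 * \<Lambda>) ^ d * (4 * M)) \<le> real (card Z)"
  proof -
    have "(s / (2 * \<Lambda>)) ^ d \<le> real p ^ d" using p_ge s0 \<Lambda>0 by (intro power_mono) auto
    hence "(s / (2 * \<Lambda>)) ^ d / (4 * M) \<le> real (p ^ d) / (4 * M)" using M_ge by (intro divide_right_mono) auto
    also have "\<dots> \<le> real (card Z)" by (rule cardZ)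
    finally show ?thesis by (simp add: power_divide)
  qed
  ultimately show ?thesis using fZ good unfolding d_def \<rho>_def by blast
qed

text \<open>It remains to fix the constants independently of \<open>n\<close>:
  \<open>\<delta>\<close> is the least of the three bounds demanded above, and \<open>n0\<close>
  makes \<open>n powr (1 / d)\<close> at least \<open>\<Lambda>\<close>.\<close>

lemma good_blocks:
  assumes r: "0 < r"
  shows "\<exists>\<delta>>0. \<exists>\<kappa>>0. \<exists>n0. \<forall>n\<ge>n0. \<exists>Z a b N. finite (Z :: ('d \<Rightarrow> nat) set) \<and> \<kappa> * real n \<le> real (card Z) \<and>
     (\<forall>z\<in>Z. good_block \<delta> (real n) (r / real n powr (1 / real CARD('d))) (a z) (b z) (N z)) \<and> disjoint_family_on N Z"
proof -
  let ?d = "CARD('d)"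
  define \<Lambda> where "\<Lambda> = 24 * M * real ?d * r + 4 * r * (4 * M + 1)"
  have \<Lambda>: "24 * M * real ?d * r \<le> \<Lambda>" "4 * r * (4 * M + 1) \<le> \<Lambda>" using r M_ge by (auto simp: \<Lambda>_def)
  have \<Lambda>0: "0 < \<Lambda>" using r M_ge by (auto simp: \<Lambda>_def intro!: add_nonneg_pos)
  define k where "k = nat \<lceil>2 * real ?d * \<Lambda> / r\<rceil> + 1"
  have k: "2 * real ?d * \<Lambda> / r < real k" unfolding k_def by linarith
  define \<delta> where "\<delta> = min (\<Lambda> ^ ?d / (2 * real k ^ ?d)) (min (\<Lambda> ^ ?d / 4) (1 / (M * (2 * \<Lambda>) ^ ?d)))"
  have \<delta>: "0 < \<delta>" using \<Lambda>0 M_ge by (auto simp: \<delta>_def k_def)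
  define \<kappa> where "\<kappa> = 1 / ((2 * \<Lambda>) ^ ?d * (4 * M))"
  have \<kappa>: "0 < \<kappa>" using \<Lambda>0 M_ge by (simp add: \<kappa>_def)
  define n0 where "n0 = Suc (nat \<lceil>\<Lambda> ^ ?d\<rceil>)"
  have main: "\<exists>Z a b N. finite (Z :: ('d \<Rightarrow> nat) set) \<and> \<kappa> * real n \<le> real (card Z) \<and>
     (\<forall>z\<in>Z. good_block \<delta> (real n) (r / real n powr (1 / real ?d)) (a z) (b z) (N z)) \<and> disjoint_family_on N Z"
    if n: "n0 \<le> n" for n
  proof -
    define s where "s = real n powr (1 / real ?d)"
    have n1: "0 < real n" "\<Lambda> ^ ?d \<le> real n" using n unfolding n0_def by linarith+
    have sd: "s ^ ?d = real n" using n1 by (simp add: s_def powr_powr flip: powr_realpow)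
    have "\<Lambda> \<le> s"
    proof (rule ccontr)
      assume "\<not> \<Lambda> \<le> s"
      hence "s ^ ?d < \<Lambda> ^ ?d" by (intro power_strict_mono) (auto simp: s_def)
      thus False using sd n1 by simp
    qed
    from good_blocks_at[OF r \<Lambda> this k \<delta>] show ?thesis unfolding sd \<kappa>_def s_def[symmetric] by (simp add: \<delta>_def)
  qed
  thus ?thesis using \<delta> \<kappa> by blast
qed

end

section \<open>The binomial process\<close>

text \<open>Bessel's inequality for an orthogonal family whose squared norms are only bounded above:
  expand the second moment of \<open>f - \<mu> - t * G\<close>, where \<open>G\<close> is the sum of
  the family.\<close>

lemma variance_ge_orthogonal:
  fixes f :: "'a \<Rightarrow> real" and g :: "'z \<Rightarrow> 'a \<Rightarrow> real"
  assumes P: "prob_space P" and Z: "finite Z"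
    and f: "integrable P f" "integrable P (\<lambda>x. (f x)\<^sup>2)"
    and fg: "\<And>z. z \<in> Z \<Longrightarrow> integrable P (\<lambda>x. f x * g z x)"
    and g: "\<And>z. z \<in> Z \<Longrightarrow> integrable P (g z)" "\<And>z w. z \<in> Z \<Longrightarrow> w \<in> Z \<Longrightarrow> integrable P (\<lambda>x. g z x * g w x)"
    and mean: "\<And>z. z \<in> Z \<Longrightarrow> (\<integral>x. g z x \<partial>P) = 0"
    and orth: "\<And>z w. z \<in> Z \<Longrightarrow> w \<in> Z \<Longrightarrow> z \<noteq> w \<Longrightarrow> (\<integral>x. g z x * g w x \<partial>P) = 0"
    and lo: "\<And>z. z \<in> Z \<Longrightarrow> c \<le> (\<integral>x. f x * g z x \<partial>P)" and up: "\<And>z. z \<in> Z \<Longrightarrow> (\<integral>x. (g z x)\<^sup>2 \<partial>P) \<le> B"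
    and B: "0 < B" and c: "0 \<le> c"
  shows "real (card Z) * (c\<^sup>2 / B) \<le> (\<integral>x. (f x - (\<integral>x. f x \<partial>P))\<^sup>2 \<partial>P)"
proof -
  interpret P: prob_space P by fact
  define \<mu> where "\<mu> = (\<integral>x. f x \<partial>P)"
  \<comment> \<open>The minimiser of \<open>t\<^sup>2 * B - 2 * t * c\<close>.\<close>
  define t where "t = c / B"
  have t0: "0 \<le> t" using B c by (simp add: t_def)
  define G where "G x = (\<Sum>z\<in>Z. g z x)" for x
  have iG: "integrable P G" unfolding G_def by (intro Bochner_Integration.integrable_sum g)
  have ifG: "integrable P (\<lambda>x. f x * G x)" unfolding G_def sum_distrib_left by (intro Bochner_Integration.integrable_sum fg)
  have G2: "(G x)\<^sup>2 = (\<Sum>z\<in>Z. \<Sum>w\<in>Z. g z x * g w x)" for x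
    unfolding G_def power2_eq_square sum_product ..
  have iG2: "integrable P (\<lambda>x. (G x)\<^sup>2)" unfolding G2 by (intro Bochner_Integration.integrable_sum g)
  have EG: "(\<integral>x. G x \<partial>P) = 0" unfolding G_def using g mean by (subst Bochner_Integration.integral_sum) auto
  have EfG: "real (card Z) * c \<le> (\<integral>x. f x * G x \<partial>P)"
  proof -
    have "(\<integral>x. f x * G x \<partial>P) = (\<Sum>z\<in>Z. \<integral>x. f x * g z x \<partial>P)"
      unfolding G_def sum_distrib_left using fg by (subst Bochner_Integration.integral_sum) auto
    also have "\<dots> \<ge> (\<Sum>z\<in>Z. c)" by (intro sum_mono lo)
    finally show ?thesis by simp
  qed
  have EG2: "(\<integral>x. (G x)\<^sup>2 \<partial>P) \<le> real (card Z) * B"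
  proof -
    have "(\<integral>x. (G x)\<^sup>2 \<partial>P) = (\<Sum>z\<in>Z. \<Sum>w\<in>Z. \<integral>x. g z x * g w x \<partial>P)"
      unfolding G2 using g by (subst Bochner_Integration.integral_sum) (auto intro!: sum.cong Bochner_Integration.integral_sum)
    also have "\<dots> = (\<Sum>z\<in>Z. \<Sum>w\<in>Z. if w = z then (\<integral>x. (g z x)\<^sup>2 \<partial>P) else 0)"
      by (intro sum.cong refl) (auto simp: power2_eq_square orth)
    also have "\<dots> = (\<Sum>z\<in>Z. \<integral>x. (g z x)\<^sup>2 \<partial>P)" using Z by (simp add: sum.delta)
    also have "\<dots> \<le> (\<Sum>z\<in>Z. B)" by (intro sum_mono up)
    finally show ?thesis by simp
  qed
  have if2: "integrable P (\<lambda>x. (f x - \<mu>)\<^sup>2)" using f by (simp add: power2_diff)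
  have "0 \<le> (\<integral>x. (f x - \<mu> - t * G x)\<^sup>2 \<partial>P)" by simp
  also have "\<dots> = (\<integral>x. (f x - \<mu>)\<^sup>2 - 2 * t * (f x * G x) + 2 * t * \<mu> * G x + t\<^sup>2 * (G x)\<^sup>2 \<partial>P)"
    by (intro Bochner_Integration.integral_cong refl) (simp add: power2_eq_square algebra_simps)
  also have "\<dots> = (\<integral>x. (f x - \<mu>)\<^sup>2 \<partial>P) - 2 * t * (\<integral>x. f x * G x \<partial>P) + t\<^sup>2 * (\<integral>x. (G x)\<^sup>2 \<partial>P)"
    using if2 iG ifG iG2 by (simp add: EG)
  also have "\<dots> \<le> (\<integral>x. (f x - \<mu>)\<^sup>2 \<partial>P) - 2 * t * (real (card Z) * c) + t\<^sup>2 * (real (card Z) * B)"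
    using EfG EG2 t0 by (intro add_mono diff_mono mult_left_mono) auto
  also have "\<dots> = (\<integral>x. (f x - \<mu>)\<^sup>2 \<partial>P) - real (card Z) * (c\<^sup>2 / B)"
    using B by (simp add: t_def power2_eq_square field_simps)
  finally show ?thesis unfolding \<mu>_def by linarith
qed

locale iid_simplices = bounded_density q M + simplex_family S \<rho>
  for q :: "real ^ 'd \<Rightarrow> real" and M and S :: "(real ^ 'd) set set" and \<rho> +
  fixes n :: nat and C :: real
  assumes S_meas: "A \<subseteq> {..<n} \<Longrightarrow> Measurable.pred (PiM {..<n} (\<lambda>_. Q)) (\<lambda>x. x ` A \<in> S)"
    and vol: "real n * (M * (2 * \<rho>) ^ CARD('d)) \<le> C"
begin

definition unit_cube :: "(real ^ 'd) set" where "unit_cube = cbox 0 1"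

text \<open>Restricting the simplices to the cube lets a point outside of it play the role of a removed point.\<close>

definition term_at :: "nat set \<Rightarrow> (nat \<Rightarrow> real ^ 'd) \<Rightarrow> real" where
  "term_at A x = (- 1) ^ (card A + 1) * of_bool (x ` A \<subseteq> unit_cube \<and> x ` A \<in> S)"

definition far :: "real ^ 'd" where "far = vec 2"

lemma unit_cube_borel[measurable, simp]: "unit_cube \<in> sets borel" by (simp add: unit_cube_def)

lemma far_notin: "far \<notin> unit_cube" by (simp add: far_def unit_cube_def mem_box_cart)

sublocale local_functional "\<lambda>_. Q" n term_at "\<lambda>_ x. x \<in> unit_cube"
  "\<lambda>_ _ x y. x \<in> unit_cube \<and> y \<in> unit_cube \<and> dist x y \<le> \<rho>" "\<lambda>_. far" C "real n"
proof (intro local_functional.intro indep_seq.intro indep_family.intro local_functional_axioms.intro, goal_cases)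
  case 1 show ?case by (rule prob_Q)
next
  case (2 A)
  have c: "(\<lambda>x. x a) \<in> borel_measurable (PiM {..<n} (\<lambda>_. Q))" if "a \<in> A" for a
    using measurable_component_singleton[of a "{..<n}" "\<lambda>_. Q"] that 2
    by (auto simp: measurable_def cong: measurable_cong_sets)
  have f: "finite A" using 2 finite_subset by blast
  have "Measurable.pred (PiM {..<n} (\<lambda>_. Q)) (\<lambda>x. \<forall>a\<in>A. x a \<in> unit_cube)"
    by (rule pred_intros_finite(3)[OF f]) (use c in measurable)
  hence [measurable]: "Measurable.pred (PiM {..<n} (\<lambda>_. Q)) (\<lambda>x. x ` A \<subseteq> unit_cube)" by (simp add: image_subset_iff)
  note [measurable] = S_meas[OF 2]
  show ?case unfolding term_at_def by measurable
next
  case (3 A x x')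
  hence "x ` A = x' ` A" by (intro image_cong) auto
  thus ?case by (simp add: term_at_def)
next
  case (6 A x i j)
  thus ?case using simplex_dist[of "x ` A" "x i" "x j"] by (auto simp: term_at_def)
next
  case (8 i j)
  show ?case by measurable
next
  case (13 j b)
  interpret Q: prob_space Q by (rule prob_Q)
  have "measure Q {a \<in> space Q. a \<in> unit_cube \<and> b \<in> unit_cube \<and> dist a b \<le> \<rho>} \<le> M * (2 * \<rho>) ^ CARD('d)"
  proof -
    have "measure Q {a \<in> space Q. a \<in> unit_cube \<and> b \<in> unit_cube \<and> dist a b \<le> \<rho>} \<le> measure Q (cball b \<rho>)"
      by (intro Q.finite_measure_mono) (auto simp: dist_commute)
    also have "\<dots> \<le> M * (2 * \<rho>) ^ CARD('d)" using R_pos by (intro Q_cball_le) simp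
    finally show ?thesis .
  qed
  hence "(\<Sum>i<n. measure Q {a \<in> space Q. a \<in> unit_cube \<and> b \<in> unit_cube \<and> dist a b \<le> \<rho>}) \<le> (\<Sum>i<n. M * (2 * \<rho>) ^ CARD('d))"
    by (intro sum_mono)
  thus ?case using vol by simp
qed (auto simp: term_at_def far_notin dist_commute abs_mult intro!: mult_left_le prob_space.prob_le_1[OF prob_Q])

lemma functional_eq:
  assumes "inj_on x {..<n}" "x ` {..<n} \<subseteq> unit_cube"
  shows "functional x = alt_count S (x ` {..<n})"
proof -
  have "x ` B \<subseteq> unit_cube" if "B \<subseteq> {..<n}" for B using assms(2) that by blast
  thus ?thesis unfolding alt_count_image[OF assms(1)] functional_def
    by (intro sum.cong) (auto simp: term_at_def)
qed

definition occ :: "(real ^ 'd) set \<Rightarrow> nat set \<Rightarrow> (nat \<Rightarrow> real ^ 'd) \<Rightarrow> real" where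
  "occ N J x = (\<Prod>k\<in>J. indicator (- N) (x k))"

text \<open>The points \<open>i\<close> and \<open>j\<close> are removed one after the other. No
  other point is within reach, so besides the two vertices only the edge can occur, and it is
  present exactly if \<open>x j\<close> is not in \<open>b\<close>.\<close>

lemma functional_two_points:
  assumes gb: "good_block \<delta> n' \<rho> a b N" and ij: "i < n" "j < n" "i \<noteq> j"
    and xi: "x i \<in> a" and xj: "x j \<in> a \<union> b" and out: "\<And>k. k < n \<Longrightarrow> k \<noteq> i \<Longrightarrow> k \<noteq> j \<Longrightarrow> x k \<notin> N"
  shows "functional x = functional (x(i := far, j := far)) + (if x j \<in> b then 2 else 1)"
proof -
  have cube: "a \<subseteq> unit_cube" "b \<subseteq> unit_cube" using gb by (auto simp: good_block_def unit_cube_def)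
  have sep: "\<And>y. y \<notin> N \<Longrightarrow> \<rho> < dist (x i) y" "\<And>y. y \<notin> N \<Longrightarrow> \<rho> < dist (x j) y"
    using gb xi xj by (auto simp: good_block_def)
  have xij: "\<rho> < dist (x i) (x j)" if "x j \<in> b" using gb xi that by (auto simp: good_block_def)
  have xij': "dist (x i) (x j) < \<rho>" if "x j \<notin> b" using gb xi xj that by (auto simp: good_block_def)
  have zero: "term_at A y = 0" if "k \<in> A" "l \<in> A" "y k \<notin> unit_cube \<or> \<rho> < dist (y k) (y l)" for A y k l
    using that simplex_dist[of "y ` A" "y k" "y l"] by (auto simp: term_at_def)
  have sing: "term_at {k} y = 1" if "y k \<in> unit_cube" for k y
    using that by (simp add: term_at_def singleton_in)
  define x' where "x' = x(i := far)"
  have 1: "functional x - functional x' = addone i x - addone i x'"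
    by (rule functional_diff) (simp add: x'_def)
  have "addone i x' = 0" unfolding addone_def
    by (intro sum.neutral ballI) (auto intro!: zero[of i _ i] simp: x'_def far_notin)
  moreover have "addone i x = (if x j \<in> b then 1 else 0)"
  proof -
    have "addone i x = (\<Sum>A\<in>{{i}, {i, j}}. term_at A x)" unfolding addone_def
    proof (rule sum.mono_neutral_right)
      show "\<forall>A\<in>{A \<in> Pow {..<n}. i \<in> A} - {{i}, {i, j}}. term_at A x = 0"
      proof
        fix A assume A: "A \<in> {A \<in> Pow {..<n}. i \<in> A} - {{i}, {i, j}}"
        then obtain k where k: "k \<in> A" "k \<noteq> i" "k \<noteq> j" by blast
        with A have "k < n" by auto
        show "term_at A x = 0" by (rule zero[of i A k]) (use A k sep(1)[OF out[OF \<open>k < n\<close> k(2,3)]] in auto)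
      qed
    qed (use ij in auto)
    also have "\<dots> = term_at {i} x + term_at {i, j} x" using ij by simp
    also have "term_at {i} x = 1" using xi cube by (intro sing) auto
    also have "term_at {i, j} x = (if x j \<in> b then 0 else - 1)"
      using xij xij' pair_in[of "x i" "x j"] zero[of i "{i, j}" j x] xi xj cube ij by (auto simp: term_at_def)
    finally show ?thesis by simp
  qed
  moreover have "functional x' - functional (x'(j := far)) = addone j x' - addone j (x'(j := far))"
    by (rule functional_diff) simp
  moreover have "addone j (x'(j := far)) = 0" unfolding addone_def
    by (intro sum.neutral ballI) (auto intro!: zero[of j _ j] simp: far_notin)
  moreover have "addone j x' = 1"
  proof -
    have "addone j x' = (\<Sum>A\<in>{{j}}. term_at A x')" unfolding addone_def
    proof (rule sum.mono_neutral_right)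
      show "\<forall>A\<in>{A \<in> Pow {..<n}. j \<in> A} - {{j}}. term_at A x' = 0"
      proof
        fix A assume A: "A \<in> {A \<in> Pow {..<n}. j \<in> A} - {{j}}"
        then obtain k where k: "k \<in> A" "k \<noteq> j" by blast
        with A have kn: "k < n" by auto
        show "term_at A x' = 0"
        proof (cases "k = i")
          case True
          show ?thesis by (rule zero[of k A k]) (use k True in \<open>auto simp: x'_def far_notin\<close>)
        next
          case False
          show ?thesis by (rule zero[of j A k]) (use A k False sep(2)[OF out[OF kn False k(2)]] ij in \<open>auto simp: x'_def\<close>)
        qed
      qed
    qed (use ij in auto)
    also have "\<dots> = 1" using sing[of x' j] xj cube ij by (auto simp: x'_def)
    finally show ?thesis .
  qed
  ultimately show ?thesis using 1 by (cases "x j \<in> b") (simp_all add: x'_def)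
qed

section \<open>Test functions for the binomial variance\<close>

definition contrast :: "(real ^ 'd) set \<Rightarrow> (real ^ 'd) set \<Rightarrow> real ^ 'd \<Rightarrow> real" where
  "contrast a b y = indicator b y / measure Q b - indicator a y / measure Q a"

definition pair_test :: "(real ^ 'd) set \<Rightarrow> (real ^ 'd) set \<Rightarrow> (real ^ 'd) set \<Rightarrow> nat \<Rightarrow> nat \<Rightarrow> (nat \<Rightarrow> real ^ 'd) \<Rightarrow> real" where
  "pair_test a b N i j x = indicator a (x i) * contrast a b (x j) * occ N ({..<n} - {i, j}) x"

definition offdiag :: "(nat \<times> nat) set" where "offdiag = {(i, j) \<in> {..<n} \<times> {..<n}. i \<noteq> j}"

text \<open>Division by \<open>n\<close> puts covariance and second moment at order one: there are
  about \<open>n\<^sup>2\<close> pairs, the covariance of each with the functional is of order 1/n,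
  its second moment is of order one, and at most two pairs are active simultaneously.\<close>

definition block_test :: "(real ^ 'd) set \<Rightarrow> (real ^ 'd) set \<Rightarrow> (real ^ 'd) set \<Rightarrow> (nat \<Rightarrow> real ^ 'd) \<Rightarrow> real" where
  "block_test a b N x = (\<Sum>(i, j)\<in>offdiag. pair_test a b N i j x) / real n"

lemma coord_measurable: "k < n \<Longrightarrow> (\<lambda>x. x k) \<in> borel_measurable single"
  using measurable_component_singleton[of k "{..<n}" "\<lambda>_. Q"]
  by (auto simp: measurable_def cong: measurable_cong_sets)

lemma contrast_measurable:
  assumes "a \<in> sets borel" "b \<in> sets borel" shows "contrast a b \<in> borel_measurable borel"
  unfolding contrast_def[abs_def] using assms by measurable

lemma contrast_mean:
  assumes "a \<in> sets borel" "b \<in> sets borel" "measure Q a \<noteq> 0" "measure Q b \<noteq> 0"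
  shows "(\<integral>y. contrast a b y \<partial>Q) = 0"
proof -
  have i: "integrable Q (\<lambda>y. indicator A y :: real)" if "A \<in> sets borel" for A
  proof (rule bounded_integrable[OF prob_Q, where B=1])
    show "(\<lambda>y. indicator A y :: real) \<in> borel_measurable Q" by (rule borel_measurable_indicator) (use that in simp)
  qed (simp add: indicator_def)
  show ?thesis unfolding contrast_def using assms i by simp
qed

lemma occ_measurable: "J \<subseteq> {..<n} \<Longrightarrow> N \<in> sets borel \<Longrightarrow> occ N J \<in> borel_measurable single"
  unfolding occ_def[abs_def] by (intro borel_measurable_prod) (auto intro!: borel_measurable_indicator' simp: subset_iff)

lemma occ_bound: "0 \<le> occ N J x" "occ N J x \<le> 1"
  unfolding occ_def by (auto intro!: prod_nonneg prod_le_1 simp: indicator_def)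

text \<open>The common pattern of the vanishing integrals below: after resampling one coordinate,
  the new value enters only through a centred factor.\<close>

lemma integral_zero_by_coordinate:
  assumes "j < n" and G: "G \<in> borel_measurable single" "\<And>x. \<bar>G x\<bar> \<le> (B :: real)"
    and u: "(\<integral>y. u y \<partial>Q) = 0" and eq: "\<And>x y. G (x(j := y)) = u y * H x"
  shows "(\<integral>x. G x \<partial>single) = 0"
proof -
  have "(\<integral>x. G x \<partial>single) = (\<integral>x. (\<integral>y. G (x(j := y)) \<partial>Q) \<partial>single)"
    by (rule resample_integral[OF _ _ G]) (use assms(1) in auto)
  thus ?thesis using u by (simp add: eq)
qed

lemma occ_upd: "j \<notin> J \<Longrightarrow> occ N J (x(j := y)) = occ N J x"
  unfolding occ_def by (intro prod.cong) auto

lemma offdiag: "finite offdiag" "card offdiag \<le> n * n" "(n - 1) * n \<le> card offdiag"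
proof -
  have "offdiag \<subseteq> {..<n} \<times> {..<n}" by (auto simp: offdiag_def)
  from card_mono[OF _ this] finite_subset[OF this] show "finite offdiag" "card offdiag \<le> n * n" by (auto simp: card_cartesian_product)
  have eq: "offdiag = (SIGMA i:{..<n}. {..<n} - {i})" by (auto simp: offdiag_def)
  have "card offdiag = (\<Sum>i<n. n - 1)" unfolding eq by (subst card_SigmaI) auto
  thus "(n - 1) * n \<le> card offdiag" by simp
qed

context
  fixes a b N :: "(real ^ 'd) set" and \<delta> n' :: real
  assumes gb: "good_block \<delta> n' \<rho> a b N" and Qpos: "0 < measure Q a" "0 < measure Q b"
begin

lemma block_sets: "a \<in> sets borel" "b \<in> sets borel" "N \<in> sets borel" "a \<subseteq> N" "b \<subseteq> N" "a \<inter> b = {}"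
proof -
  show "a \<inter> b = {}"
  proof (rule ccontr)
    assume "a \<inter> b \<noteq> {}"
    then obtain x where "x \<in> a" "x \<in> b" by auto
    hence "\<rho> < dist x x" using gb by (auto simp only: good_block_def)
    thus False using R_pos by simp
  qed
qed (use gb in \<open>auto simp: good_block_def\<close>)

lemma contrast_bound: "\<bar>contrast a b y\<bar> \<le> 1 / measure Q a + 1 / measure Q b"
proof -
  have "0 \<le> 1 / measure Q a" "0 \<le> 1 / measure Q b" by simp_all
  thus ?thesis by (auto simp: contrast_def indicator_def abs_le_iff)
qed

lemma contrast_support: "y \<notin> a \<union> b \<Longrightarrow> contrast a b y = 0"
  by (simp add: contrast_def)

lemma pair_test_measurable: "i < n \<Longrightarrow> j < n \<Longrightarrow> pair_test a b N i j \<in> borel_measurable single"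
  unfolding pair_test_def[abs_def]
  by (intro borel_measurable_times occ_measurable measurable_compose[OF coord_measurable contrast_measurable]
      measurable_compose[OF coord_measurable borel_measurable_indicator]) (use block_sets in auto)

lemma pair_test_bound: "\<bar>pair_test a b N i j x\<bar> \<le> 1 / measure Q a + 1 / measure Q b"
proof -
  have "\<bar>indicator a (x i) * contrast a b (x j) * occ N ({..<n} - {i, j}) x\<bar> \<le> (1 * (1 / measure Q a + 1 / measure Q b)) * 1"
    by (intro abs_mult_bound contrast_bound) (use occ_bound in \<open>auto simp: indicator_def\<close>)
  thus ?thesis by (simp add: pair_test_def)
qed

lemma pair_test_support:
  assumes "pair_test a b N i j x \<noteq> 0"
  shows "x i \<in> a" "x j \<in> a \<union> b" "\<And>k. k < n \<Longrightarrow> k \<noteq> i \<Longrightarrow> k \<noteq> j \<Longrightarrow> x k \<notin> N"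
proof -
  show "x i \<in> a" "x j \<in> a \<union> b" using assms contrast_support[of "x j"] by (auto simp: pair_test_def indicator_def)
  fix k assume k: "k < n" "k \<noteq> i" "k \<noteq> j"
  have "occ N ({..<n} - {i, j}) x \<noteq> 0" using assms by (auto simp: pair_test_def)
  hence "indicator (- N) (x k) \<noteq> (0 :: real)" using k by (simp add: occ_def)
  thus "x k \<notin> N" by (simp add: indicator_def split: if_splits)
qed

lemma pair_test_upd:
  assumes "i \<noteq> j"
  shows "pair_test a b N i j (x(j := y)) = contrast a b y * (indicator a (x i) * occ N ({..<n} - {i, j}) x)"
  using assms by (simp add: pair_test_def occ_upd)

lemma contrast_mean0: "(\<integral>y. contrast a b y \<partial>Q) = 0"
  by (rule contrast_mean) (use block_sets Qpos in auto)

lemma pair_test_mean: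
  assumes "i < n" "j < n" "i \<noteq> j" shows "(\<integral>x. pair_test a b N i j x \<partial>single) = 0"
  by (rule integral_zero_by_coordinate[OF assms(2) pair_test_measurable[OF assms(1,2)] pair_test_bound contrast_mean0 pair_test_upd[OF assms(3)]])

lemma far_upd_measurable: "j < n \<Longrightarrow> (\<lambda>x. x(j := far)) \<in> measurable single single"
proof -
  assume j: "j < n"
  have "(\<lambda>x. x(j := far)) \<in> measurable (PiM {..<n} (\<lambda>_. Q)) (PiM (insert j {..<n}) (\<lambda>_. Q))" by measurable
  moreover have "insert j {..<n} = {..<n}" using j by auto
  ultimately show ?thesis by simp
qed

text \<open>On the support of the test, the functional is a part \<open>F\<close> free of
  \<open>x i\<close> and \<open>x j\<close>, plus 1, plus the indicator that \<open>x j\<close> lies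
  in \<open>b\<close>. The centred contrast annihilates the first two; the third leaves an integral
  of a product over the coordinates.\<close>

lemma functional_pair_test:
  assumes ij: "i < n" "j < n" "i \<noteq> j"
  shows "(\<integral>x. functional x * pair_test a b N i j x \<partial>single) = measure Q a * (1 - measure Q N) ^ (n - 2)"
proof -
  define \<beta> where "\<beta> x = indicator a (x i) * occ N ({..<n} - {i, j}) x" for x
  define F where "F x = functional (x(i := far, j := far))" for x
  let ?B = "1 / measure Q a + 1 / measure Q b"
  have cb: "contrast a b y = 1 / measure Q b" if "y \<in> b" for y
  proof -
    have "y \<notin> a" using that block_sets(6) by auto
    thus ?thesis using that by (simp add: contrast_def)
  qed
  have eq: "functional x * pair_test a b N i j x =
      F x * pair_test a b N i j x + pair_test a b N i j x + indicator b (x j) * \<beta> x / measure Q b" for x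
  proof (cases "pair_test a b N i j x = 0")
    case True
    hence "indicator b (x j) * \<beta> x = 0"
      using Qpos cb by (cases "x j \<in> b") (auto simp: pair_test_def \<beta>_def)
    thus ?thesis using True by simp
  next
    case False
    note s = pair_test_support[OF False]
    have "functional x = F x + (if x j \<in> b then 2 else 1)"
      unfolding F_def by (rule functional_two_points[OF gb ij s])
    moreover have "pair_test a b N i j x = \<beta> x / measure Q b" if "x j \<in> b"
      using cb[OF that] by (simp add: pair_test_def \<beta>_def)
    ultimately show ?thesis by (auto simp: algebra_simps)
  qed
  have Fm: "F \<in> borel_measurable single"
    unfolding F_def by (rule measurable_compose[OF measurable_compose[OF far_upd_measurable far_upd_measurable] functional_measurable]) (use ij in auto)
  have FB: "\<bar>F x\<bar> \<le> 2 ^ n" for x unfolding F_def by (rule functional_bound)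
  note pm = pair_test_measurable[OF ij(1,2)]
  have m1: "(\<lambda>x. F x * pair_test a b N i j x) \<in> borel_measurable single" by (intro borel_measurable_times Fm pm)
  have b1: "\<bar>F x * pair_test a b N i j x\<bar> \<le> 2 ^ n * ?B" for x by (intro abs_mult_bound FB pair_test_bound)
  have z1: "(\<integral>x. F x * pair_test a b N i j x \<partial>single) = 0"
  proof (rule integral_zero_by_coordinate[OF ij(2) m1 b1 contrast_mean0])
    fix x y
    show "F (x(j := y)) * pair_test a b N i j (x(j := y)) = contrast a b y * (F x * \<beta> x)"
      unfolding pair_test_upd[OF ij(3)] using ij(3) by (simp add: F_def \<beta>_def fun_upd_twist)
  qed
  have bm: "(\<lambda>x. indicator b (x j) * \<beta> x) \<in> borel_measurable single"
    unfolding \<beta>_def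
    by (intro borel_measurable_times occ_measurable measurable_compose[OF coord_measurable borel_measurable_indicator]) (use ij block_sets in auto)
  have bb: "\<bar>indicator b (x j) * \<beta> x\<bar> \<le> 1 * (1 * 1)" for x
    unfolding \<beta>_def by (intro abs_mult_bound) (use occ_bound in \<open>auto simp: indicator_def\<close>)
  have prod: "(\<integral>x. indicator b (x j) * \<beta> x \<partial>single) = measure Q a * measure Q b * (1 - measure Q N) ^ (n - 2)"
  proof -
    define f where "f k = (if k = i then indicator a else if k = j then indicator b else indicator (- N) :: real ^ 'd \<Rightarrow> real)" for k
    have fint: "integrable Q (f k)" for k
      by (rule bounded_integrable[OF prob_Q, where B=1])
        (use block_sets in \<open>auto simp: f_def intro!: borel_measurable_indicator\<close>)
    have split: "{..<n} = insert i (insert j ({..<n} - {i, j}))" using ij by auto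
    have split_prod: "(\<Prod>k<n. g k) = g i * (g j * (\<Prod>k\<in>{..<n} - {i, j}. g k))" for g :: "nat \<Rightarrow> real"
      by (subst split) (use ij in auto)
    have "(\<integral>x. indicator b (x j) * \<beta> x \<partial>single) = (\<integral>x. (\<Prod>k<n. f k (x k)) \<partial>single)"
      unfolding split_prod using ij(3)
      by (intro Bochner_Integration.integral_cong) (auto simp: \<beta>_def occ_def f_def intro!: prod.cong)
    also have "\<dots> = (\<Prod>k<n. \<integral>y. f k y \<partial>Q)" by (rule product_integral_prod[OF _ fint]) simp
    also have "\<dots> = measure Q a * (measure Q b * (\<Prod>k\<in>{..<n} - {i, j}. measure Q (- N)))"
      unfolding split_prod using ij(3) by (auto simp: f_def intro!: prod.cong)
    also have "measure Q (- N) = 1 - measure Q N"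
      using prob_space.prob_compl[OF prob_Q, of N] block_sets by (simp add: Compl_eq_Diff_UNIV)
    also have "(\<Prod>k\<in>{..<n} - {i, j}. 1 - measure Q N) = (1 - measure Q N) ^ (n - 2)"
      using ij by (simp add: card_Diff_subset numeral_2_eq_2)
    finally show ?thesis by simp
  qed
  have "(\<integral>x. functional x * pair_test a b N i j x \<partial>single) =
     (\<integral>x. F x * pair_test a b N i j x \<partial>single) + (\<integral>x. pair_test a b N i j x \<partial>single) + (\<integral>x. indicator b (x j) * \<beta> x \<partial>single) / measure Q b"
    unfolding eq using bounded_integrable[OF prob_single m1 b1] bounded_integrable[OF prob_single pm pair_test_bound] bounded_integrable[OF prob_single bm bb]
    by simp
  thus ?thesis unfolding z1 prod pair_test_mean[OF ij] using Qpos by simp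
qed

text \<open>The factor \<open>occ\<close> is dropped. Since \<open>a\<close> and \<open>b\<close>
  are disjoint, the square of the contrast has no cross term and its mean is the sum of the
  reciprocal masses.\<close>

lemma pair_test_square:
  assumes ij: "i < n" "j < n" "i \<noteq> j"
  shows "(\<integral>x. (pair_test a b N i j x)\<^sup>2 \<partial>single) \<le> measure Q a / measure Q b + 1"
proof -
  define f where "f k = (if k = i then indicator a else if k = j then (\<lambda>y. (contrast a b y)\<^sup>2) else (\<lambda>_. 1) :: real ^ 'd \<Rightarrow> real)" for k
  have c2: "(contrast a b y)\<^sup>2 = indicator b y / (measure Q b)\<^sup>2 + indicator a y / (measure Q a)\<^sup>2" for y
    using block_sets(6) by (auto simp: contrast_def indicator_def power2_eq_square)
  have ind: "integrable Q (indicator A :: _ \<Rightarrow> real)" if "A \<in> sets borel" for A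
  proof (rule bounded_integrable[OF prob_Q, where B=1])
    show "(indicator A :: _ \<Rightarrow> real) \<in> borel_measurable Q" by (rule borel_measurable_indicator) (use that in simp)
  qed (simp add: indicator_def)
  have ci: "integrable Q (\<lambda>y. (contrast a b y)\<^sup>2)"
    unfolding c2 by (intro Bochner_Integration.integrable_add integrable_divide ind block_sets)
  have cI: "(\<integral>y. (contrast a b y)\<^sup>2 \<partial>Q) = 1 / measure Q b + 1 / measure Q a"
    unfolding c2 using ind[OF block_sets(1)] ind[OF block_sets(2)] block_sets Qpos by (simp add: power2_eq_square)
  have fint: "integrable Q (f k)" for k
    unfolding f_def using ci ind[OF block_sets(1)] bounded_integrable[OF prob_Q, where B=1 and f="\<lambda>_. 1"] by auto
  have split: "{..<n} = insert i (insert j ({..<n} - {i, j}))" using ij by auto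
  have split_prod: "(\<Prod>k<n. g k) = g i * (g j * (\<Prod>k\<in>{..<n} - {i, j}. g k))" for g :: "nat \<Rightarrow> real"
    by (subst split) (use ij in auto)
  have "(\<integral>x. (pair_test a b N i j x)\<^sup>2 \<partial>single) \<le> (\<integral>x. (\<Prod>k<n. f k (x k)) \<partial>single)"
  proof (rule integral_mono')
    show "integrable single (\<lambda>x. \<Prod>k<n. f k (x k))" by (rule product_integrable_prod[OF _ fint]) simp
    fix x
    have "(occ N ({..<n} - {i, j}) x)\<^sup>2 \<le> 1" using occ_bound by (intro power_le_one) auto
    hence "indicator a (x i) * (contrast a b (x j))\<^sup>2 * (occ N ({..<n} - {i, j}) x)\<^sup>2 \<le> indicator a (x i) * (contrast a b (x j))\<^sup>2 * 1"
      by (intro mult_left_mono) auto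
    thus "(pair_test a b N i j x)\<^sup>2 \<le> (\<Prod>k<n. f k (x k))"
    proof -
      have "(indicator a (x i) :: real)\<^sup>2 = indicator a (x i)" by (simp add: indicator_def)
      moreover have "(\<Prod>k\<in>{..<n} - {i, j}. f k (x k)) = 1" by (intro prod.neutral) (auto simp: f_def)
      ultimately show ?thesis using \<open>_ \<le> indicator a (x i) * (contrast a b (x j))\<^sup>2 * 1\<close> ij(3)
        unfolding split_prod by (simp add: pair_test_def f_def power_mult_distrib)
    qed
    show "0 \<le> (\<Prod>k<n. f k (x k))" by (intro prod_nonneg) (auto simp: f_def)
  qed
  also have "\<dots> = (\<Prod>k<n. \<integral>y. f k y \<partial>Q)" by (rule product_integral_prod[OF _ fint]) simp
  also have "\<dots> = measure Q a * (1 / measure Q b + 1 / measure Q a)"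
    unfolding split_prod using ij(3) block_sets by (auto simp: f_def cI prob_space.prob_space[OF prob_Q, simplified] intro!: prod.neutral)
  finally show ?thesis using Qpos by (simp add: distrib_left)
qed

lemma block_test_measurable: "block_test a b N \<in> borel_measurable single"
  unfolding block_test_def[abs_def]
  by (intro borel_measurable_divide borel_measurable_sum) (auto simp: offdiag_def split: prod.splits intro: pair_test_measurable)

lemma block_test_bound: "\<bar>block_test a b N x\<bar> \<le> real (card offdiag) * (1 / measure Q a + 1 / measure Q b) / real n"
proof -
  have "\<bar>\<Sum>(i, j)\<in>offdiag. pair_test a b N i j x\<bar> \<le> (\<Sum>p\<in>offdiag. 1 / measure Q a + 1 / measure Q b)"
    by (rule order_trans[OF sum_abs]) (intro sum_mono, auto intro: pair_test_bound)
  thus ?thesis unfolding block_test_def abs_divide by (simp add: divide_right_mono)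
qed

lemma block_test_mean: "(\<integral>x. block_test a b N x \<partial>single) = 0"
proof -
  have "(\<integral>x. block_test a b N x \<partial>single) = (\<Sum>(i, j)\<in>offdiag. \<integral>x. pair_test a b N i j x \<partial>single) / real n"
    unfolding block_test_def using bounded_integrable[OF prob_single pair_test_measurable pair_test_bound]
    by (subst integral_divide_zero, subst Bochner_Integration.integral_sum) (auto simp: offdiag_def split: prod.splits intro!: sum.cong)
  thus ?thesis using pair_test_mean by (auto simp: offdiag_def split: prod.splits intro!: sum.neutral)
qed

lemma functional_block_test:
  "(\<integral>x. functional x * block_test a b N x \<partial>single) = real (card offdiag) * (measure Q a * (1 - measure Q N) ^ (n - 2)) / real n"
proof -
  have i: "integrable single (\<lambda>x. functional x * pair_test a b N i j x)" if "i < n" "j < n" for i j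
    by (rule bounded_integrable[OF prob_single _ abs_mult_bound[OF functional_bound pair_test_bound]])
      (intro borel_measurable_times functional_measurable pair_test_measurable that)
  have "(\<integral>x. functional x * block_test a b N x \<partial>single) = (\<integral>x. (\<Sum>(i, j)\<in>offdiag. functional x * pair_test a b N i j x) / real n \<partial>single)"
    unfolding block_test_def by (simp add: sum_distrib_left split_beta)
  also have "\<dots> = (\<Sum>(i, j)\<in>offdiag. \<integral>x. functional x * pair_test a b N i j x \<partial>single) / real n"
    using i by (subst integral_divide_zero, subst Bochner_Integration.integral_sum) (auto simp: offdiag_def split: prod.splits intro!: sum.cong)
  also have "(\<Sum>(i, j)\<in>offdiag. \<integral>x. functional x * pair_test a b N i j x \<partial>single) = (\<Sum>p\<in>offdiag. measure Q a * (1 - measure Q N) ^ (n - 2))"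
    by (intro sum.cong) (auto simp: offdiag_def functional_pair_test)
  finally show ?thesis by simp
qed

text \<open>A nonzero value of \<open>pair_test\<close> at \<open>(i, j)\<close> determines \<open>{i, j}\<close> as the set of indices of the
  points in \<open>N\<close>, so at most two terms of the sum over pairs are nonzero.\<close>

lemma block_test_square:
  assumes n: "0 < n"
  shows "(\<integral>x. (block_test a b N x)\<^sup>2 \<partial>single) \<le> 2 * (measure Q a / measure Q b + 1)"
proof -
  let ?t = "\<lambda>p x. pair_test a b N (fst p) (snd p) x"
  have pt: "(\<Sum>p\<in>offdiag. ?t p x)\<^sup>2 \<le> 2 * (\<Sum>p\<in>offdiag. (?t p x)\<^sup>2)" for x
  proof -
    define D where "D = {p \<in> offdiag. ?t p x \<noteq> 0}"
    have cD: "card D \<le> 2"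
    proof (cases "D = {}")
      case False
      then obtain i j where ij: "(i, j) \<in> D" by auto
      hence nz: "pair_test a b N i j x \<noteq> 0" by (simp add: D_def)
      note s = pair_test_support[OF nz]
      have "D \<subseteq> {(i, j), (j, i)}"
      proof
        fix p assume p: "p \<in> D"
        obtain k l where kl: "p = (k, l)" by (cases p)
        hence nz': "pair_test a b N k l x \<noteq> 0" using p by (simp add: D_def)
        note s' = pair_test_support[OF nz']
        have "k < n" "l < n" "k \<noteq> l" using p kl by (auto simp: D_def offdiag_def)
        moreover have "x k \<in> N" "x l \<in> N" using s'(1,2) block_sets by auto
        ultimately have "k \<in> {i, j}" "l \<in> {i, j}" using s(3) by blast+
        thus "p \<in> {(i, j), (j, i)}" using kl \<open>k \<noteq> l\<close> by auto
      qed
      hence "card D \<le> card {(i, j), (j, i)}" by (intro card_mono) auto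
      also have "\<dots> \<le> 2" by (intro card_insert_le_m1) simp_all
      finally show ?thesis .
    qed simp
    have DO: "D \<subseteq> offdiag" unfolding D_def by (rule Collect_subset)
    have "(\<Sum>p\<in>offdiag. ?t p x) = (\<Sum>p\<in>D. ?t p x)"
      by (rule sum.mono_neutral_right[OF offdiag(1) DO]) (simp add: D_def)
    also have "\<dots> = (\<Sum>p\<in>D. 1 * ?t p x)" by simp
    also have "\<dots>\<^sup>2 \<le> (\<Sum>p\<in>D. 1) * (\<Sum>p\<in>D. 1 * (?t p x)\<^sup>2)" by (rule sum_square_weighted) simp
    also have "\<dots> \<le> 2 * (\<Sum>p\<in>D. 1 * (?t p x)\<^sup>2)" using cD by (intro mult_right_mono) (auto intro: sum_nonneg)
    also have "(\<Sum>p\<in>D. 1 * (?t p x)\<^sup>2) \<le> (\<Sum>p\<in>offdiag. (?t p x)\<^sup>2)"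
      unfolding mult_1 by (rule sum_mono2[OF offdiag(1) DO]) simp
    finally show ?thesis by simp
  qed
  have pB: "\<bar>(?t p x)\<^sup>2\<bar> \<le> (1 / measure Q a + 1 / measure Q b) * (1 / measure Q a + 1 / measure Q b)" for p x
    unfolding power2_eq_square by (intro abs_mult_bound pair_test_bound)
  have pi: "integrable single (\<lambda>x. (?t p x)\<^sup>2)" if "p \<in> offdiag" for p
    by (rule bounded_integrable[OF prob_single _ pB]) (use that in \<open>auto simp: offdiag_def intro!: borel_measurable_power pair_test_measurable\<close>)
  have "(\<integral>x. (block_test a b N x)\<^sup>2 \<partial>single) \<le> (\<integral>x. 2 * (\<Sum>p\<in>offdiag. (?t p x)\<^sup>2) / (real n)\<^sup>2 \<partial>single)"
  proof (rule integral_mono')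
    show "integrable single (\<lambda>x. 2 * (\<Sum>p\<in>offdiag. (?t p x)\<^sup>2) / (real n)\<^sup>2)"
      by (intro integrable_divide integrable_mult_right Bochner_Integration.integrable_sum pi)
    show "(block_test a b N x)\<^sup>2 \<le> 2 * (\<Sum>p\<in>offdiag. (?t p x)\<^sup>2) / (real n)\<^sup>2" for x
      using pt[of x] by (simp add: block_test_def power_divide divide_right_mono split_beta)
  qed (simp add: sum_nonneg)
  also have "\<dots> = 2 * (\<Sum>p\<in>offdiag. \<integral>x. (?t p x)\<^sup>2 \<partial>single) / (real n)\<^sup>2"
    by (subst integral_divide_zero, subst integral_mult_right_zero, subst Bochner_Integration.integral_sum[OF pi]) simp_all
  also have "\<dots> \<le> 2 * (\<Sum>p\<in>offdiag. measure Q a / measure Q b + 1) / (real n)\<^sup>2"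
    by (intro divide_right_mono mult_left_mono sum_mono pair_test_square) (auto simp: offdiag_def)
  also have "\<dots> \<le> 2 * (real (n * n) * (measure Q a / measure Q b + 1)) / (real n)\<^sup>2"
    unfolding sum_constant using offdiag(2) Qpos by (intro divide_right_mono mult_left_mono mult_right_mono of_nat_mono) auto
  also have "\<dots> = 2 * (measure Q a / measure Q b + 1)" using n by (simp add: power2_eq_square)
  finally show ?thesis .
qed

end

text \<open>If the pairs share an index, the common point would have to lie in both \<open>N\<close>
  and \<open>N'\<close>, so the product vanishes. Otherwise the coordinate \<open>j\<close> is
  resampled: where the contrast of the first block is nonzero, the new value is in \<open>N\<close>,
  hence not in \<open>N'\<close>, and the second test does not depend on it.\<close>

lemma pair_test_orthogonal:
  assumes A: "good_block \<delta> n' \<rho> a b N" "0 < measure Q a" "0 < measure Q b"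
    and B: "good_block \<delta>' n'' \<rho> a' b' N'" "0 < measure Q a'" "0 < measure Q b'"
    and disj: "N \<inter> N' = {}" and ij: "i < n" "j < n" "i \<noteq> j" and kl: "k < n" "l < n" "k \<noteq> l"
  shows "(\<integral>x. pair_test a b N i j x * pair_test a' b' N' k l x \<partial>single) = 0"
proof -
  note bs = block_sets[OF A] and bs' = block_sets[OF B]
  define G where "G x = pair_test a b N i j x * pair_test a' b' N' k l x" for x
  show ?thesis
  proof (cases "{i, j} \<inter> {k, l} = {}")
    case False
    have "G x = 0" for x
    proof (rule ccontr)
      assume "G x \<noteq> 0"
      hence nz: "pair_test a b N i j x \<noteq> 0" "pair_test a' b' N' k l x \<noteq> 0" by (auto simp: G_def)
      have "x i \<in> N" "x j \<in> N" using pair_test_support(1,2)[OF A nz(1)] bs by auto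
      moreover have "x k \<in> N'" "x l \<in> N'" using pair_test_support(1,2)[OF B nz(2)] bs' by auto
      ultimately show False using False disj by auto
    qed
    hence "(\<integral>x. G x \<partial>single) = 0" by simp
    thus ?thesis by (simp only: G_def)
  next
    case True
    define H where "H x = indicator a (x i) * occ N ({..<n} - {i, j}) x *
      (indicator a' (x k) * contrast a' b' (x l) * occ N' ({..<n} - {k, l} - {j}) x)" for x
    have "(\<integral>x. G x \<partial>single) = 0"
    proof (rule integral_zero_by_coordinate[OF ij(2) _ _ contrast_mean0[OF A]])
      show "G \<in> borel_measurable single" unfolding G_def
        by (intro borel_measurable_times pair_test_measurable[OF A] pair_test_measurable[OF B] ij kl)
      show "\<bar>G x\<bar> \<le> (1 / measure Q a + 1 / measure Q b) * (1 / measure Q a' + 1 / measure Q b')" for x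
        unfolding G_def by (intro abs_mult_bound pair_test_bound[OF A] pair_test_bound[OF B])
      fix x y
      have "contrast a b y * pair_test a' b' N' k l (x(j := y)) = contrast a b y *
         (indicator a' (x k) * contrast a' b' (x l) * occ N' ({..<n} - {k, l} - {j}) x)"
      proof (cases "y \<in> a \<union> b")
        case y: True
        hence yN: "y \<notin> N'" using bs disj by auto
        have J: "{..<n} - {k, l} = insert j ({..<n} - {k, l} - {j})" using ij True by auto
        have "occ N' ({..<n} - {k, l}) (x(j := y)) = occ N' ({..<n} - {k, l} - {j}) x"
        proof -
          have "occ N' ({..<n} - {k, l}) (x(j := y)) = indicator (- N') y * occ N' ({..<n} - {k, l} - {j}) (x(j := y))"
            unfolding occ_def by (subst J, subst prod.insert) auto
          thus ?thesis using yN by (simp add: occ_upd)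
        qed
        thus ?thesis using True by (auto simp: pair_test_def)
      qed (simp add: contrast_support[OF A])
      moreover have "G (x(j := y)) = (indicator a (x i) * occ N ({..<n} - {i, j}) x) * (contrast a b y * pair_test a' b' N' k l (x(j := y)))"
        unfolding G_def pair_test_upd[OF A ij(3)] by (simp only: mult_ac)
      ultimately show "G (x(j := y)) = contrast a b y * H x"
        unfolding H_def by (simp only: mult_ac)
    qed
    thus ?thesis by (simp add: G_def)
  qed
qed

lemma block_test_orthogonal:
  assumes A: "good_block \<delta> n' \<rho> a b N" "0 < measure Q a" "0 < measure Q b"
    and B: "good_block \<delta>' n'' \<rho> a' b' N'" "0 < measure Q a'" "0 < measure Q b'"
    and disj: "N \<inter> N' = {}"
  shows "(\<integral>x. block_test a b N x * block_test a' b' N' x \<partial>single) = 0"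
proof -
  let ?t = "\<lambda>p x. pair_test a b N (fst p) (snd p) x" and ?u = "\<lambda>p x. pair_test a' b' N' (fst p) (snd p) x"
  have i: "integrable single (\<lambda>x. ?t p x * ?u r x)" if "p \<in> offdiag" "r \<in> offdiag" for p r
    by (rule bounded_integrable[OF prob_single _ abs_mult_bound[OF pair_test_bound[OF A] pair_test_bound[OF B]]])
      (use that in \<open>auto simp: offdiag_def intro!: borel_measurable_times pair_test_measurable[OF A] pair_test_measurable[OF B]\<close>)
  have "(\<integral>x. block_test a b N x * block_test a' b' N' x \<partial>single) = (\<integral>x. (\<Sum>p\<in>offdiag. \<Sum>r\<in>offdiag. ?t p x * ?u r x) / (real n * real n) \<partial>single)"
    unfolding block_test_def by (simp add: sum_product split_beta)
  also have "\<dots> = (\<Sum>p\<in>offdiag. \<Sum>r\<in>offdiag. \<integral>x. ?t p x * ?u r x \<partial>single) / (real n * real n)"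
    using i by (subst integral_divide_zero, subst Bochner_Integration.integral_sum)
      (auto intro!: sum.cong Bochner_Integration.integral_sum Bochner_Integration.integrable_sum)
  also have "\<dots> = 0"
    using pair_test_orthogonal[OF A B disj] by (auto simp: offdiag_def intro!: sum.neutral)
  finally show ?thesis .
qed

text \<open>On the given interval \<open>(1 - x) * (1 + 2 * x) \<ge> 1\<close>, and the second
  factor is at most \<open>exp (2 * x)\<close>.\<close>

lemma one_minus_power_ge:
  assumes "0 \<le> x" "x \<le> 1 / 2" shows "exp (- 2 * real k * x) \<le> (1 - x) ^ k"
proof -
  have "exp (- 2 * x) \<le> 1 - x"
  proof -
    have "0 \<le> x * (1 - 2 * x)" using assms by simp
    hence "1 \<le> (1 - x) * (1 + 2 * x)" by (simp add: algebra_simps)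
    also have "\<dots> \<le> (1 - x) * exp (2 * x)"
      using assms by (intro mult_left_mono exp_ge_add_one_self) auto
    finally have "1 \<le> (1 - x) * exp (2 * x)" .
    thus ?thesis by (simp add: exp_minus field_simps)
  qed
  from power_mono[OF this, of k] show ?thesis by (simp flip: exp_of_nat_mult add: mult_ac)
qed

text \<open>Bessel's inequality with the block tests; \<open>2 / \<delta> \<le> n\<close> makes the
  mass of every block at most 1/2.\<close>

lemma variance_lower_bound:
  fixes Z :: "'z set"
  assumes Z: "finite Z" and gb: "\<And>z. z \<in> Z \<Longrightarrow> good_block \<delta> (real n) \<rho> (a z) (b z) (N z)"
    and disj: "disjoint_family_on N Z" and \<delta>: "0 < \<delta>" and n: "2 \<le> n" "2 / \<delta> \<le> real n"
  shows "real (card Z) * ((\<delta> / 2 * exp (- 2 / \<delta>))\<^sup>2 / (2 * (1 / \<delta>\<^sup>2 + 1))) \<le> (\<integral>x. (functional x - (\<integral>x. functional x \<partial>single))\<^sup>2 \<partial>single)"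
proof -
  have n0: "0 < real n" using n by simp
  have pos: "0 < measure Q (a z)" "0 < measure Q (b z)" if "z \<in> Z" for z
  proof -
    have "0 < \<delta> / real n" using \<delta> n0 by simp
    moreover have "\<delta> / real n \<le> measure Q (a z)" "\<delta> / real n \<le> measure Q (b z)" using gb[OF that] by (auto simp only: good_block_def)
    ultimately show "0 < measure Q (a z)" "0 < measure Q (b z)" by linarith+
  qed
  note G = gb pos
  have fB2: "\<bar>(functional x)\<^sup>2\<bar> \<le> 2 ^ n * 2 ^ n" for x
    unfolding power2_eq_square by (intro abs_mult_bound functional_bound)
  show ?thesis
  proof (rule variance_ge_orthogonal[OF prob_single Z, where g = "\<lambda>z. block_test (a z) (b z) (N z)"])
    show "integrable single functional" by (rule bounded_integrable[OF prob_single functional_measurable functional_bound])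
    show "integrable single (\<lambda>x. (functional x)\<^sup>2)"
      by (rule bounded_integrable[OF prob_single _ fB2]) (intro borel_measurable_power functional_measurable)
    fix z assume z: "z \<in> Z"
    note gz = G(1)[OF z] G(2)[OF z] G(3)[OF z]
    show "integrable single (block_test (a z) (b z) (N z))"
      by (rule bounded_integrable[OF prob_single block_test_measurable[OF gz] block_test_bound[OF gz]])
    show "integrable single (\<lambda>x. functional x * block_test (a z) (b z) (N z) x)"
      by (rule bounded_integrable[OF prob_single _ abs_mult_bound[OF functional_bound block_test_bound[OF gz]]])
        (intro borel_measurable_times functional_measurable block_test_measurable[OF gz])
    show "(\<integral>x. block_test (a z) (b z) (N z) x \<partial>single) = 0" by (rule block_test_mean[OF gz])
    \<comment> \<open>The exponential bounds from below the probability that the other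
      \<open>n - 2\<close> points avoid the block, and the factor 1/2 comes from
      \<open>n * (n - 1) \<ge> n\<^sup>2 / 2\<close>.\<close>
    show "\<delta> / 2 * exp (- 2 / \<delta>) \<le> (\<integral>x. functional x * block_test (a z) (b z) (N z) x \<partial>single)"
    proof -
      have NQ: "measure Q (N z) \<le> 1 / (\<delta> * real n)" and aQ: "\<delta> / real n \<le> measure Q (a z)"
        using gz by (auto simp: good_block_def)
      have half: "1 / (\<delta> * real n) \<le> 1 / 2" using n \<delta> by (simp add: field_simps)
      have "- 2 / \<delta> \<le> - 2 * real (n - 2) * (1 / (\<delta> * real n))"
        using n \<delta> by (simp add: field_simps of_nat_diff)
      hence "exp (- 2 / \<delta>) \<le> exp (- 2 * real (n - 2) * (1 / (\<delta> * real n)))" by simp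
      also have "\<dots> \<le> (1 - 1 / (\<delta> * real n)) ^ (n - 2)" using half \<delta> n0 by (intro one_minus_power_ge) auto
      also have "\<dots> \<le> (1 - measure Q (N z)) ^ (n - 2)" using NQ half by (intro power_mono) auto
      finally have e: "exp (- 2 / \<delta>) \<le> (1 - measure Q (N z)) ^ (n - 2)" .
      have "\<delta> / 2 * exp (- 2 / \<delta>) = (real n / 2) * ((\<delta> / real n) * exp (- 2 / \<delta>))" using n0 by simp
      also have "\<dots> \<le> (real (card offdiag) / real n) * (measure Q (a z) * (1 - measure Q (N z)) ^ (n - 2))"
      proof (intro mult_mono e aQ)
        have "real ((n - 1) * n) \<le> real (card offdiag)" using offdiag(3) by (rule of_nat_mono)
        moreover have "real n * real n / 2 \<le> real ((n - 1) * n)" using n by (simp add: of_nat_diff)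
        ultimately have "real n * real n / 2 \<le> real (card offdiag)" by linarith
        thus "real n / 2 \<le> real (card offdiag) / real n" using n0 by (simp add: field_simps)
      qed (use \<delta> n0 in auto)
      also have "\<dots> = (\<integral>x. functional x * block_test (a z) (b z) (N z) x \<partial>single)"
        unfolding functional_block_test[OF gz] by simp
      finally show ?thesis .
    qed
    show "(\<integral>x. (block_test (a z) (b z) (N z) x)\<^sup>2 \<partial>single) \<le> 2 * (1 / \<delta>\<^sup>2 + 1)"
    proof -
      have "measure Q (a z) \<le> measure Q (N z)"
        by (rule finite_measure.finite_measure_mono[OF prob_space.finite_measure[OF prob_Q]]) (use block_sets[OF gz] in auto)
      also have "\<dots> \<le> 1 / (\<delta> * real n)" using gz(1) by (simp add: good_block_def)
      finally have "measure Q (a z) / measure Q (b z) \<le> (1 / (\<delta> * real n)) / (\<delta> / real n)"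
        using gz(1) \<delta> n0 by (intro frac_le) (auto simp: good_block_def)
      also have "\<dots> = 1 / \<delta>\<^sup>2" using n0 by (simp add: power2_eq_square)
      finally show ?thesis using block_test_square[OF gz] n by auto
    qed
    fix w assume w: "w \<in> Z"
    note gw = G(1)[OF w] G(2)[OF w] G(3)[OF w]
    show "integrable single (\<lambda>x. block_test (a z) (b z) (N z) x * block_test (a w) (b w) (N w) x)"
      by (rule bounded_integrable[OF prob_single _ abs_mult_bound[OF block_test_bound[OF gz] block_test_bound[OF gw]]])
        (intro borel_measurable_times block_test_measurable[OF gz] block_test_measurable[OF gw])
    show "(\<integral>x. block_test (a z) (b z) (N z) x * block_test (a w) (b w) (N w) x \<partial>single) = 0" if "z \<noteq> w"
      by (rule block_test_orthogonal[OF gz gw]) (use disj z w that in \<open>auto simp: disjoint_family_on_def\<close>)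
  qed (use \<delta> in \<open>auto intro!: add_pos_pos add_nonneg_pos\<close>)
qed

end

section \<open>Kolmogorov distance for the binomial process\<close>

lemma kolmogorov_dist_le:
  assumes "\<And>t. \<bar>measure M {\<omega> \<in> space M. Y \<omega> \<le> t} - measure M' {\<omega> \<in> space M'. Z \<omega> \<le> t}\<bar> \<le> D"
  shows "kolmogorov_dist M Y M' Z \<le> D"
  unfolding kolmogorov_dist_def by (rule cSUP_least) (auto intro: assms)

lemma std_normal_cdf_eq: "measure std_normal_distribution {\<omega> \<in> space std_normal_distribution. \<omega> \<le> t} = std_normal_cdf t"
  by (simp add: std_normal_cdf_def atMost_def)

text \<open>Settles all \<open>n\<close> below the threshold from which blocks are
  available.\<close>

lemma kolmogorov_dist_normal_le_1:
  assumes "prob_space M" shows "kolmogorov_dist M Y std_normal_distribution (\<lambda>x. x) \<le> 1"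
proof (rule kolmogorov_dist_le)
  fix t
  have "0 \<le> measure M {\<omega> \<in> space M. Y \<omega> \<le> t}" "measure M {\<omega> \<in> space M. Y \<omega> \<le> t} \<le> 1"
    using prob_space.prob_le_1[OF assms] by auto
  thus "\<bar>measure M {\<omega> \<in> space M. Y \<omega> \<le> t} - measure std_normal_distribution {\<omega> \<in> space std_normal_distribution. \<omega> \<le> t}\<bar> \<le> 1"
    unfolding std_normal_cdf_eq using std_normal_cdf_bounds[of t] by linarith
qed

context iid_simplices begin

lemma Q_singleton: "measure Q {y} = 0"
  using Q_cball_le[of 0 y] measure_nonneg[of Q "{y}"] by (simp add: zero_power)

text \<open>Resampling \<open>x i\<close> with \<open>x j\<close> kept fixed reduces the claim to
  singletons, which are balls of radius zero and thus have mass zero.\<close>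

lemma AE_distinct:
  assumes ij: "i < n" "j < n" "i \<noteq> j" shows "AE x in single. x i \<noteq> x j"
proof -
  interpret S: prob_space single by (rule prob_single)
  let ?E = "{x \<in> space single. x i = x j}"
  have Em: "?E \<in> sets single" using coord_measurable[OF ij(1)] coord_measurable[OF ij(2)] by measurable
  define f where "f = (\<lambda>x. indicator ?E x :: real)"
  have fm: "f \<in> borel_measurable single" unfolding f_def using Em by (rule borel_measurable_indicator)
  have sp: "x \<in> space single \<Longrightarrow> x(i := y) \<in> space single" for x y
    using ij by (auto simp: space_PiM PiE_def extensional_def)
  have "measure single ?E = (\<integral>x. f x \<partial>single)" using Em by (simp add: f_def Int_absorb1 sets.sets_into_space)
  also have "\<dots> = (\<integral>x. (\<integral>y. f (x(i := y)) \<partial>Q) \<partial>single)"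
    by (rule resample_integral[OF _ _ fm, where B = 1]) (use ij in \<open>auto simp: f_def indicator_def\<close>)
  also have "\<dots> = (\<integral>x. 0 \<partial>single)"
  proof (rule Bochner_Integration.integral_cong[OF refl])
    fix x assume x: "x \<in> space single"
    have "(\<integral>y. f (x(i := y)) \<partial>Q) = (\<integral>y. indicator {x j} y \<partial>Q)"
      using ij sp[OF x] by (intro Bochner_Integration.integral_cong) (auto simp: f_def indicator_def)
    also have "\<dots> = 0" by (simp add: Q_singleton)
    finally show "(\<integral>y. f (x(i := y)) \<partial>Q) = 0" .
  qed
  finally have "measure single ?E = 0" by simp
  hence "emeasure single ?E = 0" by (simp add: S.emeasure_eq_measure)
  thus ?thesis using Em by (intro AE_I[of _ _ ?E]) auto
qed

lemma AE_functional: "AE x in single. alt_count S (x ` {..<n}) = functional x"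
proof -
  have 1: "AE x in single. \<forall>i\<in>{..<n}. \<forall>j\<in>{..<n}. i \<noteq> j \<longrightarrow> x i \<noteq> x j"
  proof (intro AE_finite_allI finite_lessThan)
    fix i j assume "i \<in> {..<n}" "j \<in> {..<n}"
    thus "AE x in single. i \<noteq> j \<longrightarrow> x i \<noteq> x j" using AE_distinct[of i j] by (cases "i = j") auto
  qed
  have c: "AE y in Q. y \<in> unit_cube"
  proof (rule AE_I[of _ _ "- cbox 0 1"])
    show "emeasure Q (- cbox 0 1) = 0"
      using Q_outside by (simp add: finite_measure.emeasure_eq_measure[OF prob_space.finite_measure[OF prob_Q]])
  qed (auto simp: unit_cube_def)
  have 2: "AE x in single. \<forall>i\<in>{..<n}. x i \<in> unit_cube"
    by (intro AE_finite_allI finite_lessThan AE_PiM_component[OF prob_Q _ c])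
  from 1 2 show ?thesis
  proof eventually_elim
    case (elim x)
    hence "inj_on x {..<n}" "x ` {..<n} \<subseteq> unit_cube" by (auto simp: inj_on_def)
    from functional_eq[OF this] show ?case ..
  qed
qed

text \<open>Coinciding points make the image smaller than the index set. Representing every point by
  its least index gives a formula that holds everywhere and not just almost everywhere.\<close>

lemma alt_count_measurable: "(\<lambda>x. alt_count S (x ` {..<n})) \<in> borel_measurable single"
proof -
  define first where "first x = {i \<in> {..<n}. \<forall>j<i. x j \<noteq> x i}" for x :: "nat \<Rightarrow> real ^ 'd"
  have eq: "alt_count S (x ` {..<n}) =
    (\<Sum>A\<in>Pow {..<n}. (- 1) ^ (card A + 1) * (of_bool (\<forall>i\<in>A. \<forall>j\<in>{..<i}. x j \<noteq> x i) * of_bool (x ` A \<in> S)))" for x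
  proof -
    have inj: "inj_on x (first x)"
    proof (rule inj_onI)
      fix i j assume "i \<in> first x" "j \<in> first x" "x i = x j"
      thus "i = j" by (cases i j rule: linorder_cases) (auto simp: first_def)
    qed
    have im: "x ` first x = x ` {..<n}"
    proof (intro equalityI subsetI)
      fix y assume "y \<in> x ` {..<n}"
      then obtain i where i: "i < n" "x i = y" by auto
      define k where "k = (LEAST k. x k = y)"
      have k: "x k = y" "k \<le> i" unfolding k_def using i(2) by (auto intro: LeastI Least_le)
      have "x j \<noteq> x k" if "j < k" for j using not_less_Least[of j "\<lambda>k. x k = y"] that k(1) unfolding k_def[symmetric] by auto
      hence "k \<in> first x" using k i by (auto simp: first_def)
      thus "y \<in> x ` first x" using k by auto
    qed (auto simp: first_def)
    have "alt_count S (x ` {..<n}) = (\<Sum>B\<in>Pow (first x). (- 1) ^ (card B + 1) * of_bool (x ` B \<in> S))"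
      unfolding im[symmetric] by (rule alt_count_image[OF inj])
    also have "\<dots> = (\<Sum>A\<in>Pow {..<n}. (- 1) ^ (card A + 1) * (of_bool (\<forall>i\<in>A. \<forall>j\<in>{..<i}. x j \<noteq> x i) * of_bool (x ` A \<in> S)))"
      by (rule sum.mono_neutral_cong_left) (auto simp: first_def)
    finally show ?thesis .
  qed
  show ?thesis unfolding eq
  proof (intro borel_measurable_sum borel_measurable_times borel_measurable_const)
    fix A assume A: "A \<in> Pow {..<n}"
    hence fA: "finite A" by (auto intro: finite_subset)
    have "Measurable.pred single (\<lambda>x. \<forall>i\<in>A. \<forall>j\<in>{..<i}. x j \<noteq> x i)"
    proof (intro pred_intros_finite(3) fA finite_lessThan)
      fix i j assume "i \<in> A" "j \<in> {..<i}"
      hence ij: "i < n" "j < n" using A by auto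
      show "Measurable.pred single (\<lambda>x. x j \<noteq> x i)"
      proof -
        have "(\<lambda>x. dist (x j) (x i)) \<in> borel_measurable single" by (intro borel_measurable_dist coord_measurable ij)
        hence "{x \<in> space single. 0 < dist (x j) (x i)} \<in> sets single" by measurable
        thus ?thesis by (simp only: pred_def zero_less_dist_iff)
      qed
    qed
    thus "(\<lambda>x. of_bool (\<forall>i\<in>A. \<forall>j\<in>{..<i}. x j \<noteq> x i) :: real) \<in> borel_measurable single" by measurable
    have "Measurable.pred single (\<lambda>x. x ` A \<in> S)" using S_meas A by blast
    thus "(\<lambda>x. of_bool (x ` A \<in> S) :: real) \<in> borel_measurable single" by measurable
  qed
qed

lemma distr_binomial:
  assumes P: "prob_space P" and indep: "prob_space.indep_vars P (\<lambda>_. borel) X {..<n}"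
    and dist: "\<And>i. i < n \<Longrightarrow> distributed P lborel (X i) (\<lambda>x. ennreal (q x))" and n: "0 < n"
  shows "(\<lambda>\<omega>. \<lambda>i\<in>{..<n}. X i \<omega>) \<in> measurable P single"
    "distr P single (\<lambda>\<omega>. \<lambda>i\<in>{..<n}. X i \<omega>) = single"
proof -
  interpret W: prob_space P by fact
  have rv: "X i \<in> measurable P borel" if "i \<in> {..<n}" for i
    using dist[of i] that by (auto simp: distributed_def)
  have Xi: "distr P borel (X i) = Q" if "i \<in> {..<n}" for i
  proof -
    have "distr P borel (X i) = distr P lborel (X i)" by (rule distr_cong) auto
    thus ?thesis using dist[of i] that by (simp add: distributed_def Q_def)
  qed
  have sb: "sets (PiM {..<n} (\<lambda>_. borel :: (real ^ 'd) measure)) = sets single"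
    by (rule sets_PiM_cong) auto
  have "(\<lambda>\<omega>. \<lambda>i\<in>{..<n}. X i \<omega>) \<in> measurable P (PiM {..<n} (\<lambda>_. borel))"
    by (rule measurable_restrict) (rule rv)
  thus "(\<lambda>\<omega>. \<lambda>i\<in>{..<n}. X i \<omega>) \<in> measurable P single"
    using measurable_cong_sets[OF refl sb] by blast
  have "distr P (PiM {..<n} (\<lambda>_. borel)) (\<lambda>\<omega>. \<lambda>i\<in>{..<n}. X i \<omega>) = PiM {..<n} (\<lambda>i. distr P borel (X i))"
    using W.indep_vars_iff_distr_eq_PiM'[of "{..<n}" X "\<lambda>_. borel"] indep rv n by auto
  also have "\<dots> = single" by (rule PiM_cong) (auto simp: Xi)
  finally show "distr P single (\<lambda>\<omega>. \<lambda>i\<in>{..<n}. X i \<omega>) = single"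
    by (subst distr_cong[OF refl sb[symmetric] refl])
qed

lemma binomial_bound:
  assumes P: "prob_space P" and indep: "prob_space.indep_vars P (\<lambda>_. borel) X {..<n}"
    and dist: "\<And>i. i < n \<Longrightarrow> distributed P lborel (X i) (\<lambda>x. ennreal (q x))"
    and \<xi>: "\<And>\<omega>. \<omega> \<in> space P \<Longrightarrow> Y \<omega> = alt_count S ((\<lambda>i. X i \<omega>) ` {..<n})"
    and n: "0 < n" and v: "0 < v" "v * real n \<le> (\<integral>x. (functional x - (\<integral>x. functional x \<partial>single))\<^sup>2 \<partial>single)"
    and C: "0 \<le> C"
  shows "kolmogorov_dist P (standardized P Y) std_normal_distribution (\<lambda>x. x)
     \<le> 3 * sqrt (2 * 256 ^ 4 * exp (512 * C)) / v * (1 / sqrt (real n))"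
proof -
  interpret W: prob_space P by fact
  define f where "f x = alt_count S (x ` {..<n})" for x
  have fm: "f \<in> borel_measurable single" unfolding f_def[abs_def] by (rule alt_count_measurable)
  define U where "U \<omega> = (\<lambda>i\<in>{..<n}. X i \<omega>)" for \<omega>
  have U: "U \<in> measurable P single" "distr P single U = single"
    using distr_binomial[OF P indep dist n] unfolding U_def[abs_def] by blast+
  have Yf: "Y \<omega> = f (U \<omega>)" if "\<omega> \<in> space P" for \<omega>
  proof -
    have "(\<lambda>i. X i \<omega>) ` {..<n} = U \<omega> ` {..<n}" unfolding U_def by (intro image_cong) auto
    thus ?thesis using \<xi>[OF that] by (simp add: f_def)
  qed
  have int: "(\<integral>\<omega>. g (Y \<omega>) \<partial>P) = (\<integral>x. g (functional x) \<partial>single)" if [measurable]: "g \<in> borel_measurable borel" for g :: "real \<Rightarrow> real"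
  proof -
    have "(\<integral>\<omega>. g (Y \<omega>) \<partial>P) = (\<integral>\<omega>. g (f (U \<omega>)) \<partial>P)" by (intro Bochner_Integration.integral_cong) (simp_all add: Yf)
    also have "\<dots> = (\<integral>x. g (f x) \<partial>distr P single U)"
      by (rule integral_distr[symmetric, OF U(1)]) (use fm in measurable)
    also have "\<dots> = (\<integral>x. g (functional x) \<partial>single)"
      unfolding U(2)
    proof (rule integral_cong_AE)
      show "AE x in single. g (f x) = g (functional x)" using AE_functional by (auto simp: f_def)
    qed (use fm functional_measurable in measurable)
    finally show ?thesis .
  qed
  define \<mu> where "\<mu> = (\<integral>x. functional x \<partial>single)"
  define \<sigma> where "\<sigma> = sqrt (\<integral>x. (functional x - \<mu>)\<^sup>2 \<partial>single)"
  have n0: "0 < real n" using n by simp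
  have var: "v * real n \<le> \<sigma>\<^sup>2" and \<sigma>2: "\<sigma>\<^sup>2 = (\<integral>x. (functional x - \<mu>)\<^sup>2 \<partial>single)"
    using v by (simp_all add: \<sigma>_def \<mu>_def)
  have \<sigma>0: "0 < \<sigma>" using var mult_pos_pos[OF v(1) n0] by (auto simp: \<sigma>_def)
  have mean: "W.expectation Y = \<mu>" unfolding \<mu>_def using int[of "\<lambda>x. x"] by simp
  have variance: "W.variance Y = \<sigma>\<^sup>2" unfolding mean \<sigma>2 using int[of "\<lambda>x. (x - \<mu>)\<^sup>2"] by simp
  have std: "standardized P Y \<omega> = (Y \<omega> - \<mu>) / \<sigma>" for \<omega>
    unfolding standardized_def variance unfolding mean using \<sigma>0 by simp
  show ?thesis
  proof (rule kolmogorov_dist_le)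
    fix t
    have "measure P {\<omega> \<in> space P. standardized P Y \<omega> \<le> t} = measure P (U -` {x \<in> space single. (f x - \<mu>) / \<sigma> \<le> t} \<inter> space P)"
      unfolding std using measurable_space[OF U(1)] by (intro arg_cong2[where f = measure] refl) (auto simp: Yf)
    also have "\<dots> = measure single {x \<in> space single. (f x - \<mu>) / \<sigma> \<le> t}"
      by (subst measure_distr[symmetric, OF U(1)]) (use fm in \<open>measurable, simp add: U(2)\<close>)
    also have "\<dots> = measure single {x \<in> space single. (functional x - \<mu>) / \<sigma> \<le> t}"
    proof (rule measure_eq_AE)
      show "AE x in single. x \<in> {x \<in> space single. (f x - \<mu>) / \<sigma> \<le> t} \<longleftrightarrow> x \<in> {x \<in> space single. (functional x - \<mu>) / \<sigma> \<le> t}"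
        using AE_functional unfolding f_def by eventually_elim simp
    qed (use fm functional_measurable in measurable)
    finally have "\<bar>measure P {\<omega> \<in> space P. standardized P Y \<omega> \<le> t} - std_normal_cdf t\<bar> \<le> 3 * sqrt (2 * 256 ^ 4 * exp (512 * C) * real n) / \<sigma>\<^sup>2"
      using Berry_Esseen_local[OF C \<mu>_def \<sigma>2 \<sigma>0, of t] by simp
    \<comment> \<open>The rate arises here: fluctuations of order \<open>sqrt n\<close> are divided
      by a variance of order \<open>n\<close>.\<close>
    also have "\<dots> \<le> 3 * sqrt (2 * 256 ^ 4 * exp (512 * C) * real n) / (v * real n)"
      using var v(1) n0 \<sigma>0 by (intro divide_left_mono mult_pos_pos) auto
    also have "\<dots> = 3 * sqrt (2 * 256 ^ 4 * exp (512 * C)) / v * (sqrt (real n) / real n)"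
      unfolding real_sqrt_mult[of _ "real n"] by simp
    also have "sqrt (real n) / real n = 1 / sqrt (real n)" using n0 by (simp add: field_simps)
    finally show "\<bar>measure P {\<omega> \<in> space P. standardized P Y \<omega> \<le> t} - measure std_normal_distribution {\<omega> \<in> space std_normal_distribution. \<omega> \<le> t}\<bar>
      \<le> 3 * sqrt (2 * 256 ^ 4 * exp (512 * C)) / v * (1 / sqrt (real n))"
      unfolding std_normal_cdf_eq .
  qed
qed

end

lemma sqrt_bound_trivial:
  assumes "n \<le> n0" "0 < n" shows "1 \<le> sqrt (real n0) * (1 / sqrt (real n))"
  using assms by (simp add: field_simps)

lemma powr_root_power: "0 < x \<Longrightarrow> (x powr (1 / real CARD('d::finite))) ^ CARD('d) = x"
  by (simp add: powr_powr flip: powr_realpow)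

theorem (in bounded_density) binomial_case:
  fixes K :: "real \<Rightarrow> (real ^ 'd) set \<Rightarrow> (real ^ 'd) set set"
  assumes K: "K = cech_complex \<or> K = rips_complex" and r: "0 < r"
  shows "\<exists>C\<^sub>0>0. \<forall>n\<ge>2. \<forall>(P :: 'w measure) \<xi>. binomial_point_process P \<xi> n q \<longrightarrow>
       kolmogorov_dist P (standardized P (\<lambda>\<omega>. euler_characteristic (K r (rescaled n (\<xi> \<omega>))))) std_normal_distribution (\<lambda>x. x)
         \<le> C\<^sub>0 * (1 / sqrt (real n))"
proof -
  obtain \<delta> \<kappa> n0 where \<delta>: "0 < \<delta>" and \<kappa>: "0 < \<kappa>" and blocks: "\<And>n. n0 \<le> n \<Longrightarrow> \<exists>Z a b N. finite (Z :: ('d \<Rightarrow> nat) set) \<and> \<kappa> * real n \<le> real (card Z) \<and>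
     (\<forall>z\<in>Z. good_block \<delta> (real n) (r / real n powr (1 / real CARD('d))) (a z) (b z) (N z)) \<and> disjoint_family_on N Z"
    using good_blocks[OF r] by blast
  define C where "C = M * (2 * r) ^ CARD('d)"
  have C: "0 \<le> C" using M_ge r by (simp add: C_def)
  define \<theta> where "\<theta> = (\<delta> / 2 * exp (- 2 / \<delta>))\<^sup>2 / (2 * (1 / \<delta>\<^sup>2 + 1))"
  have \<theta>: "0 < \<theta>" unfolding \<theta>_def using \<delta> by (intro divide_pos_pos zero_less_power mult_pos_pos add_nonneg_pos) auto
  define v where "v = \<kappa> * \<theta>"
  have v: "0 < v" using \<kappa> \<theta> by (simp add: v_def)
  \<comment> \<open>The threshold \<open>n0\<close> supplies the blocks; beyond
    \<open>2 / \<delta>\<close> the mass of a block is at most 1/2.\<close>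
  define n1 where "n1 = max n0 (nat \<lceil>2 / \<delta>\<rceil>)"
  define A where "A = 3 * sqrt (2 * 256 ^ 4 * exp (512 * C)) / v"
  have A: "0 \<le> A" using v by (simp add: A_def)
  \<comment> \<open>The root covers the \<open>n\<close> below the threshold, where the distance is
    at most 1, and the final 1 makes the constant positive.\<close>
  define C0 where "C0 = A + sqrt (real n1) + 1"
  have "kolmogorov_dist P (standardized P (\<lambda>\<omega>. euler_characteristic (K r (rescaled n (\<xi> \<omega>))))) std_normal_distribution (\<lambda>x. x)
         \<le> C0 * (1 / sqrt (real n))"
    if n: "2 \<le> n" and bpp: "binomial_point_process P \<xi> n q" for n :: nat and P :: "'w measure" and \<xi>
  proof -
    let ?Y = "\<lambda>\<omega>. euler_characteristic (K r (rescaled n (\<xi> \<omega>)))"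
    have psP: "prob_space P" using bpp by (simp add: binomial_point_process_def)
    have n0: "0 < real n" using n by simp
    show ?thesis
    proof (cases "n1 \<le> n")
      case False
      have "kolmogorov_dist P (standardized P ?Y) std_normal_distribution (\<lambda>x. x) \<le> 1"
        by (rule kolmogorov_dist_normal_le_1[OF psP])
      also have "\<dots> \<le> sqrt (real n1) * (1 / sqrt (real n))" using False n by (intro sqrt_bound_trivial) auto
      also have "\<dots> \<le> C0 * (1 / sqrt (real n))" using A by (intro mult_right_mono) (auto simp: C0_def)
      finally show ?thesis .
    next
      case True
      define c where "c = real n powr (1 / real CARD('d))"
      have c: "0 < c" using n0 by (simp add: c_def)
      have cd: "c ^ CARD('d) = real n" unfolding c_def by (rule powr_root_power[OF n0])
      define S where "S = scaled_simplices K c r"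
      interpret iid_simplices q M S "r / c" n C
      proof (intro iid_simplices.intro iid_simplices_axioms.intro)
        show "bounded_density q M" by (rule bounded_density_axioms)
        show "simplex_family S (r / c)" unfolding S_def by (rule simplex_family_scaled[OF K c r])
        show "Measurable.pred (PiM {..<n} (\<lambda>_. bounded_density.Q q)) (\<lambda>x. x ` A \<in> S)" if "A \<subseteq> {..<n}" for A
          unfolding S_def by (rule simplex_measurable[OF K that]) (use that in \<open>auto intro: finite_subset\<close>)
        show "real n * (M * (2 * (r / c)) ^ CARD('d)) \<le> C"
          using cd n0 by (simp add: C_def power_divide power_mult_distrib)
      qed
      obtain X where X: "prob_space.indep_vars P (\<lambda>_. borel) X {..<n}" "\<And>i. i < n \<Longrightarrow> distributed P lborel (X i) (\<lambda>x. ennreal (q x))"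
        "\<And>\<omega>. \<omega> \<in> space P \<Longrightarrow> \<xi> \<omega> = (\<lambda>i. X i \<omega>) ` {..<n}"
        using bpp unfolding binomial_point_process_def by blast
      have Y: "?Y \<omega> = alt_count S ((\<lambda>i. X i \<omega>) ` {..<n})" if "\<omega> \<in> space P" for \<omega>
        unfolding S_def rescaled_def X(3)[OF that] c_def[symmetric] by (rule complex_rescaled[OF K c]) simp
      have n1n: "n0 \<le> n" "2 / \<delta> \<le> real n" using True unfolding n1_def by linarith+
      obtain Z :: "('d \<Rightarrow> nat) set" and a b N where Z: "finite Z" "\<kappa> * real n \<le> real (card Z)"
        "\<And>z. z \<in> Z \<Longrightarrow> good_block \<delta> (real n) (r / c) (a z) (b z) (N z)" "disjoint_family_on N Z"
        using blocks[OF n1n(1)] unfolding c_def by blast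
      have "v * real n \<le> real (card Z) * \<theta>" using mult_right_mono[OF Z(2), of \<theta>] \<theta> by (simp add: v_def mult_ac)
      also have "\<dots> \<le> (\<integral>x. (functional x - (\<integral>x. functional x \<partial>single))\<^sup>2 \<partial>single)"
        unfolding \<theta>_def by (rule variance_lower_bound[OF Z(1,3,4) \<delta> n n1n(2)])
      finally have var: "v * real n \<le> (\<integral>x. (functional x - (\<integral>x. functional x \<partial>single))\<^sup>2 \<partial>single)" .
      have "kolmogorov_dist P (standardized P ?Y) std_normal_distribution (\<lambda>x. x) \<le> A * (1 / sqrt (real n))"
        unfolding A_def by (rule binomial_bound[OF psP X(1,2) Y _ v var C]) (use n in auto)
      also have "\<dots> \<le> C0 * (1 / sqrt (real n))" by (intro mult_right_mono) (auto simp: C0_def)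
      finally show ?thesis .
    qed
  qed
  moreover have "0 < C0" using A by (simp add: C0_def add_nonneg_pos)
  ultimately show ?thesis by blast
qed

section \<open>The Poisson process\<close>

locale poisson_process = bounded_density q M for q :: "real ^ 'd \<Rightarrow> real" and M +
  fixes W :: "'w measure" and pts :: "'w \<Rightarrow> (real ^ 'd) set" and n :: nat
  assumes prob_W: "prob_space W" and finite_pts: "\<omega> \<in> space W \<Longrightarrow> finite (pts \<omega>)"
    and count_meas: "A \<in> sets borel \<Longrightarrow> (\<lambda>\<omega>. card (pts \<omega> \<inter> A)) \<in> measurable W (count_space UNIV)"
    and count_law: "A \<in> sets borel \<Longrightarrow> measure W {\<omega> \<in> space W. card (pts \<omega> \<inter> A) = k}
      = exp (- (real n * measure Q A)) * (real n * measure Q A) ^ k / fact k"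
    and count_indep: "range D \<subseteq> sets borel \<Longrightarrow> disjoint_family D \<Longrightarrow>
      prob_space.indep_vars W (\<lambda>_. count_space UNIV) (\<lambda>i \<omega>. card (pts \<omega> \<inter> D i)) (UNIV :: nat set)"

lemma (in bounded_density) poisson_processI:
  assumes "poisson_point_process W pts (scale_measure (ennreal (real n)) (density lborel (\<lambda>x. ennreal (q x))))"
  shows "poisson_process q M W pts n"
proof -
  have m: "measure (scale_measure (ennreal (real n)) (density lborel (\<lambda>x. ennreal (q x)))) A = real n * measure Q A" for A
    by (simp add: Q_def)
  show ?thesis
    using assms unfolding poisson_point_process_def m
    by (intro poisson_process.intro bounded_density_axioms poisson_process_axioms.intro) auto
qed

context poisson_process begin

abbreviation count :: "(real ^ 'd) set \<Rightarrow> 'w \<Rightarrow> nat" where "count A \<omega> \<equiv> card (pts \<omega> \<inter> A)"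

lemma count_borel: "A \<in> sets borel \<Longrightarrow> (\<lambda>\<omega>. f (count A \<omega>) :: real) \<in> borel_measurable W"
  using measurable_compose[OF count_meas, of A f borel] by simp

lemma count_level:
  assumes "A \<in> sets borel" shows "{\<omega> \<in> space W. count A \<omega> = k} \<in> sets W"
proof -
  have "{\<omega> \<in> space W. count A \<omega> = k} = (\<lambda>\<omega>. count A \<omega>) -` {k} \<inter> space W" by auto
  also have "\<dots> \<in> sets W" by (rule measurable_sets[OF count_meas[OF assms]]) simp
  finally show ?thesis .
qed

text \<open>The generating function of a Poisson variable is finite everywhere. With
  \<open>z = 4\<close> it dominates the squares of all Euler characteristics that occur.\<close>

lemma integrable_power_total:
  fixes z :: real
  assumes z: "0 \<le> z" shows "integrable W (\<lambda>\<omega>. z ^ card (pts \<omega>))"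
proof -
  have U: "measure Q UNIV = 1" using prob_space.prob_space[OF prob_Q] by simp
  have meas: "(\<lambda>\<omega>. z ^ count UNIV \<omega>) \<in> borel_measurable W" by (rule count_borel[where f="\<lambda>k. z ^ k"]) simp
  have E: "{\<omega> \<in> space W. count UNIV \<omega> = k} \<in> sets W" for k
    by (rule count_level) simp
  interpret W: prob_space W by (rule prob_W)
  have "(\<integral>\<^sup>+\<omega>. ennreal (z ^ count UNIV \<omega>) \<partial>W) = (\<integral>\<^sup>+\<omega>. (\<Sum>k. ennreal (z ^ k) * indicator {\<omega> \<in> space W. count UNIV \<omega> = k} \<omega>) \<partial>W)"
  proof (rule nn_integral_cong)
    fix \<omega> assume w: "\<omega> \<in> space W"
    have "(\<Sum>k. ennreal (z ^ k) * indicator {\<omega> \<in> space W. count UNIV \<omega> = k} \<omega>) =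
      (\<Sum>k\<in>{count UNIV \<omega>}. ennreal (z ^ k) * indicator {\<omega> \<in> space W. count UNIV \<omega> = k} \<omega>)"
      by (rule suminf_finite) (auto simp: indicator_def)
    thus "ennreal (z ^ count UNIV \<omega>) = (\<Sum>k. ennreal (z ^ k) * indicator {\<omega> \<in> space W. count UNIV \<omega> = k} \<omega>)"
      using w by simp
  qed
  also have "\<dots> = (\<Sum>k. \<integral>\<^sup>+\<omega>. ennreal (z ^ k) * indicator {\<omega> \<in> space W. count UNIV \<omega> = k} \<omega> \<partial>W)"
    by (rule nn_integral_suminf) (intro borel_measurable_times_ennreal borel_measurable_const borel_measurable_indicator E)
  also have "\<dots> = (\<Sum>k. ennreal (exp (- real n) * ((z * real n) ^ k / fact k)))"
  proof (rule suminf_cong)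
    fix k
    have "(\<integral>\<^sup>+\<omega>. ennreal (z ^ k) * indicator {\<omega> \<in> space W. count UNIV \<omega> = k} \<omega> \<partial>W) = ennreal (z ^ k) * emeasure W {\<omega> \<in> space W. count UNIV \<omega> = k}"
      using E by (rule nn_integral_cmult_indicator)
    also have "\<dots> = ennreal (z ^ k) * ennreal (exp (- real n) * real n ^ k / fact k)"
      using count_law[of UNIV k] by (simp add: W.emeasure_eq_measure U)
    also have "\<dots> = ennreal (z ^ k * (exp (- real n) * real n ^ k / fact k))" using z by (intro ennreal_mult[symmetric]) auto
    also have "z ^ k * (exp (- real n) * real n ^ k / fact k) = exp (- real n) * ((z * real n) ^ k / fact k)"
      by (simp add: power_mult_distrib)
    finally show "(\<integral>\<^sup>+\<omega>. ennreal (z ^ k) * indicator {\<omega> \<in> space W. count UNIV \<omega> = k} \<omega> \<partial>W) = ennreal (exp (- real n) * ((z * real n) ^ k / fact k))" .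
  qed
  also have "\<dots> < \<infinity>"
  proof -
    have "summable (\<lambda>k. exp (- real n) * ((z * real n) ^ k / fact k))"
      using summable_exp[of "z * real n"] by (intro summable_mult) (simp add: field_simps)
    thus ?thesis using z by (subst suminf_ennreal2) auto
  qed
  finally have "(\<integral>\<^sup>+\<omega>. ennreal (norm (z ^ count UNIV \<omega>)) \<partial>W) < \<infinity>" using z by simp
  thus ?thesis using meas by (intro integrableI_bounded) auto
qed

lemma counts_independent:
  fixes D :: "nat \<Rightarrow> (real ^ 'd) set" and u v :: "(nat \<Rightarrow> nat) \<Rightarrow> real"
  assumes D: "range D \<subseteq> sets borel" "disjoint_family D" and IJ: "I \<inter> J = {}"
    and u: "u \<in> borel_measurable (PiM I (\<lambda>_. count_space UNIV))" and v: "v \<in> borel_measurable (PiM J (\<lambda>_. count_space UNIV))"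
    and iu: "integrable W (\<lambda>\<omega>. u (\<lambda>i\<in>I. count (D i) \<omega>))" and iv: "integrable W (\<lambda>\<omega>. v (\<lambda>i\<in>J. count (D i) \<omega>))"
  shows "(\<integral>\<omega>. u (\<lambda>i\<in>I. count (D i) \<omega>) * v (\<lambda>i\<in>J. count (D i) \<omega>) \<partial>W) =
      (\<integral>\<omega>. u (\<lambda>i\<in>I. count (D i) \<omega>) \<partial>W) * (\<integral>\<omega>. v (\<lambda>i\<in>J. count (D i) \<omega>) \<partial>W)"
proof -
  interpret W: prob_space W by (rule prob_W)
  have "W.indep_var borel (u \<circ> (\<lambda>\<omega>. \<lambda>i\<in>I. count (D i) \<omega>)) borel (v \<circ> (\<lambda>\<omega>. \<lambda>i\<in>J. count (D i) \<omega>))"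
    by (rule W.indep_var_compose[OF W.indep_var_restrict[OF count_indep[OF D] IJ] u v]) auto
  from W.indep_var_lebesgue_integral[OF this] iu iv show ?thesis by (simp add: comp_def)
qed

lemma distr_counts:
  fixes D :: "nat \<Rightarrow> (real ^ 'd) set"
  assumes D: "range D \<subseteq> sets borel" "disjoint_family D" and m: "0 < m"
  shows "distr W (PiM {..<m} (\<lambda>_. count_space UNIV)) (\<lambda>\<omega>. \<lambda>i\<in>{..<m}. count (D i) \<omega>)
    = PiM {..<m} (\<lambda>i. distr W (count_space UNIV) (count (D i)))"
proof -
  interpret W: prob_space W by (rule prob_W)
  have "W.indep_vars (\<lambda>_. count_space UNIV) (\<lambda>i. count (D i)) {..<m}"
    by (rule W.indep_vars_subset[OF count_indep[OF D]]) simp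
  thus ?thesis using W.indep_vars_iff_distr_eq_PiM'[of "{..<m}" "\<lambda>i. count (D i)" "\<lambda>_. count_space UNIV"] m D count_meas
    by (auto simp: image_subset_iff)
qed

text \<open>By \<open>1 - exp (- x) \<le> x\<close>, the probability that a cell is occupied is at
  most its mean number of points.\<close>

lemma prob_positive_le:
  assumes A: "A \<in> sets borel"
  shows "measure W {\<omega> \<in> space W. 0 < count A \<omega>} \<le> real n * measure Q A"
proof -
  interpret W: prob_space W by (rule prob_W)
  have E: "{\<omega> \<in> space W. count A \<omega> = 0} \<in> sets W"
    by (rule count_level[OF A])
  have "{\<omega> \<in> space W. 0 < count A \<omega>} = space W - {\<omega> \<in> space W. count A \<omega> = 0}" by auto
  hence "measure W {\<omega> \<in> space W. 0 < count A \<omega>} = 1 - measure W {\<omega> \<in> space W. count A \<omega> = 0}"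
    using W.prob_compl[OF E] by simp
  also have "\<dots> = 1 - exp (- (real n * measure Q A))" using count_law[OF A, of 0] by simp
  also have "\<dots> \<le> real n * measure Q A" using exp_ge_add_one_self[of "- (real n * measure Q A)"] by linarith
  finally show ?thesis .
qed

end

section \<open>Approximation by occupied cells\<close>

lemma finite_ball_cover:
  fixes K :: "'a::metric_space set"
  assumes "compact K" "0 < e"
  shows "\<exists>(m::nat) c. K \<subseteq> (\<Union>i<m. ball (c i) e)"
proof -
  obtain k where k: "finite k" "K \<subseteq> (\<Union>x\<in>k. ball x e)"
    using compact_eq_totally_bounded[THEN iffD1, OF assms(1)] assms(2) by blast
  obtain c :: "nat \<Rightarrow> 'a" and m where "k = c ` {i. i < m}" using finite_imp_nat_seg_image_inj_on[OF k(1)] by blast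
  with k(2) show ?thesis by (intro exI[of _ m] exI[of _ c]) (auto simp: lessThan_def)
qed

text \<open>The balls to be covered grow with \<open>k\<close>, so that every finite configuration,
  wherever its points lie, is eventually covered.\<close>

locale cell_sequence =
  fixes sz :: "nat \<Rightarrow> nat" and ctr :: "nat \<Rightarrow> nat \<Rightarrow> 'a::euclidean_space" and mesh :: "nat \<Rightarrow> real"
  assumes mesh: "mesh \<longlonglongrightarrow> 0" "0 < mesh k" and cover: "cball 0 (real k) \<subseteq> (\<Union>i<sz k. ball (ctr k i) (mesh k))"
begin

definition cell :: "nat \<Rightarrow> nat \<Rightarrow> 'a set" where
  "cell k i = (if i < sz k then ball (ctr k i) (mesh k) - (\<Union>j<i. ball (ctr k j) (mesh k)) else {})"

definition occupied :: "nat \<Rightarrow> (nat \<Rightarrow> nat) \<Rightarrow> nat set" where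
  "occupied k N = {i \<in> {..<sz k}. 0 < N i}"

lemma cell_borel: "cell k i \<in> sets borel" by (simp add: cell_def)

lemma cell_disjoint: "i \<noteq> j \<Longrightarrow> cell k i \<inter> cell k j = {}"
  by (cases i j rule: linorder_cases) (auto simp: cell_def)

lemma cell_center: "x \<in> cell k i \<Longrightarrow> dist (ctr k i) x < mesh k"
  by (auto simp: cell_def split: if_splits)

lemma sz_pos: "0 < sz k"
proof -
  have "(0 :: 'a) \<in> cball 0 (real k)" by simp
  thus ?thesis using cover[of k] by fastforce
qed

lemma in_cell:
  assumes "norm x \<le> real k" shows "\<exists>i<sz k. x \<in> cell k i"
proof -
  have ex: "\<exists>i. i < sz k \<and> x \<in> ball (ctr k i) (mesh k)" using cover[of k] assms by (auto simp: subset_iff)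
  define i where "i = (LEAST i. i < sz k \<and> x \<in> ball (ctr k i) (mesh k))"
  have i: "i < sz k \<and> x \<in> ball (ctr k i) (mesh k)" unfolding i_def by (rule LeastI_ex[OF ex])
  have "x \<notin> ball (ctr k j) (mesh k)" if "j < i" for j
    using not_less_Least[of j "\<lambda>i. i < sz k \<and> x \<in> ball (ctr k i) (mesh k)"] that i unfolding i_def[symmetric] by auto
  thus ?thesis using i by (auto simp: cell_def)
qed

text \<open>An occupied cell counts as one vertex at its centre, however many points it holds, so
  only finitely many index sets occur and the functional is bounded for fixed
  \<open>k\<close>.\<close>

definition cell_functional :: "'a set set \<Rightarrow> nat \<Rightarrow> (nat \<Rightarrow> nat) \<Rightarrow> real" where
  "cell_functional S k N = (\<Sum>B\<in>Pow {..<sz k}. (- 1) ^ (card B + 1) * of_bool ((\<forall>i\<in>B. 0 < N i) \<and> ctr k ` B \<in> S))"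

lemma cell_functional_occupied:
  "cell_functional S k N = (\<Sum>B\<in>Pow (occupied k N). (- 1) ^ (card B + 1) * of_bool (ctr k ` B \<in> S))"
  unfolding cell_functional_def by (rule sum.mono_neutral_cong_right) (auto simp: occupied_def)

text \<open>Choosing one point in each occupied cell is injective, because the cells are
  disjoint.\<close>

lemma card_occupied:
  assumes "finite A" shows "card (occupied k (\<lambda>i. card (A \<inter> cell k i))) \<le> card A"
proof -
  define g where "g i = (SOME x. x \<in> A \<inter> cell k i)" for i
  have g: "g i \<in> A \<inter> cell k i" if "i \<in> occupied k (\<lambda>i. card (A \<inter> cell k i))" for i
  proof -
    have "A \<inter> cell k i \<noteq> {}" using that by (auto simp: occupied_def card_gt_0_iff)
    thus ?thesis unfolding g_def by (rule some_in_eq[THEN iffD2])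
  qed
  have "inj_on g (occupied k (\<lambda>i. card (A \<inter> cell k i)))"
  proof (rule inj_onI)
    fix i j assume ij: "i \<in> occupied k (\<lambda>i. card (A \<inter> cell k i))" "j \<in> occupied k (\<lambda>i. card (A \<inter> cell k i))" "g i = g j"
    show "i = j" using g[OF ij(1)] g[OF ij(2)] ij(3) cell_disjoint[of i j k] by auto
  qed
  thus ?thesis using g assms by (intro card_inj_on_le[of g]) auto
qed

text \<open>The bound does not depend on \<open>k\<close>, as dominated convergence
  requires.\<close>

lemma cell_functional_bound:
  assumes "finite A" shows "\<bar>cell_functional S k (\<lambda>i. card (A \<inter> cell k i))\<bar> \<le> 2 ^ card A"
proof -
  let ?O = "occupied k (\<lambda>i. card (A \<inter> cell k i))"
  have "\<bar>cell_functional S k (\<lambda>i. card (A \<inter> cell k i))\<bar> \<le> (\<Sum>B\<in>Pow ?O. 1)"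
    unfolding cell_functional_occupied by (rule order_trans[OF sum_abs]) (intro sum_mono, auto simp: abs_mult)
  also have "\<dots> = 2 ^ card ?O" by (simp add: card_Pow occupied_def)
  also have "\<dots> \<le> 2 ^ card A" using card_occupied[OF assms] by (intro power_increasing) auto
  finally show ?thesis .
qed

text \<open>From some \<open>k\<close> on, all points of \<open>A\<close> are covered, different
  points lie in different cells, and for each of the finitely many subsets the centres span a
  simplex exactly if the points do. Then occupied cells and points correspond bijectively.\<close>

lemma cell_functional_eventually:
  assumes A: "finite A" and S: "\<And>p \<sigma>. finite \<sigma> \<Longrightarrow> (\<And>x. x \<in> \<sigma> \<Longrightarrow> eventually (\<lambda>k. dist (p k x) x \<le> mesh k) sequentially)
      \<Longrightarrow> eventually (\<lambda>k. p k ` \<sigma> \<in> Sk k \<longleftrightarrow> \<sigma> \<in> S) sequentially"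
  shows "eventually (\<lambda>k. cell_functional (Sk k) k (\<lambda>i. card (A \<inter> cell k i)) = alt_count S A) sequentially"
proof -
  define idx where "idx k x = (SOME i. x \<in> cell k i)" for k x
  define p where "p k x = ctr k (idx k x)" for k x
  have inc: "eventually (\<lambda>k. x \<in> cell k (idx k x)) sequentially" for x
  proof -
    obtain k0 :: nat where "norm x \<le> real k0" using real_arch_simple by blast
    hence "norm x \<le> real k" if "k0 \<le> k" for k using that by linarith
    hence "\<exists>i. x \<in> cell k i" if "k0 \<le> k" for k using in_cell[of x k] that by blast
    thus ?thesis unfolding idx_def eventually_sequentially by (meson someI_ex)
  qed
  have pd: "eventually (\<lambda>k. dist (p k x) x \<le> mesh k) sequentially" for x
    using inc[of x] by eventually_elim (use cell_center in \<open>force simp: p_def\<close>)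
  have e1: "eventually (\<lambda>k. \<forall>x\<in>A. x \<in> cell k (idx k x)) sequentially"
    by (rule eventually_ball_finite[OF A]) (use inc in blast)
  have e2: "eventually (\<lambda>k. \<forall>x\<in>A. \<forall>y\<in>A. x \<noteq> y \<longrightarrow> 2 * mesh k < dist x y) sequentially"
  proof (intro eventually_ball_finite A ballI)
    fix x y assume "x \<in> A" "y \<in> A"
    show "eventually (\<lambda>k. x \<noteq> y \<longrightarrow> 2 * mesh k < dist x y) sequentially"
    proof (cases "x = y")
      case False
      have "(\<lambda>k. 2 * mesh k) \<longlonglongrightarrow> 2 * 0" by (intro tendsto_intros mesh)
      from order_tendstoD(2)[OF this, of "dist x y"] False show ?thesis by simp
    qed simp
  qed
  have e3: "eventually (\<lambda>k. \<forall>\<sigma>\<in>Pow A. p k ` \<sigma> \<in> Sk k \<longleftrightarrow> \<sigma> \<in> S) sequentially"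
  proof (rule eventually_ball_finite)
    show "finite (Pow A)" using A by simp
    show "\<forall>\<sigma>\<in>Pow A. eventually (\<lambda>k. p k ` \<sigma> \<in> Sk k \<longleftrightarrow> \<sigma> \<in> S) sequentially"
      using A by (auto intro!: S pd intro: finite_subset)
  qed
  from e1 e2 e3 show ?thesis
  proof eventually_elim
    case (elim k)
    have inj: "inj_on (idx k) A"
    proof (rule inj_onI, rule ccontr)
      fix x y assume xy: "x \<in> A" "y \<in> A" "idx k x = idx k y" "x \<noteq> y"
      have "dist (ctr k (idx k x)) x < mesh k" "dist (ctr k (idx k x)) y < mesh k"
        using elim(1) xy cell_center by (metis, metis)
      hence "dist x y < 2 * mesh k" using dist_triangle3[of x y "ctr k (idx k x)"] by linarith
      thus False using elim(2) xy by fastforce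
    qed
    have idx: "x \<in> cell k i \<Longrightarrow> x \<in> A \<Longrightarrow> idx k x = i" for x i
      using elim(1) cell_disjoint[of "idx k x" i k] by auto
    have occ: "occupied k (\<lambda>i. card (A \<inter> cell k i)) = idx k ` A"
    proof (intro equalityI subsetI)
      fix i assume "i \<in> occupied k (\<lambda>i. card (A \<inter> cell k i))"
      then obtain x where "x \<in> A" "x \<in> cell k i" by (auto simp: occupied_def card_gt_0_iff)
      thus "i \<in> idx k ` A" using idx by auto
    next
      fix i assume "i \<in> idx k ` A"
      then obtain x where x: "x \<in> A" "i = idx k x" by auto
      hence xc: "x \<in> cell k i" using elim(1) by auto
      hence "i < sz k" by (auto simp: cell_def split: if_splits)
      thus "i \<in> occupied k (\<lambda>i. card (A \<inter> cell k i))" using x xc A by (auto simp: occupied_def card_gt_0_iff)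
    qed
    have bij: "bij_betw ((`) (idx k)) (Pow A) (Pow (idx k ` A))" by (intro bij_betw_imageI inj_on_image_Pow inj image_Pow_surj refl)
    have "cell_functional (Sk k) k (\<lambda>i. card (A \<inter> cell k i)) =
       (\<Sum>\<sigma>\<in>Pow A. (- 1) ^ (card (idx k ` \<sigma>) + 1) * of_bool (ctr k ` (idx k ` \<sigma>) \<in> Sk k))"
      unfolding cell_functional_occupied occ by (rule sum.reindex_bij_betw[OF bij, symmetric])
    also have "\<dots> = alt_count S A" unfolding alt_count_def
    proof (intro sum.cong refl)
      fix \<sigma> assume s: "\<sigma> \<in> Pow A"
      hence "card (idx k ` \<sigma>) = card \<sigma>" using inj by (intro card_image) (auto intro: inj_on_subset)
      moreover have "ctr k ` (idx k ` \<sigma>) = p k ` \<sigma>" by (auto simp: p_def image_image)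
      ultimately show "(- 1 :: real) ^ (card (idx k ` \<sigma>) + 1) * of_bool (ctr k ` (idx k ` \<sigma>) \<in> Sk k) = (- 1) ^ (card \<sigma> + 1) * of_bool (\<sigma> \<in> S)"
        using elim(3) s by simp
    qed
    finally show ?case .
  qed
qed

end

lemma cell_sequence_exists: "\<exists>sz (ctr :: nat \<Rightarrow> nat \<Rightarrow> 'a::euclidean_space). cell_sequence sz ctr (\<lambda>k. 1 / real (Suc k))"
proof -
  have "\<exists>(m::nat) c. cball (0 :: 'a) (real k) \<subseteq> (\<Union>i<m. ball (c i) (1 / real (Suc k)))" for k :: nat
    by (rule finite_ball_cover) auto
  then obtain sz :: "nat \<Rightarrow> nat" and ctr :: "nat \<Rightarrow> nat \<Rightarrow> 'a" where "\<And>k. cball 0 (real k) \<subseteq> (\<Union>i<sz k. ball (ctr k i) (1 / real (Suc k)))"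
    by metis
  hence "cell_sequence sz ctr (\<lambda>k. 1 / real (Suc k))"
    using LIMSEQ_inverse_real_of_nat unfolding inverse_eq_divide by unfold_locales simp_all
  thus ?thesis by blast
qed

text \<open>Eventual equality replaces continuity: \<open>g\<close> may be the indicator of a
  half-line, which is what convergence of distribution functions requires.\<close>

lemma tendsto_comp_eventually_eq:
  assumes "eventually (\<lambda>k. f k = l) sequentially"
  shows "(\<lambda>k. g (f k) :: real) \<longlonglongrightarrow> g l"
  by (rule tendsto_eventually) (use assms in \<open>auto elim: eventually_mono\<close>)

section \<open>Normal approximation for the Poisson process by refining the mesh\<close>

locale poisson_complex = poisson_process q M W pts n
  for q :: "real ^ 'd \<Rightarrow> real" and M and W :: "'w measure" and pts n +
  fixes K :: "real \<Rightarrow> (real ^ 'd) set \<Rightarrow> (real ^ 'd) set set" and r c :: real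
    and sz :: "nat \<Rightarrow> nat" and ctr :: "nat \<Rightarrow> nat \<Rightarrow> real ^ 'd" and mesh :: "nat \<Rightarrow> real"
  assumes K: "K = cech_complex \<or> K = rips_complex" and r: "0 < r" and c: "0 < c" and n_pos: "0 < n"
    and cells: "cell_sequence sz ctr mesh"
begin

sublocale cell_sequence sz ctr mesh by (rule cells)

definition S where "S = scaled_simplices K c r"
definition Sk where "Sk k = perturbed K c r (mesh k)"

sublocale simplex_family S "r / c" unfolding S_def by (rule simplex_family_scaled[OF K c r])

text \<open>The restriction to \<open>B\<close> makes it possible to approximate separately the
  contribution of the points outside a block.\<close>

definition approx :: "(real ^ 'd) set \<Rightarrow> nat \<Rightarrow> 'w \<Rightarrow> real" where
  "approx B k \<omega> = cell_functional (Sk k) k (\<lambda>i. card (pts \<omega> \<inter> B \<inter> cell k i))"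

lemma approx_eventually:
  assumes "\<omega> \<in> space W"
  shows "eventually (\<lambda>k. approx B k \<omega> = alt_count S (pts \<omega> \<inter> B)) sequentially"
  unfolding approx_def
proof (rule cell_functional_eventually)
  show "finite (pts \<omega> \<inter> B)" using finite_pts[OF assms] by simp
  fix p :: "nat \<Rightarrow> real ^ 'd \<Rightarrow> real ^ 'd" and \<sigma>
  assume "finite \<sigma>" "\<And>x. x \<in> \<sigma> \<Longrightarrow> eventually (\<lambda>k. dist (p k x) x \<le> mesh k) sequentially"
  thus "eventually (\<lambda>k. p k ` \<sigma> \<in> Sk k \<longleftrightarrow> \<sigma> \<in> S) sequentially"
    unfolding Sk_def S_def by (intro perturbed_eventually[OF K c]) (auto intro: mesh less_imp_le)
qed

lemma approx_bound:
  assumes "\<omega> \<in> space W" shows "\<bar>approx B k \<omega>\<bar> \<le> 2 ^ card (pts \<omega>)"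
proof -
  have "\<bar>approx B k \<omega>\<bar> \<le> 2 ^ card (pts \<omega> \<inter> B)"
    unfolding approx_def by (rule cell_functional_bound) (use finite_pts[OF assms] in simp)
  also have "\<dots> \<le> 2 ^ card (pts \<omega>)" using finite_pts[OF assms] by (intro power_increasing card_mono) auto
  finally show ?thesis .
qed

lemma cell_functional_cong: "(\<And>i. i < sz k \<Longrightarrow> N i = N' i) \<Longrightarrow> cell_functional T k N = cell_functional T k N'"
  unfolding cell_functional_def by (intro sum.cong refl) (auto simp: subset_iff)

lemma cell_functional_measurable:
  assumes "{..<sz k} \<subseteq> I" and \<nu>: "\<And>i. sets (\<nu> i) = UNIV"
  shows "cell_functional T k \<in> borel_measurable (PiM I \<nu>)"
  unfolding cell_functional_def
proof (intro borel_measurable_sum borel_measurable_times borel_measurable_const)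
  fix B assume B: "B \<in> Pow {..<sz k}"
  have fB: "finite B" using B by (auto intro: finite_subset)
  have "Measurable.pred (PiM I \<nu>) (\<lambda>N. \<forall>i\<in>B. 0 < N i)"
  proof (rule pred_intros_finite(3)[OF fB])
    fix i assume "i \<in> B"
    hence "i \<in> I" using B assms by auto
    show "Measurable.pred (PiM I \<nu>) (\<lambda>N. 0 < N i)"
      by (rule measurable_compose[OF measurable_component_singleton[OF \<open>i \<in> I\<close>, of \<nu>]]) (auto simp: measurable_def \<nu>)
  qed
  thus "(\<lambda>N. of_bool ((\<forall>i\<in>B. 0 < N i) \<and> ctr k ` B \<in> T) :: real) \<in> borel_measurable (PiM I \<nu>)" by measurable
qed

lemma approx_measurable:
  assumes B: "B \<in> sets borel" shows "approx B k \<in> borel_measurable W"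
proof -
  have "(\<lambda>\<omega>. \<lambda>i\<in>{..<sz k}. count (B \<inter> cell k i) \<omega>) \<in> measurable W (PiM {..<sz k} (\<lambda>_. count_space UNIV))"
    by (rule measurable_restrict) (use B in \<open>auto intro!: count_meas sets.Int cell_borel\<close>)
  from measurable_compose[OF this cell_functional_measurable[of k "{..<sz k}" "\<lambda>_. count_space UNIV" "Sk k"]]
  have "(\<lambda>\<omega>. cell_functional (Sk k) k (\<lambda>i\<in>{..<sz k}. count (B \<inter> cell k i) \<omega>)) \<in> borel_measurable W" by auto
  moreover have "cell_functional (Sk k) k (\<lambda>i\<in>{..<sz k}. count (B \<inter> cell k i) \<omega>) = approx B k \<omega>" for \<omega>
    unfolding approx_def by (rule cell_functional_cong) (auto simp: Int_assoc)
  ultimately show ?thesis by simp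
qed

definition chi :: "(real ^ 'd) set \<Rightarrow> 'w \<Rightarrow> real" where "chi B \<omega> = alt_count S (pts \<omega> \<inter> B)"

lemma chi_limit: "\<omega> \<in> space W \<Longrightarrow> (\<lambda>k. g (approx B k \<omega>) :: real) \<longlonglongrightarrow> g (chi B \<omega>)"
  unfolding chi_def by (rule tendsto_comp_eventually_eq[OF approx_eventually])

lemma chi_measurable: "B \<in> sets borel \<Longrightarrow> chi B \<in> borel_measurable W"
  by (rule borel_measurable_LIMSEQ_real[of W "approx B"]) (auto intro: chi_limit[of _ "\<lambda>x. x"] approx_measurable)

text \<open>Dominated convergence with majorant
  \<open>(a + b * 4 ^ card (pts \<omega>)) * L\<close>. The choices \<open>x\<close>,
  \<open>x\<^sup>2\<close> and an indicator for \<open>g\<close> give means, second moments and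
  distribution functions; the weight \<open>h\<close> gives covariances with the block
  tests.\<close>

lemma approx_dominated:
  assumes B: "B \<in> sets borel" and g: "g \<in> borel_measurable borel" "\<And>x. \<bar>g x\<bar> \<le> a + b * x\<^sup>2" "0 \<le> b"
    and h: "h \<in> borel_measurable W" "\<And>\<omega>. \<bar>h \<omega>\<bar> \<le> L"
  shows "(\<lambda>k. \<integral>\<omega>. g (approx B k \<omega>) * h \<omega> \<partial>W) \<longlonglongrightarrow> (\<integral>\<omega>. g (chi B \<omega>) * h \<omega> \<partial>W)"
    and "integrable W (\<lambda>\<omega>. g (chi B \<omega>) * h \<omega>)" and "integrable W (\<lambda>\<omega>. g (approx B k \<omega>) * h \<omega>)"
proof -
  interpret W: prob_space W by (rule prob_W)
  have L: "0 \<le> L" using order_trans[OF abs_ge_zero h(2)] .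
  define w where "w \<omega> = (a + b * 4 ^ card (pts \<omega>)) * L" for \<omega>
  have wi: "integrable W w" unfolding w_def using integrable_power_total[of 4] by simp
  have dom: "\<bar>g x * h \<omega>\<bar> \<le> w \<omega>" if "\<bar>x\<bar> \<le> 2 ^ card (pts \<omega>)" for x \<omega>
  proof -
    have "x\<^sup>2 \<le> (2 ^ card (pts \<omega>))\<^sup>2" using that abs_le_square_iff[of x "2 ^ card (pts \<omega>)"] by simp
    also have "\<dots> = 4 ^ card (pts \<omega>)" by (simp flip: power_mult add: mult.commute[of _ 2]) (simp add: power_mult)
    finally have "\<bar>g x\<bar> \<le> a + b * 4 ^ card (pts \<omega>)" using order_trans[OF g(2) add_left_mono[OF mult_left_mono]] g(3) by blast
    thus ?thesis unfolding w_def by (intro abs_mult_bound h)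
  qed
  have m1: "(\<lambda>\<omega>. g (chi B \<omega>) * h \<omega>) \<in> borel_measurable W" using chi_measurable[OF B] g(1) h(1) by measurable
  have m2: "(\<lambda>\<omega>. g (approx B k \<omega>) * h \<omega>) \<in> borel_measurable W" for k using approx_measurable[OF B] g(1) h(1) by measurable
  have l: "AE \<omega> in W. (\<lambda>k. g (approx B k \<omega>) * h \<omega>) \<longlonglongrightarrow> g (chi B \<omega>) * h \<omega>"
    by (intro AE_I2 tendsto_mult chi_limit tendsto_const)
  have d: "AE \<omega> in W. norm (g (approx B k \<omega>) * h \<omega>) \<le> w \<omega>" for k
    by (intro AE_I2) (use dom approx_bound in auto)
  show "(\<lambda>k. \<integral>\<omega>. g (approx B k \<omega>) * h \<omega> \<partial>W) \<longlonglongrightarrow> (\<integral>\<omega>. g (chi B \<omega>) * h \<omega> \<partial>W)"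
    by (rule integral_dominated_convergence[OF m1 m2 wi l d])
  show "integrable W (\<lambda>\<omega>. g (chi B \<omega>) * h \<omega>)"
    by (rule integrable_dominated_convergence[OF m1 m2 wi l d])
  show "integrable W (\<lambda>\<omega>. g (approx B k \<omega>) * h \<omega>)"
    by (rule integrable_dominated_convergence2[OF m1 m2 wi l d])
qed

definition mu where "mu = (\<integral>\<omega>. chi UNIV \<omega> \<partial>W)"
definition sig2 where "sig2 = (\<integral>\<omega>. (chi UNIV \<omega> - mu)\<^sup>2 \<partial>W)"
definition cell_law where "cell_law k i = distr W (count_space UNIV) (count (cell k i))"

lemma prob_cell_law: "prob_space (cell_law k i)"
  unfolding cell_law_def by (rule prob_space.prob_space_distr[OF prob_W count_meas[OF cell_borel]])

lemma sets_cell_law: "sets (cell_law k i) = UNIV" and space_cell_law: "space (cell_law k i) = UNIV"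
  by (simp_all add: cell_law_def)

lemma cell_law_positive: "measure (cell_law k i) {a \<in> space (cell_law k i). 0 < a} \<le> real n * measure Q (cell k i)"
proof -
  have "measure (cell_law k i) {a. 0 < a} = measure W (count (cell k i) -` {a. 0 < a} \<inter> space W)"
    unfolding cell_law_def by (rule measure_distr[OF count_meas[OF cell_borel]]) simp
  also have "count (cell k i) -` {a. 0 < a} \<inter> space W = {\<omega> \<in> space W. 0 < count (cell k i) \<omega>}" by auto
  also have "measure W \<dots> \<le> real n * measure Q (cell k i)" by (rule prob_positive_le[OF cell_borel])
  finally show ?thesis by (simp add: space_cell_law)
qed

lemma cell_sum:
  assumes "I \<subseteq> {..<sz k}" "A \<in> sets borel" "\<And>i. i \<in> I \<Longrightarrow> cell k i \<subseteq> A"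
  shows "(\<Sum>i\<in>I. real n * measure Q (cell k i)) \<le> real n * measure Q A"
proof -
  interpret Q: prob_space Q by (rule prob_Q)
  have fI: "finite I" using assms(1) by (rule finite_subset) simp
  have "(\<Sum>i\<in>I. measure Q (cell k i)) = measure Q (\<Union>i\<in>I. cell k i)"
    by (rule Q.finite_measure_finite_Union[symmetric]) (use fI cell_disjoint cell_borel in \<open>auto simp: disjoint_family_on_def\<close>)
  also have "\<dots> \<le> measure Q A" by (rule Q.finite_measure_mono) (use assms in auto)
  finally show ?thesis by (simp add: mult_left_mono flip: sum_distrib_left)
qed

text \<open>For fixed mesh the approximation is a local functional of the independent cell counts,
  with the empty cell as dead value. The constants do not depend on the number of cells: the
  occupation probabilities sum to at most \<open>n\<close>, and those near a given cell are bounded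
  by the mean number of points in a ball.\<close>

lemma approx_Berry_Esseen:
  assumes mesh_small: "mesh k \<le> r / (4 * c)"
    and \<mu>: "\<mu> = (\<integral>\<omega>. approx UNIV k \<omega> \<partial>W)" and \<sigma>: "\<sigma>\<^sup>2 = (\<integral>\<omega>. (approx UNIV k \<omega> - \<mu>)\<^sup>2 \<partial>W)" "0 < \<sigma>"
    and C: "real n * (M * (6 * (r / c)) ^ CARD('d)) \<le> C"
  shows "\<bar>measure W {\<omega> \<in> space W. (approx UNIV k \<omega> - \<mu>) / \<sigma> \<le> z} - std_normal_cdf z\<bar>
    \<le> 3 * sqrt (2 * 256 ^ 4 * exp (512 * C) * real n) / \<sigma>\<^sup>2"
proof -
  define rk where "rk = (if K = cech_complex then r + 2 * c * mesh k else r - 2 * c * mesh k)"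
  have cm: "0 < 2 * c * mesh k" "2 * c * mesh k \<le> r / 2"
    using mesh_small c mesh(2)[of k] by (auto simp: field_simps)
  have rk: "0 < rk" "rk \<le> 2 * r" using cm r unfolding rk_def by auto
  have Sk: "Sk k = scaled_simplices K c rk" by (simp add: Sk_def perturbed_def rk_def)
  interpret F: simplex_family "Sk k" "rk / c" unfolding Sk by (rule simplex_family_scaled[OF K c rk(1)])
  have rkc: "rk / c \<le> 2 * (r / c)" using rk c by (simp add: field_simps)
  define h where "h A x = (- 1 :: real) ^ (card A + 1) * of_bool ((\<forall>i\<in>A. 0 < x i) \<and> ctr k ` A \<in> Sk k)" for A and x :: "nat \<Rightarrow> nat"
  \<comment> \<open>The small mesh keeps the perturbed parameter \<open>rk\<close> at most
    \<open>2 * r\<close>, which fixes this distance independently of the mesh.\<close>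
  define near where "near i j a b \<longleftrightarrow> 0 < a \<and> 0 < b \<and> dist (ctr k i) (ctr k j) \<le> 2 * (r / c)" for i j and a b :: nat
  have C0: "0 \<le> C"
  proof -
    have "0 \<le> real n * (M * (6 * (r / c)) ^ CARD('d))" using M_ge r c by simp
    thus ?thesis using C by linarith
  qed
  interpret L: local_functional "cell_law k" "sz k" h "\<lambda>_ a. 0 < a" near "\<lambda>_. 0" C "real n"
  proof (intro local_functional.intro indep_seq.intro indep_family.intro local_functional_axioms.intro, goal_cases)
    case (1 i) show ?case by (rule prob_cell_law)
  next
    case (2 A)
    have fA: "finite A" using 2 by (rule finite_subset) simp
    have "Measurable.pred (PiM {..<sz k} (cell_law k)) (\<lambda>N. \<forall>i\<in>A. 0 < N i)"
    proof (rule pred_intros_finite(3)[OF fA])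
      fix i assume "i \<in> A"
      hence i: "i \<in> {..<sz k}" using 2 by auto
      show "Measurable.pred (PiM {..<sz k} (cell_law k)) (\<lambda>N. 0 < N i)"
        by (rule measurable_compose[OF measurable_component_singleton[OF i, of "cell_law k"]])
          (auto simp: measurable_def sets_cell_law)
    qed
    thus ?case unfolding h_def by measurable
  next
    case (3 A x x') thus ?case by (auto simp: h_def)
  next
    case (6 A x i j)
    hence "dist (ctr k i) (ctr k j) \<le> rk / c" using F.simplex_dist[of "ctr k ` A" "ctr k i" "ctr k j"] by (auto simp: h_def)
    thus ?case using 6 rkc by (auto simp: h_def near_def)
  next
    case (8 i j)
    have [measurable_cong]: "sets (cell_law k i) = sets (count_space UNIV)" "sets (cell_law k j) = sets (count_space UNIV)"
      by (simp_all add: sets_cell_law)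
    show ?case unfolding near_def by measurable
  next
    case (9 i) show ?case by (simp add: pred_def sets_cell_law)
  next
    case 12
    have "(\<Sum>i<sz k. measure (cell_law k i) {a \<in> space (cell_law k i). 0 < a}) \<le> (\<Sum>i<sz k. real n * measure Q (cell k i))"
      by (intro sum_mono cell_law_positive)
    also have "\<dots> \<le> real n * measure Q UNIV" by (rule cell_sum) auto
    finally show ?case using prob_space.prob_space[OF prob_Q] by simp
  next
    case (13 j b)
    define I where "I = {i \<in> {..<sz k}. dist (ctr k i) (ctr k j) \<le> 2 * (r / c)}"
    have "(\<Sum>i<sz k. measure (cell_law k i) {a \<in> space (cell_law k i). near i j a b}) \<le>
      (\<Sum>i<sz k. if i \<in> I then real n * measure Q (cell k i) else 0)"
    proof (rule sum_mono)
      fix i assume i: "i \<in> {..<sz k}"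
      show "measure (cell_law k i) {a \<in> space (cell_law k i). near i j a b} \<le> (if i \<in> I then real n * measure Q (cell k i) else 0)"
      proof (cases "i \<in> I")
        case True
        have "measure (cell_law k i) {a \<in> space (cell_law k i). near i j a b} \<le> measure (cell_law k i) {a \<in> space (cell_law k i). 0 < a}"
          by (rule finite_measure.finite_measure_mono[OF prob_space.finite_measure[OF prob_cell_law]]) (auto simp: near_def sets_cell_law)
        also have "\<dots> \<le> real n * measure Q (cell k i)" by (rule cell_law_positive)
        finally show ?thesis using True by simp
      next
        case False
        hence e: "{a \<in> space (cell_law k i). near i j a b} = {}" using i by (auto simp: near_def I_def)
        show ?thesis unfolding e using False by (simp only: measure_empty if_False order_refl)
      qed
    qed
    also have "\<dots> = (\<Sum>i\<in>I. real n * measure Q (cell k i))"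
      by (rule sum.mono_neutral_cong_right) (auto simp: I_def)
    \<comment> \<open>Near cells have centres within \<open>2 * (r / c)\<close> and radius at most
      \<open>r / c\<close>. The ball estimate doubles the resulting 3, which gives the 6 in the
      hypothesis on \<open>C\<close>.\<close>
    also have "\<dots> \<le> real n * measure Q (cball (ctr k j) (3 * (r / c)))"
    proof (rule cell_sum)
      fix i assume "i \<in> I"
      hence d: "dist (ctr k j) (ctr k i) \<le> 2 * (r / c)" by (simp add: I_def dist_commute)
      have m: "mesh k \<le> r / c" using cm c r by (simp add: field_simps)
      show "cell k i \<subseteq> cball (ctr k j) (3 * (r / c))"
      proof
        fix x assume "x \<in> cell k i"
        from cell_center[OF this] d m dist_triangle[of "ctr k j" x "ctr k i"] show "x \<in> cball (ctr k j) (3 * (r / c))" by simp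
      qed
    qed (auto simp: I_def)
    also have "\<dots> \<le> real n * (M * (2 * (3 * (r / c))) ^ CARD('d))" using r c by (intro mult_left_mono Q_cball_le) auto
    finally show ?case using C by simp
  qed (auto simp: h_def near_def abs_mult dist_commute space_cell_law)
  define D where "D i = cell k i" for i
  have Dr: "range D \<subseteq> sets borel" "disjoint_family D" using cell_borel cell_disjoint by (auto simp: D_def disjoint_family_on_def)
  define U where "U \<omega> = (\<lambda>i\<in>{..<sz k}. count (D i) \<omega>)" for \<omega>
  have sc: "sets (PiM {..<sz k} (\<lambda>_. count_space (UNIV :: nat set))) = sets L.single"
    by (rule sets_PiM_cong) (auto simp: sets_cell_law)
  have Um: "U \<in> measurable W L.single"
  proof -
    have "U \<in> measurable W (PiM {..<sz k} (\<lambda>_. count_space UNIV))"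
      unfolding U_def by (rule measurable_restrict) (use Dr in \<open>auto intro!: count_meas\<close>)
    thus ?thesis using measurable_cong_sets[OF refl sc] by blast
  qed
  have UL: "distr W L.single U = L.single"
  proof -
    have "distr W L.single U = distr W (PiM {..<sz k} (\<lambda>_. count_space UNIV)) U" by (rule distr_cong) (auto simp: sc)
    also have "\<dots> = L.single" using distr_counts[OF Dr sz_pos] unfolding U_def cell_law_def D_def by simp
    finally show ?thesis .
  qed
  have fU: "approx UNIV k \<omega> = L.functional (U \<omega>)" for \<omega>
  proof -
    have "L.functional (U \<omega>) = cell_functional (Sk k) k (U \<omega>)"
      unfolding L.functional_def cell_functional_def h_def ..
    also have "\<dots> = approx UNIV k \<omega>" unfolding approx_def by (rule cell_functional_cong) (simp add: U_def D_def)
    finally show ?thesis ..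
  qed
  have int: "(\<integral>\<omega>. g (approx UNIV k \<omega>) \<partial>W) = (\<integral>x. g (L.functional x) \<partial>L.single)" if [measurable]: "g \<in> borel_measurable borel" for g :: "real \<Rightarrow> real"
    unfolding fU by (subst integral_distr[OF Um, of "\<lambda>x. g (L.functional x)", symmetric]) (measurable, simp add: UL)
  have \<mu>': "\<mu> = (\<integral>x. L.functional x \<partial>L.single)" unfolding \<mu> using int[of "\<lambda>x. x"] by simp
  have \<sigma>': "\<sigma>\<^sup>2 = (\<integral>x. (L.functional x - \<mu>)\<^sup>2 \<partial>L.single)" unfolding \<sigma>(1) using int[of "\<lambda>x. (x - \<mu>)\<^sup>2"] by simp
  have "measure W {\<omega> \<in> space W. (approx UNIV k \<omega> - \<mu>) / \<sigma> \<le> z} = measure W (U -` {x \<in> space L.single. (L.functional x - \<mu>) / \<sigma> \<le> z} \<inter> space W)"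
    unfolding fU using measurable_space[OF Um] by (intro arg_cong2[where f = measure] refl) auto
  also have "\<dots> = measure L.single {x \<in> space L.single. (L.functional x - \<mu>) / \<sigma> \<le> z}"
    by (subst measure_distr[symmetric, OF Um]) (measurable, simp add: UL)
  finally show ?thesis using L.Berry_Esseen_local[OF C0 \<mu>' \<sigma>' \<sigma>(2), of z] by simp
qed

text \<open>Both sides of the estimate for the approximation converge. Mean and variance converge by
  domination, and the distribution function converges at every point, because the approximation is
  eventually exact.\<close>

lemma chi_Berry_Esseen:
  assumes pos: "0 < sig2" and C: "real n * (M * (6 * (r / c)) ^ CARD('d)) \<le> C"
  shows "\<bar>measure W {\<omega> \<in> space W. (chi UNIV \<omega> - mu) / sqrt sig2 \<le> z} - std_normal_cdf z\<bar>
    \<le> 3 * sqrt (2 * 256 ^ 4 * exp (512 * C) * real n) / sig2"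
proof -
  interpret W: prob_space W by (rule prob_W)
  define \<mu> where "\<mu> k = (\<integral>\<omega>. approx UNIV k \<omega> \<partial>W)" for k
  define s2 where "s2 k = (\<integral>\<omega>. (approx UNIV k \<omega>)\<^sup>2 \<partial>W)" for k
  define v where "v k = (\<integral>\<omega>. (approx UNIV k \<omega> - \<mu> k)\<^sup>2 \<partial>W)" for k
  have x1: "\<bar>x\<bar> \<le> 1 + 1 * x\<^sup>2" for x :: real
    using zero_le_power2[of "\<bar>x\<bar> - 1"] zero_le_power2[of x] by (simp add: power2_eq_square algebra_simps)
  note d1 = approx_dominated[of UNIV "\<lambda>x. x" 1 1 "\<lambda>_. 1" 1, simplified, OF x1[simplified]]
  note d2 = approx_dominated[of UNIV "\<lambda>x. x\<^sup>2" 0 1 "\<lambda>_. 1" 1, simplified]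
  have l1: "\<mu> \<longlonglongrightarrow> mu" unfolding \<mu>_def mu_def by (rule d1)
  have l2: "s2 \<longlonglongrightarrow> (\<integral>\<omega>. (chi UNIV \<omega>)\<^sup>2 \<partial>W)" unfolding s2_def by (rule d2)
  have veq: "v k = s2 k - (\<mu> k)\<^sup>2" for k unfolding v_def s2_def \<mu>_def by (rule W.variance_eq) (rule d1 d2)+
  have sig2: "sig2 = (\<integral>\<omega>. (chi UNIV \<omega>)\<^sup>2 \<partial>W) - mu\<^sup>2" unfolding sig2_def mu_def by (rule W.variance_eq) (rule d1 d2)+
  have lv: "v \<longlonglongrightarrow> sig2" unfolding veq sig2 by (intro tendsto_intros l1 l2)
  \<comment> \<open>The unstandardised threshold stays fixed while the mesh varies. Its standardised
    value then moves with the mean and variance of the approximation and converges to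
    \<open>z\<close>.\<close>
  define s where "s = mu + sqrt sig2 * z"
  have set: "{\<omega> \<in> space W. (chi UNIV \<omega> - mu) / sqrt sig2 \<le> z} = {\<omega> \<in> space W. chi UNIV \<omega> \<le> s}"
    using pos by (auto simp: s_def field_simps)
  have seq: "{\<omega> \<in> space W. (approx UNIV k \<omega> - \<mu> k) / sqrt (v k) \<le> (s - \<mu> k) / sqrt (v k)} = {\<omega> \<in> space W. approx UNIV k \<omega> \<le> s}" if "0 < v k" for k
    using that by (auto simp: divide_le_cancel)
  have ind: "(\<lambda>x::real. of_bool (x \<le> s) :: real) \<in> borel_measurable borel" by measurable
  have lp: "(\<lambda>k. measure W {\<omega> \<in> space W. approx UNIV k \<omega> \<le> s}) \<longlonglongrightarrow> measure W {\<omega> \<in> space W. chi UNIV \<omega> \<le> s}"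
  proof -
    have ob: "(\<integral>\<omega>. of_bool (f \<omega> \<le> s) \<partial>W) = measure W {\<omega> \<in> space W. f \<omega> \<le> s}" if [measurable]: "f \<in> borel_measurable W" for f :: "'w \<Rightarrow> real"
    proof -
      have "(\<integral>\<omega>. of_bool (f \<omega> \<le> s) \<partial>W) = (\<integral>\<omega>. indicator {\<omega> \<in> space W. f \<omega> \<le> s} \<omega> \<partial>W)"
        by (intro Bochner_Integration.integral_cong) auto
      also have "\<dots> = measure W ({\<omega> \<in> space W. f \<omega> \<le> s} \<inter> space W)" by (rule Bochner_Integration.integral_indicator)
      also have "{\<omega> \<in> space W. f \<omega> \<le> s} \<inter> space W = {\<omega> \<in> space W. f \<omega> \<le> s}" by blast
      finally show ?thesis .
    qed
    have "\<bar>of_bool (x \<le> s) :: real\<bar> \<le> 1 + 0 * x\<^sup>2" for x by simp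
    from approx_dominated(1)[of UNIV "\<lambda>x. of_bool (x \<le> s)" 1 0 "\<lambda>_. 1" 1, OF _ ind this]
    show ?thesis by (simp add: ob approx_measurable chi_measurable)
  qed
  have ms: "eventually (\<lambda>k. mesh k < r / (4 * c)) sequentially"
    by (rule order_tendstoD(2)[OF mesh(1)]) (use r c in simp)
  have ev: "eventually (\<lambda>k. \<bar>measure W {\<omega> \<in> space W. approx UNIV k \<omega> \<le> s} - std_normal_cdf ((s - \<mu> k) / sqrt (v k))\<bar>
      \<le> 3 * sqrt (2 * 256 ^ 4 * exp (512 * C) * real n) / v k) sequentially"
    using order_tendstoD(1)[OF lv pos] ms
  proof eventually_elim
    case (elim k)
    have sv: "(sqrt (v k))\<^sup>2 = v k" "0 < sqrt (v k)" using elim by auto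
    have "mesh k \<le> r / (4 * c)" using elim by simp
    from approx_Berry_Esseen[OF this \<mu>_def[of k] _ sv(2) C, of "(s - \<mu> k) / sqrt (v k)"] show ?case
      unfolding seq[OF elim(1)] sv(1) by (simp add: v_def)
  qed
  have cont: "isCont std_normal_cdf x" for x by (rule DERIV_isCont[OF std_normal_cdf_deriv])
  have lz: "(\<lambda>k. (s - \<mu> k) / sqrt (v k)) \<longlonglongrightarrow> (s - mu) / sqrt sig2"
    by (intro tendsto_intros l1 lv) (use pos in auto)
  have z: "(s - mu) / sqrt sig2 = z" using pos by (simp add: s_def)
  have "(\<lambda>k. \<bar>measure W {\<omega> \<in> space W. approx UNIV k \<omega> \<le> s} - std_normal_cdf ((s - \<mu> k) / sqrt (v k))\<bar>) \<longlonglongrightarrow>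
     \<bar>measure W {\<omega> \<in> space W. chi UNIV \<omega> \<le> s} - std_normal_cdf z\<bar>"
    unfolding z[symmetric] by (intro tendsto_intros lp isCont_tendsto_compose[OF cont lz])
  moreover have "(\<lambda>k. 3 * sqrt (2 * 256 ^ 4 * exp (512 * C) * real n) / v k) \<longlonglongrightarrow> 3 * sqrt (2 * 256 ^ 4 * exp (512 * C) * real n) / sig2"
    by (intro tendsto_intros lv) (use pos in auto)
  ultimately show ?thesis unfolding set by (rule LIMSEQ_le) (use ev in \<open>simp add: eventually_sequentially\<close>)
qed

section \<open>Block tests for the Poisson variance\<close>

context
  fixes a b N :: "(real ^ 'd) set" and \<delta> :: real
  assumes gb: "good_block \<delta> (real n) (r / c) a b N" and \<delta>: "0 < \<delta>"
begin

definition rest :: "(real ^ 'd) set" where "rest = N - (a \<union> b)"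

text \<open>Both events put exactly two points into the block. They form two components here, and an
  edge in the event \<open>together\<close>, so the Euler characteristics of the block are 2 and
  1.\<close>

definition apart :: "'w set" where
  "apart = {\<omega> \<in> space W. count a \<omega> = 1 \<and> count b \<omega> = 1 \<and> count rest \<omega> = 0}"
definition together :: "'w set" where
  "together = {\<omega> \<in> space W. count a \<omega> = 2 \<and> count b \<omega> = 0 \<and> count rest \<omega> = 0}"

lemma block_facts: "a \<in> sets borel" "b \<in> sets borel" "N \<in> sets borel" "rest \<in> sets borel"
  "a \<inter> b = {}" "a \<inter> rest = {}" "b \<inter> rest = {}" "a \<union> b \<union> rest = N"
proof -
  show "a \<inter> b = {}"
  proof (rule ccontr)
    assume "a \<inter> b \<noteq> {}"
    then obtain x where "x \<in> a" "x \<in> b" by auto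
    hence "r / c < dist x x" using gb by (auto simp only: good_block_def)
    thus False using R_pos by simp
  qed
qed (use gb in \<open>auto simp: good_block_def rest_def\<close>)

lemma masses:
  "\<delta> \<le> real n * measure Q a" "\<delta> \<le> real n * measure Q b"
  "real n * measure Q a + real n * measure Q b + real n * measure Q rest \<le> 1 / \<delta>"
proof -
  interpret Q: prob_space Q by (rule prob_Q)
  have n0: "0 < real n" using n_pos by simp
  have g: "\<delta> / real n \<le> measure Q a" "\<delta> / real n \<le> measure Q b" "measure Q N \<le> 1 / (\<delta> * real n)"
    using gb by (auto simp: good_block_def)
  show "\<delta> \<le> real n * measure Q a" "\<delta> \<le> real n * measure Q b" using g(1,2) n0 by (simp_all add: field_simps)
  have "measure Q (a \<union> b \<union> rest) = measure Q (a \<union> b) + measure Q rest"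
    using block_facts by (intro Q.finite_measure_Union) auto
  also have "measure Q (a \<union> b) = measure Q a + measure Q b"
    using block_facts by (intro Q.finite_measure_Union) auto
  finally have "measure Q N = measure Q a + measure Q b + measure Q rest" using block_facts by simp
  thus "real n * measure Q a + real n * measure Q b + real n * measure Q rest \<le> 1 / \<delta>"
    using g(3) n0 \<delta> by (simp add: field_simps)
qed

text \<open>Padded with empty sets, since independence is given for sequences of disjoint
  sets.\<close>

definition three :: "nat \<Rightarrow> (real ^ 'd) set" where
  "three i = (if i = 0 then a else if i = 1 then b else if i = 2 then rest else {})"

lemma three: "range three \<subseteq> sets borel" "disjoint_family three"
  using block_facts by (auto simp: three_def disjoint_family_on_def)

lemma prob_three:
  "measure W {\<omega> \<in> space W. count a \<omega> = i \<and> count b \<omega> = j \<and> count rest \<omega> = k} =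
    measure W {\<omega> \<in> space W. count a \<omega> = i} * measure W {\<omega> \<in> space W. count b \<omega> = j} * measure W {\<omega> \<in> space W. count rest \<omega> = k}"
proof -
  interpret W: prob_space W by (rule prob_W)
  define E where "E l = (if l = 0 then {i} else if l = 1 then {j} else {k})" for l :: nat
  have "W.prob (\<Inter>l\<in>{0,1,2::nat}. count (three l) -` E l \<inter> space W) = (\<Prod>l\<in>{0,1,2::nat}. W.prob (count (three l) -` E l \<inter> space W))"
    by (rule W.indep_varsD[OF count_indep[OF three]]) auto
  moreover have "(\<Inter>l\<in>{0,1,2::nat}. count (three l) -` E l \<inter> space W) = {\<omega> \<in> space W. count a \<omega> = i \<and> count b \<omega> = j \<and> count rest \<omega> = k}"
    by (auto simp: three_def E_def)
  moreover have "count (three 0) -` E 0 \<inter> space W = {\<omega> \<in> space W. count a \<omega> = i}"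
    "count (three 1) -` E 1 \<inter> space W = {\<omega> \<in> space W. count b \<omega> = j}"
    "count (three 2) -` E 2 \<inter> space W = {\<omega> \<in> space W. count rest \<omega> = k}"
    by (auto simp: three_def E_def)
  ultimately show ?thesis by simp
qed

lemma events: "apart \<in> sets W" "together \<in> sets W"
proof -
  note l = count_level[OF block_facts(1)] count_level[OF block_facts(2)] count_level[OF block_facts(4)]
  have "apart = {\<omega> \<in> space W. count a \<omega> = 1} \<inter> {\<omega> \<in> space W. count b \<omega> = 1} \<inter> {\<omega> \<in> space W. count rest \<omega> = 0}"
    by (auto simp: apart_def)
  thus "apart \<in> sets W" using l by (simp only: sets.Int)
  have "together = {\<omega> \<in> space W. count a \<omega> = 2} \<inter> {\<omega> \<in> space W. count b \<omega> = 0} \<inter> {\<omega> \<in> space W. count rest \<omega> = 0}"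
    by (auto simp: together_def)
  thus "together \<in> sets W" using l by (simp only: sets.Int)
qed

text \<open>The mean counts of \<open>a\<close> and \<open>b\<close> are at least
  \<open>\<delta>\<close> and that of the whole block is at most \<open>1 / \<delta>\<close>. The
  factor 1/2 is the factorial in the probability of two points in \<open>a\<close>; it is kept for
  \<open>apart\<close> to have a common bound.\<close>

lemma event_probs: "\<delta>\<^sup>2 / 2 * exp (- 1 / \<delta>) \<le> measure W apart" "\<delta>\<^sup>2 / 2 * exp (- 1 / \<delta>) \<le> measure W together"
proof -
  define A B R where "A = real n * measure Q a" and "B = real n * measure Q b" and "R = real n * measure Q rest"
  have m: "\<delta> \<le> A" "\<delta> \<le> B" "A + B + R \<le> 1 / \<delta>" using masses by (simp_all add: A_def B_def R_def)
  have e: "exp (- 1 / \<delta>) \<le> exp (- (A + B + R))" using m(3) by simp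
  have split: "exp (- (A + B + R)) = exp (- A) * exp (- B) * exp (- R)" by (simp add: exp_add[symmetric])
  have "measure W apart = exp (- A) * A * (exp (- B) * B) * exp (- R)"
    unfolding apart_def prob_three using block_facts by (simp add: count_law A_def B_def R_def)
  also have "\<dots> = A * B * exp (- (A + B + R))" unfolding split by (simp only: mult_ac)
  also have "\<dots> \<ge> (\<delta> * \<delta>) * exp (- 1 / \<delta>)" using m \<delta> by (intro mult_mono e) auto
  finally show "\<delta>\<^sup>2 / 2 * exp (- 1 / \<delta>) \<le> measure W apart"
    using mult_right_mono[of "\<delta>\<^sup>2 / 2" "\<delta> * \<delta>" "exp (- 1 / \<delta>)"] by (simp add: power2_eq_square)
  have "measure W together = exp (- A) * A\<^sup>2 / 2 * exp (- B) * exp (- R)"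
    unfolding together_def prob_three using block_facts by (simp add: count_law A_def B_def R_def)
  also have "\<dots> = A * A / 2 * exp (- (A + B + R))" unfolding split by (simp add: power2_eq_square)
  also have "\<dots> \<ge> (\<delta> * \<delta> / 2) * exp (- 1 / \<delta>)" using m \<delta> by (intro mult_mono divide_right_mono e) auto
  finally show "\<delta>\<^sup>2 / 2 * exp (- 1 / \<delta>) \<le> measure W together" by (simp add: power2_eq_square)
qed

text \<open>Expressed in the three counts, so that independence of counts carries over to the
  tests.\<close>

definition weights :: "nat \<Rightarrow> nat \<Rightarrow> nat \<Rightarrow> real" where
  "weights i j k = of_bool (i = 1 \<and> j = 1 \<and> k = 0) / measure W apart - of_bool (i = 2 \<and> j = 0 \<and> k = 0) / measure W together"

definition test :: "'w \<Rightarrow> real" where "test \<omega> = weights (count a \<omega>) (count b \<omega>) (count rest \<omega>)"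

lemma test_eq: "\<omega> \<in> space W \<Longrightarrow> test \<omega> = indicator apart \<omega> / measure W apart - indicator together \<omega> / measure W together"
  by (auto simp: test_def weights_def apart_def together_def indicator_def)

lemma probs_pos: "0 < measure W apart" "0 < measure W together"
proof -
  have "0 < \<delta>\<^sup>2 / 2 * exp (- 1 / \<delta>)" using \<delta> by simp
  thus "0 < measure W apart" "0 < measure W together" using event_probs by linarith+
qed

lemma weights_bound: "\<bar>weights i j k\<bar> \<le> 1 / measure W apart + 1 / measure W together"
proof -
  have "0 \<le> 1 / measure W apart" "0 \<le> 1 / measure W together" by simp_all
  thus ?thesis by (auto simp: weights_def abs_le_iff of_bool_def)
qed

lemma test_bound: "\<bar>test \<omega>\<bar> \<le> 1 / measure W apart + 1 / measure W together"
  unfolding test_def by (rule weights_bound)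

lemma test_measurable: "test \<in> borel_measurable W"
proof -
  have "(\<lambda>\<omega>. indicator apart \<omega> / measure W apart - indicator together \<omega> / measure W together :: real) \<in> borel_measurable W"
    using events by measurable
  thus ?thesis by (rule measurable_cong[THEN iffD1, rotated]) (simp add: test_eq)
qed

lemma int_indicator: "E \<in> sets W \<Longrightarrow> integrable W (indicator E :: _ \<Rightarrow> real)"
  by (rule bounded_integrable[OF prob_W, where B=1]) (auto simp: indicator_def intro!: borel_measurable_indicator)

lemma events_Int: "apart \<inter> space W = apart" "together \<inter> space W = together"
  by (auto simp: apart_def together_def)

lemma test_mean: "(\<integral>\<omega>. test \<omega> \<partial>W) = 0"
proof -
  have "(\<integral>\<omega>. test \<omega> \<partial>W) = (\<integral>\<omega>. indicator apart \<omega> / measure W apart - indicator together \<omega> / measure W together \<partial>W)"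
    by (rule Bochner_Integration.integral_cong) (simp_all add: test_eq)
  also have "\<dots> = 0" using int_indicator[OF events(1)] int_indicator[OF events(2)] probs_pos
    by (simp add: events_Int)
  finally show ?thesis .
qed

text \<open>The two events are disjoint, so the cross term vanishes and the sum of the reciprocal
  probabilities remains.\<close>

lemma test_square: "(\<integral>\<omega>. (test \<omega>)\<^sup>2 \<partial>W) \<le> 4 / \<delta>\<^sup>2 * exp (1 / \<delta>)"
proof -
  have "(\<integral>\<omega>. (test \<omega>)\<^sup>2 \<partial>W) = (\<integral>\<omega>. indicator apart \<omega> / (measure W apart)\<^sup>2 + indicator together \<omega> / (measure W together)\<^sup>2 \<partial>W)"
    by (rule Bochner_Integration.integral_cong) (auto simp: test_eq indicator_def apart_def together_def power2_eq_square)
  also have "\<dots> = 1 / measure W apart + 1 / measure W together"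
    using int_indicator[OF events(1)] int_indicator[OF events(2)] probs_pos
    by (simp add: events_Int power2_eq_square)
  also have "\<dots> \<le> 1 / (\<delta>\<^sup>2 / 2 * exp (- 1 / \<delta>)) + 1 / (\<delta>\<^sup>2 / 2 * exp (- 1 / \<delta>))"
    using probs_pos \<delta> by (intro add_mono divide_left_mono event_probs mult_pos_pos) auto
  also have "\<dots> = 4 / \<delta>\<^sup>2 * exp (1 / \<delta>)" using \<delta> by (simp add: exp_minus field_simps)
  finally show ?thesis .
qed

text \<open>On both events the points of the block are farther than \<open>r / c\<close> from all
  others, so the alternating count is additive.\<close>

lemma chi_split:
  assumes w: "\<omega> \<in> space W" and E: "\<omega> \<in> apart \<or> \<omega> \<in> together"
  shows "chi UNIV \<omega> = chi (- N) \<omega> + (if \<omega> \<in> apart then 2 else 1)"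
proof -
  have fin: "finite (pts \<omega>)" using finite_pts[OF w] .
  have "count rest \<omega> = 0" using E by (auto simp: apart_def together_def)
  hence "pts \<omega> \<inter> rest = {}" using fin by simp
  hence PN: "pts \<omega> \<inter> N = (pts \<omega> \<inter> a) \<union> (pts \<omega> \<inter> b)" using block_facts(8) by auto
  have far: "r / c < dist x y" if "x \<in> pts \<omega> \<inter> N" "y \<in> pts \<omega> \<inter> - N" for x y
    using gb that PN unfolding good_block_def by blast
  have "chi UNIV \<omega> = alt_count S ((pts \<omega> \<inter> N) \<union> (pts \<omega> \<inter> - N))"
    unfolding chi_def by (rule arg_cong[where f = "alt_count S"]) auto
  also have "\<dots> = alt_count S (pts \<omega> \<inter> N) + alt_count S (pts \<omega> \<inter> - N)"
    by (rule alt_count_union) (use fin far in auto)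
  also have "alt_count S (pts \<omega> \<inter> N) = (if \<omega> \<in> apart then 2 else 1)"
  proof (cases "\<omega> \<in> apart")
    case True
    hence "count a \<omega> = 1" "count b \<omega> = 1" by (auto simp: apart_def)
    then obtain x y where xy: "pts \<omega> \<inter> a = {x}" "pts \<omega> \<inter> b = {y}" by (meson card_1_singletonE)
    have "x \<in> a" "y \<in> b" using xy by auto
    hence d: "r / c < dist x y" using gb by (auto simp: good_block_def)
    have "alt_count S ({x} \<union> {y}) = alt_count S {x} + alt_count S {y}" by (rule alt_count_union) (use d in auto)
    thus ?thesis using True unfolding PN xy by (simp add: alt_count_singleton)
  next
    case False
    hence t: "count a \<omega> = 2" "count b \<omega> = 0" using E by (auto simp: together_def)
    obtain x y where xy: "pts \<omega> \<inter> a = {x, y}" "x \<noteq> y" using t(1) by (meson card_2_iff)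
    have "pts \<omega> \<inter> b = {}" using t(2) fin by simp
    have "x \<in> a" "y \<in> a" using xy by auto
    hence "dist x y < r / c" using gb by (auto simp: good_block_def)
    hence "alt_count S {x, y} = 1" by (rule alt_count_pair[OF xy(2)])
    thus ?thesis using False unfolding PN xy \<open>pts \<omega> \<inter> b = {}\<close> by simp
  qed
  finally show ?thesis by (simp add: chi_def)
qed

text \<open>Independence is available for counts only, whereas \<open>chi (- N)\<close> depends on
  the positions of the points. Its approximation depends on counts in the cells cut by the
  complement of \<open>N\<close>, so the identity holds for every mesh and passes to the
  limit.\<close>

lemma out_test: "(\<integral>\<omega>. chi (- N) \<omega> * test \<omega> \<partial>W) = 0"
proof -
  have mN: "- N \<in> sets borel" using block_facts(3) by simp
  have x1: "\<bar>x\<bar> \<le> 1 + 1 * x\<^sup>2" for x :: real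
    using zero_le_power2[of "\<bar>x\<bar> - 1"] zero_le_power2[of x] by (simp add: power2_eq_square algebra_simps)
  note d = approx_dominated[OF mN _ x1 _ test_measurable test_bound]
  note d1 = approx_dominated[OF mN _ x1 _ borel_measurable_const, of "1::real" 1]
  have "(\<integral>\<omega>. approx (- N) k \<omega> * test \<omega> \<partial>W) = 0" for k
  proof -
    \<comment> \<open>One disjoint sequence containing the three sets of the block and then the cut
      cells, hence the shift by 3.\<close>
    define D where "D i = (if i < 3 then three i else cell k (i - 3) - N)" for i :: nat
    have D: "range D \<subseteq> sets borel" "disjoint_family D"
    proof -
      show "range D \<subseteq> sets borel" using three(1) cell_borel block_facts(3) by (auto simp: D_def)
      have N3: "three i \<subseteq> N" for i using block_facts(8) by (auto simp: three_def)
      show "disjoint_family D"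
        unfolding disjoint_family_on_def
      proof (intro ballI impI)
        fix i j :: nat assume ij: "i \<noteq> j"
        consider "i < 3" "j < 3" | "i < 3" "3 \<le> j" | "3 \<le> i" "j < 3" | "3 \<le> i" "3 \<le> j" by linarith
        thus "D i \<inter> D j = {}"
        proof cases
          case 1
          thus ?thesis using three(2) ij unfolding disjoint_family_on_def D_def by auto
        next
          case 2
          thus ?thesis using N3[of i] by (auto simp: D_def)
        next
          case 3
          thus ?thesis using N3[of j] by (auto simp: D_def)
        next
          case 4
          hence "i - 3 \<noteq> j - 3" using ij by linarith
          thus ?thesis using 4 cell_disjoint[of "i - 3" "j - 3" k] by (auto simp: D_def)
        qed
      qed
    qed
    define I J where "I = {3..<3 + sz k}" and "J = {0..<3::nat}"
    define u where "u x = cell_functional (Sk k) k (\<lambda>i. x (i + 3))" for x :: "nat \<Rightarrow> nat"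
    define v where "v x = weights (x 0) (x 1) (x 2)" for x :: "nat \<Rightarrow> nat"
    have eu: "u (\<lambda>i\<in>I. count (D i) \<omega>) = approx (- N) k \<omega>" for \<omega>
      unfolding u_def approx_def by (rule cell_functional_cong) (auto simp: I_def D_def intro!: arg_cong[where f = card])
    have ev: "v (\<lambda>i\<in>J. count (D i) \<omega>) = test \<omega>" for \<omega>
      unfolding v_def test_def by (simp add: J_def D_def three_def)
    have um: "u \<in> borel_measurable (PiM I (\<lambda>_. count_space UNIV))"
    proof -
      have "(\<lambda>x. \<lambda>i\<in>{..<sz k}. x (i + 3)) \<in> measurable (PiM I (\<lambda>_. count_space UNIV)) (PiM {..<sz k} (\<lambda>_. count_space (UNIV :: nat set)))"
        by (rule measurable_restrict) (auto simp: I_def)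
      from measurable_compose[OF this cell_functional_measurable[of k "{..<sz k}" "\<lambda>_. count_space UNIV" "Sk k"]]
      have "(\<lambda>x. cell_functional (Sk k) k (\<lambda>i\<in>{..<sz k}. x (i + 3))) \<in> borel_measurable (PiM I (\<lambda>_. count_space UNIV))" by auto
      moreover have "cell_functional (Sk k) k (\<lambda>i\<in>{..<sz k}. x (i + 3)) = u x" for x
        unfolding u_def by (rule cell_functional_cong) simp
      ultimately show ?thesis by simp
    qed
    have vm: "v \<in> borel_measurable (PiM J (\<lambda>_. count_space UNIV))"
    proof -
      have [measurable]: "(\<lambda>x. x i) \<in> measurable (PiM J (\<lambda>_. count_space UNIV)) (count_space (UNIV :: nat set))" if "i \<in> {0, 1, 2}" for i
        using that by (intro measurable_component_singleton) (auto simp: J_def)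
      show ?thesis unfolding v_def weights_def by measurable
    qed
    have iu: "integrable W (\<lambda>\<omega>. u (\<lambda>i\<in>I. count (D i) \<omega>))" unfolding eu using d1(3)[of k] by simp
    have iv: "integrable W (\<lambda>\<omega>. v (\<lambda>i\<in>J. count (D i) \<omega>))" unfolding ev
      by (rule bounded_integrable[OF prob_W test_measurable test_bound])
    have IJ: "I \<inter> J = {}" by (auto simp: I_def J_def)
    from counts_independent[OF D IJ um vm iu iv] show ?thesis unfolding eu ev by (simp add: test_mean)
  qed
  hence "(\<lambda>k. \<integral>\<omega>. approx (- N) k \<omega> * test \<omega> \<partial>W) \<longlonglongrightarrow> 0" by simp
  moreover have "(\<lambda>k. \<integral>\<omega>. approx (- N) k \<omega> * test \<omega> \<partial>W) \<longlonglongrightarrow> (\<integral>\<omega>. chi (- N) \<omega> * test \<omega> \<partial>W)"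
    by (rule d(1)) auto
  ultimately show ?thesis using LIMSEQ_unique by blast
qed

text \<open>The contribution from outside the block has mean zero against the test. What remains is
  2 from the event \<open>apart\<close> minus 1 from the event \<open>together\<close>.\<close>

lemma chi_test: "(\<integral>\<omega>. chi UNIV \<omega> * test \<omega> \<partial>W) = 1"
proof -
  have mN: "- N \<in> sets borel" using block_facts(3) by simp
  have x1: "\<bar>x\<bar> \<le> 1 + 1 * x\<^sup>2" for x :: real
    using zero_le_power2[of "\<bar>x\<bar> - 1"] zero_le_power2[of x] by (simp add: power2_eq_square algebra_simps)
  have i: "integrable W (\<lambda>\<omega>. chi (- N) \<omega> * test \<omega>)"
    by (rule approx_dominated(2)[OF mN _ x1 _ test_measurable test_bound]) auto
  have "(\<integral>\<omega>. chi UNIV \<omega> * test \<omega> \<partial>W) =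
    (\<integral>\<omega>. chi (- N) \<omega> * test \<omega> + (2 * (indicator apart \<omega> / measure W apart) - indicator together \<omega> / measure W together) \<partial>W)"
  proof (rule Bochner_Integration.integral_cong[OF refl])
    fix \<omega> assume w: "\<omega> \<in> space W"
    show "chi UNIV \<omega> * test \<omega> = chi (- N) \<omega> * test \<omega> + (2 * (indicator apart \<omega> / measure W apart) - indicator together \<omega> / measure W together)"
    proof (cases "\<omega> \<in> apart \<or> \<omega> \<in> together")
      case True
      have ex: "\<omega> \<in> apart \<Longrightarrow> \<omega> \<notin> together" by (auto simp: apart_def together_def)
      show ?thesis unfolding chi_split[OF w True] test_eq[OF w] using True ex
        by (cases "\<omega> \<in> apart") (simp_all add: algebra_simps add_divide_distrib)
    next
      case False
      thus ?thesis by (simp add: test_eq[OF w])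
    qed
  qed
  also have "\<dots> = (\<integral>\<omega>. chi (- N) \<omega> * test \<omega> \<partial>W) + 1"
    using i int_indicator[OF events(1)] int_indicator[OF events(2)] probs_pos
    by (simp add: events_Int)
  finally show ?thesis by (simp add: out_test)
qed

end

text \<open>Two blocks give six disjoint sets, so the tests are independent, and each has mean
  zero.\<close>

lemma test_orthogonal:
  assumes A: "good_block \<delta> (real n) (r / c) a b N" "0 < \<delta>"
    and B: "good_block \<delta>' (real n) (r / c) a' b' N'" "0 < \<delta>'" and disj: "N \<inter> N' = {}"
  shows "(\<integral>\<omega>. test a b N \<omega> * test a' b' N' \<omega> \<partial>W) = 0"
proof -
  note f = block_facts[OF A] and f' = block_facts[OF B]
  define D where "D i = (if i < 3 then three a b N i else three a' b' N' (i - 3))" for i :: nat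
  have N3: "three a b N i \<subseteq> N" "three a' b' N' i \<subseteq> N'" for i
    using f(8) f'(8) by (auto simp: three_def[OF A] three_def[OF B])
  have D: "range D \<subseteq> sets borel" "disjoint_family D"
  proof -
    show "range D \<subseteq> sets borel" using three(1)[OF A] three(1)[OF B] by (auto simp: D_def)
    show "disjoint_family D" unfolding disjoint_family_on_def
    proof (intro ballI impI)
      fix i j :: nat assume ij: "i \<noteq> j"
      consider "i < 3" "j < 3" | "i < 3" "3 \<le> j" | "3 \<le> i" "j < 3" | "3 \<le> i" "3 \<le> j" by linarith
      thus "D i \<inter> D j = {}"
      proof cases
        case 1
        thus ?thesis using three(2)[OF A] ij unfolding disjoint_family_on_def D_def by auto
      next
        case 2
        thus ?thesis using N3(1)[of i] N3(2)[of "j - 3"] disj by (auto simp: D_def)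
      next
        case 3
        thus ?thesis using N3(1)[of j] N3(2)[of "i - 3"] disj by (auto simp: D_def)
      next
        case 4
        hence "i - 3 \<noteq> j - 3" using ij by linarith
        thus ?thesis using 4 three(2)[OF B] unfolding disjoint_family_on_def D_def by auto
      qed
    qed
  qed
  define I J where "I = {0..<3::nat}" and "J = {3..<6::nat}"
  define u where "u x = weights a b N (x 0) (x 1) (x 2)" for x :: "nat \<Rightarrow> nat"
  define v where "v x = weights a' b' N' (x 3) (x 4) (x 5)" for x :: "nat \<Rightarrow> nat"
  have eu: "u (\<lambda>i\<in>I. count (D i) \<omega>) = test a b N \<omega>" for \<omega>
    unfolding u_def test_def[OF A] by (simp add: I_def D_def three_def[OF A])
  have ev: "v (\<lambda>i\<in>J. count (D i) \<omega>) = test a' b' N' \<omega>" for \<omega>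
    unfolding v_def test_def[OF B] by (simp add: J_def D_def three_def[OF B])
  have um: "u \<in> borel_measurable (PiM I (\<lambda>_. count_space UNIV))"
  proof -
    have [measurable]: "(\<lambda>x. x i) \<in> measurable (PiM I (\<lambda>_. count_space UNIV)) (count_space (UNIV :: nat set))" if "i \<in> {0, 1, 2}" for i
      using that by (intro measurable_component_singleton) (auto simp: I_def)
    show ?thesis unfolding u_def weights_def[OF A] by measurable
  qed
  have vm: "v \<in> borel_measurable (PiM J (\<lambda>_. count_space UNIV))"
  proof -
    have [measurable]: "(\<lambda>x. x i) \<in> measurable (PiM J (\<lambda>_. count_space UNIV)) (count_space (UNIV :: nat set))" if "i \<in> {3, 4, 5}" for i
      using that by (intro measurable_component_singleton) (auto simp: J_def)
    show ?thesis unfolding v_def weights_def[OF B] by measurable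
  qed
  have iu: "integrable W (\<lambda>\<omega>. u (\<lambda>i\<in>I. count (D i) \<omega>))" unfolding eu
    by (rule bounded_integrable[OF prob_W test_measurable[OF A] test_bound[OF A]])
  have iv: "integrable W (\<lambda>\<omega>. v (\<lambda>i\<in>J. count (D i) \<omega>))" unfolding ev
    by (rule bounded_integrable[OF prob_W test_measurable[OF B] test_bound[OF B]])
  have IJ: "I \<inter> J = {}" by (auto simp: I_def J_def)
  from counts_independent[OF D IJ um vm iu iv] show ?thesis unfolding eu ev by (simp add: test_mean[OF A])
qed

text \<open>Bessel's inequality, with covariances equal to 1 and the second moments bounded by
  \<open>test_square\<close>.\<close>

lemma poisson_variance_lower_bound:
  fixes Z :: "'z set"
  assumes Z: "finite Z" and gb: "\<And>z. z \<in> Z \<Longrightarrow> good_block \<delta> (real n) (r / c) (a z) (b z) (N z)"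
    and disj: "disjoint_family_on N Z" and \<delta>: "0 < \<delta>"
  shows "real (card Z) * (1\<^sup>2 / (4 / \<delta>\<^sup>2 * exp (1 / \<delta>))) \<le> sig2"
  unfolding sig2_def mu_def
proof (rule variance_ge_orthogonal[OF prob_W Z, where g = "\<lambda>z. test (a z) (b z) (N z)"])
  have x1: "\<bar>x\<bar> \<le> 1 + 1 * x\<^sup>2" for x :: real
    using zero_le_power2[of "\<bar>x\<bar> - 1"] zero_le_power2[of x] by (simp add: power2_eq_square algebra_simps)
  show "integrable W (chi UNIV)"
    using approx_dominated(2)[of UNIV "\<lambda>x. x", OF _ _ x1 _ borel_measurable_const, of "1::real" 1] by simp
  show "integrable W (\<lambda>\<omega>. (chi UNIV \<omega>)\<^sup>2)"
    using approx_dominated(2)[of UNIV "\<lambda>x. x\<^sup>2" 0 1 "\<lambda>_. 1" 1] by simp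
  fix z assume z: "z \<in> Z"
  note gz = gb[OF z] \<delta>
  show "integrable W (\<lambda>\<omega>. chi UNIV \<omega> * test (a z) (b z) (N z) \<omega>)"
    by (rule approx_dominated(2)[OF _ _ x1 _ test_measurable[OF gz] test_bound[OF gz]]) auto
  show "integrable W (test (a z) (b z) (N z))"
    by (rule bounded_integrable[OF prob_W test_measurable[OF gz] test_bound[OF gz]])
  show "(\<integral>\<omega>. test (a z) (b z) (N z) \<omega> \<partial>W) = 0" by (rule test_mean[OF gz])
  show "1 \<le> (\<integral>\<omega>. chi UNIV \<omega> * test (a z) (b z) (N z) \<omega> \<partial>W)" by (simp add: chi_test[OF gz])
  show "(\<integral>\<omega>. (test (a z) (b z) (N z) \<omega>)\<^sup>2 \<partial>W) \<le> 4 / \<delta>\<^sup>2 * exp (1 / \<delta>)" by (rule test_square[OF gz])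
  fix w assume w: "w \<in> Z"
  note gw = gb[OF w] \<delta>
  show "integrable W (\<lambda>\<omega>. test (a z) (b z) (N z) \<omega> * test (a w) (b w) (N w) \<omega>)"
    by (rule bounded_integrable[OF prob_W _ abs_mult_bound[OF test_bound[OF gz] test_bound[OF gw]]])
      (intro borel_measurable_times test_measurable[OF gz] test_measurable[OF gw])
  show "(\<integral>\<omega>. test (a z) (b z) (N z) \<omega> * test (a w) (b w) (N w) \<omega> \<partial>W) = 0" if "z \<noteq> w"
    by (rule test_orthogonal[OF gz gw]) (use disj z w that in \<open>auto simp: disjoint_family_on_def\<close>)
qed (use \<delta> in auto)

lemma poisson_kolmogorov:
  fixes Z :: "'z set"
  assumes c_def: "c = real n powr (1 / real CARD('d))"
    and Z: "finite Z" "\<kappa> * real n \<le> real (card Z)"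
      "\<And>z. z \<in> Z \<Longrightarrow> good_block \<delta> (real n) (r / c) (a z) (b z) (N z)" "disjoint_family_on N Z"
    and \<delta>: "0 < \<delta>" and \<kappa>: "0 < \<kappa>"
  shows "kolmogorov_dist W (standardized W (\<lambda>\<omega>. euler_characteristic (K r (rescaled n (pts \<omega>))))) std_normal_distribution (\<lambda>x. x)
    \<le> 3 * sqrt (2 * 256 ^ 4 * exp (512 * (M * (6 * r) ^ CARD('d)))) / (\<kappa> / (4 / \<delta>\<^sup>2 * exp (1 / \<delta>))) * (1 / sqrt (real n))"
proof -
  let ?Y = "\<lambda>\<omega>. euler_characteristic (K r (rescaled n (pts \<omega>)))"
  define C where "C = M * (6 * r) ^ CARD('d)"
  define \<theta> where "\<theta> = 1\<^sup>2 / (4 / \<delta>\<^sup>2 * exp (1 / \<delta>))"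
  have \<theta>: "0 < \<theta>" unfolding \<theta>_def using \<delta> by simp
  define v where "v = \<kappa> * \<theta>"
  have v: "0 < v" using \<kappa> \<theta> by (simp add: v_def)
  have veq: "\<kappa> / (4 / \<delta>\<^sup>2 * exp (1 / \<delta>)) = v" by (simp add: v_def \<theta>_def)
  have n0: "0 < real n" using n_pos by simp
  have cd: "c ^ CARD('d) = real n" unfolding c_def by (rule powr_root_power[OF n0])
  have "v * real n \<le> real (card Z) * \<theta>" using mult_right_mono[OF Z(2), of \<theta>] \<theta> by (simp add: v_def mult_ac)
  also have "\<dots> \<le> sig2" unfolding \<theta>_def by (rule poisson_variance_lower_bound[OF Z(1,3,4) \<delta>])
  finally have var: "v * real n \<le> sig2" .
  have sp: "0 < sig2" using var mult_pos_pos[OF v n0] by linarith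
  have Y: "?Y \<omega> = chi UNIV \<omega>" if "\<omega> \<in> space W" for \<omega>
    unfolding rescaled_def c_def[symmetric] chi_def S_def using complex_rescaled[OF K c finite_pts[OF that], of r] by simp
  have mean: "(\<integral>\<omega>. ?Y \<omega> \<partial>W) = mu" unfolding mu_def by (rule Bochner_Integration.integral_cong) (simp_all only: Y)
  have variance: "(\<integral>\<omega>. (?Y \<omega> - mu)\<^sup>2 \<partial>W) = sig2" unfolding sig2_def by (rule Bochner_Integration.integral_cong) (simp_all only: Y)
  have std: "standardized W ?Y \<omega> = (chi UNIV \<omega> - mu) / sqrt sig2" if "\<omega> \<in> space W" for \<omega>
    unfolding standardized_def mean variance Y[OF that] ..
  have "real n * (M * (6 * (r / c)) ^ CARD('d)) = M * (6 * r) ^ CARD('d)"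
    using cd n0 by (simp add: power_divide power_mult_distrib)
  hence Cn: "real n * (M * (6 * (r / c)) ^ CARD('d)) \<le> C" by (simp only: C_def order_refl)
  show ?thesis unfolding veq C_def[symmetric]
  proof (rule kolmogorov_dist_le)
    fix t
    have "{\<omega> \<in> space W. standardized W ?Y \<omega> \<le> t} = {\<omega> \<in> space W. (chi UNIV \<omega> - mu) / sqrt sig2 \<le> t}"
      by (rule Collect_cong) (metis std)
    hence "\<bar>measure W {\<omega> \<in> space W. standardized W ?Y \<omega> \<le> t} - std_normal_cdf t\<bar> \<le> 3 * sqrt (2 * 256 ^ 4 * exp (512 * C) * real n) / sig2"
      using chi_Berry_Esseen[OF sp Cn, of t] by simp
    also have "\<dots> \<le> 3 * sqrt (2 * 256 ^ 4 * exp (512 * C) * real n) / (v * real n)"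
      using var sp v n0 by (intro divide_left_mono mult_pos_pos) auto
    also have "\<dots> = 3 * sqrt (2 * 256 ^ 4 * exp (512 * C)) / v * (sqrt (real n) / real n)"
      unfolding real_sqrt_mult[of _ "real n"] by simp
    also have "sqrt (real n) / real n = 1 / sqrt (real n)" using n0 by (simp add: field_simps)
    finally show "\<bar>measure W {\<omega> \<in> space W. standardized W ?Y \<omega> \<le> t} - measure std_normal_distribution {\<omega> \<in> space std_normal_distribution. \<omega> \<le> t}\<bar>
      \<le> 3 * sqrt (2 * 256 ^ 4 * exp (512 * C)) / v * (1 / sqrt (real n))" unfolding std_normal_cdf_eq .
  qed
qed

end

theorem (in bounded_density) poisson_case:
  fixes K :: "real \<Rightarrow> (real ^ 'd) set \<Rightarrow> (real ^ 'd) set set"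
  assumes K: "K = cech_complex \<or> K = rips_complex" and r: "0 < r"
  shows "\<exists>C\<^sub>0>0. \<forall>n\<ge>1. \<forall>(W :: 'w measure) pts.
       poisson_point_process W pts (scale_measure (ennreal (real n)) (density lborel (\<lambda>x. ennreal (q x)))) \<longrightarrow>
       kolmogorov_dist W (standardized W (\<lambda>\<omega>. euler_characteristic (K r (rescaled n (pts \<omega>))))) std_normal_distribution (\<lambda>x. x)
         \<le> C\<^sub>0 * (1 / sqrt (real n))"
proof -
  obtain \<delta> \<kappa> n0 where \<delta>: "0 < \<delta>" and \<kappa>: "0 < \<kappa>" and blocks: "\<And>n. n0 \<le> n \<Longrightarrow> \<exists>Z a b N. finite (Z :: ('d \<Rightarrow> nat) set) \<and> \<kappa> * real n \<le> real (card Z) \<and>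
     (\<forall>z\<in>Z. good_block \<delta> (real n) (r / real n powr (1 / real CARD('d))) (a z) (b z) (N z)) \<and> disjoint_family_on N Z"
    using good_blocks[OF r] by blast
  define A where "A = 3 * sqrt (2 * 256 ^ 4 * exp (512 * (M * (6 * r) ^ CARD('d)))) / (\<kappa> / (4 / \<delta>\<^sup>2 * exp (1 / \<delta>)))"
  have A: "0 \<le> A" using \<kappa> by (simp add: A_def)
  \<comment> \<open>The root handles \<open>n < n0\<close> by the trivial bound on the
    distance.\<close>
  define C0 where "C0 = A + sqrt (real n0) + 1"
  obtain sz :: "nat \<Rightarrow> nat" and ctr :: "nat \<Rightarrow> nat \<Rightarrow> real ^ 'd" where cells: "cell_sequence sz ctr (\<lambda>k. 1 / real (Suc k))"
    using cell_sequence_exists by blast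
  have "kolmogorov_dist W (standardized W (\<lambda>\<omega>. euler_characteristic (K r (rescaled n (pts \<omega>))))) std_normal_distribution (\<lambda>x. x)
         \<le> C0 * (1 / sqrt (real n))"
    if n: "1 \<le> n" and ppp: "poisson_point_process W pts (scale_measure (ennreal (real n)) (density lborel (\<lambda>x. ennreal (q x))))"
    for n :: nat and W :: "'w measure" and pts
  proof -
    let ?Y = "\<lambda>\<omega>. euler_characteristic (K r (rescaled n (pts \<omega>)))"
    have psW: "prob_space W" using ppp by (simp add: poisson_point_process_def)
    have n0: "0 < real n" using n by simp
    show ?thesis
    proof (cases "n0 \<le> n")
      case False
      have "kolmogorov_dist W (standardized W ?Y) std_normal_distribution (\<lambda>x. x) \<le> 1"
        by (rule kolmogorov_dist_normal_le_1[OF psW])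
      also have "\<dots> \<le> sqrt (real n0) * (1 / sqrt (real n))" using False n by (intro sqrt_bound_trivial) auto
      also have "\<dots> \<le> C0 * (1 / sqrt (real n))" using A by (intro mult_right_mono) (auto simp: C0_def)
      finally show ?thesis .
    next
      case True
      define c where "c = real n powr (1 / real CARD('d))"
      have c: "0 < c" using n0 by (simp add: c_def)
      have pc: "poisson_complex q M W pts n K r c sz ctr (\<lambda>k. 1 / real (Suc k))"
        by (intro poisson_complex.intro poisson_complex_axioms.intro poisson_processI[OF ppp] K r c cells) (use n in simp)
      obtain Z :: "('d \<Rightarrow> nat) set" and a b N where Z: "finite Z" "\<kappa> * real n \<le> real (card Z)"
        "\<And>z. z \<in> Z \<Longrightarrow> good_block \<delta> (real n) (r / c) (a z) (b z) (N z)" "disjoint_family_on N Z"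
        using blocks[OF True] unfolding c_def by blast
      have "kolmogorov_dist W (standardized W ?Y) std_normal_distribution (\<lambda>x. x) \<le> A * (1 / sqrt (real n))"
        unfolding A_def by (rule poisson_complex.poisson_kolmogorov[OF pc c_def Z \<delta> \<kappa>])
      also have "\<dots> \<le> C0 * (1 / sqrt (real n))" by (intro mult_right_mono) (auto simp: C0_def)
      finally show ?thesis .
    qed
  qed
  moreover have "0 < C0" using A by (simp add: C0_def add_nonneg_pos)
  ultimately show ?thesis by blast
qed

theorem theorem4p3:
  fixes q :: "real ^ 'd \<Rightarrow> real"
    and T r :: real
    and K :: "real \<Rightarrow> (real ^ 'd) set \<Rightarrow> (real ^ 'd) set set"
    and F :: "nat \<Rightarrow> (real ^ 'd) set \<Rightarrow> real"
  assumes "q \<in> borel_measurable borel"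
    and "\<And>x. 0 \<le> q x"
    and "bounded (range q)"
    and "\<And>x. x \<notin> cbox 0 1 \<Longrightarrow> q x = 0"
    and "prob_space (density lborel (\<lambda>x. ennreal (q x)))"
    and "0 < T" and "0 < r" and "r \<le> T"
    and "K = cech_complex \<or> K = rips_complex"
    and F_def: "\<And>n \<eta>. F n \<eta> = euler_characteristic (K r (rescaled n \<eta>))"
  shows "\<exists>C\<^sub>0>0.
    (\<forall>n\<ge>1. \<forall>(M :: 'v measure) P.
       poisson_point_process M P
         (scale_measure (ennreal (real n)) (density lborel (\<lambda>x. ennreal (q x)))) \<longrightarrow>
       prob_space.variance M (\<lambda>\<omega>. F n (P \<omega>)) > 0 \<longrightarrow>
       kolmogorov_dist M (standardized M (\<lambda>\<omega>. F n (P \<omega>))) std_normal_distribution (\<lambda>x. x)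
         \<le> C\<^sub>0 * (1 / sqrt (real n))) \<and>
    (\<forall>n\<ge>2. \<forall>(M :: 'w measure) \<xi>.
       binomial_point_process M \<xi> n q \<longrightarrow>
       prob_space.variance M (\<lambda>\<omega>. F n (\<xi> \<omega>)) > 0 \<longrightarrow>
       kolmogorov_dist M (standardized M (\<lambda>\<omega>. F n (\<xi> \<omega>))) std_normal_distribution (\<lambda>x. x)
         \<le> C\<^sub>0 * (1 / sqrt (real n)))"
proof -
  obtain B where B: "\<bar>q x\<bar> \<le> B" for x using \<open>bounded (range q)\<close> by (auto simp: bounded_iff)
  have qB: "q x \<le> max B 1" for x using B[of x] by linarith
  \<comment> \<open>Taking the maximum with 1 provides the lower bound on the density bound that
    simplifies the block estimates.\<close>
  interpret bounded_density q "max B 1"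
    by (rule bounded_density.intro) (use assms(1,2,4,5) qB in simp_all)
  note cases = poisson_case[OF \<open>K = cech_complex \<or> K = rips_complex\<close> \<open>0 < r\<close>, where 'w = 'v, folded F_def]
    binomial_case[OF \<open>K = cech_complex \<or> K = rips_complex\<close> \<open>0 < r\<close>, where 'w = 'w, folded F_def]
  obtain C\<^sub>1 where C\<^sub>1: "0 < C\<^sub>1" "\<forall>n\<ge>1. \<forall>(M :: 'v measure) P.
       poisson_point_process M P (scale_measure (ennreal (real n)) (density lborel (\<lambda>x. ennreal (q x)))) \<longrightarrow>
       kolmogorov_dist M (standardized M (\<lambda>\<omega>. F n (P \<omega>))) std_normal_distribution (\<lambda>x. x) \<le> C\<^sub>1 * (1 / sqrt (real n))"
    using cases(1) by (elim exE conjE that)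
  obtain C\<^sub>2 where C\<^sub>2: "0 < C\<^sub>2" "\<forall>n\<ge>2. \<forall>(M :: 'w measure) \<xi>. binomial_point_process M \<xi> n q \<longrightarrow>
       kolmogorov_dist M (standardized M (\<lambda>\<omega>. F n (\<xi> \<omega>))) std_normal_distribution (\<lambda>x. x) \<le> C\<^sub>2 * (1 / sqrt (real n))"
    using cases(2) by (elim exE conjE that)
  have le: "C\<^sub>1 * (1 / sqrt (real n)) \<le> (C\<^sub>1 + C\<^sub>2) * (1 / sqrt (real n))"
    "C\<^sub>2 * (1 / sqrt (real n)) \<le> (C\<^sub>1 + C\<^sub>2) * (1 / sqrt (real n))" for n
    using C\<^sub>1(1) C\<^sub>2(1) by (intro mult_right_mono; simp)+
  show ?thesis
  \<comment> \<open>The sum of the two constants serves both processes.\<close>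
  proof (intro exI[of _ "C\<^sub>1 + C\<^sub>2"] conjI allI impI)
    show "0 < C\<^sub>1 + C\<^sub>2" using C\<^sub>1(1) C\<^sub>2(1) by simp
  next
    fix n :: nat and M :: "'v measure" and P
    assume "1 \<le> n" and "poisson_point_process M P (scale_measure (ennreal (real n)) (density lborel (\<lambda>x. ennreal (q x))))"
    with C\<^sub>1(2) have "kolmogorov_dist M (standardized M (\<lambda>\<omega>. F n (P \<omega>))) std_normal_distribution (\<lambda>x. x) \<le> C\<^sub>1 * (1 / sqrt (real n))"
      by blast
    thus "kolmogorov_dist M (standardized M (\<lambda>\<omega>. F n (P \<omega>))) std_normal_distribution (\<lambda>x. x) \<le> (C\<^sub>1 + C\<^sub>2) * (1 / sqrt (real n))"
      using le(1) by (rule order_trans)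
  next
    fix n :: nat and M :: "'w measure" and \<xi>
    assume "2 \<le> n" and "binomial_point_process M \<xi> n q"
    with C\<^sub>2(2) have "kolmogorov_dist M (standardized M (\<lambda>\<omega>. F n (\<xi> \<omega>))) std_normal_distribution (\<lambda>x. x) \<le> C\<^sub>2 * (1 / sqrt (real n))"
      by blast
    thus "kolmogorov_dist M (standardized M (\<lambda>\<omega>. F n (\<xi> \<omega>))) std_normal_distribution (\<lambda>x. x) \<le> (C\<^sub>1 + C\<^sub>2) * (1 / sqrt (real n))"
      using le(2) by (rule order_trans)
  qed
qed

end
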